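(* Let $\Lambda$ be a finitely aligned $k$-graph and let $\mathcal{G}_\Lambda$ be its boundary-path groupoid. Let $R$ be a commutative ring with $1$. Then there is an isomorphism $\pi_T:\operatorname{KP}_R(\Lambda)\to A_R(\mathcal{G}_\Lambda)$ such that $\pi_T(s_\lambda)=1_{Z_\Lambda(\lambda *_s s(\lambda))}$ and $\pi_T(s_{\mu^*})=1_{Z_\Lambda(s(\mu)*_s\mu)}$ for all $\lambda,\mu\in\Lambda$.
   Context: $\mathbb{N}$ contains $0$; for $m,n\in\mathbb{N}^k$ ($k\ge 1$), $m\le n$ and $m\vee n$ (maximum) are taken coordinatewise. A $k$-graph $\Lambda$ is a countable small category with a functor $d:\Lambda\to\mathbb{N}^k$ ($\mathbb{N}^k$ viewed as a category with one object) satisfying the factorisation property: if $d(\lambda)=m+n$ there are unique $\mu,\nu\in\Lambda$ with $\lambda=\mu\nu$, $d(\mu)=m$, $d(\nu)=n$; write $\lambda(0,m)=\mu$, $\lambda(m,m+n)=\nu$. $\Lambda^0$ denotes the objects (vertices), identified with the identity morphisms, i.e. the morphisms of degree $0$. $r(\lambda), s(\lambda)$ are the range (codomain) and source (domain); $\lambda\mu$ is defined when $s(\lambda)=r(\mu)$. $v\Lambda=\{\lambda\in\Lambda: r(\lambda)=v\}$. For $\lambda,\mu\in\Lambda$, $\operatorname{MCE}(\lambda,\mu)$ is the set of $\tau\in\Lambda$ with $d(\tau)=d(\lambda)\vee d(\mu)$, $\tau(0,d(\lambda))=\lambda$, $\tau(0,d(\mu))=\mu$, and $\Lambda^{\min}(\lambda,\mu)=\{(\rho,\tau)\in\Lambda\times\Lambda:\lambda\rho=\mu\tau\in\operatorname{MCE}(\lambda,\mu)\}$.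 $\Lambda$ is finitely aligned if every $\Lambda^{\min}(\lambda,\mu)$ is finite (possibly empty). A set $E\subseteq v\Lambda$ is exhaustive if for every $\lambda\in v\Lambda$ there is $\mu\in E$ with $\Lambda^{\min}(\lambda,\mu)\ne\emptyset$. $\operatorname{FE}(\Lambda)$ is the collection of all finite exhaustive sets $E\subseteq v\Lambda\setminus\{v\}$, $v\in\Lambda^0$; for such $E$, $r(E):=v$. Ghost paths: for each $\lambda\in\Lambda$ there is a formal symbol $\lambda^*$, with $v^*:=v$ for $v\in\Lambda^0$; $G(\Lambda^{\ne0})$ is the set of $\lambda^*$ with $\lambda\notin\Lambda^0$. $R$-algebras are associative and not assumed unital. A Kumjian-Pask $\Lambda$-family $\{S_\lambda,S_{\mu^*}:\lambda,\mu\in\Lambda\}$ in an $R$-algebra $A$ is a map $S:\Lambda\cup G(\Lambda^{\neq0})\to A$ such that: (KP1) $\{S_v:v\in\Lambda^0\}$ are mutually orthogonal idempotents; (KP2) if $s(\lambda)=r(\mu)$ then $S_\lambda S_\mu=S_{\lambda\mu}$ and $S_{\mu^*}S_{\lambda^*}=S_{(\lambda\mu)^*}$; (KP3) $S_{\lambda^*}S_\mu=\sum_{(\rho,\tau)\in\Lambda^{\min}(\lambda,\mu)}S_\rho S_{\tau^*}$ for all $\lambda,\mu\in\Lambda$ (empty sum is $0$); (KP4) $\prod_{\lambda\in E}(S_{r(E)}-S_\lambda S_{\lambda^*})=0$ for all $E\in\operatorname{FE}(\Lambda)$ (the factors commute as a consequence of (KP1)-(KP3)). $\operatorname{KP}_R(\Lambda)$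 is the universal $R$-algebra generated by a Kumjian-Pask $\Lambda$-family $\{s_\lambda,s_{\mu^*}\}$: every Kumjian-Pask $\Lambda$-family $S$ in an $R$-algebra $A$ induces a unique $R$-algebra homomorphism $\operatorname{KP}_R(\Lambda)\to A$ with $s_\lambda\mapsto S_\lambda$, $s_{\mu^*}\mapsto S_{\mu^*}$. Boundary paths: for $m\in(\mathbb{N}\cup\{\infty\})^k$, $\Omega_{k,m}=\{(p,q)\in\mathbb{N}^k\times\mathbb{N}^k:p\le q\le m\}$ is the $k$-graph with objects $\{p\in\mathbb{N}^k:p\le m\}$, $r(p,q)=p$, $s(p,q)=q$, $d(p,q)=q-p$. A boundary path of $\Lambda$ is a degree-preserving functor $x:\Omega_{k,m}\to\Lambda$ such that for every $n\in\mathbb{N}^k$ with $n\le m$ and every $E\in\operatorname{FE}(\Lambda)$ with $r(E)=x(n,n)$ there is $\lambda\in E$ with $n+d(\lambda)\le m$ and $x(n,n+d(\lambda))=\lambda$. Put $d(x)=m$, $x(n)=x(n,n)$, $r(x)=x(0)$. $\partial\Lambda$ is the set of boundary paths; $v\partial\Lambda=\{x\in\partial\Lambda:r(x)=v\}$. For $n\le d(x)$, $\sigma^nx\in\partial\Lambda$ is given by $(\sigma^nx)(p,q)=x(n+p,n+q)$; for $\lambda\in\Lambda$ with $s(\lambda)=r(x)$, $\lambda x\in\partial\Lambda$ is the boundary path with $(\lambda x)(0,d(\lambda))=\lambda$ and $\sigma^{d(\lambda)}(\lambda x)=x$; $\lambda\partial\Lambda=\{\lambda x:x\in s(\lambda)\partial\Lambda\}$.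 Boundary-path groupoid $\mathcal{G}_\Lambda$: unit space $\partial\Lambda$ (with $x$ identified with $(x,0,x)$); morphisms are the triples $(\lambda z,d(\lambda)-d(\mu),\mu z)\in\partial\Lambda\times\mathbb{Z}^k\times\partial\Lambda$ with $\lambda,\mu\in\Lambda$, $s(\lambda)=s(\mu)$, $z\in s(\lambda)\partial\Lambda$; $r(x,m,y)=x$, $s(x,m,y)=y$, $(x,m,y)(y,n,w)=(x,m+n,w)$, $(x,m,y)^{-1}=(y,-m,x)$. For $s(\lambda)=s(\mu)$ and finite non-exhaustive $G\subseteq s(\lambda)\Lambda$, let $Z_\Lambda(\lambda)=\lambda\partial\Lambda$, $Z_\Lambda(\lambda*_s\mu)=\{(x,d(\lambda)-d(\mu),y)\in\mathcal{G}_\Lambda:x\in Z_\Lambda(\lambda),\,y\in Z_\Lambda(\mu),\,\sigma^{d(\lambda)}x=\sigma^{d(\mu)}y\}$ and $Z_\Lambda(\lambda*_s\mu\setminus G)=Z_\Lambda(\lambda*_s\mu)\setminus\bigcup_{\nu\in G}Z_\Lambda(\lambda\nu*_s\mu\nu)$. The sets $Z_\Lambda(\lambda*_s\mu\setminus G)$ form a basis of compact open bisections for a second-countable Hausdorff topology making $\mathcal{G}_\Lambda$ an ample topological groupoid (one with a basis of compact open bisections, where an open bisection is an open set on which $r$ and $s$ restrict to homeomorphisms into the unit space). Steinberg algebra: for a Hausdorff ample groupoid $\mathcal{G}$, $A_R(\mathcal{G})$ is the $R$-algebra of locally constant, compactly supported functions $f:\mathcal{G}\to R$ with pointwise addition and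 scalar multiplication and product $(f\star g)(a)=\sum_{r(b)=r(a)}f(b)g(b^{-1}a)$. $1_U$ denotes the characteristic function of $U$. *)

theory Defs
  imports
    "HOL-Analysis.Abstract_Topology"
    "HOL-Analysis.Finite_Cartesian_Product"
    "HOL-Library.Extended_Nat"
    "HOL-Library.Countable_Set"
    "HOL-Algebra.QuotRing"
    "HOL-Algebra.Module"
begin

section \<open>Higher-rank graphs\<close>

text \<open>Small categories are single-sorted: an object is its identity morphism.  The rank is the
  cardinality of the finite type \<open>'k\<close>.  \<open>comp \<Lambda> \<alpha> \<mu>\<close> is meaningful only if
  \<open>src \<Lambda> \<alpha> = rng \<Lambda> \<mu>\<close>.\<close>

record ('l, 'k) kgraph =
  paths :: "'l set"
  rng :: "'l \<Rightarrow> 'l"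
  src :: "'l \<Rightarrow> 'l"
  comp :: "'l \<Rightarrow> 'l \<Rightarrow> 'l"
  deg :: "'l \<Rightarrow> nat ^ 'k"

locale k_graph =
  fixes \<Lambda> :: "('l, 'k::finite) kgraph"
  assumes countable_paths: "countable (paths \<Lambda>)"
    and rng_closed: "\<alpha> \<in> paths \<Lambda> \<Longrightarrow> rng \<Lambda> \<alpha> \<in> paths \<Lambda>"
    and src_closed: "\<alpha> \<in> paths \<Lambda> \<Longrightarrow> src \<Lambda> \<alpha> \<in> paths \<Lambda>"
    and rng_rng: "\<alpha> \<in> paths \<Lambda> \<Longrightarrow> rng \<Lambda> (rng \<Lambda> \<alpha>) = rng \<Lambda> \<alpha>"
    and src_rng: "\<alpha> \<in> paths \<Lambda> \<Longrightarrow> src \<Lambda> (rng \<Lambda> \<alpha>) = rng \<Lambda> \<alpha>"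
    and rng_src: "\<alpha> \<in> paths \<Lambda> \<Longrightarrow> rng \<Lambda> (src \<Lambda> \<alpha>) = src \<Lambda> \<alpha>"
    and src_src: "\<alpha> \<in> paths \<Lambda> \<Longrightarrow> src \<Lambda> (src \<Lambda> \<alpha>) = src \<Lambda> \<alpha>"
    and comp_closed: "\<lbrakk>\<alpha> \<in> paths \<Lambda>; \<mu> \<in> paths \<Lambda>; src \<Lambda> \<alpha> = rng \<Lambda> \<mu>\<rbrakk> \<Longrightarrow> comp \<Lambda> \<alpha> \<mu> \<in> paths \<Lambda>"
    and rng_comp: "\<lbrakk>\<alpha> \<in> paths \<Lambda>; \<mu> \<in> paths \<Lambda>; src \<Lambda> \<alpha> = rng \<Lambda> \<mu>\<rbrakk> \<Longrightarrow> rng \<Lambda> (comp \<Lambda> \<alpha> \<mu>) = rng \<Lambda> \<alpha>"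
    and src_comp: "\<lbrakk>\<alpha> \<in> paths \<Lambda>; \<mu> \<in> paths \<Lambda>; src \<Lambda> \<alpha> = rng \<Lambda> \<mu>\<rbrakk> \<Longrightarrow> src \<Lambda> (comp \<Lambda> \<alpha> \<mu>) = src \<Lambda> \<mu>"
    and comp_assoc: "\<lbrakk>\<alpha> \<in> paths \<Lambda>; \<mu> \<in> paths \<Lambda>; \<nu> \<in> paths \<Lambda>; src \<Lambda> \<alpha> = rng \<Lambda> \<mu>; src \<Lambda> \<mu> = rng \<Lambda> \<nu>\<rbrakk>
      \<Longrightarrow> comp \<Lambda> (comp \<Lambda> \<alpha> \<mu>) \<nu> = comp \<Lambda> \<alpha> (comp \<Lambda> \<mu> \<nu>)"
    and comp_rng: "\<alpha> \<in> paths \<Lambda> \<Longrightarrow> comp \<Lambda> (rng \<Lambda> \<alpha>) \<alpha> = \<alpha>"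
    and comp_src: "\<alpha> \<in> paths \<Lambda> \<Longrightarrow> comp \<Lambda> \<alpha> (src \<Lambda> \<alpha>) = \<alpha>"
    and deg_comp: "\<lbrakk>\<alpha> \<in> paths \<Lambda>; \<mu> \<in> paths \<Lambda>; src \<Lambda> \<alpha> = rng \<Lambda> \<mu>\<rbrakk>
      \<Longrightarrow> deg \<Lambda> (comp \<Lambda> \<alpha> \<mu>) = deg \<Lambda> \<alpha> + deg \<Lambda> \<mu>"
    and deg_rng: "\<alpha> \<in> paths \<Lambda> \<Longrightarrow> deg \<Lambda> (rng \<Lambda> \<alpha>) = 0"
    and factorisation: "\<lbrakk>\<alpha> \<in> paths \<Lambda>; deg \<Lambda> \<alpha> = m + n\<rbrakk>
      \<Longrightarrow> \<exists>!(\<mu>, \<nu>). \<mu> \<in> paths \<Lambda> \<and> \<nu> \<in> paths \<Lambda> \<and> src \<Lambda> \<mu> = rng \<Lambda> \<nu> \<and> \<alpha> = comp \<Lambda> \<mu> \<nu>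
            \<and> deg \<Lambda> \<mu> = m \<and> deg \<Lambda> \<nu> = n"

definition vertices :: "('l, 'k::finite) kgraph \<Rightarrow> 'l set" where
  "vertices \<Lambda> = {v \<in> paths \<Lambda>. rng \<Lambda> v = v}"

definition paths_from :: "('l, 'k::finite) kgraph \<Rightarrow> 'l \<Rightarrow> 'l set" where
  "paths_from \<Lambda> v = {\<alpha> \<in> paths \<Lambda>. rng \<Lambda> \<alpha> = v}"

lemma (in k_graph) vertices_iff_deg_0: "v \<in> vertices \<Lambda> \<longleftrightarrow> v \<in> paths \<Lambda> \<and> deg \<Lambda> v = 0"
proof
  assume "v \<in> vertices \<Lambda>"
  then show "v \<in> paths \<Lambda> \<and> deg \<Lambda> v = 0"
    unfolding vertices_def using deg_rng[of v] by auto
next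
  assume v: "v \<in> paths \<Lambda> \<and> deg \<Lambda> v = 0"
  have d: "deg \<Lambda> (src \<Lambda> v) = 0" using v deg_rng[OF src_closed[of v]] by (simp add: rng_src)
  let ?P = "\<lambda>(\<mu>, \<nu>). \<mu> \<in> paths \<Lambda> \<and> \<nu> \<in> paths \<Lambda> \<and> src \<Lambda> \<mu> = rng \<Lambda> \<nu> \<and> v = comp \<Lambda> \<mu> \<nu>
            \<and> deg \<Lambda> \<mu> = 0 \<and> deg \<Lambda> \<nu> = 0"
  have "?P (rng \<Lambda> v, v)" using v by (simp add: rng_closed src_rng comp_rng deg_rng)
  moreover have "?P (v, src \<Lambda> v)" using v d by (simp add: src_closed rng_src comp_src)
  ultimately have "(rng \<Lambda> v, v) = (v, src \<Lambda> v)"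
    using factorisation[of v 0 0] v by (metis (no_types, lifting) add.right_neutral)
  then show "v \<in> vertices \<Lambda>" using v by (simp add: vertices_def)
qed

text \<open>\<open>initial_seg \<Lambda> \<alpha> m\<close> is \<open>\<alpha>(0,m)\<close>; it is meaningful for \<open>m \<le> deg \<Lambda> \<alpha>\<close>, and the degree
  of the second factor is then forced.\<close>

definition initial_seg :: "('l, 'k::finite) kgraph \<Rightarrow> 'l \<Rightarrow> nat ^ 'k \<Rightarrow> 'l" where
  "initial_seg \<Lambda> \<alpha> m = (THE \<mu>. \<mu> \<in> paths \<Lambda> \<and> deg \<Lambda> \<mu> = m \<and>
     (\<exists>\<nu> \<in> paths \<Lambda>. src \<Lambda> \<mu> = rng \<Lambda> \<nu> \<and> \<alpha> = comp \<Lambda> \<mu> \<nu>))"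

definition deg_join :: "nat ^ 'k \<Rightarrow> nat ^ 'k \<Rightarrow> nat ^ 'k" where
  "deg_join m n = (\<chi> i. max (m $ i) (n $ i))"

definition MCE :: "('l, 'k::finite) kgraph \<Rightarrow> 'l \<Rightarrow> 'l \<Rightarrow> 'l set" where
  "MCE \<Lambda> \<alpha> \<mu> = {\<tau> \<in> paths \<Lambda>. deg \<Lambda> \<tau> = deg_join (deg \<Lambda> \<alpha>) (deg \<Lambda> \<mu>) \<and>
     initial_seg \<Lambda> \<tau> (deg \<Lambda> \<alpha>) = \<alpha> \<and> initial_seg \<Lambda> \<tau> (deg \<Lambda> \<mu>) = \<mu>}"

definition Lambda_min :: "('l, 'k::finite) kgraph \<Rightarrow> 'l \<Rightarrow> 'l \<Rightarrow> ('l \<times> 'l) set" where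
  "Lambda_min \<Lambda> \<alpha> \<mu> = {(\<rho>, \<tau>). \<rho> \<in> paths \<Lambda> \<and> \<tau> \<in> paths \<Lambda> \<and>
     src \<Lambda> \<alpha> = rng \<Lambda> \<rho> \<and> src \<Lambda> \<mu> = rng \<Lambda> \<tau> \<and>
     comp \<Lambda> \<alpha> \<rho> = comp \<Lambda> \<mu> \<tau> \<and> comp \<Lambda> \<alpha> \<rho> \<in> MCE \<Lambda> \<alpha> \<mu>}"

definition finitely_aligned :: "('l, 'k::finite) kgraph \<Rightarrow> bool" where
  "finitely_aligned \<Lambda> \<longleftrightarrow> (\<forall>\<alpha> \<in> paths \<Lambda>. \<forall>\<mu> \<in> paths \<Lambda>. finite (Lambda_min \<Lambda> \<alpha> \<mu>))"

definition exhaustive :: "('l, 'k::finite) kgraph \<Rightarrow> 'l \<Rightarrow> 'l set \<Rightarrow> bool" where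
  "exhaustive \<Lambda> v E \<longleftrightarrow> E \<subseteq> paths_from \<Lambda> v \<and>
     (\<forall>\<alpha> \<in> paths_from \<Lambda> v. \<exists>\<mu> \<in> E. Lambda_min \<Lambda> \<alpha> \<mu> \<noteq> {})"

text \<open>\<open>FE \<Lambda> v\<close> consists of the \<open>E \<in> FE(\<Lambda>)\<close> with \<open>r(E) = v\<close>.  Such an \<open>E\<close> is nonempty, so it
  determines \<open>v\<close>.\<close>

definition FE :: "('l, 'k::finite) kgraph \<Rightarrow> 'l \<Rightarrow> 'l set set" where
  "FE \<Lambda> v = {E. finite E \<and> exhaustive \<Lambda> v E \<and> v \<notin> E}"


section \<open>Boundary paths\<close>

definition enat_vec :: "nat ^ 'k \<Rightarrow> enat ^ 'k" where
  "enat_vec n = (\<chi> i. enat (n $ i))"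

definition Omega :: "enat ^ 'k::finite \<Rightarrow> ((nat ^ 'k) \<times> (nat ^ 'k), 'k) kgraph" where
  "Omega m = \<lparr>paths = {(p, q). p \<le> q \<and> enat_vec q \<le> m},
     rng = (\<lambda>(p, q). (p, p)),
     src = (\<lambda>(p, q). (q, q)),
     comp = (\<lambda>(p, q) (p', q'). (p, q')),
     deg = (\<lambda>(p, q). q - p)\<rparr>"

lemma k_graph_Omega: "k_graph (Omega (m :: enat ^ 'k::finite))"
proof
  fix x :: "(nat ^ 'k) \<times> (nat ^ 'k)" and a b
  assume x: "x \<in> paths (Omega m)" and d: "deg (Omega m) x = a + b"
  obtain p q where pq: "x = (p, q)" "p \<le> q" "enat_vec q \<le> m" using x by (auto simp: Omega_def)
  have q: "q = p + a + b"
    using d pq by (auto simp: Omega_def vec_eq_iff less_eq_vec_def) (metis add.assoc le_add_diff_inverse)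
  have le: "p \<le> p + a" "p + a \<le> q" "enat_vec (p + a) \<le> m"
    using pq q by (auto simp: less_eq_vec_def enat_vec_def) (meson enat_ord_simps(1) le_add1 order_trans)
  show "\<exists>!(\<mu>, \<nu>). \<mu> \<in> paths (Omega m) \<and> \<nu> \<in> paths (Omega m) \<and>
      src (Omega m) \<mu> = rng (Omega m) \<nu> \<and> x = comp (Omega m) \<mu> \<nu> \<and>
      deg (Omega m) \<mu> = a \<and> deg (Omega m) \<nu> = b"
  proof (rule ex1I[of _ "((p, p + a), (p + a, q))"])
    show "case ((p, p + a), (p + a, q)) of (\<mu>, \<nu>) \<Rightarrow> \<mu> \<in> paths (Omega m) \<and> \<nu> \<in> paths (Omega m) \<and>
      src (Omega m) \<mu> = rng (Omega m) \<nu> \<and> x = comp (Omega m) \<mu> \<nu> \<and>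
      deg (Omega m) \<mu> = a \<and> deg (Omega m) \<nu> = b"
      using pq le by (simp add: Omega_def) (simp add: q vec_eq_iff)
  next
    fix y
    assume "case y of (\<mu>, \<nu>) \<Rightarrow> \<mu> \<in> paths (Omega m) \<and> \<nu> \<in> paths (Omega m) \<and>
      src (Omega m) \<mu> = rng (Omega m) \<nu> \<and> x = comp (Omega m) \<mu> \<nu> \<and>
      deg (Omega m) \<mu> = a \<and> deg (Omega m) \<nu> = b"
    then obtain t where t: "y = ((p, t), (t, q))" "p \<le> t" "t - p = a"
      using pq by (auto simp: Omega_def)
    have "t = p + a" using t(2,3) by (auto simp: vec_eq_iff less_eq_vec_def) (metis le_add_diff_inverse)
    then show "y = ((p, p + a), (p + a, q))" using t by simp
  qed
next
  show "countable (paths (Omega m))" by (rule countableI_type)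
qed (auto simp: Omega_def vec_eq_iff less_eq_vec_def enat_vec_def intro: order_trans,
    (meson enat_ord_simps(1) order_trans)+)

text \<open>Functors are extensional, i.e. \<open>undefined\<close> off the domain category, so that equality in HOL
  is equality of functors.\<close>

definition degree_functors ::
    "('a, 'k::finite) kgraph \<Rightarrow> ('l, 'k) kgraph \<Rightarrow> ('a \<Rightarrow> 'l) set" where
  "degree_functors \<Gamma> \<Lambda> = {x \<in> paths \<Gamma> \<rightarrow>\<^sub>E paths \<Lambda>.
     (\<forall>a \<in> paths \<Gamma>. x (rng \<Gamma> a) = rng \<Lambda> (x a) \<and> x (src \<Gamma> a) = src \<Lambda> (x a) \<and>
        deg \<Lambda> (x a) = deg \<Gamma> a) \<and>
     (\<forall>a \<in> paths \<Gamma>. \<forall>b \<in> paths \<Gamma>. src \<Gamma> a = rng \<Gamma> b \<longrightarrow> x (comp \<Gamma> a b) = comp \<Lambda> (x a) (x b))}"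

text \<open>A functor on \<open>Omega m\<close> is stored together with its degree \<open>m\<close>.\<close>

type_synonym ('l, 'k) bpath = "(enat ^ 'k) \<times> ((nat ^ 'k) \<times> (nat ^ 'k) \<Rightarrow> 'l)"

abbreviation bdeg :: "('l, 'k) bpath \<Rightarrow> enat ^ 'k" where
  "bdeg x \<equiv> fst x"

abbreviation bseg :: "('l, 'k) bpath \<Rightarrow> nat ^ 'k \<Rightarrow> nat ^ 'k \<Rightarrow> 'l" where
  "bseg x p q \<equiv> snd x (p, q)"

definition boundary_paths :: "('l, 'k::finite) kgraph \<Rightarrow> ('l, 'k) bpath set" where
  "boundary_paths \<Lambda> = {x. snd x \<in> degree_functors (Omega (bdeg x)) \<Lambda> \<and>
     (\<forall>n. enat_vec n \<le> bdeg x \<longrightarrow> (\<forall>E \<in> FE \<Lambda> (bseg x n n).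
        \<exists>\<alpha> \<in> E. enat_vec (n + deg \<Lambda> \<alpha>) \<le> bdeg x \<and> bseg x n (n + deg \<Lambda> \<alpha>) = \<alpha>))}"

definition boundary_paths_from :: "('l, 'k::finite) kgraph \<Rightarrow> 'l \<Rightarrow> ('l, 'k) bpath set" where
  "boundary_paths_from \<Lambda> v = {x \<in> boundary_paths \<Lambda>. bseg x 0 0 = v}"

definition shift :: "nat ^ 'k::finite \<Rightarrow> ('l, 'k) bpath \<Rightarrow> ('l, 'k) bpath" where
  "shift n x = (let m = bdeg x - enat_vec n in (m, \<lambda>(p, q) \<in> paths (Omega m). bseg x (n + p) (n + q)))"

definition prepend :: "('l, 'k::finite) kgraph \<Rightarrow> 'l \<Rightarrow> ('l, 'k) bpath \<Rightarrow> ('l, 'k) bpath" where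
  "prepend \<Lambda> \<alpha> x = (THE y. y \<in> boundary_paths \<Lambda> \<and> enat_vec (deg \<Lambda> \<alpha>) \<le> bdeg y \<and>
     bseg y 0 (deg \<Lambda> \<alpha>) = \<alpha> \<and> shift (deg \<Lambda> \<alpha>) y = x)"

definition Z_path :: "('l, 'k::finite) kgraph \<Rightarrow> 'l \<Rightarrow> ('l, 'k) bpath set" where
  "Z_path \<Lambda> \<alpha> = prepend \<Lambda> \<alpha> ` boundary_paths_from \<Lambda> (src \<Lambda> \<alpha>)"


section \<open>The boundary-path groupoid\<close>

text \<open>Units of a groupoid are arrows: \<open>g_rng\<close> and \<open>g_src\<close> take arrows to unit arrows.\<close>

record 'g top_groupoid =
  arrows :: "'g set"
  g_rng :: "'g \<Rightarrow> 'g"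
  g_src :: "'g \<Rightarrow> 'g"
  g_comp :: "'g \<Rightarrow> 'g \<Rightarrow> 'g"
  g_inv :: "'g \<Rightarrow> 'g"
  g_top :: "'g topology"

type_synonym ('l, 'k) barrow = "('l, 'k) bpath \<times> (int ^ 'k) \<times> ('l, 'k) bpath"

definition deg_diff :: "nat ^ 'k \<Rightarrow> nat ^ 'k \<Rightarrow> int ^ 'k" where
  "deg_diff m n = (\<chi> i. int (m $ i) - int (n $ i))"

definition boundary_arrows :: "('l, 'k::finite) kgraph \<Rightarrow> ('l, 'k) barrow set" where
  "boundary_arrows \<Lambda> = {(prepend \<Lambda> \<alpha> z, deg_diff (deg \<Lambda> \<alpha>) (deg \<Lambda> \<mu>), prepend \<Lambda> \<mu> z) | \<alpha> \<mu> z.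
     \<alpha> \<in> paths \<Lambda> \<and> \<mu> \<in> paths \<Lambda> \<and> src \<Lambda> \<alpha> = src \<Lambda> \<mu> \<and> z \<in> boundary_paths_from \<Lambda> (src \<Lambda> \<alpha>)}"

definition Z_pair :: "('l, 'k::finite) kgraph \<Rightarrow> 'l \<Rightarrow> 'l \<Rightarrow> ('l, 'k) barrow set" where
  "Z_pair \<Lambda> \<alpha> \<mu> = {(x, n, y) \<in> boundary_arrows \<Lambda>. n = deg_diff (deg \<Lambda> \<alpha>) (deg \<Lambda> \<mu>) \<and>
     x \<in> Z_path \<Lambda> \<alpha> \<and> y \<in> Z_path \<Lambda> \<mu> \<and> shift (deg \<Lambda> \<alpha>) x = shift (deg \<Lambda> \<mu>) y}"

definition Z_pair_minus :: "('l, 'k::finite) kgraph \<Rightarrow> 'l \<Rightarrow> 'l \<Rightarrow> 'l set \<Rightarrow> ('l, 'k) barrow set" where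
  "Z_pair_minus \<Lambda> \<alpha> \<mu> G = Z_pair \<Lambda> \<alpha> \<mu> - (\<Union>\<nu> \<in> G. Z_pair \<Lambda> (comp \<Lambda> \<alpha> \<nu>) (comp \<Lambda> \<mu> \<nu>))"

definition boundary_basis :: "('l, 'k::finite) kgraph \<Rightarrow> ('l, 'k) barrow set set" where
  "boundary_basis \<Lambda> = {Z_pair_minus \<Lambda> \<alpha> \<mu> G | \<alpha> \<mu> G.
     \<alpha> \<in> paths \<Lambda> \<and> \<mu> \<in> paths \<Lambda> \<and> src \<Lambda> \<alpha> = src \<Lambda> \<mu> \<and>
     finite G \<and> G \<subseteq> paths_from \<Lambda> (src \<Lambda> \<alpha>) \<and> \<not> exhaustive \<Lambda> (src \<Lambda> \<alpha>) G}"

definition boundary_groupoid :: "('l, 'k::finite) kgraph \<Rightarrow> ('l, 'k) barrow top_groupoid" where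
  "boundary_groupoid \<Lambda> = \<lparr>arrows = boundary_arrows \<Lambda>,
     g_rng = (\<lambda>(x, m, y). (x, 0, x)),
     g_src = (\<lambda>(x, m, y). (y, 0, y)),
     g_comp = (\<lambda>(x, m, y) (y', n, w). (x, m + n, w)),
     g_inv = (\<lambda>(x, m, y). (y, - m, x)),
     g_top = topology_generated_by (boundary_basis \<Lambda>)\<rparr>"


section \<open>Algebras over a commutative ring\<close>

text \<open>The records of \<^theory>\<open>HOL-Algebra.Module\<close> carry a field \<^const>\<open>one\<close>.  The algebras below need
  not have a unit; the field is never used and is filled with zero.\<close>

locale nonunital_algebra = module R A for R (structure) and A (structure) +
  assumes amult_closed: "\<lbrakk>x \<in> carrier A; y \<in> carrier A\<rbrakk> \<Longrightarrow> x \<otimes>\<^bsub>A\<^esub> y \<in> carrier A"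
    and amult_assoc: "\<lbrakk>x \<in> carrier A; y \<in> carrier A; z \<in> carrier A\<rbrakk>
      \<Longrightarrow> (x \<otimes>\<^bsub>A\<^esub> y) \<otimes>\<^bsub>A\<^esub> z = x \<otimes>\<^bsub>A\<^esub> (y \<otimes>\<^bsub>A\<^esub> z)"
    and amult_l_distr: "\<lbrakk>x \<in> carrier A; y \<in> carrier A; z \<in> carrier A\<rbrakk>
      \<Longrightarrow> (x \<oplus>\<^bsub>A\<^esub> y) \<otimes>\<^bsub>A\<^esub> z = (x \<otimes>\<^bsub>A\<^esub> z) \<oplus>\<^bsub>A\<^esub> (y \<otimes>\<^bsub>A\<^esub> z)"
    and amult_r_distr: "\<lbrakk>x \<in> carrier A; y \<in> carrier A; z \<in> carrier A\<rbrakk>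
      \<Longrightarrow> z \<otimes>\<^bsub>A\<^esub> (x \<oplus>\<^bsub>A\<^esub> y) = (z \<otimes>\<^bsub>A\<^esub> x) \<oplus>\<^bsub>A\<^esub> (z \<otimes>\<^bsub>A\<^esub> y)"
    and smult_amult_l: "\<lbrakk>r \<in> carrier R; x \<in> carrier A; y \<in> carrier A\<rbrakk>
      \<Longrightarrow> (r \<odot>\<^bsub>A\<^esub> x) \<otimes>\<^bsub>A\<^esub> y = r \<odot>\<^bsub>A\<^esub> (x \<otimes>\<^bsub>A\<^esub> y)"
    and smult_amult_r: "\<lbrakk>r \<in> carrier R; x \<in> carrier A; y \<in> carrier A\<rbrakk>
      \<Longrightarrow> x \<otimes>\<^bsub>A\<^esub> (r \<odot>\<^bsub>A\<^esub> y) = r \<odot>\<^bsub>A\<^esub> (x \<otimes>\<^bsub>A\<^esub> y)"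

definition algebra_hom ::
    "('r, 'm) ring_scheme \<Rightarrow> ('r, 'a, 'n) module_scheme \<Rightarrow> ('r, 'b, 'p) module_scheme \<Rightarrow> ('a \<Rightarrow> 'b) set" where
  "algebra_hom R A B = {h \<in> carrier A \<rightarrow> carrier B.
     (\<forall>x \<in> carrier A. \<forall>y \<in> carrier A.
        h (x \<oplus>\<^bsub>A\<^esub> y) = h x \<oplus>\<^bsub>B\<^esub> h y \<and> h (x \<otimes>\<^bsub>A\<^esub> y) = h x \<otimes>\<^bsub>B\<^esub> h y) \<and>
     (\<forall>r \<in> carrier R. \<forall>x \<in> carrier A. h (r \<odot>\<^bsub>A\<^esub> x) = r \<odot>\<^bsub>B\<^esub> h x)}"

definition algebra_iso ::
    "('r, 'm) ring_scheme \<Rightarrow> ('r, 'a, 'n) module_scheme \<Rightarrow> ('r, 'b, 'p) module_scheme \<Rightarrow> ('a \<Rightarrow> 'b) set" where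
  "algebra_iso R A B = {h \<in> algebra_hom R A B. bij_betw h (carrier A) (carrier B)}"

definition algebra_ideal :: "('r, 'm) ring_scheme \<Rightarrow> ('r, 'a, 'n) module_scheme \<Rightarrow> 'a set \<Rightarrow> bool" where
  "algebra_ideal R A J \<longleftrightarrow> submodule J R A \<and>
     (\<forall>j \<in> J. \<forall>x \<in> carrier A. x \<otimes>\<^bsub>A\<^esub> j \<in> J \<and> j \<otimes>\<^bsub>A\<^esub> x \<in> J)"

definition generated_ideal :: "('r, 'm) ring_scheme \<Rightarrow> ('r, 'a, 'n) module_scheme \<Rightarrow> 'a set \<Rightarrow> 'a set" where
  "generated_ideal R A X = \<Inter>{J. algebra_ideal R A J \<and> X \<subseteq> J}"

text \<open>The counterpart of \<^const>\<open>FactRing\<close>.\<close>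

definition quotient_algebra :: "('r, 'a, 'n) module_scheme \<Rightarrow> 'a set \<Rightarrow> ('r, 'a set) module" where
  "quotient_algebra A J = \<lparr>carrier = a_rcosets\<^bsub>A\<^esub> J, mult = rcoset_mult A J, one = J,
     zero = J, add = set_add A,
     smult = (\<lambda>r X. \<Union>x \<in> X. J +>\<^bsub>A\<^esub> (r \<odot>\<^bsub>A\<^esub> x))\<rparr>"

text \<open>The free algebra without unit on a set \<open>X\<close>: finitely supported \<open>R\<close>-valued functions on the
  nonempty words over \<open>X\<close>, with convolution along concatenation of words.\<close>

definition free_algebra :: "('r, 'm) ring_scheme \<Rightarrow> 'x set \<Rightarrow> ('r, 'x list \<Rightarrow> 'r) module" where
  "free_algebra R X = \<lparr>
     carrier = {f. (\<forall>w. f w \<in> carrier R) \<and> finite {w. f w \<noteq> \<zero>\<^bsub>R\<^esub>} \<and>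
        (\<forall>w. f w \<noteq> \<zero>\<^bsub>R\<^esub> \<longrightarrow> w \<noteq> [] \<and> set w \<subseteq> X)},
     mult = (\<lambda>f g w. \<Oplus>\<^bsub>R\<^esub>i \<in> {..length w}. f (take i w) \<otimes>\<^bsub>R\<^esub> g (drop i w)),
     one = (\<lambda>w. \<zero>\<^bsub>R\<^esub>),
     zero = (\<lambda>w. \<zero>\<^bsub>R\<^esub>),
     add = (\<lambda>f g w. f w \<oplus>\<^bsub>R\<^esub> g w),
     smult = (\<lambda>r f w. r \<otimes>\<^bsub>R\<^esub> f w)\<rparr>"

definition monomial :: "('r, 'm) ring_scheme \<Rightarrow> 'r \<Rightarrow> 'x list \<Rightarrow> ('x list \<Rightarrow> 'r)" where
  "monomial R r w = (\<lambda>u. if u = w then r else \<zero>\<^bsub>R\<^esub>)"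

text \<open>Product of a nonempty list; the unit is not involved.\<close>

fun list_product :: "('a, 'm) monoid_scheme \<Rightarrow> 'a list \<Rightarrow> 'a" where
  "list_product A [] = undefined"
| "list_product A [x] = x"
| "list_product A (x # y # zs) = x \<otimes>\<^bsub>A\<^esub> list_product A (y # zs)"


section \<open>Kumjian-Pask algebras\<close>

datatype 'l generator = Path 'l | Ghost 'l

definition kp_generators :: "('l, 'k::finite) kgraph \<Rightarrow> 'l generator set" where
  "kp_generators \<Lambda> = Path ` paths \<Lambda> \<union> Ghost ` (paths \<Lambda> - vertices \<Lambda>)"

definition star :: "('l, 'k::finite) kgraph \<Rightarrow> 'l \<Rightarrow> 'l generator" where
  "star \<Lambda> \<alpha> = (if \<alpha> \<in> vertices \<Lambda> then Path \<alpha> else Ghost \<alpha>)"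

text \<open>The Kumjian-Pask relations for a map \<open>S\<close> into \<open>A\<close>, as pairs (left-hand side, right-hand side).
  In (KP4) the product is taken along every enumeration of \<open>E\<close>: by (KP1)-(KP3) the factors commute,
  so all enumerations give the same relation.\<close>

inductive_set kp_relations :: "('l, 'k::finite) kgraph \<Rightarrow> ('r, 'a, 'n) module_scheme \<Rightarrow> ('l generator \<Rightarrow> 'a) \<Rightarrow> ('a \<times> 'a) set"
  for \<Lambda> A S where
  KP1_idem: "v \<in> vertices \<Lambda> \<Longrightarrow> (S (Path v) \<otimes>\<^bsub>A\<^esub> S (Path v), S (Path v)) \<in> kp_relations \<Lambda> A S"
| KP1_orth: "\<lbrakk>v \<in> vertices \<Lambda>; w \<in> vertices \<Lambda>; v \<noteq> w\<rbrakk>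
    \<Longrightarrow> (S (Path v) \<otimes>\<^bsub>A\<^esub> S (Path w), \<zero>\<^bsub>A\<^esub>) \<in> kp_relations \<Lambda> A S"
| KP2_path: "\<lbrakk>\<alpha> \<in> paths \<Lambda>; \<mu> \<in> paths \<Lambda>; src \<Lambda> \<alpha> = rng \<Lambda> \<mu>\<rbrakk>
    \<Longrightarrow> (S (Path \<alpha>) \<otimes>\<^bsub>A\<^esub> S (Path \<mu>), S (Path (comp \<Lambda> \<alpha> \<mu>))) \<in> kp_relations \<Lambda> A S"
| KP2_ghost: "\<lbrakk>\<alpha> \<in> paths \<Lambda>; \<mu> \<in> paths \<Lambda>; src \<Lambda> \<alpha> = rng \<Lambda> \<mu>\<rbrakk>
    \<Longrightarrow> (S (star \<Lambda> \<mu>) \<otimes>\<^bsub>A\<^esub> S (star \<Lambda> \<alpha>), S (star \<Lambda> (comp \<Lambda> \<alpha> \<mu>))) \<in> kp_relations \<Lambda> A S"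
| KP3: "\<lbrakk>\<alpha> \<in> paths \<Lambda>; \<mu> \<in> paths \<Lambda>\<rbrakk>
    \<Longrightarrow> (S (star \<Lambda> \<alpha>) \<otimes>\<^bsub>A\<^esub> S (Path \<mu>),
         \<Oplus>\<^bsub>A\<^esub>p \<in> Lambda_min \<Lambda> \<alpha> \<mu>. S (Path (fst p)) \<otimes>\<^bsub>A\<^esub> S (star \<Lambda> (snd p))) \<in> kp_relations \<Lambda> A S"
| KP4: "\<lbrakk>v \<in> vertices \<Lambda>; E \<in> FE \<Lambda> v; distinct \<alpha>s; set \<alpha>s = E\<rbrakk>
    \<Longrightarrow> (list_product A (map (\<lambda>\<alpha>. S (Path v) \<ominus>\<^bsub>A\<^esub> S (Path \<alpha>) \<otimes>\<^bsub>A\<^esub> S (star \<Lambda> \<alpha>)) \<alpha>s), \<zero>\<^bsub>A\<^esub>)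
          \<in> kp_relations \<Lambda> A S"

definition kp_family :: "('l, 'k::finite) kgraph \<Rightarrow> ('r, 'a, 'n) module_scheme \<Rightarrow> ('l generator \<Rightarrow> 'a) \<Rightarrow> bool" where
  "kp_family \<Lambda> A S \<longleftrightarrow> S \<in> kp_generators \<Lambda> \<rightarrow> carrier A \<and> (\<forall>(a, b) \<in> kp_relations \<Lambda> A S. a = b)"

definition kp_free :: "('r, 'm) ring_scheme \<Rightarrow> ('l, 'k::finite) kgraph \<Rightarrow> ('r, 'l generator list \<Rightarrow> 'r) module" where
  "kp_free R \<Lambda> = free_algebra R (kp_generators \<Lambda>)"

definition kp_ideal :: "('r, 'm) ring_scheme \<Rightarrow> ('l, 'k::finite) kgraph \<Rightarrow> ('l generator list \<Rightarrow> 'r) set" where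
  "kp_ideal R \<Lambda> = generated_ideal R (kp_free R \<Lambda>)
     {a \<ominus>\<^bsub>kp_free R \<Lambda>\<^esub> b | a b. (a, b) \<in> kp_relations \<Lambda> (kp_free R \<Lambda>) (\<lambda>g. monomial R \<one>\<^bsub>R\<^esub> [g])}"

text \<open>\<open>KP_R(\<Lambda>)\<close>, with its universal family \<open>kp_gen R \<Lambda>\<close>; for the universal property see
  \<open>kp_algebra_universal\<close> at the end of this theory.\<close>

definition kp_algebra :: "('r, 'm) ring_scheme \<Rightarrow> ('l, 'k::finite) kgraph \<Rightarrow>
    ('r, ('l generator list \<Rightarrow> 'r) set) module" where
  "kp_algebra R \<Lambda> = quotient_algebra (kp_free R \<Lambda>) (kp_ideal R \<Lambda>)"

definition kp_gen :: "('r, 'm) ring_scheme \<Rightarrow> ('l, 'k::finite) kgraph \<Rightarrow> 'l generator \<Rightarrow>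
    ('l generator list \<Rightarrow> 'r) set" where
  "kp_gen R \<Lambda> g = kp_ideal R \<Lambda> +>\<^bsub>kp_free R \<Lambda>\<^esub> monomial R \<one>\<^bsub>R\<^esub> [g]"


section \<open>Steinberg algebras\<close>

text \<open>In the product, for fixed \<open>a\<close>, only finitely many \<open>b\<close> with \<open>g_rng G b = g_rng G a\<close> satisfy
  \<open>f b \<noteq> \<zero>\<close> if \<open>G\<close> is ample; the index set is restricted to these because \<^const>\<open>finsum\<close> is zero on
  infinite index sets.\<close>

definition steinberg_algebra :: "('r, 'm) ring_scheme \<Rightarrow> 'g top_groupoid \<Rightarrow> ('r, 'g \<Rightarrow> 'r) module" where
  "steinberg_algebra R G = \<lparr>
     carrier = {f \<in> arrows G \<rightarrow>\<^sub>E carrier R.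
        (\<forall>a \<in> arrows G. \<exists>U. openin (g_top G) U \<and> a \<in> U \<and> (\<forall>b \<in> U. f b = f a)) \<and>
        compactin (g_top G) (Abstract_Topology.closure_of (g_top G) {a \<in> arrows G. f a \<noteq> \<zero>\<^bsub>R\<^esub>})},
     mult = (\<lambda>f g. \<lambda>a \<in> arrows G.
        \<Oplus>\<^bsub>R\<^esub>b \<in> {b \<in> arrows G. g_rng G b = g_rng G a \<and> f b \<noteq> \<zero>\<^bsub>R\<^esub>}.
          f b \<otimes>\<^bsub>R\<^esub> g (g_comp G (g_inv G b) a)),
     one = (\<lambda>a \<in> arrows G. \<zero>\<^bsub>R\<^esub>),
     zero = (\<lambda>a \<in> arrows G. \<zero>\<^bsub>R\<^esub>),
     add = (\<lambda>f g. \<lambda>a \<in> arrows G. f a \<oplus>\<^bsub>R\<^esub> g a),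
     smult = (\<lambda>r f. \<lambda>a \<in> arrows G. r \<otimes>\<^bsub>R\<^esub> f a)\<rparr>"

definition char_fun :: "('r, 'm) ring_scheme \<Rightarrow> 'g top_groupoid \<Rightarrow> 'g set \<Rightarrow> ('g \<Rightarrow> 'r)" where
  "char_fun R G U = (\<lambda>a \<in> arrows G. if a \<in> U then \<one>\<^bsub>R\<^esub> else \<zero>\<^bsub>R\<^esub>)"


section \<open>The universal property of the Kumjian-Pask algebra\<close>

context cring
begin

lemma free_algebra_simps:
  "carrier (free_algebra R X) = {f. (\<forall>w. f w \<in> carrier R) \<and> finite {w. f w \<noteq> \<zero>} \<and>
        (\<forall>w. f w \<noteq> \<zero> \<longrightarrow> w \<noteq> [] \<and> set w \<subseteq> X)}"
  "f \<otimes>\<^bsub>free_algebra R X\<^esub> g = (\<lambda>w. \<Oplus>i \<in> {..length w}. f (take i w) \<otimes> g (drop i w))"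
  "\<zero>\<^bsub>free_algebra R X\<^esub> = (\<lambda>w. \<zero>)"
  "f \<oplus>\<^bsub>free_algebra R X\<^esub> g = (\<lambda>w. f w \<oplus> g w)"
  "r \<odot>\<^bsub>free_algebra R X\<^esub> f = (\<lambda>w. r \<otimes> f w)"
  by (simp_all add: free_algebra_def)

lemma free_carrierI:
  assumes "\<And>w. f w \<in> carrier R" "finite W" "\<And>w. f w \<noteq> \<zero> \<Longrightarrow> w \<in> W \<and> w \<noteq> [] \<and> set w \<subseteq> X"
  shows "f \<in> carrier (free_algebra R X)"
  using assms finite_subset[of "{w. f w \<noteq> \<zero>}" W] by (auto simp: free_algebra_simps)

lemma free_carrierD:
  assumes "f \<in> carrier (free_algebra R X)"
  shows "f w \<in> carrier R" "finite {w. f w \<noteq> \<zero>}" "f w \<noteq> \<zero> \<Longrightarrow> w \<noteq> []" "f w \<noteq> \<zero> \<Longrightarrow> set w \<subseteq> X"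
  using assms by (auto simp: free_algebra_simps)

lemma free_carrier_Nil: "f \<in> carrier (free_algebra R X) \<Longrightarrow> f [] = \<zero>"
  using free_carrierD(3) by blast

lemma free_add_closed:
  assumes f: "f \<in> carrier (free_algebra R X)" and g: "g \<in> carrier (free_algebra R X)"
  shows "(\<lambda>w. f w \<oplus> g w) \<in> carrier (free_algebra R X)"
proof (rule free_carrierI)
  show "finite ({w. f w \<noteq> \<zero>} \<union> {w. g w \<noteq> \<zero>})" using free_carrierD(2) f g by blast
  fix w assume nz: "f w \<oplus> g w \<noteq> \<zero>"
  then have "f w \<noteq> \<zero> \<or> g w \<noteq> \<zero>" by auto
  then show "w \<in> {w. f w \<noteq> \<zero>} \<union> {w. g w \<noteq> \<zero>} \<and> w \<noteq> [] \<and> set w \<subseteq> X"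
    using free_carrierD(3,4)[OF f] free_carrierD(3,4)[OF g] by blast
qed (use free_carrierD(1) f g in blast)

lemma free_smult_closed:
  assumes f: "f \<in> carrier (free_algebra R X)" and r: "r \<in> carrier R"
  shows "(\<lambda>w. r \<otimes> f w) \<in> carrier (free_algebra R X)"
proof (rule free_carrierI)
  show "finite ({w. f w \<noteq> \<zero>})" using free_carrierD(2) f by blast
  fix w assume nz: "r \<otimes> f w \<noteq> \<zero>"
  then have "f w \<noteq> \<zero>" using r by auto
  then show "w \<in> {w. f w \<noteq> \<zero>} \<and> w \<noteq> [] \<and> set w \<subseteq> X"
    using free_carrierD(3,4)[OF f] by blast
qed (use free_carrierD(1)[OF f] r in blast)

lemma free_mult_closed:
  assumes f: "f \<in> carrier (free_algebra R X)" and g: "g \<in> carrier (free_algebra R X)"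
  shows "(\<lambda>w. \<Oplus>i \<in> {..length w}. f (take i w) \<otimes> g (drop i w)) \<in> carrier (free_algebra R X)"
    (is "?h \<in> _")
proof (rule free_carrierI)
  let ?W = "(\<lambda>(u, v). u @ v) ` ({w. f w \<noteq> \<zero>} \<times> {w. g w \<noteq> \<zero>})"
  show "finite ?W" using free_carrierD(2) f g by blast
  show "?h w \<in> carrier R" for w
    using free_carrierD(1)[OF f] free_carrierD(1)[OF g] by (auto intro!: finsum_closed)
  fix w assume nz: "?h w \<noteq> \<zero>"
  then obtain i where i: "f (take i w) \<otimes> g (drop i w) \<noteq> \<zero>"
    using add.finprod_one_eqI[of "{..length w}" "\<lambda>i. f (take i w) \<otimes> g (drop i w)"] by blast
  then have fg: "f (take i w) \<noteq> \<zero>" "g (drop i w) \<noteq> \<zero>"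
    using free_carrierD(1)[OF f] free_carrierD(1)[OF g] by auto
  have "w = (\<lambda>(u, v). u @ v) (take i w, drop i w)" by simp
  then have "w \<in> ?W" using fg by blast
  moreover have "w \<noteq> []" using free_carrierD(3)[OF f fg(1)] by auto
  moreover have "set w \<subseteq> X"
    using free_carrierD(4)[OF f fg(1)] free_carrierD(4)[OF g fg(2)]
    by (metis append_take_drop_id set_append sup.bounded_iff)
  ultimately show "w \<in> ?W \<and> w \<noteq> [] \<and> set w \<subseteq> X" by blast
qed

lemma finsum_triangle:
  fixes F :: "nat \<Rightarrow> nat \<Rightarrow> 'a" and n :: nat
  assumes "\<And>i j. F i j \<in> carrier R"
  shows "(\<Oplus>i\<in>{..n}. \<Oplus>j\<in>{..i}. F i j) = (\<Oplus>j\<in>{..n}. \<Oplus>l\<in>{..n - j}. F (j + l) j)"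
proof (induction n)
  case 0
  then show ?case using assms by simp
next
  case (Suc n)
  have S: "(\<Oplus>l\<in>{..Suc n - j}. F (j + l) j) = F (Suc n) j \<oplus> (\<Oplus>l\<in>{..n - j}. F (j + l) j)"
    if "j \<in> {..n}" for j
    using that assms by (simp add: Suc_diff_le Pi_def)
  have "(\<Oplus>j\<in>{..Suc n}. \<Oplus>l\<in>{..Suc n - j}. F (j + l) j)
      = F (Suc n) (Suc n) \<oplus> (\<Oplus>j\<in>{..n}. \<Oplus>l\<in>{..Suc n - j}. F (j + l) j)"
    using assms by (simp add: Pi_def)
  also have "(\<Oplus>j\<in>{..n}. \<Oplus>l\<in>{..Suc n - j}. F (j + l) j)
      = (\<Oplus>j\<in>{..n}. F (Suc n) j \<oplus> (\<Oplus>l\<in>{..n - j}. F (j + l) j))"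
    by (rule finsum_cong') (use S assms in auto)
  also have "\<dots> = (\<Oplus>j\<in>{..n}. F (Suc n) j) \<oplus> (\<Oplus>j\<in>{..n}. \<Oplus>l\<in>{..n - j}. F (j + l) j)"
    using assms by (simp add: Pi_def finsum_addf)
  also have "(\<Oplus>j\<in>{..n}. \<Oplus>l\<in>{..n - j}. F (j + l) j) = (\<Oplus>i\<in>{..n}. \<Oplus>j\<in>{..i}. F i j)"
    using Suc by simp
  finally show ?case using assms by (simp add: Pi_def a_ac)
qed

lemma free_mult_assoc:
  assumes f: "f \<in> carrier (free_algebra R X)" and g: "g \<in> carrier (free_algebra R X)"
    and h: "h \<in> carrier (free_algebra R X)"
  shows "(f \<otimes>\<^bsub>free_algebra R X\<^esub> g) \<otimes>\<^bsub>free_algebra R X\<^esub> h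
    = f \<otimes>\<^bsub>free_algebra R X\<^esub> (g \<otimes>\<^bsub>free_algebra R X\<^esub> h)"
proof
  fix w
  note c = free_carrierD(1)[OF f] free_carrierD(1)[OF g] free_carrierD(1)[OF h]
  let ?F = "\<lambda>i j. f (take j w) \<otimes> (g (drop j (take i w)) \<otimes> h (drop i w))"
  have L: "(\<Oplus>j\<in>{..length (take i w)}. f (take j (take i w)) \<otimes> g (drop j (take i w))) \<otimes> h (drop i w)
     = (\<Oplus>j\<in>{..i}. ?F i j)" if "i \<in> {..length w}" for i
  proof -
    have "(\<Oplus>j\<in>{..length (take i w)}. f (take j (take i w)) \<otimes> g (drop j (take i w))) \<otimes> h (drop i w)
      = (\<Oplus>j\<in>{..i}. f (take j (take i w)) \<otimes> g (drop j (take i w))  \<otimes> h (drop i w))"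
      using that c by (simp add: finsum_ldistr min_absorb2 Pi_def)
    also have "\<dots> = (\<Oplus>j\<in>{..i}. ?F i j)"
      by (rule finsum_cong') (use c in \<open>auto simp: min_absorb1 m_assoc\<close>)
    finally show ?thesis .
  qed
  have Rr: "f (take j w) \<otimes> (\<Oplus>l\<in>{..length (drop j w)}. g (take l (drop j w)) \<otimes> h (drop l (drop j w)))
     = (\<Oplus>l\<in>{..length w - j}. ?F (j + l) j)" for j
  proof -
    have "f (take j w) \<otimes> (\<Oplus>l\<in>{..length (drop j w)}. g (take l (drop j w)) \<otimes> h (drop l (drop j w)))
      = (\<Oplus>l\<in>{..length w - j}. f (take j w) \<otimes> (g (take l (drop j w)) \<otimes> h (drop l (drop j w))))"
      using c by (simp add: finsum_rdistr Pi_def)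
    also have "\<dots> = (\<Oplus>l\<in>{..length w - j}. ?F (j + l) j)"
      by (rule finsum_cong') (use c in \<open>auto simp: take_drop add.commute\<close>)
    finally show ?thesis .
  qed
  have "((f \<otimes>\<^bsub>free_algebra R X\<^esub> g) \<otimes>\<^bsub>free_algebra R X\<^esub> h) w = (\<Oplus>i\<in>{..length w}. \<Oplus>j\<in>{..i}. ?F i j)"
    unfolding free_algebra_simps by (rule finsum_cong') (use L c in \<open>auto intro!: finsum_closed\<close>)
  also have "\<dots> = (\<Oplus>j\<in>{..length w}. \<Oplus>l\<in>{..length w - j}. ?F (j + l) j)"
    by (rule finsum_triangle) (use c in auto)
  also have "\<dots> = (f \<otimes>\<^bsub>free_algebra R X\<^esub> (g \<otimes>\<^bsub>free_algebra R X\<^esub> h)) w"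
    unfolding free_algebra_simps using Rr by simp
  finally show "((f \<otimes>\<^bsub>free_algebra R X\<^esub> g) \<otimes>\<^bsub>free_algebra R X\<^esub> h) w
    = (f \<otimes>\<^bsub>free_algebra R X\<^esub> (g \<otimes>\<^bsub>free_algebra R X\<^esub> h)) w" .
qed

lemma free_zero_closed: "(\<lambda>w. \<zero>) \<in> carrier (free_algebra R X)"
  by (simp add: free_algebra_simps)

lemma nonunital_algebra_free: "nonunital_algebra R (free_algebra R X)"
proof (intro nonunital_algebra.intro moduleI nonunital_algebra_axioms.intro)
  let ?F = "free_algebra R X"
  note c = free_carrierD(1)[of _ X]
  show "(x \<otimes>\<^bsub>?F\<^esub> y) \<otimes>\<^bsub>?F\<^esub> z = x \<otimes>\<^bsub>?F\<^esub> (y \<otimes>\<^bsub>?F\<^esub> z)"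
    if "x \<in> carrier ?F" "y \<in> carrier ?F" "z \<in> carrier ?F" for x y z
    using that by (rule free_mult_assoc)
  show "abelian_group ?F"
  proof (rule abelian_groupI)
    fix x assume x: "x \<in> carrier ?F"
    have "(\<lambda>w. \<ominus> \<one> \<otimes> x w) \<in> carrier ?F" by (rule free_smult_closed[OF x]) simp
    moreover have "(\<lambda>w. \<ominus> \<one> \<otimes> x w) \<oplus>\<^bsub>?F\<^esub> x = \<zero>\<^bsub>?F\<^esub>"
      using c[OF x] by (auto simp: free_algebra_simps l_minus l_neg)
    ultimately show "\<exists>y \<in> carrier ?F. y \<oplus>\<^bsub>?F\<^esub> x = \<zero>\<^bsub>?F\<^esub>" by blast
    show "x \<oplus>\<^bsub>?F\<^esub> y = y \<oplus>\<^bsub>?F\<^esub> x" if "y \<in> carrier ?F" for y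
      using c[OF x] c[OF that] by (simp add: free_algebra_simps(4) a_comm)
  qed (auto simp: free_algebra_simps(2-5) free_add_closed free_zero_closed c a_assoc)
qed (auto simp: free_algebra_simps(2-5) free_add_closed free_zero_closed free_carrierD(1)[of _ X] free_smult_closed free_mult_closed
   l_distr r_distr m_assoc is_cring Pi_def finsum_ldistr finsum_rdistr
   m_lcomm)


lemma monomial_closed:
  assumes "r \<in> carrier R" "w \<noteq> []" "set w \<subseteq> X"
  shows "monomial R r w \<in> carrier (free_algebra R X)"
  by (rule free_carrierI[of _ "{w}"]) (use assms in \<open>auto simp: monomial_def split: if_splits\<close>)

lemma monomial_mult:
  assumes "r \<in> carrier R" "s \<in> carrier R"
  shows "monomial R r u \<otimes>\<^bsub>free_algebra R X\<^esub> monomial R s v = monomial R (r \<otimes> s) (u @ v)"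
proof
  fix w
  show "(monomial R r u \<otimes>\<^bsub>free_algebra R X\<^esub> monomial R s v) w = monomial R (r \<otimes> s) (u @ v) w"
  proof (cases "w = u @ v")
    case True
    have "(monomial R r u \<otimes>\<^bsub>free_algebra R X\<^esub> monomial R s v) w
       = (\<Oplus>i\<in>{..length w}. if i = length u then r \<otimes> s else \<zero>)"
      unfolding free_algebra_simps monomial_def True
    proof (rule finsum_cong'[OF refl])
      fix i assume "i \<in> {..length (u @ v)}"
      then have "take i (u @ v) = u \<longleftrightarrow> i = length u"
        by (auto dest: arg_cong[where f = length])
      then show "(if take i (u @ v) = u then r else \<zero>) \<otimes> (if drop i (u @ v) = v then s else \<zero>)
        = (if i = length u then r \<otimes> s else \<zero>)" using assms by auto
    qed (use assms in auto)
    also have "\<dots> = r \<otimes> s"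
      using add.finprod_singleton_swap[of "length u" "{..length w}" "\<lambda>_. r \<otimes> s"] assms True by simp
    finally show ?thesis by (simp add: monomial_def True)
  next
    case False
    have "(if take i w = u then r else \<zero>) \<otimes> (if drop i w = v then s else \<zero>) = \<zero>" for i
    proof -
      have "\<not> (take i w = u \<and> drop i w = v)" using False append_take_drop_id[of i w] by fastforce
      then show ?thesis using assms by auto
    qed
    then show ?thesis using False by (simp add: free_algebra_simps monomial_def)
  qed
qed

lemma free_algebra_induct [consumes 1, case_names zero add]:
  assumes f: "f \<in> carrier (free_algebra R X)"
    and z: "P \<zero>\<^bsub>free_algebra R X\<^esub>"
    and a: "\<And>r w g. \<lbrakk>r \<in> carrier R; w \<noteq> []; set w \<subseteq> X; g \<in> carrier (free_algebra R X); P g\<rbrakk>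
      \<Longrightarrow> P (monomial R r w \<oplus>\<^bsub>free_algebra R X\<^esub> g)"
  shows "P f"
proof -
  have "f \<in> carrier (free_algebra R X) \<Longrightarrow> {w. f w \<noteq> \<zero>} \<subseteq> W \<Longrightarrow> P f" if "finite W" for W f
    using that
  proof (induction W arbitrary: f rule: finite_induct)
    case empty
    then have "f = (\<lambda>w. \<zero>)" by auto
    then show ?case using z by (simp add: free_algebra_simps)
  next
    case (insert w W)
    note f = insert.prems(1)
    show ?case
    proof (cases "f w = \<zero>")
      case True
      then have "{w. f w \<noteq> \<zero>} \<subseteq> W" using insert.prems(2) by auto
      then show ?thesis using insert.IH[OF f] by simp
    next
      case False
      let ?g = "f(w := \<zero>)"
      have g: "?g \<in> carrier (free_algebra R X)"
        by (rule free_carrierI[of _ "{w. f w \<noteq> \<zero>}"])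
          (use free_carrierD[OF f] in \<open>auto split: if_splits\<close>)
      have "P ?g" by (rule insert.IH[OF g]) (use insert.prems in auto)
      then have "P (\<lambda>u. monomial R (f w) w u \<oplus> ?g u)"
        using a[of "f w" w ?g] free_carrierD(1,3,4)[OF f] False g
        unfolding free_algebra_simps(4) by blast
      moreover have "(\<lambda>u. monomial R (f w) w u \<oplus> ?g u) = f"
        using free_carrierD(1)[OF f] by (auto simp: monomial_def)
      ultimately show ?thesis by simp
    qed
  qed
  from this[OF free_carrierD(2)[OF f] f] show ?thesis by blast
qed

end

context nonunital_algebra
begin

lemma list_product_closed: "\<lbrakk>xs \<noteq> []; set xs \<subseteq> carrier A\<rbrakk> \<Longrightarrow> list_product A xs \<in> carrier A"
proof (induction xs)
  case (Cons x xs)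
  then show ?case by (cases xs) (auto intro: amult_closed)
qed simp

lemma list_product_append:
  "\<lbrakk>xs \<noteq> []; ys \<noteq> []; set xs \<subseteq> carrier A; set ys \<subseteq> carrier A\<rbrakk>
    \<Longrightarrow> list_product A (xs @ ys) = list_product A xs \<otimes>\<^bsub>A\<^esub> list_product A ys"
proof (induction xs)
  case (Cons x xs)
  show ?case
  proof (cases xs)
    case Nil
    then show ?thesis using Cons.prems by (cases ys) auto
  next
    case (Cons x' xs')
    then show ?thesis using Cons.IH Cons.prems list_product_closed[of xs] list_product_closed[of ys]
      by (simp add: amult_assoc)
  qed
qed simp

lemma amult_zero:
  assumes "x \<in> carrier A"
  shows "x \<otimes>\<^bsub>A\<^esub> \<zero>\<^bsub>A\<^esub> = \<zero>\<^bsub>A\<^esub>" "\<zero>\<^bsub>A\<^esub> \<otimes>\<^bsub>A\<^esub> x = \<zero>\<^bsub>A\<^esub>"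
proof -
  show "x \<otimes>\<^bsub>A\<^esub> \<zero>\<^bsub>A\<^esub> = \<zero>\<^bsub>A\<^esub>"
    using smult_amult_r[of \<zero> x "\<zero>\<^bsub>A\<^esub>"] amult_closed[of x "\<zero>\<^bsub>A\<^esub>"] assms by simp
  show "\<zero>\<^bsub>A\<^esub> \<otimes>\<^bsub>A\<^esub> x = \<zero>\<^bsub>A\<^esub>"
    using smult_amult_l[of \<zero> "\<zero>\<^bsub>A\<^esub>" x] amult_closed[of "\<zero>\<^bsub>A\<^esub>" x] assms by simp
qed

definition free_lift :: "('x \<Rightarrow> 'c) \<Rightarrow> ('x list \<Rightarrow> 'a) \<Rightarrow> 'c" where
  "free_lift S f = (\<Oplus>\<^bsub>A\<^esub>w \<in> {w. f w \<noteq> \<zero>}. f w \<odot>\<^bsub>A\<^esub> list_product A (map S w))"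

context
  fixes S :: "'x \<Rightarrow> 'c" and X
  assumes S: "S \<in> X \<rightarrow> carrier A"
begin

lemma word_closed: "\<lbrakk>w \<noteq> []; set w \<subseteq> X\<rbrakk> \<Longrightarrow> list_product A (map S w) \<in> carrier A"
  using S by (intro list_product_closed) auto

lemma free_lift_eq:
  assumes f: "f \<in> carrier (free_algebra R X)" and W: "finite W" "{w. f w \<noteq> \<zero>} \<subseteq> W"
    "\<And>w. w \<in> W \<Longrightarrow> w \<noteq> [] \<and> set w \<subseteq> X"
  shows "free_lift S f = (\<Oplus>\<^bsub>A\<^esub>w \<in> W. f w \<odot>\<^bsub>A\<^esub> list_product A (map S w))"
  unfolding free_lift_def
  by (rule M.add.finprod_mono_neutral_cong_left[OF W(1,2)])
    (use W(3) word_closed R.free_carrierD(1)[OF f] in auto)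

lemma free_lift_term_closed:
  assumes f: "f \<in> carrier (free_algebra R X)" and w: "f w \<noteq> \<zero>"
  shows "list_product A (map S w) \<in> carrier A"
  using word_closed R.free_carrierD(3,4)[OF f w] by blast

lemma free_lift_closed:
  assumes f: "f \<in> carrier (free_algebra R X)"
  shows "free_lift S f \<in> carrier A"
  unfolding free_lift_def
proof (rule M.finsum_closed, rule Pi_I)
  fix w assume "w \<in> {w. f w \<noteq> \<zero>}"
  then show "f w \<odot>\<^bsub>A\<^esub> list_product A (map S w) \<in> carrier A"
    using free_lift_term_closed[OF f] R.free_carrierD(1)[OF f] by simp
qed

lemma free_lift_zero: "free_lift S \<zero>\<^bsub>free_algebra R X\<^esub> = \<zero>\<^bsub>A\<^esub>"
  by (simp add: free_lift_def R.free_algebra_simps(3))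

lemma free_lift_add:
  assumes f: "f \<in> carrier (free_algebra R X)" and g: "g \<in> carrier (free_algebra R X)"
  shows "free_lift S (f \<oplus>\<^bsub>free_algebra R X\<^esub> g) = free_lift S f \<oplus>\<^bsub>A\<^esub> free_lift S g"
proof -
  define W where "W = {w. f w \<noteq> \<zero>} \<union> {w. g w \<noteq> \<zero>}"
  let ?s = "\<lambda>w. list_product A (map S w)"
  have c: "f w \<in> carrier R" "g w \<in> carrier R" for w
    by (rule R.free_carrierD(1)[OF f], rule R.free_carrierD(1)[OF g])
  have fin: "finite W" unfolding W_def using R.free_carrierD(2)[OF f] R.free_carrierD(2)[OF g] by simp
  have W: "w \<noteq> [] \<and> set w \<subseteq> X" if "w \<in> W" for w
    using that R.free_carrierD(3,4)[OF f, of w] R.free_carrierD(3,4)[OF g, of w] unfolding W_def by blast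
  have s: "?s w \<in> carrier A" if "w \<in> W" for w using W[OF that] word_closed by blast
  have "free_lift S (\<lambda>w. f w \<oplus> g w) = (\<Oplus>\<^bsub>A\<^esub>w \<in> W. (f w \<oplus> g w) \<odot>\<^bsub>A\<^esub> ?s w)"
    by (rule free_lift_eq[OF R.free_add_closed[OF f g] fin _ W]) (auto simp: W_def)
  also have "\<dots> = (\<Oplus>\<^bsub>A\<^esub>w \<in> W. f w \<odot>\<^bsub>A\<^esub> ?s w \<oplus>\<^bsub>A\<^esub> g w \<odot>\<^bsub>A\<^esub> ?s w)"
    by (rule M.finsum_cong') (auto simp: smult_l_distr c s)
  also have "\<dots> = (\<Oplus>\<^bsub>A\<^esub>w \<in> W. f w \<odot>\<^bsub>A\<^esub> ?s w) \<oplus>\<^bsub>A\<^esub> (\<Oplus>\<^bsub>A\<^esub>w \<in> W. g w \<odot>\<^bsub>A\<^esub> ?s w)"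
    by (rule M.finsum_addf) (auto simp: c s)
  also have "(\<Oplus>\<^bsub>A\<^esub>w \<in> W. f w \<odot>\<^bsub>A\<^esub> ?s w) = free_lift S f"
    by (rule free_lift_eq[OF f fin _ W, symmetric]) (auto simp: W_def)
  also have "(\<Oplus>\<^bsub>A\<^esub>w \<in> W. g w \<odot>\<^bsub>A\<^esub> ?s w) = free_lift S g"
    by (rule free_lift_eq[OF g fin _ W, symmetric]) (auto simp: W_def)
  finally show ?thesis by (simp add: R.free_algebra_simps(4))
qed

lemma free_lift_monomial:
  assumes r: "r \<in> carrier R" and w: "w \<noteq> []" "set w \<subseteq> X"
  shows "free_lift S (monomial R r w) = r \<odot>\<^bsub>A\<^esub> list_product A (map S w)"
proof -
  have s: "r \<odot>\<^bsub>A\<^esub> list_product A (map S w) \<in> carrier A" using r word_closed[OF w] by simp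
  have "free_lift S (monomial R r w)
      = (\<Oplus>\<^bsub>A\<^esub>u \<in> {w}. monomial R r w u \<odot>\<^bsub>A\<^esub> list_product A (map S u))"
  proof (rule free_lift_eq[OF R.monomial_closed[OF r w]])
    show "{u. monomial R r w u \<noteq> \<zero>} \<subseteq> {w}" by (auto simp: monomial_def split: if_splits)
  qed (use w in auto)
  then show ?thesis using s by (simp add: monomial_def)
qed

lemma free_lift_smult:
  assumes f: "f \<in> carrier (free_algebra R X)" and r: "r \<in> carrier R"
  shows "free_lift S (r \<odot>\<^bsub>free_algebra R X\<^esub> f) = r \<odot>\<^bsub>A\<^esub> free_lift S f"
proof -
  let ?F = "free_algebra R X"
  interpret F: nonunital_algebra R ?F by (rule R.nonunital_algebra_free)
  have m: "r \<odot>\<^bsub>?F\<^esub> monomial R s w = monomial R (r \<otimes> s) w" for s w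
    using r by (auto simp: monomial_def R.free_algebra_simps)
  show ?thesis
    using f
  proof (induction rule: R.free_algebra_induct)
    case zero
    then show ?case using r by (simp add: free_lift_zero)
  next
    case (add s w g)
    then show ?case
      using r by (simp add: F.smult_r_distr free_lift_add m R.monomial_closed free_lift_monomial
          smult_r_distr word_closed free_lift_closed smult_assoc1)
  qed
qed

lemma free_lift_mult:
  assumes f: "f \<in> carrier (free_algebra R X)" and g: "g \<in> carrier (free_algebra R X)"
  shows "free_lift S (f \<otimes>\<^bsub>free_algebra R X\<^esub> g) = free_lift S f \<otimes>\<^bsub>A\<^esub> free_lift S g"
proof -
  let ?F = "free_algebra R X"
  interpret F: nonunital_algebra R ?F by (rule R.nonunital_algebra_free)
  have mono: "free_lift S (monomial R r u \<otimes>\<^bsub>?F\<^esub> g) = free_lift S (monomial R r u) \<otimes>\<^bsub>A\<^esub> free_lift S g"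
    if u: "r \<in> carrier R" "u \<noteq> []" "set u \<subseteq> X" for r u
    using g
  proof (induction rule: R.free_algebra_induct)
    case zero
    then show ?case using u
      by (simp add: F.amult_zero free_lift_zero amult_zero free_lift_closed R.monomial_closed)
  next
    case (add s w q)
    have Su: "set (map S u) \<subseteq> carrier A" "set (map S w) \<subseteq> carrier A"
      using S u add by (auto simp: Pi_iff)
    have "free_lift S (monomial R (r \<otimes> s) (u @ w)) = (r \<otimes> s) \<odot>\<^bsub>A\<^esub> list_product A (map S (u @ w))"
      using u add by (intro free_lift_monomial) auto
    also have "list_product A (map S (u @ w)) = list_product A (map S u) \<otimes>\<^bsub>A\<^esub> list_product A (map S w)"
      using u add list_product_append[OF _ _ Su] by simp
    also have "(r \<otimes> s) \<odot>\<^bsub>A\<^esub> (list_product A (map S u) \<otimes>\<^bsub>A\<^esub> list_product A (map S w))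
       = (r \<odot>\<^bsub>A\<^esub> list_product A (map S u)) \<otimes>\<^bsub>A\<^esub> (s \<odot>\<^bsub>A\<^esub> list_product A (map S w))"
      using u add word_closed by (simp add: smult_amult_l smult_assoc1 amult_closed) (simp add: smult_amult_r)
    finally have "free_lift S (monomial R r u \<otimes>\<^bsub>?F\<^esub> monomial R s w)
       = free_lift S (monomial R r u) \<otimes>\<^bsub>A\<^esub> free_lift S (monomial R s w)"
      using u add by (simp add: R.monomial_mult free_lift_monomial)
    then show ?case using add u
      by (simp add: F.amult_r_distr R.monomial_closed free_lift_add
          F.amult_closed amult_r_distr free_lift_closed)
  qed
  show ?thesis
    using f
  proof (induction rule: R.free_algebra_induct)
    case zero
    then show ?case using g
      by (simp add: F.amult_zero free_lift_zero amult_zero free_lift_closed)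
  next
    case (add s w q)
    then show ?case using mono[of s w] g
      by (simp add: F.amult_l_distr R.monomial_closed free_lift_add
          F.amult_closed amult_l_distr free_lift_closed)
  qed
qed

lemma free_lift_hom: "free_lift S \<in> algebra_hom R (free_algebra R X) A"
  by (auto simp: algebra_hom_def free_lift_closed free_lift_mult free_lift_add free_lift_smult)

lemma free_lift_generator: "x \<in> X \<Longrightarrow> free_lift S (monomial R \<one> [x]) = S x"
  using S smult_one[of "S x"] free_lift_monomial[of \<one> "[x]"] by (auto simp: Pi_iff)

end

end


lemma algebra_hom_props:
  fixes R (structure)
  assumes A: "nonunital_algebra R A" and B: "nonunital_algebra R B" and h: "h \<in> algebra_hom R A B"
  shows "x \<in> carrier A \<Longrightarrow> h x \<in> carrier B"
    and "\<lbrakk>x \<in> carrier A; y \<in> carrier A\<rbrakk> \<Longrightarrow> h (x \<oplus>\<^bsub>A\<^esub> y) = h x \<oplus>\<^bsub>B\<^esub> h y"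
    and "\<lbrakk>x \<in> carrier A; y \<in> carrier A\<rbrakk> \<Longrightarrow> h (x \<otimes>\<^bsub>A\<^esub> y) = h x \<otimes>\<^bsub>B\<^esub> h y"
    and "\<lbrakk>r \<in> carrier R; x \<in> carrier A\<rbrakk> \<Longrightarrow> h (r \<odot>\<^bsub>A\<^esub> x) = r \<odot>\<^bsub>B\<^esub> h x"
    and "h \<zero>\<^bsub>A\<^esub> = \<zero>\<^bsub>B\<^esub>"
    and "\<lbrakk>x \<in> carrier A; y \<in> carrier A\<rbrakk> \<Longrightarrow> h (x \<ominus>\<^bsub>A\<^esub> y) = h x \<ominus>\<^bsub>B\<^esub> h y"
    and "\<lbrakk>xs \<noteq> []; set xs \<subseteq> carrier A\<rbrakk> \<Longrightarrow> h (list_product A xs) = list_product B (map h xs)"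
    and "f \<in> I \<rightarrow> carrier A \<Longrightarrow> h (finsum A f I) = (\<Oplus>\<^bsub>B\<^esub>i\<in>I. h (f i))"
proof -
  interpret A: nonunital_algebra R A by fact
  interpret B: nonunital_algebra R B by fact
  show c: "x \<in> carrier A \<Longrightarrow> h x \<in> carrier B" for x using h by (auto simp: algebra_hom_def)
  show a: "\<lbrakk>x \<in> carrier A; y \<in> carrier A\<rbrakk> \<Longrightarrow> h (x \<oplus>\<^bsub>A\<^esub> y) = h x \<oplus>\<^bsub>B\<^esub> h y" for x y
    using h by (auto simp: algebra_hom_def)
  show m: "\<lbrakk>x \<in> carrier A; y \<in> carrier A\<rbrakk> \<Longrightarrow> h (x \<otimes>\<^bsub>A\<^esub> y) = h x \<otimes>\<^bsub>B\<^esub> h y" for x y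
    using h by (auto simp: algebra_hom_def)
  show s: "\<lbrakk>r \<in> carrier R; x \<in> carrier A\<rbrakk> \<Longrightarrow> h (r \<odot>\<^bsub>A\<^esub> x) = r \<odot>\<^bsub>B\<^esub> h x" for r x
    using h by (auto simp: algebra_hom_def)
  show z: "h \<zero>\<^bsub>A\<^esub> = \<zero>\<^bsub>B\<^esub>"
    using s[of \<zero> "\<zero>\<^bsub>A\<^esub>"] c by simp
  show "h (x \<ominus>\<^bsub>A\<^esub> y) = h x \<ominus>\<^bsub>B\<^esub> h y" if xy: "x \<in> carrier A" "y \<in> carrier A"
  proof -
    have "h (\<ominus>\<^bsub>A\<^esub> y) = h ((\<ominus> \<one>) \<odot>\<^bsub>A\<^esub> y)" using xy by (simp add: A.smult_l_minus)
    also have "\<dots> = \<ominus>\<^bsub>B\<^esub> h y" using xy c by (simp add: s B.smult_l_minus)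
    finally show ?thesis using xy by (simp add: a_minus_def a)
  qed
  show "\<lbrakk>xs \<noteq> []; set xs \<subseteq> carrier A\<rbrakk> \<Longrightarrow> h (list_product A xs) = list_product B (map h xs)"
  proof (induction xs)
    case (Cons x xs)
    then show ?case using A.list_product_closed[of xs] by (cases xs) (auto simp: m)
  qed simp
  show "f \<in> I \<rightarrow> carrier A \<Longrightarrow> h (finsum A f I) = (\<Oplus>\<^bsub>B\<^esub>i\<in>I. h (f i))"
  proof (induction I rule: infinite_finite_induct)
    case (insert i I)
    then show ?case by (simp add: a c Pi_iff)
  qed (auto simp: z A.finsum_infinite B.finsum_infinite)
qed

context nonunital_algebra
begin

lemma algebra_ideal_carrier: "algebra_ideal R A (carrier A)"
  by (simp add: algebra_ideal_def carrier_is_submodule amult_closed)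

lemma algebra_ideal_generated:
  assumes "X \<subseteq> carrier A"
  shows "algebra_ideal R A (generated_ideal R A X)" "X \<subseteq> generated_ideal R A X"
proof -
  let ?C = "{J. algebra_ideal R A J \<and> X \<subseteq> J}"
  have ne: "?C \<noteq> {}" using algebra_ideal_carrier assms by blast
  have "subgroup (\<Inter>?C) (add_monoid A)"
    by (rule M.add.subgroups_Inter[OF _ ne]) (simp add: algebra_ideal_def submodule_def)
  then have "submodule (\<Inter>?C) R A"
    by (intro submodule.intro submodule_axioms.intro)
      (auto simp: algebra_ideal_def submodule_def submodule_axioms_def)
  then show "algebra_ideal R A (generated_ideal R A X)"
    unfolding generated_ideal_def algebra_ideal_def[of R A "\<Inter>?C"]
    by (auto simp: algebra_ideal_def)
  show "X \<subseteq> generated_ideal R A X" by (auto simp: generated_ideal_def)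
qed

context
  fixes J
  assumes J: "algebra_ideal R A J"
begin

lemma ideal_abelian_subgroup: "abelian_subgroup J A"
  using J M.abelian_group_axioms
  by (intro abelian_subgroupI3 additive_subgroupI) (auto simp: algebra_ideal_def submodule_def)

lemma coset_eq_iff:
  assumes "x \<in> carrier A" "y \<in> carrier A"
  shows "J +>\<^bsub>A\<^esub> x = J +>\<^bsub>A\<^esub> y \<longleftrightarrow> x \<ominus>\<^bsub>A\<^esub> y \<in> J"
proof -
  interpret abelian_subgroup J A by (rule ideal_abelian_subgroup)
  have "J +>\<^bsub>A\<^esub> x = J +>\<^bsub>A\<^esub> y \<longleftrightarrow> x \<in> J +>\<^bsub>A\<^esub> y"
    using assms a_rcos_self[of x] a_repr_independence'[of x y] by auto
  then show ?thesis using assms a_rcos_module[of y x] by (simp add: a_minus_def)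
qed

lemma coset_rep:
  assumes x: "x \<in> carrier A" and y: "y \<in> J +>\<^bsub>A\<^esub> x"
  shows "y \<in> carrier A" "y \<ominus>\<^bsub>A\<^esub> x \<in> J" "\<exists>j \<in> J. y = j \<oplus>\<^bsub>A\<^esub> x"
proof -
  interpret abelian_subgroup J A by (rule ideal_abelian_subgroup)
  show "y \<in> carrier A" using a_elemrcos_carrier x y by blast
  show "y \<ominus>\<^bsub>A\<^esub> x \<in> J" using a_rcos_module_imp x y by (simp add: a_minus_def)
  show "\<exists>j \<in> J. y = j \<oplus>\<^bsub>A\<^esub> x" using y by (auto simp: a_r_coset_def r_coset_def)
qed

lemma quotient_simps:
  shows "carrier (quotient_algebra A J) = (\<lambda>x. J +>\<^bsub>A\<^esub> x) ` carrier A"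
    and "\<zero>\<^bsub>quotient_algebra A J\<^esub> = J +>\<^bsub>A\<^esub> \<zero>\<^bsub>A\<^esub>"
    and "\<lbrakk>x \<in> carrier A; y \<in> carrier A\<rbrakk> \<Longrightarrow>
      (J +>\<^bsub>A\<^esub> x) \<oplus>\<^bsub>quotient_algebra A J\<^esub> (J +>\<^bsub>A\<^esub> y) = J +>\<^bsub>A\<^esub> (x \<oplus>\<^bsub>A\<^esub> y)"
    and "\<lbrakk>x \<in> carrier A; y \<in> carrier A\<rbrakk> \<Longrightarrow>
      (J +>\<^bsub>A\<^esub> x) \<otimes>\<^bsub>quotient_algebra A J\<^esub> (J +>\<^bsub>A\<^esub> y) = J +>\<^bsub>A\<^esub> (x \<otimes>\<^bsub>A\<^esub> y)"
    and "\<lbrakk>r \<in> carrier R; x \<in> carrier A\<rbrakk> \<Longrightarrow>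
      r \<odot>\<^bsub>quotient_algebra A J\<^esub> (J +>\<^bsub>A\<^esub> x) = J +>\<^bsub>A\<^esub> (r \<odot>\<^bsub>A\<^esub> x)"
proof -
  interpret abelian_subgroup J A by (rule ideal_abelian_subgroup)
  show "carrier (quotient_algebra A J) = (\<lambda>x. J +>\<^bsub>A\<^esub> x) ` carrier A"
    by (auto simp: quotient_algebra_def A_RCOSETS_def RCOSETS_def a_r_coset_def)
  show "\<zero>\<^bsub>quotient_algebra A J\<^esub> = J +>\<^bsub>A\<^esub> \<zero>\<^bsub>A\<^esub>"
    using a_rcos_const[OF zero_closed] by (simp add: quotient_algebra_def)
  show "(J +>\<^bsub>A\<^esub> x) \<oplus>\<^bsub>quotient_algebra A J\<^esub> (J +>\<^bsub>A\<^esub> y) = J +>\<^bsub>A\<^esub> (x \<oplus>\<^bsub>A\<^esub> y)"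
    if "x \<in> carrier A" "y \<in> carrier A"
    using a_rcos_sum[OF that] by (simp add: quotient_algebra_def)
  show "(J +>\<^bsub>A\<^esub> x) \<otimes>\<^bsub>quotient_algebra A J\<^esub> (J +>\<^bsub>A\<^esub> y) = J +>\<^bsub>A\<^esub> (x \<otimes>\<^bsub>A\<^esub> y)"
    if x: "x \<in> carrier A" and y: "y \<in> carrier A"
  proof -
    have "J +>\<^bsub>A\<^esub> (x' \<otimes>\<^bsub>A\<^esub> y') = J +>\<^bsub>A\<^esub> (x \<otimes>\<^bsub>A\<^esub> y)" if x': "x' \<in> J +>\<^bsub>A\<^esub> x" and y': "y' \<in> J +>\<^bsub>A\<^esub> y" for x' y'
    proof -
      obtain i j where ij: "i \<in> J" "j \<in> J" "x' = i \<oplus>\<^bsub>A\<^esub> x" "y' = j \<oplus>\<^bsub>A\<^esub> y"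
        using coset_rep(3)[OF x x'] coset_rep(3)[OF y y'] by blast
      have c: "x' \<in> carrier A" "y' \<in> carrier A" using coset_rep(1) x y x' y' by blast+
      have ic: "i \<in> carrier A" "j \<in> carrier A" using ij a_subset by auto
      have "x' \<otimes>\<^bsub>A\<^esub> y' = (i \<otimes>\<^bsub>A\<^esub> y' \<oplus>\<^bsub>A\<^esub> x \<otimes>\<^bsub>A\<^esub> j) \<oplus>\<^bsub>A\<^esub> x \<otimes>\<^bsub>A\<^esub> y"
        using c ic x y ij by (simp add: amult_l_distr amult_r_distr amult_closed M.a_ac)
      moreover have "i \<otimes>\<^bsub>A\<^esub> y' \<oplus>\<^bsub>A\<^esub> x \<otimes>\<^bsub>A\<^esub> j \<in> J"
        using J ij c x by (auto simp: algebra_ideal_def)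
      ultimately have "x' \<otimes>\<^bsub>A\<^esub> y' \<in> J +>\<^bsub>A\<^esub> (x \<otimes>\<^bsub>A\<^esub> y)"
        by (auto simp: a_r_coset_def r_coset_def)
      then show ?thesis using a_repr_independence'[of "x' \<otimes>\<^bsub>A\<^esub> y'" "x \<otimes>\<^bsub>A\<^esub> y"] x y amult_closed by simp
    qed
    then have "rcoset_mult A J (J +>\<^bsub>A\<^esub> x) (J +>\<^bsub>A\<^esub> y) = J +>\<^bsub>A\<^esub> (x \<otimes>\<^bsub>A\<^esub> y)"
      using a_rcos_self[OF x] a_rcos_self[OF y] unfolding rcoset_mult_def by blast
    then show ?thesis by (simp add: quotient_algebra_def)
  qed
  show "r \<odot>\<^bsub>quotient_algebra A J\<^esub> (J +>\<^bsub>A\<^esub> x) = J +>\<^bsub>A\<^esub> (r \<odot>\<^bsub>A\<^esub> x)"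
    if r: "r \<in> carrier R" and x: "x \<in> carrier A"
  proof -
    have "J +>\<^bsub>A\<^esub> (r \<odot>\<^bsub>A\<^esub> x') = J +>\<^bsub>A\<^esub> (r \<odot>\<^bsub>A\<^esub> x)" if x': "x' \<in> J +>\<^bsub>A\<^esub> x" for x'
    proof -
      obtain i where i: "i \<in> J" "x' = i \<oplus>\<^bsub>A\<^esub> x" using coset_rep(3)[OF x x'] by blast
      have "r \<odot>\<^bsub>A\<^esub> x' = r \<odot>\<^bsub>A\<^esub> i \<oplus>\<^bsub>A\<^esub> r \<odot>\<^bsub>A\<^esub> x"
        using i r x a_subset by (auto simp: smult_r_distr)
      moreover have "r \<odot>\<^bsub>A\<^esub> i \<in> J"
        using J i r by (auto simp: algebra_ideal_def submodule_def submodule_axioms_def)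
      ultimately have "r \<odot>\<^bsub>A\<^esub> x' \<in> J +>\<^bsub>A\<^esub> (r \<odot>\<^bsub>A\<^esub> x)"
        by (auto simp: a_r_coset_def r_coset_def)
      then show ?thesis using a_repr_independence'[of "r \<odot>\<^bsub>A\<^esub> x'" "r \<odot>\<^bsub>A\<^esub> x"] r x by simp
    qed
    then have "(\<Union>x' \<in> J +>\<^bsub>A\<^esub> x. J +>\<^bsub>A\<^esub> (r \<odot>\<^bsub>A\<^esub> x')) = J +>\<^bsub>A\<^esub> (r \<odot>\<^bsub>A\<^esub> x)"
      using a_rcos_self[OF x] by blast
    then show ?thesis by (simp add: quotient_algebra_def)
  qed
qed

lemma nonunital_algebra_quotient: "nonunital_algebra R (quotient_algebra A J)"
proof (intro nonunital_algebra.intro moduleI nonunital_algebra_axioms.intro)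
  let ?Q = "quotient_algebra A J"
  show "abelian_group ?Q"
  proof (rule abelian_groupI)
    fix x assume "x \<in> carrier ?Q"
    then obtain a where a: "a \<in> carrier A" "x = J +>\<^bsub>A\<^esub> a" by (auto simp: quotient_simps(1))
    have "(J +>\<^bsub>A\<^esub> (\<ominus>\<^bsub>A\<^esub> a)) \<oplus>\<^bsub>?Q\<^esub> x = \<zero>\<^bsub>?Q\<^esub>"
      using a by (simp add: quotient_simps M.l_neg)
    then show "\<exists>y \<in> carrier ?Q. y \<oplus>\<^bsub>?Q\<^esub> x = \<zero>\<^bsub>?Q\<^esub>"
      using a by (auto simp: quotient_simps(1))
  qed (auto simp: quotient_simps M.a_ac)
qed (auto simp: quotient_simps amult_closed R.is_cring smult_l_distr smult_r_distr smult_assoc1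
    amult_assoc amult_l_distr amult_r_distr smult_amult_l smult_amult_r)

lemma quotient_proj_hom: "(\<lambda>x. J +>\<^bsub>A\<^esub> x) \<in> algebra_hom R A (quotient_algebra A J)"
  by (auto simp: algebra_hom_def quotient_simps)

lemma quotient_lift:
  assumes B: "nonunital_algebra R B" and h: "h \<in> algebra_hom R A B"
    and ker: "\<And>j. j \<in> J \<Longrightarrow> h j = \<zero>\<^bsub>B\<^esub>"
  shows "\<exists>h' \<in> algebra_hom R (quotient_algebra A J) B. \<forall>x \<in> carrier A. h' (J +>\<^bsub>A\<^esub> x) = h x"
proof -
  interpret abelian_subgroup J A by (rule ideal_abelian_subgroup)
  interpret B: nonunital_algebra R B by fact
  note hp = algebra_hom_props[OF nonunital_algebra_axioms B h]
  define h' where "h' = (\<lambda>X. h (SOME x. x \<in> X))"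
  have h': "h' (J +>\<^bsub>A\<^esub> x) = h x" if x: "x \<in> carrier A" for x
  proof -
    let ?y = "SOME y. y \<in> J +>\<^bsub>A\<^esub> x"
    have "?y \<in> J +>\<^bsub>A\<^esub> x" using a_rcos_self[OF x] by (rule someI)
    then obtain j where j: "j \<in> J" "?y = j \<oplus>\<^bsub>A\<^esub> x" using coset_rep(3)[OF x] by blast
    have "h ?y = h j \<oplus>\<^bsub>B\<^esub> h x" using j x a_subset hp(2) by auto
    then show ?thesis using ker[OF j(1)] hp(1)[OF x] by (simp add: h'_def)
  qed
  have "h' \<in> algebra_hom R (quotient_algebra A J) B"
    by (auto simp: algebra_hom_def quotient_simps h' hp(1-4) amult_closed)
  then show ?thesis using h' by blast
qed

end

end

lemma star_mem_generators: "\<alpha> \<in> paths \<Lambda> \<Longrightarrow> star \<Lambda> \<alpha> \<in> kp_generators \<Lambda>"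
  by (auto simp: star_def kp_generators_def)

lemma Path_mem_generators: "\<alpha> \<in> paths \<Lambda> \<Longrightarrow> Path \<alpha> \<in> kp_generators \<Lambda>"
  by (auto simp: kp_generators_def)

lemma kp_factors_closed:
  fixes R (structure)
  assumes A: "nonunital_algebra R A" and S: "S \<in> kp_generators \<Lambda> \<rightarrow> carrier A"
    and v: "v \<in> vertices \<Lambda>" and E: "E \<in> FE \<Lambda> v" "set \<alpha>s = E"
  shows "\<alpha>s \<noteq> []"
    and "\<And>\<alpha>. \<alpha> \<in> set \<alpha>s \<Longrightarrow> S (Path v) \<in> carrier A \<and> S (Path \<alpha>) \<in> carrier A \<and> S (star \<Lambda> \<alpha>) \<in> carrier A"
    and "set (map (\<lambda>\<alpha>. S (Path v) \<ominus>\<^bsub>A\<^esub> S (Path \<alpha>) \<otimes>\<^bsub>A\<^esub> S (star \<Lambda> \<alpha>)) \<alpha>s) \<subseteq> carrier A"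
proof -
  interpret A: nonunital_algebra R A by fact
  have vp: "v \<in> paths \<Lambda>" "v \<in> paths_from \<Lambda> v" using v by (auto simp: vertices_def paths_from_def)
  show "\<alpha>s \<noteq> []" using E vp(2) by (auto simp: FE_def exhaustive_def)
  have Ep: "\<alpha> \<in> paths \<Lambda>" if "\<alpha> \<in> set \<alpha>s" for \<alpha>
    using that E by (auto simp: FE_def exhaustive_def paths_from_def)
  show c: "S (Path v) \<in> carrier A \<and> S (Path \<alpha>) \<in> carrier A \<and> S (star \<Lambda> \<alpha>) \<in> carrier A"
    if "\<alpha> \<in> set \<alpha>s" for \<alpha>
    using funcset_mem[OF S Path_mem_generators[OF vp(1)]]
      funcset_mem[OF S Path_mem_generators[OF Ep[OF that]]]
      funcset_mem[OF S star_mem_generators[OF Ep[OF that]]] by simp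
  show "set (map (\<lambda>\<alpha>. S (Path v) \<ominus>\<^bsub>A\<^esub> S (Path \<alpha>) \<otimes>\<^bsub>A\<^esub> S (star \<Lambda> \<alpha>)) \<alpha>s) \<subseteq> carrier A"
    using c[THEN conjunct1] c[THEN conjunct2, THEN conjunct1] c[THEN conjunct2, THEN conjunct2]
    by (auto simp del: in_set_conv_nth intro!: A.M.minus_closed A.amult_closed)
qed

lemma kp_relations_closed:
  fixes R (structure)
  assumes "k_graph \<Lambda>" and A: "nonunital_algebra R A" and S: "S \<in> kp_generators \<Lambda> \<rightarrow> carrier A"
    and ab: "(a, b) \<in> kp_relations \<Lambda> A S"
  shows "a \<in> carrier A \<and> b \<in> carrier A"
proof -
  interpret k_graph \<Lambda> by fact
  interpret A: nonunital_algebra R A by fact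
  have S1: "S (Path \<alpha>) \<in> carrier A" "S (star \<Lambda> \<alpha>) \<in> carrier A" if "\<alpha> \<in> paths \<Lambda>" for \<alpha>
    using funcset_mem[OF S Path_mem_generators[OF that]] funcset_mem[OF S star_mem_generators[OF that]]
    by simp_all
  have vp: "v \<in> paths \<Lambda>" if "v \<in> vertices \<Lambda>" for v using that by (simp add: vertices_def)
  show ?thesis using ab
  proof (cases rule: kp_relations.cases)
    case (KP3 \<alpha> \<mu>)
    have "(\<Oplus>\<^bsub>A\<^esub>p \<in> Lambda_min \<Lambda> \<alpha> \<mu>. S (Path (fst p)) \<otimes>\<^bsub>A\<^esub> S (star \<Lambda> (snd p))) \<in> carrier A"
      by (rule A.M.finsum_closed) (auto simp: Lambda_min_def intro!: A.amult_closed S1)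
    then show ?thesis using KP3 S1 by (simp add: A.amult_closed)
  next
    case (KP4 v E \<alpha>s)
    then show ?thesis
      using A.list_product_closed kp_factors_closed(1,3)[OF A S, of v E \<alpha>s] by simp
  qed (auto simp: A.amult_closed S1 vp comp_closed)
qed

lemma kp_relations_hom:
  fixes R (structure)
  assumes "k_graph \<Lambda>" and A: "nonunital_algebra R A" and B: "nonunital_algebra R B"
    and h: "h \<in> algebra_hom R A B" and S: "S \<in> kp_generators \<Lambda> \<rightarrow> carrier A"
    and S': "\<And>g. g \<in> kp_generators \<Lambda> \<Longrightarrow> S' g = h (S g)"
  shows "kp_relations \<Lambda> B S' = map_prod h h ` kp_relations \<Lambda> A S"
proof -
  interpret k_graph \<Lambda> by fact
  interpret A: nonunital_algebra R A by fact
  note hp = algebra_hom_props[OF A B h]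
  have S1: "S (Path \<alpha>) \<in> carrier A" "S (star \<Lambda> \<alpha>) \<in> carrier A"
    "S' (Path \<alpha>) = h (S (Path \<alpha>))" "S' (star \<Lambda> \<alpha>) = h (S (star \<Lambda> \<alpha>))" if "\<alpha> \<in> paths \<Lambda>" for \<alpha>
    using funcset_mem[OF S Path_mem_generators[OF that]] funcset_mem[OF S star_mem_generators[OF that]]
      S'[OF Path_mem_generators[OF that]] S'[OF star_mem_generators[OF that]]
    by simp_all
  have vp: "v \<in> paths \<Lambda>" if "v \<in> vertices \<Lambda>" for v using that by (simp add: vertices_def)
  have s3: "h (\<Oplus>\<^bsub>A\<^esub>p \<in> Lambda_min \<Lambda> \<alpha> \<mu>. S (Path (fst p)) \<otimes>\<^bsub>A\<^esub> S (star \<Lambda> (snd p)))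
      = (\<Oplus>\<^bsub>B\<^esub>p \<in> Lambda_min \<Lambda> \<alpha> \<mu>. S' (Path (fst p)) \<otimes>\<^bsub>B\<^esub> S' (star \<Lambda> (snd p)))" for \<alpha> \<mu>
  proof -
    interpret B: nonunital_algebra R B by fact
    have "h (\<Oplus>\<^bsub>A\<^esub>p \<in> Lambda_min \<Lambda> \<alpha> \<mu>. S (Path (fst p)) \<otimes>\<^bsub>A\<^esub> S (star \<Lambda> (snd p)))
      = (\<Oplus>\<^bsub>B\<^esub>p \<in> Lambda_min \<Lambda> \<alpha> \<mu>. h (S (Path (fst p)) \<otimes>\<^bsub>A\<^esub> S (star \<Lambda> (snd p))))"
      by (rule hp(8)) (auto simp: Lambda_min_def intro!: A.amult_closed S1)
    also have "\<dots> = (\<Oplus>\<^bsub>B\<^esub>p \<in> Lambda_min \<Lambda> \<alpha> \<mu>. S' (Path (fst p)) \<otimes>\<^bsub>B\<^esub> S' (star \<Lambda> (snd p)))"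
      by (rule B.M.finsum_cong') (auto simp: Lambda_min_def S1 hp(1,3) B.amult_closed)
    finally show ?thesis .
  qed
  have s4: "h (list_product A (map (\<lambda>\<alpha>. S (Path v) \<ominus>\<^bsub>A\<^esub> S (Path \<alpha>) \<otimes>\<^bsub>A\<^esub> S (star \<Lambda> \<alpha>)) \<alpha>s))
     = list_product B (map (\<lambda>\<alpha>. S' (Path v) \<ominus>\<^bsub>B\<^esub> S' (Path \<alpha>) \<otimes>\<^bsub>B\<^esub> S' (star \<Lambda> \<alpha>)) \<alpha>s)"
    if v: "v \<in> vertices \<Lambda>" and E: "E \<in> FE \<Lambda> v" "set \<alpha>s = E" for v E \<alpha>s
  proof -
    note kf = kp_factors_closed[OF A S v E]
    have "map h (map (\<lambda>\<alpha>. S (Path v) \<ominus>\<^bsub>A\<^esub> S (Path \<alpha>) \<otimes>\<^bsub>A\<^esub> S (star \<Lambda> \<alpha>)) \<alpha>s)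
      = map (\<lambda>\<alpha>. S' (Path v) \<ominus>\<^bsub>B\<^esub> S' (Path \<alpha>) \<otimes>\<^bsub>B\<^esub> S' (star \<Lambda> \<alpha>)) \<alpha>s"
    proof (subst map_map, rule map_cong[OF refl])
      fix \<alpha> assume \<alpha>: "\<alpha> \<in> set \<alpha>s"
      have "\<alpha> \<in> paths \<Lambda>" using \<alpha> E by (auto simp: FE_def exhaustive_def paths_from_def)
      then show "(h \<circ> (\<lambda>\<alpha>. S (Path v) \<ominus>\<^bsub>A\<^esub> S (Path \<alpha>) \<otimes>\<^bsub>A\<^esub> S (star \<Lambda> \<alpha>))) \<alpha>
        = S' (Path v) \<ominus>\<^bsub>B\<^esub> S' (Path \<alpha>) \<otimes>\<^bsub>B\<^esub> S' (star \<Lambda> \<alpha>)"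
        using vp[OF v] by (simp add: S1 hp(3,6) A.amult_closed)
    qed
    then show ?thesis using hp(7)[OF _ kf(3)] kf(1) by (simp del: map_map)
  qed
  show ?thesis
  proof (intro equalityI subsetI)
    fix p assume p: "p \<in> kp_relations \<Lambda> B S'"
    obtain a b where ab: "p = (a, b)" by (cases p)
    have "(a, b) \<in> kp_relations \<Lambda> B S'" using p ab by simp
    then show "p \<in> map_prod h h ` kp_relations \<Lambda> A S"
    proof (cases rule: kp_relations.cases)
      case (KP1_idem v)
      then show ?thesis
        by (intro image_eqI[OF _ kp_relations.KP1_idem[of v \<Lambda> A S]]) (simp_all add: ab vp S1 hp(3))
    next
      case (KP1_orth v w)
      then show ?thesis
        by (intro image_eqI[OF _ kp_relations.KP1_orth[of v \<Lambda> w A S]]) (simp_all add: ab vp S1 hp(3,5))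
    next
      case (KP2_path \<alpha> \<mu>)
      then show ?thesis
        by (intro image_eqI[OF _ kp_relations.KP2_path[of \<alpha> \<Lambda> \<mu> A S]]) (simp_all add: ab S1 hp(3) comp_closed)
    next
      case (KP2_ghost \<alpha> \<mu>)
      then show ?thesis
        by (intro image_eqI[OF _ kp_relations.KP2_ghost[of \<alpha> \<Lambda> \<mu> A S]]) (simp_all add: ab S1 hp(3) comp_closed)
    next
      case (KP3 \<alpha> \<mu>)
      then show ?thesis
        by (intro image_eqI[OF _ kp_relations.KP3[of \<alpha> \<Lambda> \<mu> A S]]) (simp_all add: ab S1 hp(3) s3)
    next
      case (KP4 v E \<alpha>s)
      then show ?thesis
        by (intro image_eqI[OF _ kp_relations.KP4[of v \<Lambda> E \<alpha>s A S]]) (simp_all add: ab s4 hp(5))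
    qed
  next
    fix p assume "p \<in> map_prod h h ` kp_relations \<Lambda> A S"
    then obtain a b where q: "(a, b) \<in> kp_relations \<Lambda> A S" "p = (h a, h b)" by auto
    from q(1) show "p \<in> kp_relations \<Lambda> B S'"
    proof (cases rule: kp_relations.cases)
      case (KP1_idem v)
      then show ?thesis using kp_relations.KP1_idem[of v \<Lambda> B S'] q(2) by (simp add: vp S1 hp(3))
    next
      case (KP1_orth v w)
      then show ?thesis using kp_relations.KP1_orth[of v \<Lambda> w B S'] q(2) by (simp add: vp S1 hp(3,5))
    next
      case (KP2_path \<alpha> \<mu>)
      then show ?thesis using kp_relations.KP2_path[of \<alpha> \<Lambda> \<mu> B S'] q(2) by (simp add: S1 hp(3) comp_closed)
    next
      case (KP2_ghost \<alpha> \<mu>)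
      then show ?thesis using kp_relations.KP2_ghost[of \<alpha> \<Lambda> \<mu> B S'] q(2) by (simp add: S1 hp(3) comp_closed)
    next
      case (KP3 \<alpha> \<mu>)
      then show ?thesis using kp_relations.KP3[of \<alpha> \<Lambda> \<mu> B S'] q(2) by (simp add: S1 hp(3) s3)
    next
      case (KP4 v E \<alpha>s)
      then show ?thesis using kp_relations.KP4[of v \<Lambda> E \<alpha>s B S'] q(2) by (simp add: s4 hp(5))
    qed
  qed
qed

lemma monomial_eq_product:
  fixes R (structure)
  assumes "cring R" and r: "r \<in> carrier R" and w: "w \<noteq> []" "set w \<subseteq> X"
  shows "monomial R r w = r \<odot>\<^bsub>free_algebra R X\<^esub> list_product (free_algebra R X) (map (\<lambda>x. monomial R \<one> [x]) w)"
proof -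
  interpret cring R by fact
  have "list_product (free_algebra R X) (map (\<lambda>x. monomial R \<one> [x]) w) = monomial R \<one> w"
    using w(1)
  proof (induction w)
    case (Cons x w)
    then show ?case using monomial_mult[of \<one> \<one> X "[x]" w] by (cases w) auto
  qed simp
  then show ?thesis using r by (auto simp: monomial_def free_algebra_simps)
qed

lemma free_algebra_hom_unique:
  fixes R (structure)
  assumes R: "cring R" and B: "nonunital_algebra R B"
    and h: "h \<in> algebra_hom R (free_algebra R X) B" and h': "h' \<in> algebra_hom R (free_algebra R X) B"
    and eq: "\<And>x. x \<in> X \<Longrightarrow> h (monomial R \<one> [x]) = h' (monomial R \<one> [x])"
    and f: "f \<in> carrier (free_algebra R X)"
  shows "h f = h' f"
proof -
  interpret cring R by fact
  let ?F = "free_algebra R X"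
  have F: "nonunital_algebra R ?F" by (rule nonunital_algebra_free)
  interpret F: nonunital_algebra R ?F by fact
  note hp = algebra_hom_props[OF F B h]
  note hp' = algebra_hom_props[OF F B h']
  show ?thesis using f
  proof (induction rule: free_algebra_induct)
    case zero
    then show ?case by (simp add: hp(5) hp'(5))
  next
    case (add r w g)
    let ?ws = "map (\<lambda>x. monomial R \<one> [x]) w"
    have ws: "set ?ws \<subseteq> carrier ?F" using add by (auto intro!: monomial_closed)
    have lp: "list_product ?F ?ws \<in> carrier ?F" using add ws by (intro F.list_product_closed) auto
    have ne: "?ws \<noteq> []" using add by simp
    have hw: "map h ?ws = map h' ?ws" using add eq by auto
    have "h (list_product ?F ?ws) = h' (list_product ?F ?ws)"
      by (simp only: hp(7)[OF ne ws] hp'(7)[OF ne ws] hw)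
    then have "h (monomial R r w) = h' (monomial R r w)"
      using add lp by (simp add: monomial_eq_product[OF R, of r w X] hp(4) hp'(4))
    then show ?case using add by (simp add: hp(2) hp'(2) monomial_closed)
  qed
qed

theorem kp_algebra_universal:
  fixes \<Lambda> :: "('l, 'k::finite) kgraph" and R (structure)
  assumes \<Lambda>: "k_graph \<Lambda>" and R: "cring R"
  shows "nonunital_algebra R (kp_algebra R \<Lambda>)"
    and "kp_family \<Lambda> (kp_algebra R \<Lambda>) (kp_gen R \<Lambda>)"
    and "\<lbrakk>nonunital_algebra R A; kp_family \<Lambda> A S\<rbrakk> \<Longrightarrow>
      \<exists>h \<in> algebra_hom R (kp_algebra R \<Lambda>) A. (\<forall>g \<in> kp_generators \<Lambda>. h (kp_gen R \<Lambda> g) = S g) \<and>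
        (\<forall>h' \<in> algebra_hom R (kp_algebra R \<Lambda>) A. (\<forall>g \<in> kp_generators \<Lambda>. h' (kp_gen R \<Lambda> g) = S g) \<longrightarrow>
           (\<forall>x \<in> carrier (kp_algebra R \<Lambda>). h' x = h x))"
proof -
  interpret cring R by fact
  let ?X = "kp_generators \<Lambda>"
  let ?F = "kp_free R \<Lambda>"
  let ?m = "\<lambda>g. monomial R \<one> [g]"
  let ?I = "kp_ideal R \<Lambda>"
  let ?Q = "kp_algebra R \<Lambda>"
  let ?rel = "kp_relations \<Lambda> ?F ?m"
  let ?X' = "{a \<ominus>\<^bsub>?F\<^esub> b | a b. (a, b) \<in> ?rel}"
  have F: "nonunital_algebra R ?F" unfolding kp_free_def by (rule nonunital_algebra_free)
  interpret F: nonunital_algebra R ?F by fact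
  have m: "?m \<in> ?X \<rightarrow> carrier ?F" by (auto simp: kp_free_def intro!: monomial_closed)
  have relc: "a \<in> carrier ?F" "b \<in> carrier ?F" if "(a, b) \<in> ?rel" for a b
    using kp_relations_closed[OF \<Lambda> F m that] by auto
  have X': "?X' \<subseteq> carrier ?F" using relc by (auto intro!: F.M.minus_closed)
  have I: "algebra_ideal R ?F ?I" "?X' \<subseteq> ?I"
    unfolding kp_ideal_def using F.algebra_ideal_generated[OF X'] by auto
  show Q: "nonunital_algebra R ?Q" unfolding kp_algebra_def by (rule F.nonunital_algebra_quotient[OF I(1)])
  have \<pi>: "(\<lambda>x. ?I +>\<^bsub>?F\<^esub> x) \<in> algebra_hom R ?F ?Q" unfolding kp_algebra_def
    by (rule F.quotient_proj_hom[OF I(1)])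
  show "kp_family \<Lambda> ?Q (kp_gen R \<Lambda>)"
    unfolding kp_family_def
  proof (intro conjI ballI)
    show "kp_gen R \<Lambda> \<in> ?X \<rightarrow> carrier ?Q"
      using algebra_hom_props(1)[OF F Q \<pi>, OF funcset_mem[OF m]] by (auto simp: kp_gen_def)
    have r: "kp_relations \<Lambda> ?Q (kp_gen R \<Lambda>) = map_prod (\<lambda>x. ?I +>\<^bsub>?F\<^esub> x) (\<lambda>x. ?I +>\<^bsub>?F\<^esub> x) ` ?rel"
      by (rule kp_relations_hom[OF \<Lambda> F Q \<pi> m]) (simp add: kp_gen_def)
    fix p assume "p \<in> kp_relations \<Lambda> ?Q (kp_gen R \<Lambda>)"
    then obtain a b where ab: "(a, b) \<in> ?rel" "p = (?I +>\<^bsub>?F\<^esub> a, ?I +>\<^bsub>?F\<^esub> b)" unfolding r by auto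
    have "a \<ominus>\<^bsub>?F\<^esub> b \<in> ?I" using ab(1) I(2) by blast
    then show "case p of (a, b) \<Rightarrow> a = b"
      using F.coset_eq_iff[OF I(1) relc[OF ab(1)]] ab(2) by simp
  qed
  assume A: "nonunital_algebra R A" and S: "kp_family \<Lambda> A S"
  interpret A: nonunital_algebra R A by fact
  have S1: "S \<in> ?X \<rightarrow> carrier A" and S2: "\<And>a b. (a, b) \<in> kp_relations \<Lambda> A S \<Longrightarrow> a = b"
    using S by (auto simp: kp_family_def)
  let ?h = "A.free_lift S"
  have h: "?h \<in> algebra_hom R ?F A" unfolding kp_free_def by (rule A.free_lift_hom[OF S1])
  have hm: "?h (?m g) = S g" if "g \<in> ?X" for g by (rule A.free_lift_generator[OF S1 that])
  note hp = algebra_hom_props[OF F A h]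
  have rA: "kp_relations \<Lambda> A S = map_prod ?h ?h ` ?rel"
    by (rule kp_relations_hom[OF \<Lambda> F A h m]) (simp add: hm)
  have ker: "?h j = \<zero>\<^bsub>A\<^esub>" if "j \<in> ?I" for j
  proof -
    let ?K = "{x \<in> carrier ?F. ?h x = \<zero>\<^bsub>A\<^esub>}"
    have "submodule ?K R ?F"
    proof (rule F.submoduleI)
      fix a assume a: "a \<in> ?K"
      then have "?h (\<zero>\<^bsub>?F\<^esub> \<ominus>\<^bsub>?F\<^esub> a) = \<zero>\<^bsub>A\<^esub> \<ominus>\<^bsub>A\<^esub> \<zero>\<^bsub>A\<^esub>" by (simp add: hp(5,6))
      then show "\<ominus>\<^bsub>?F\<^esub> a \<in> ?K" using a by (simp add: a_minus_def)
    qed (auto simp: hp(2,4,5))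
    then have "algebra_ideal R ?F ?K"
      by (auto simp: algebra_ideal_def F.amult_closed hp(1,3) A.amult_zero)
    moreover have "?X' \<subseteq> ?K"
    proof
      fix x assume "x \<in> ?X'"
      then obtain a b where ab: "(a, b) \<in> ?rel" "x = a \<ominus>\<^bsub>?F\<^esub> b" by blast
      have "(?h a, ?h b) \<in> kp_relations \<Lambda> A S" unfolding rA using ab(1) by force
      then have "?h a = ?h b" by (rule S2)
      then show "x \<in> ?K" using ab relc[OF ab(1)] hp(1)[OF relc(2)[OF ab(1)]]
        by (simp add: hp(6) A.M.r_neg a_minus_def[of A] F.M.minus_closed)
    qed
    ultimately have "?I \<subseteq> ?K" by (auto simp: kp_ideal_def generated_ideal_def)
    then show ?thesis using that by auto
  qed
  obtain k where k: "k \<in> algebra_hom R ?Q A" "\<And>x. x \<in> carrier ?F \<Longrightarrow> k (?I +>\<^bsub>?F\<^esub> x) = ?h x"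
    using F.quotient_lift[OF I(1) A h ker] unfolding kp_algebra_def by blast
  have kg: "k (kp_gen R \<Lambda> g) = S g" if "g \<in> ?X" for g
    using k(2)[of "?m g"] m hm that by (auto simp: kp_gen_def)
  have uniq: "h' x = k x" if h': "h' \<in> algebra_hom R ?Q A" and g: "\<forall>g \<in> ?X. h' (kp_gen R \<Lambda> g) = S g"
    and x: "x \<in> carrier ?Q" for h' x
  proof -
    obtain f where f: "f \<in> carrier ?F" "x = ?I +>\<^bsub>?F\<^esub> f"
      using x F.quotient_simps(1)[OF I(1)] by (auto simp: kp_algebra_def)
    have comp_hom: "(\<lambda>x. q (?I +>\<^bsub>?F\<^esub> x)) \<in> algebra_hom R ?F A" if "q \<in> algebra_hom R ?Q A" for q
      using algebra_hom_props(1-4)[OF F Q \<pi>] algebra_hom_props(1-4)[OF Q A that]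
      by (auto simp: algebra_hom_def[of R ?F A])
    have "h' (?I +>\<^bsub>?F\<^esub> f) = k (?I +>\<^bsub>?F\<^esub> f)"
      by (rule free_algebra_hom_unique[OF R A, of _ ?X, folded kp_free_def, OF comp_hom[OF h'] comp_hom[OF k(1)] _ f(1)])
        (use g kg in \<open>auto simp: kp_gen_def\<close>)
    then show ?thesis using f by simp
  qed
  show "\<exists>h \<in> algebra_hom R ?Q A. (\<forall>g \<in> ?X. h (kp_gen R \<Lambda> g) = S g) \<and>
        (\<forall>h' \<in> algebra_hom R ?Q A. (\<forall>g \<in> ?X. h' (kp_gen R \<Lambda> g) = S g) \<longrightarrow> (\<forall>x \<in> carrier ?Q. h' x = h x))"
    using k(1) kg uniq by blast
qed

end

theory Submission
  imports Defs "HOL-Analysis.Function_Topology"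
begin

text \<open>A boundary path is determined by the set of its initial segments, and the sets arising in this way
  are the filters of \<open>v\<Lambda>\<close> that meet every finite exhaustive set.  For countable \<open>\<Lambda>\<close> the
  Rasiowa-Sikorski argument yields enough of them, and finite alignment makes the set of all of them closed in
  the Cantor space, so that the sets \<open>Z(\<alpha> *\<^sub>s \<mu>)\<close> are compact and open; their indicators
  span the Steinberg algebra and multiply like the elements \<open>s\<^sub>\<alpha> s\<^sub>\<mu>\<^sub>*\<close> of the
  Kumjian-Pask algebra, which span that algebra.

  For injectivity let \<open>c = \<Sum> r\<^sub>i s\<^sub>\<alpha>\<^sub>i s\<^sub>\<mu>\<^sub>i\<^sub>*\<close> be mapped to \<open>0\<close>.  Repeated splitting along
  the \<open>\<mu>\<^sub>i\<close> reduces \<open>c = 0\<close> to the vanishing of \<open>c\<close> on cells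
  \<open>s\<^sub>\<tau> \<Prod>\<^sub>\<nu> (s\<^sub>v - s\<^sub>\<nu> s\<^sub>\<nu>\<^sub>*)\<close>, \<open>\<nu> \<in> G\<close>, on which each \<open>s\<^sub>\<mu>\<^sub>i\<^sub>*\<close> acts either as
  \<open>0\<close> or by cancelling an initial segment of \<open>\<tau>\<close>.  If \<open>G\<close> is exhaustive, the cell is \<open>0\<close> by (KP4).
  Otherwise some boundary path \<open>z\<close> avoids \<open>G\<close>, and the values of the image of \<open>c\<close> at the arrows
  \<open>(\<sigma>z, d(\<sigma>) - d(\<tau>), \<tau>z)\<close> are exactly the coefficients that remain on the cell.\<close>

section \<open>Paths and their factorisations\<close>

text \<open>Boundary paths are functors on varying domains, and already prepending a path is a
  \<open>THE\<close> whose value has to be constructed. With sets of initial segments, equality of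
  boundary paths is equality of sets, prepending is a downward closure, and every comparison of two
  paths reduces to directedness and to the minimal common extension below a given common extension.

  In the injectivity argument only the right-hand paths \<open>\<mu>\<close> are split. On a cell
  given by \<open>\<tau>\<close> the surviving terms have the form \<open>P \<sigma>\<close> times a
  fixed factor, and for fixed \<open>z\<close> the arrows \<open>arrow \<sigma> \<tau> z\<close> are
  distinct for distinct \<open>\<sigma>\<close>; so terms with equal \<open>\<sigma>\<close> are
  collected, and one arrow reads off each collected coefficient. Nothing is cancelled in
  \<open>R\<close>, which may have zero divisors. One pass through the finitely many
  \<open>\<mu>\<close> suffices because a decision survives further cutting
  (\<open>decided_extend\<close>). The algebra need not have a unit, so the process starts from the
  finitely many vertices that carry the given element (\<open>comb_local_unit\<close>).\<close>

lemma deg_join_upper: "m \<le> deg_join m n" "n \<le> deg_join m n"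
  by (simp_all add: deg_join_def less_eq_vec_def)

lemma deg_join_least: "m \<le> l \<Longrightarrow> n \<le> l \<Longrightarrow> deg_join m n \<le> l"
  by (simp add: deg_join_def less_eq_vec_def)

lemma deg_join_commute: "deg_join m n = deg_join n m"
  by (simp add: deg_join_def vec_eq_iff max.commute)

lemma deg_join_absorb: "m \<le> n \<Longrightarrow> deg_join m n = n"
  by (simp add: deg_join_def vec_eq_iff less_eq_vec_def max_absorb2)

lemma vec_add_diff_inverse: "m \<le> n \<Longrightarrow> m + (n - m) = (n :: nat ^ 'k::finite)"
  by (simp add: vec_eq_iff less_eq_vec_def)

lemma vec_le_add: "m \<le> m + (n :: nat ^ 'k::finite)"
  by (simp add: less_eq_vec_def)

lemma vec_add_le_cancel_left: "l + m \<le> l + n \<longleftrightarrow> m \<le> (n :: nat ^ 'k::finite)"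
  by (simp add: less_eq_vec_def)

context k_graph
begin

definition prefix :: "'l \<Rightarrow> 'l \<Rightarrow> bool" where
  "prefix \<alpha> \<tau> \<longleftrightarrow> \<alpha> \<in> paths \<Lambda> \<and> (\<exists>\<beta> \<in> paths \<Lambda>. src \<Lambda> \<alpha> = rng \<Lambda> \<beta> \<and> \<tau> = comp \<Lambda> \<alpha> \<beta>)"

lemma prefixI: "\<lbrakk>\<alpha> \<in> paths \<Lambda>; \<beta> \<in> paths \<Lambda>; src \<Lambda> \<alpha> = rng \<Lambda> \<beta>\<rbrakk> \<Longrightarrow> prefix \<alpha> (comp \<Lambda> \<alpha> \<beta>)"
  by (auto simp: prefix_def)

lemma prefixE:
  assumes "prefix \<alpha> \<tau>"
  obtains \<beta> where "\<alpha> \<in> paths \<Lambda>" "\<beta> \<in> paths \<Lambda>" "src \<Lambda> \<alpha> = rng \<Lambda> \<beta>" "\<tau> = comp \<Lambda> \<alpha> \<beta>"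
  using assms by (auto simp: prefix_def)

text \<open>Equality of the first degrees is enough: additivity of \<open>deg\<close> and
  cancellation force the second degrees to agree, and then \<open>factorisation\<close>
  applies.\<close>

lemma factor_unique:
  assumes "\<alpha> \<in> paths \<Lambda>" "\<beta> \<in> paths \<Lambda>" "src \<Lambda> \<alpha> = rng \<Lambda> \<beta>"
    and "\<alpha>' \<in> paths \<Lambda>" "\<beta>' \<in> paths \<Lambda>" "src \<Lambda> \<alpha>' = rng \<Lambda> \<beta>'"
    and "comp \<Lambda> \<alpha> \<beta> = comp \<Lambda> \<alpha>' \<beta>'" "deg \<Lambda> \<alpha> = deg \<Lambda> \<alpha>'"
  shows "\<alpha> = \<alpha>'" "\<beta> = \<beta>'"
proof -
  have d: "deg \<Lambda> (comp \<Lambda> \<alpha> \<beta>) = deg \<Lambda> \<alpha> + deg \<Lambda> \<beta>" using assms deg_comp by blast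
  moreover have "deg \<Lambda> (comp \<Lambda> \<alpha> \<beta>) = deg \<Lambda> \<alpha> + deg \<Lambda> \<beta>'" using assms deg_comp by metis
  ultimately have e: "deg \<Lambda> \<beta> = deg \<Lambda> \<beta>'" by simp
  define P where "P = (\<lambda>(\<mu>, \<nu>). \<mu> \<in> paths \<Lambda> \<and> \<nu> \<in> paths \<Lambda> \<and> src \<Lambda> \<mu> = rng \<Lambda> \<nu> \<and> comp \<Lambda> \<alpha> \<beta> = comp \<Lambda> \<mu> \<nu>
    \<and> deg \<Lambda> \<mu> = deg \<Lambda> \<alpha> \<and> deg \<Lambda> \<nu> = deg \<Lambda> \<beta>)"
  have "\<exists>!p. P p" unfolding P_def by (rule factorisation[OF comp_closed[OF assms(1-3)] d])
  moreover have "P (\<alpha>, \<beta>)" "P (\<alpha>', \<beta>')" using assms e by (simp_all add: P_def)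
  ultimately have "(\<alpha>, \<beta>) = (\<alpha>', \<beta>')" by blast
  then show "\<alpha> = \<alpha>'" "\<beta> = \<beta>'" by auto
qed

lemma comp_left_cancel:
  assumes "\<alpha> \<in> paths \<Lambda>" "\<beta> \<in> paths \<Lambda>" "src \<Lambda> \<alpha> = rng \<Lambda> \<beta>" "\<beta>' \<in> paths \<Lambda>" "src \<Lambda> \<alpha> = rng \<Lambda> \<beta>'"
    and "comp \<Lambda> \<alpha> \<beta> = comp \<Lambda> \<alpha> \<beta>'"
  shows "\<beta> = \<beta>'"
  using factor_unique(2)[OF assms(1-3) assms(1) assms(4-6)] by simp

lemma prefix_paths: "prefix \<alpha> \<tau> \<Longrightarrow> \<alpha> \<in> paths \<Lambda>" "prefix \<alpha> \<tau> \<Longrightarrow> \<tau> \<in> paths \<Lambda>"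
  by (auto simp: prefix_def comp_closed)

lemma prefix_rng: "prefix \<alpha> \<tau> \<Longrightarrow> rng \<Lambda> \<tau> = rng \<Lambda> \<alpha>"
  by (auto simp: prefix_def rng_comp)

lemma prefix_refl: "\<alpha> \<in> paths \<Lambda> \<Longrightarrow> prefix \<alpha> \<alpha>"
  by (metis comp_src prefixI rng_src src_closed)

lemma prefix_trans:
  assumes "prefix \<alpha> \<beta>" "prefix \<beta> \<gamma>" shows "prefix \<alpha> \<gamma>"
proof -
  obtain \<mu> where m: "\<alpha> \<in> paths \<Lambda>" "\<mu> \<in> paths \<Lambda>" "src \<Lambda> \<alpha> = rng \<Lambda> \<mu>" "\<beta> = comp \<Lambda> \<alpha> \<mu>"
    using assms(1) by (rule prefixE)
  obtain \<nu> where n: "\<nu> \<in> paths \<Lambda>" "src \<Lambda> \<beta> = rng \<Lambda> \<nu>" "\<gamma> = comp \<Lambda> \<beta> \<nu>"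
    using assms(2) by (rule prefixE)
  have "\<gamma> = comp \<Lambda> \<alpha> (comp \<Lambda> \<mu> \<nu>)" using m n by (simp add: comp_assoc src_comp)
  then show ?thesis using m n by (simp add: prefixI comp_closed rng_comp src_comp)
qed

lemma prefix_deg: "prefix \<alpha> \<tau> \<Longrightarrow> deg \<Lambda> \<alpha> \<le> deg \<Lambda> \<tau>"
  by (auto simp: prefix_def deg_comp vec_le_add)

lemma prefix_unique: "\<lbrakk>prefix \<alpha> \<tau>; prefix \<alpha>' \<tau>; deg \<Lambda> \<alpha> = deg \<Lambda> \<alpha>'\<rbrakk> \<Longrightarrow> \<alpha> = \<alpha>'"
  by (auto elim!: prefixE dest: factor_unique(1))

lemma prefix_ex:
  assumes "\<tau> \<in> paths \<Lambda>" "n \<le> deg \<Lambda> \<tau>"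
  shows "\<exists>\<alpha>. prefix \<alpha> \<tau> \<and> deg \<Lambda> \<alpha> = n"
proof -
  have "deg \<Lambda> \<tau> = n + (deg \<Lambda> \<tau> - n)" using assms(2) by (simp add: vec_add_diff_inverse)
  then show ?thesis using factorisation[OF assms(1)] unfolding prefix_def by blast
qed

text \<open>Initial segments of one path are ordered by degree: \<open>\<beta>\<close> has an
  initial segment of degree \<open>deg \<Lambda> \<alpha>\<close>, which is also one of
  \<open>\<tau>\<close>, so uniqueness identifies it with \<open>\<alpha>\<close>.\<close>

lemma prefix_chain:
  assumes "prefix \<alpha> \<tau>" "prefix \<beta> \<tau>" "deg \<Lambda> \<alpha> \<le> deg \<Lambda> \<beta>"
  shows "prefix \<alpha> \<beta>"
  using prefix_ex[OF prefix_paths(1)[OF assms(2)] assms(3)] prefix_unique prefix_trans assms by metis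

lemma prefix_comp_iff:
  assumes "\<alpha> \<in> paths \<Lambda>" "\<beta> \<in> paths \<Lambda>" "\<gamma> \<in> paths \<Lambda>" "src \<Lambda> \<alpha> = rng \<Lambda> \<beta>" "src \<Lambda> \<alpha> = rng \<Lambda> \<gamma>"
  shows "prefix (comp \<Lambda> \<alpha> \<beta>) (comp \<Lambda> \<alpha> \<gamma>) \<longleftrightarrow> prefix \<beta> \<gamma>"
proof
  assume "prefix (comp \<Lambda> \<alpha> \<beta>) (comp \<Lambda> \<alpha> \<gamma>)"
  then obtain \<delta> where d: "\<delta> \<in> paths \<Lambda>" "src \<Lambda> (comp \<Lambda> \<alpha> \<beta>) = rng \<Lambda> \<delta>"
    "comp \<Lambda> \<alpha> \<gamma> = comp \<Lambda> (comp \<Lambda> \<alpha> \<beta>) \<delta>" by (rule prefixE)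
  have sd: "src \<Lambda> \<beta> = rng \<Lambda> \<delta>" using d(2) src_comp[OF assms(1,2,4)] by simp
  have e: "comp \<Lambda> \<alpha> \<gamma> = comp \<Lambda> \<alpha> (comp \<Lambda> \<beta> \<delta>)"
    unfolding d(3) by (rule comp_assoc[OF assms(1,2) d(1) assms(4) sd])
  have "\<gamma> = comp \<Lambda> \<beta> \<delta>"
    by (rule comp_left_cancel[OF assms(1,3,5) comp_closed[OF assms(2) d(1) sd] _ e])
      (simp add: rng_comp[OF assms(2) d(1) sd] assms(4))
  then show "prefix \<beta> \<gamma>" using prefixI[OF assms(2) d(1) sd] by simp
next
  assume "prefix \<beta> \<gamma>"
  then obtain \<delta> where "\<delta> \<in> paths \<Lambda>" "src \<Lambda> \<beta> = rng \<Lambda> \<delta>" "\<gamma> = comp \<Lambda> \<beta> \<delta>" by (rule prefixE)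
  then show "prefix (comp \<Lambda> \<alpha> \<beta>) (comp \<Lambda> \<alpha> \<gamma>)"
    using assms by (auto simp: comp_assoc[symmetric] comp_closed src_comp intro!: prefixI)
qed

lemma prefix_comp_mono:
  assumes "\<alpha> \<in> paths \<Lambda>" "src \<Lambda> \<alpha> = rng \<Lambda> \<gamma>" "prefix \<beta> \<gamma>"
  shows "prefix (comp \<Lambda> \<alpha> \<beta>) (comp \<Lambda> \<alpha> \<gamma>)"
  using prefix_comp_iff[of \<alpha> \<beta> \<gamma>] prefix_paths[OF assms(3)] prefix_rng[OF assms(3)] assms by simp

lemma initial_seg_eq_iff:
  assumes "\<tau> \<in> paths \<Lambda>" "\<alpha> \<in> paths \<Lambda>" "deg \<Lambda> \<alpha> \<le> deg \<Lambda> \<tau>"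
  shows "initial_seg \<Lambda> \<tau> (deg \<Lambda> \<alpha>) = \<alpha> \<longleftrightarrow> prefix \<alpha> \<tau>"
proof -
  obtain \<beta> where b: "prefix \<beta> \<tau>" "deg \<Lambda> \<beta> = deg \<Lambda> \<alpha>" using prefix_ex assms by blast
  have "initial_seg \<Lambda> \<tau> (deg \<Lambda> \<alpha>) = (THE \<mu>. prefix \<mu> \<tau> \<and> deg \<Lambda> \<mu> = deg \<Lambda> \<alpha>)"
    unfolding initial_seg_def prefix_def by (rule arg_cong[where f = The]) auto
  also have "\<dots> = \<beta>" using b by (auto intro!: the_equality dest: prefix_unique)
  finally show ?thesis using b prefix_unique by auto
qed

section \<open>Minimal common extensions\<close>

lemma Lambda_min_iff:
  assumes "\<alpha> \<in> paths \<Lambda>" "\<mu> \<in> paths \<Lambda>"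
  shows "(\<rho>, \<tau>) \<in> Lambda_min \<Lambda> \<alpha> \<mu> \<longleftrightarrow> \<rho> \<in> paths \<Lambda> \<and> \<tau> \<in> paths \<Lambda> \<and>
     src \<Lambda> \<alpha> = rng \<Lambda> \<rho> \<and> src \<Lambda> \<mu> = rng \<Lambda> \<tau> \<and> comp \<Lambda> \<alpha> \<rho> = comp \<Lambda> \<mu> \<tau> \<and>
     deg \<Lambda> (comp \<Lambda> \<alpha> \<rho>) = deg_join (deg \<Lambda> \<alpha>) (deg \<Lambda> \<mu>)" (is "?L \<longleftrightarrow> ?R")
proof
  assume ?R
  then have "prefix \<alpha> (comp \<Lambda> \<alpha> \<rho>)" "prefix \<mu> (comp \<Lambda> \<alpha> \<rho>)"
    using assms by (auto intro: prefixI) (metis prefixI)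
  then show ?L using \<open>?R\<close> assms initial_seg_eq_iff[of "comp \<Lambda> \<alpha> \<rho>"] comp_closed prefix_deg
    unfolding Lambda_min_def MCE_def by auto
qed (auto simp: Lambda_min_def MCE_def)

lemma Lambda_minD:
  assumes "(\<rho>, \<tau>) \<in> Lambda_min \<Lambda> \<alpha> \<mu>"
  shows "\<rho> \<in> paths \<Lambda>" "\<tau> \<in> paths \<Lambda>" "src \<Lambda> \<alpha> = rng \<Lambda> \<rho>" "src \<Lambda> \<mu> = rng \<Lambda> \<tau>"
    "comp \<Lambda> \<alpha> \<rho> = comp \<Lambda> \<mu> \<tau>" "deg \<Lambda> (comp \<Lambda> \<alpha> \<rho>) = deg_join (deg \<Lambda> \<alpha>) (deg \<Lambda> \<mu>)"
  using assms by (auto simp: Lambda_min_def MCE_def)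

lemma Lambda_min_src:
  assumes "\<alpha> \<in> paths \<Lambda>" "\<mu> \<in> paths \<Lambda>" "(\<rho>, \<tau>) \<in> Lambda_min \<Lambda> \<alpha> \<mu>"
  shows "src \<Lambda> \<rho> = src \<Lambda> \<tau>"
  using Lambda_minD[OF assms(3)] src_comp assms(1,2) by metis

lemma Lambda_min_swap:
  assumes "\<alpha> \<in> paths \<Lambda>" "\<mu> \<in> paths \<Lambda>"
  shows "(\<rho>, \<tau>) \<in> Lambda_min \<Lambda> \<alpha> \<mu> \<longleftrightarrow> (\<tau>, \<rho>) \<in> Lambda_min \<Lambda> \<mu> \<alpha>"
  using assms by (auto simp: Lambda_min_iff deg_join_commute)

lemma Lambda_min_fst_unique:
  assumes "\<alpha> \<in> paths \<Lambda>" "\<mu> \<in> paths \<Lambda>" "(\<rho>, \<tau>) \<in> Lambda_min \<Lambda> \<alpha> \<mu>" "(\<rho>, \<tau>') \<in> Lambda_min \<Lambda> \<alpha> \<mu>"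
  shows "\<tau> = \<tau>'"
  using comp_left_cancel[of \<mu> \<tau> \<tau>'] Lambda_minD(2,4,5)[OF assms(3)] Lambda_minD(2,4,5)[OF assms(4)] assms by metis

lemma Lambda_min_deg_fst:
  assumes "\<alpha> \<in> paths \<Lambda>" "(\<rho>, \<tau>) \<in> Lambda_min \<Lambda> \<alpha> \<mu>"
  shows "deg \<Lambda> \<alpha> + deg \<Lambda> \<rho> = deg_join (deg \<Lambda> \<alpha>) (deg \<Lambda> \<mu>)"
  using Lambda_minD[OF assms(2)] deg_comp[of \<alpha> \<rho>] assms by auto

text \<open>The initial segment of degree \<open>deg_join\<close> of a common extension extends both
  paths, since initial segments are ordered by degree; it is therefore a minimal common extension,
  and left cancellation splits off the same remainder \<open>\<gamma>\<close> on both sides. Most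
  later comparisons of two paths rest on this.\<close>

lemma common_extension:
  assumes "\<alpha> \<in> paths \<Lambda>" "\<beta> \<in> paths \<Lambda>" "src \<Lambda> \<alpha> = rng \<Lambda> \<beta>"
    and "\<mu> \<in> paths \<Lambda>" "\<nu> \<in> paths \<Lambda>" "src \<Lambda> \<mu> = rng \<Lambda> \<nu>"
    and eq: "comp \<Lambda> \<alpha> \<beta> = comp \<Lambda> \<mu> \<nu>"
  obtains \<rho> \<tau> \<gamma> where "(\<rho>, \<tau>) \<in> Lambda_min \<Lambda> \<alpha> \<mu>" "\<gamma> \<in> paths \<Lambda>" "src \<Lambda> \<rho> = rng \<Lambda> \<gamma>"
    "src \<Lambda> \<tau> = rng \<Lambda> \<gamma>" "\<beta> = comp \<Lambda> \<rho> \<gamma>" "\<nu> = comp \<Lambda> \<tau> \<gamma>"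
proof -
  let ?\<kappa> = "comp \<Lambda> \<alpha> \<beta>"
  have k: "?\<kappa> \<in> paths \<Lambda>" "prefix \<alpha> ?\<kappa>" "prefix \<mu> ?\<kappa>"
    using assms by (auto simp: comp_closed intro: prefixI) (metis prefixI)
  then have "deg_join (deg \<Lambda> \<alpha>) (deg \<Lambda> \<mu>) \<le> deg \<Lambda> ?\<kappa>" by (intro deg_join_least prefix_deg)
  then obtain \<sigma> where s: "prefix \<sigma> ?\<kappa>" "deg \<Lambda> \<sigma> = deg_join (deg \<Lambda> \<alpha>) (deg \<Lambda> \<mu>)"
    using prefix_ex k(1) by blast
  have "prefix \<alpha> \<sigma>" "prefix \<mu> \<sigma>" using prefix_chain k s deg_join_upper by metis+
  then obtain \<rho> \<tau> where r: "\<rho> \<in> paths \<Lambda>" "src \<Lambda> \<alpha> = rng \<Lambda> \<rho>" "\<sigma> = comp \<Lambda> \<alpha> \<rho>"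
     "\<tau> \<in> paths \<Lambda>" "src \<Lambda> \<mu> = rng \<Lambda> \<tau>" "\<sigma> = comp \<Lambda> \<mu> \<tau>"
    by (metis prefixE)
  obtain \<gamma> where g: "\<gamma> \<in> paths \<Lambda>" "src \<Lambda> \<sigma> = rng \<Lambda> \<gamma>" "?\<kappa> = comp \<Lambda> \<sigma> \<gamma>" using s(1) by (rule prefixE)
  have sg: "src \<Lambda> \<rho> = rng \<Lambda> \<gamma>" "src \<Lambda> \<tau> = rng \<Lambda> \<gamma>" using r g assms by (metis src_comp)+
  have "\<beta> = comp \<Lambda> \<rho> \<gamma>"
    by (rule comp_left_cancel[of \<alpha>]) (use assms r g sg in \<open>auto simp: comp_closed rng_comp comp_assoc\<close>)
  moreover have "\<nu> = comp \<Lambda> \<tau> \<gamma>"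
    by (rule comp_left_cancel[of \<mu>]) (use assms r g sg in \<open>auto simp: comp_closed rng_comp comp_assoc[symmetric]\<close>)
  moreover have "(\<rho>, \<tau>) \<in> Lambda_min \<Lambda> \<alpha> \<mu>"
    using r s(2) assms by (simp add: Lambda_min_iff)
  ultimately show ?thesis using that g sg by blast
qed

lemma Lambda_min_nonempty_iff:
  assumes "\<alpha> \<in> paths \<Lambda>" "\<mu> \<in> paths \<Lambda>"
  shows "Lambda_min \<Lambda> \<alpha> \<mu> \<noteq> {} \<longleftrightarrow> (\<exists>\<tau>. prefix \<alpha> \<tau> \<and> prefix \<mu> \<tau>)"
proof
  assume "Lambda_min \<Lambda> \<alpha> \<mu> \<noteq> {}"
  then obtain \<rho> \<tau> where "(\<rho>, \<tau>) \<in> Lambda_min \<Lambda> \<alpha> \<mu>" by auto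
  note d = Lambda_minD[OF this]
  have "prefix \<alpha> (comp \<Lambda> \<alpha> \<rho>)" "prefix \<mu> (comp \<Lambda> \<mu> \<tau>)"
    using prefixI[OF assms(1) d(1,3)] prefixI[OF assms(2) d(2,4)] by auto
  then show "\<exists>\<tau>. prefix \<alpha> \<tau> \<and> prefix \<mu> \<tau>" using d(5) by auto
next
  assume "\<exists>\<tau>. prefix \<alpha> \<tau> \<and> prefix \<mu> \<tau>"
  then show "Lambda_min \<Lambda> \<alpha> \<mu> \<noteq> {}" by (metis prefixE common_extension empty_iff)
qed

text \<open>When one path extends the other, the join of the degrees is the degree of the longer
  path; the factor added to it has degree 0, so it is a vertex, and the other factor follows by
  cancellation.\<close>

lemma Lambda_min_prefix:
  assumes "\<alpha> \<in> paths \<Lambda>" "\<beta> \<in> paths \<Lambda>" "src \<Lambda> \<alpha> = rng \<Lambda> \<beta>"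
  shows "Lambda_min \<Lambda> \<alpha> (comp \<Lambda> \<alpha> \<beta>) = {(\<beta>, src \<Lambda> \<beta>)}"
proof -
  let ?s = "src \<Lambda> \<beta>"
  have s: "?s \<in> paths \<Lambda>" "src \<Lambda> (comp \<Lambda> \<alpha> \<beta>) = ?s" "rng \<Lambda> ?s = ?s"
    using assms by (auto simp: src_closed src_comp rng_src)
  have c: "comp \<Lambda> \<alpha> \<beta> \<in> paths \<Lambda>" using assms by (simp add: comp_closed)
  have j: "deg_join (deg \<Lambda> \<alpha>) (deg \<Lambda> (comp \<Lambda> \<alpha> \<beta>)) = deg \<Lambda> (comp \<Lambda> \<alpha> \<beta>)"
    using assms by (simp add: deg_join_absorb deg_comp vec_le_add)
  have cs: "comp \<Lambda> (comp \<Lambda> \<alpha> \<beta>) ?s = comp \<Lambda> \<alpha> \<beta>" using comp_src[OF c] s by simp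
  have "(\<rho>, \<tau>) = (\<beta>, ?s)" if "(\<rho>, \<tau>) \<in> Lambda_min \<Lambda> \<alpha> (comp \<Lambda> \<alpha> \<beta>)" for \<rho> \<tau>
  proof -
    note d = Lambda_minD[OF that]
    have "deg \<Lambda> (comp \<Lambda> \<alpha> \<beta>) + deg \<Lambda> \<tau> = deg \<Lambda> (comp \<Lambda> \<alpha> \<beta>) + 0"
      unfolding deg_comp[OF c d(2,4), symmetric] d(5)[symmetric] d(6) j by simp
    then have "deg \<Lambda> \<tau> = 0" by (rule add_left_imp_eq)
    then have "rng \<Lambda> \<tau> = \<tau>" using vertices_iff_deg_0 d(2) by (auto simp: vertices_def)
    then have t: "\<tau> = ?s" using d(4) s(2) by simp
    have "comp \<Lambda> \<alpha> \<rho> = comp \<Lambda> \<alpha> \<beta>" using d(5) cs unfolding t by simp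
    then have "\<rho> = \<beta>" by (intro comp_left_cancel[OF assms(1) d(1,3) assms(2,3)])
    then show ?thesis using t by simp
  qed
  moreover have "(\<beta>, ?s) \<in> Lambda_min \<Lambda> \<alpha> (comp \<Lambda> \<alpha> \<beta>)"
    unfolding Lambda_min_iff[OF assms(1) c] j cs using assms s by simp
  ultimately show ?thesis by fast
qed

lemma vertexD:
  assumes "v \<in> vertices \<Lambda>"
  shows "v \<in> paths \<Lambda>" "rng \<Lambda> v = v" "src \<Lambda> v = v" "deg \<Lambda> v = 0"
  using assms vertices_iff_deg_0 src_rng[of v] by (auto simp: vertices_def)

lemma vertex_src: "\<alpha> \<in> paths \<Lambda> \<Longrightarrow> src \<Lambda> \<alpha> \<in> vertices \<Lambda>"
  by (simp add: vertices_def src_closed rng_src)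

lemma vertex_rng: "\<alpha> \<in> paths \<Lambda> \<Longrightarrow> rng \<Lambda> \<alpha> \<in> vertices \<Lambda>"
  by (simp add: vertices_def rng_closed rng_rng)

lemma Lambda_min_self:
  assumes "\<alpha> \<in> paths \<Lambda>"
  shows "Lambda_min \<Lambda> \<alpha> \<alpha> = {(src \<Lambda> \<alpha>, src \<Lambda> \<alpha>)}"
  using Lambda_min_prefix[of \<alpha> "src \<Lambda> \<alpha>"] assms by (simp add: src_closed rng_src src_src comp_src)

text \<open>A common extension would have two different initial segments of the same degree. This is
  the source of most disjointness and orthogonality statements below.\<close>

lemma Lambda_min_same_deg:
  assumes "\<alpha> \<in> paths \<Lambda>" "\<mu> \<in> paths \<Lambda>" "deg \<Lambda> \<alpha> = deg \<Lambda> \<mu>" "\<alpha> \<noteq> \<mu>"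
  shows "Lambda_min \<Lambda> \<alpha> \<mu> = {}"
  using Lambda_min_nonempty_iff[OF assms(1,2)] prefix_unique assms by blast

lemma Lambda_min_rng:
  assumes "\<alpha> \<in> paths \<Lambda>" "\<mu> \<in> paths \<Lambda>" "Lambda_min \<Lambda> \<alpha> \<mu> \<noteq> {}"
  shows "rng \<Lambda> \<alpha> = rng \<Lambda> \<mu>"
  using Lambda_min_nonempty_iff[OF assms(1,2)] prefix_rng assms(3) by metis

end

section \<open>Boundary paths as filters of initial segments\<close>

lemma enat_vec_le_iff: "enat_vec n \<le> m \<longleftrightarrow> (\<forall>i. enat (n $ i) \<le> m $ i)"
  by (simp add: enat_vec_def less_eq_vec_def)

lemma enat_vec_le_trans: "\<lbrakk>p \<le> q; enat_vec q \<le> m\<rbrakk> \<Longrightarrow> enat_vec p \<le> m"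
  by (simp add: enat_vec_def less_eq_vec_def) (meson enat_ord_simps(1) order_trans)

lemma enat_vec_join_le: "\<lbrakk>enat_vec p \<le> m; enat_vec q \<le> m\<rbrakk> \<Longrightarrow> enat_vec (deg_join p q) \<le> m"
  unfolding enat_vec_le_iff deg_join_def by (simp add: max_def)

lemma enat_vec_zero_le: "enat_vec 0 \<le> m"
  by (simp add: enat_vec_le_iff zero_enat_def[symmetric])

text \<open>Subtraction of extended naturals truncates at 0; the hypothesis excludes this, for
  otherwise \<open>q = 0\<close> would satisfy the left side but not the right.\<close>

lemma enat_vec_le_diff_iff:
  assumes "enat_vec n \<le> m" shows "enat_vec q \<le> m - enat_vec n \<longleftrightarrow> enat_vec (n + q) \<le> m"
proof -
  have "enat b \<le> y - enat a \<longleftrightarrow> enat (a + b) \<le> y" if "enat a \<le> y" for a b y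
    using that by (cases y) auto
  then show ?thesis using assms unfolding enat_vec_le_iff by (simp add: enat_vec_def)
qed

text \<open>An extended degree is the supremum of the finite ones below it. Vectors supported on one
  coordinate reduce the comparison to single extended naturals.\<close>

lemma enat_vec_eqI:
  assumes "\<And>n. enat_vec n \<le> m \<longleftrightarrow> enat_vec n \<le> m'" shows "m = m'"
proof -
  have le: "a \<le> b" if "\<And>t. enat t \<le> a \<Longrightarrow> enat t \<le> b" for a b :: enat
  proof (cases b)
    case (enat t)
    then have "\<not> enat (Suc t) \<le> a" using that[of "Suc t"] by auto
    then show ?thesis using enat by (cases a) auto
  qed simp
  have "m $ i = m' $ i" for i
  proof -
    have "enat t \<le> m $ i \<longleftrightarrow> enat t \<le> m' $ i" for t
    proof -
      have "enat_vec (\<chi> j. if j = i then t else 0) \<le> l \<longleftrightarrow> enat t \<le> l $ i" for l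
        unfolding enat_vec_le_iff by (auto simp: zero_enat_def[symmetric])
      then show ?thesis using assms by metis
    qed
    then show ?thesis using le[of "m $ i" "m' $ i"] le[of "m' $ i" "m $ i"] by (intro order_antisym) blast+
  qed
  then show ?thesis by (simp add: vec_eq_iff)
qed

lemma mem_paths_Omega: "(p, q) \<in> paths (Omega m) \<longleftrightarrow> p \<le> q \<and> enat_vec q \<le> m"
  by (simp add: Omega_def)

context k_graph
begin

section \<open>Boundary paths and their segments\<close>

lemma boundary_path_seg:
  assumes "x \<in> boundary_paths \<Lambda>" "p \<le> q" "enat_vec q \<le> bdeg x"
  shows "bseg x p q \<in> paths \<Lambda>" "rng \<Lambda> (bseg x p q) = bseg x p p" "src \<Lambda> (bseg x p q) = bseg x q q"
    "deg \<Lambda> (bseg x p q) = q - p"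
proof -
  have f: "snd x \<in> degree_functors (Omega (bdeg x)) \<Lambda>" using assms by (simp add: boundary_paths_def)
  have m: "(p, q) \<in> paths (Omega (bdeg x))" using assms by (simp add: mem_paths_Omega)
  show "bseg x p q \<in> paths \<Lambda>" using f m by (auto simp: degree_functors_def)
  have "snd x (rng (Omega (bdeg x)) (p, q)) = rng \<Lambda> (snd x (p, q)) \<and>
    snd x (src (Omega (bdeg x)) (p, q)) = src \<Lambda> (snd x (p, q)) \<and>
    deg \<Lambda> (snd x (p, q)) = deg (Omega (bdeg x)) (p, q)"
    using f m unfolding degree_functors_def by blast
  then show "rng \<Lambda> (bseg x p q) = bseg x p p" "src \<Lambda> (bseg x p q) = bseg x q q"
    "deg \<Lambda> (bseg x p q) = q - p"
    by (simp_all add: Omega_def)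
qed

lemma boundary_path_comp:
  assumes "x \<in> boundary_paths \<Lambda>" "p \<le> q" "q \<le> r" "enat_vec r \<le> bdeg x"
  shows "comp \<Lambda> (bseg x p q) (bseg x q r) = bseg x p r"
proof -
  have f: "snd x \<in> degree_functors (Omega (bdeg x)) \<Lambda>" using assms by (simp add: boundary_paths_def)
  have m: "(p, q) \<in> paths (Omega (bdeg x))" "(q, r) \<in> paths (Omega (bdeg x))"
    using assms enat_vec_le_trans by (auto simp: mem_paths_Omega)
  have "src (Omega (bdeg x)) (p, q) = rng (Omega (bdeg x)) (q, r)" by (simp add: Omega_def)
  then have "snd x (comp (Omega (bdeg x)) (p, q) (q, r)) = comp \<Lambda> (snd x (p, q)) (snd x (q, r))"
    using f m unfolding degree_functors_def by blast
  then show ?thesis by (simp add: Omega_def)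
qed

lemma boundary_path_tight:
  assumes "x \<in> boundary_paths \<Lambda>" "enat_vec n \<le> bdeg x" "E \<in> FE \<Lambda> (bseg x n n)"
  shows "\<exists>\<alpha> \<in> E. enat_vec (n + deg \<Lambda> \<alpha>) \<le> bdeg x \<and> bseg x n (n + deg \<Lambda> \<alpha>) = \<alpha>"
  using assms by (simp add: boundary_paths_def)

lemma boundary_pathI:
  assumes ext: "snd x \<in> extensional (paths (Omega (bdeg x)))"
    and seg: "\<And>p q. \<lbrakk>p \<le> q; enat_vec q \<le> bdeg x\<rbrakk> \<Longrightarrow> bseg x p q \<in> paths \<Lambda> \<and> rng \<Lambda> (bseg x p q) = bseg x p p \<and>
       src \<Lambda> (bseg x p q) = bseg x q q \<and> deg \<Lambda> (bseg x p q) = q - p"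
    and cmp: "\<And>p q r. \<lbrakk>p \<le> q; q \<le> r; enat_vec r \<le> bdeg x\<rbrakk> \<Longrightarrow> comp \<Lambda> (bseg x p q) (bseg x q r) = bseg x p r"
    and tight: "\<And>n E. \<lbrakk>enat_vec n \<le> bdeg x; E \<in> FE \<Lambda> (bseg x n n)\<rbrakk>
      \<Longrightarrow> \<exists>\<alpha> \<in> E. enat_vec (n + deg \<Lambda> \<alpha>) \<le> bdeg x \<and> bseg x n (n + deg \<Lambda> \<alpha>) = \<alpha>"
  shows "x \<in> boundary_paths \<Lambda>"
proof -
  let ?O = "Omega (bdeg x)"
  have 1: "snd x \<in> paths ?O \<rightarrow>\<^sub>E paths \<Lambda>"
    unfolding PiE_def using ext seg by (auto simp: mem_paths_Omega)
  have 2: "snd x (rng ?O a) = rng \<Lambda> (snd x a) \<and> snd x (src ?O a) = src \<Lambda> (snd x a) \<and>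
        deg \<Lambda> (snd x a) = deg ?O a" if "a \<in> paths ?O" for a
  proof (cases a)
    case (Pair p q)
    then show ?thesis using seg[of p q] that by (simp add: mem_paths_Omega) (simp add: Omega_def)
  qed
  have 3: "snd x (comp ?O a b) = comp \<Lambda> (snd x a) (snd x b)"
    if h: "a \<in> paths ?O" "b \<in> paths ?O" "src ?O a = rng ?O b" for a b
  proof -
    obtain p q r where a: "a = (p, q)" "b = (q, r)" using h(3) by (cases a, cases b) (auto simp: Omega_def)
    have "comp ?O a b = (p, r)" by (simp add: a Omega_def)
    then show ?thesis using cmp[of p q r] h by (simp add: mem_paths_Omega a)
  qed
  show ?thesis unfolding boundary_paths_def degree_functors_def
    using 1 2 3 tight by auto
qed

definition initial_segs :: "('l, 'k) bpath \<Rightarrow> 'l set" where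
  "initial_segs x = {bseg x 0 n | n. enat_vec n \<le> bdeg x}"

text \<open>The first clauses describe a filter for the order \<open>prefix\<close>. The last clause
  is the boundary condition at the position reached by \<open>\<alpha>\<close>, written without
  reference to positions. A common range vertex is not prescribed; directedness forces it.\<close>

definition tight :: "'l set \<Rightarrow> bool" where
  "tight F \<longleftrightarrow> F \<subseteq> paths \<Lambda> \<and> F \<noteq> {} \<and> (\<forall>\<tau> \<in> F. \<forall>\<alpha>. prefix \<alpha> \<tau> \<longrightarrow> \<alpha> \<in> F) \<and>
     (\<forall>\<alpha> \<in> F. \<forall>\<beta> \<in> F. \<exists>\<tau> \<in> F. prefix \<alpha> \<tau> \<and> prefix \<beta> \<tau>) \<and>
     (\<forall>\<alpha> \<in> F. \<forall>E \<in> FE \<Lambda> (src \<Lambda> \<alpha>). \<exists>\<nu> \<in> E. comp \<Lambda> \<alpha> \<nu> \<in> F)"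

lemma tight_paths: "\<lbrakk>tight F; \<alpha> \<in> F\<rbrakk> \<Longrightarrow> \<alpha> \<in> paths \<Lambda>"
  by (auto simp: tight_def)

lemma tight_hereditary: "\<lbrakk>tight F; \<tau> \<in> F; prefix \<alpha> \<tau>\<rbrakk> \<Longrightarrow> \<alpha> \<in> F"
  by (auto simp: tight_def)

lemma tight_directed:
  assumes "tight F" "\<alpha> \<in> F" "\<beta> \<in> F"
  obtains \<tau> where "\<tau> \<in> F" "prefix \<alpha> \<tau>" "prefix \<beta> \<tau>"
  using assms unfolding tight_def by blast

lemma tight_FE: "\<lbrakk>tight F; \<alpha> \<in> F; E \<in> FE \<Lambda> (src \<Lambda> \<alpha>)\<rbrakk> \<Longrightarrow> \<exists>\<nu> \<in> E. comp \<Lambda> \<alpha> \<nu> \<in> F"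
  by (auto simp: tight_def)

lemma tight_rng: "\<lbrakk>tight F; \<alpha> \<in> F; \<beta> \<in> F\<rbrakk> \<Longrightarrow> rng \<Lambda> \<alpha> = rng \<Lambda> \<beta>"
  by (metis tight_directed prefix_rng)

lemma tight_prefix: "\<lbrakk>tight F; \<alpha> \<in> F; \<beta> \<in> F; deg \<Lambda> \<alpha> \<le> deg \<Lambda> \<beta>\<rbrakk> \<Longrightarrow> prefix \<alpha> \<beta>"
  by (metis tight_directed prefix_chain)

lemma tight_deg_unique: "\<lbrakk>tight F; \<alpha> \<in> F; \<beta> \<in> F; deg \<Lambda> \<alpha> = deg \<Lambda> \<beta>\<rbrakk> \<Longrightarrow> \<alpha> = \<beta>"
  by (metis tight_directed prefix_unique)

lemma tight_rng_mem: "\<lbrakk>tight F; \<alpha> \<in> F\<rbrakk> \<Longrightarrow> rng \<Lambda> \<alpha> \<in> F"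
  by (metis comp_rng prefixI rng_closed src_rng tight_hereditary tight_paths)

lemma initial_segs_deg:
  assumes "x \<in> boundary_paths \<Lambda>"
  shows "enat_vec n \<le> bdeg x \<longleftrightarrow> (\<exists>\<alpha> \<in> initial_segs x. deg \<Lambda> \<alpha> = n)"
    and "\<alpha> \<in> initial_segs x \<longleftrightarrow> enat_vec (deg \<Lambda> \<alpha>) \<le> bdeg x \<and> bseg x 0 (deg \<Lambda> \<alpha>) = \<alpha>"
proof -
  have d: "deg \<Lambda> (bseg x 0 n) = n" if "enat_vec n \<le> bdeg x" for n
    using boundary_path_seg(4)[OF assms _ that, of 0] by (simp add: less_eq_vec_def vec_eq_iff)
  then show "enat_vec n \<le> bdeg x \<longleftrightarrow> (\<exists>\<alpha> \<in> initial_segs x. deg \<Lambda> \<alpha> = n)"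
    by (auto simp: initial_segs_def)
  show "\<alpha> \<in> initial_segs x \<longleftrightarrow> enat_vec (deg \<Lambda> \<alpha>) \<le> bdeg x \<and> bseg x 0 (deg \<Lambda> \<alpha>) = \<alpha>"
    unfolding initial_segs_def mem_Collect_eq using d by metis
qed

lemma initial_segs_prefix:
  assumes x: "x \<in> boundary_paths \<Lambda>" and "p \<le> q" "enat_vec q \<le> bdeg x"
  shows "prefix (bseg x 0 p) (bseg x 0 q)"
proof -
  have z: "(0 :: nat ^ 'k) \<le> p" by (simp add: less_eq_vec_def)
  have p: "enat_vec p \<le> bdeg x" using enat_vec_le_trans assms by blast
  show ?thesis
    using prefixI[OF boundary_path_seg(1)[OF x z p] boundary_path_seg(1)[OF x assms(2,3)]]
      boundary_path_comp[OF x z assms(2,3)] boundary_path_seg(3)[OF x z p] boundary_path_seg(2)[OF x assms(2,3)]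
    by simp
qed

text \<open>Directedness holds because the finite degrees below \<open>bdeg x\<close> are closed
  under joins. The last clause is the boundary condition at position
  \<open>deg \<Lambda> \<alpha>\<close>, with the segment \<open>\<alpha>\<close> composed in
  front.\<close>

lemma initial_segs_tight:
  assumes x: "x \<in> boundary_paths \<Lambda>"
  shows "tight (initial_segs x)"
  unfolding tight_def
proof (intro conjI ballI allI impI)
  have z: "(0 :: nat ^ 'k) \<le> n" for n by (simp add: less_eq_vec_def)
  show "initial_segs x \<subseteq> paths \<Lambda>"
    using boundary_path_seg(1)[OF x z] by (auto simp: initial_segs_def)
  show "initial_segs x \<noteq> {}" using enat_vec_zero_le by (auto simp: initial_segs_def)
next
  fix \<tau> \<alpha> assume t: "\<tau> \<in> initial_segs x" and p: "prefix \<alpha> \<tau>"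
  then have e: "enat_vec (deg \<Lambda> \<tau>) \<le> bdeg x" "bseg x 0 (deg \<Lambda> \<tau>) = \<tau>"
    using initial_segs_deg(2)[OF x] by auto
  then have "prefix (bseg x 0 (deg \<Lambda> \<alpha>)) \<tau>"
    using initial_segs_prefix[OF x prefix_deg[OF p] e(1)] by simp
  moreover have ea: "enat_vec (deg \<Lambda> \<alpha>) \<le> bdeg x" using e(1) p prefix_deg enat_vec_le_trans by blast
  then have "bseg x 0 (deg \<Lambda> \<alpha>) \<in> initial_segs x" by (auto simp: initial_segs_def)
  moreover have "deg \<Lambda> (bseg x 0 (deg \<Lambda> \<alpha>)) = deg \<Lambda> \<alpha>"
    using boundary_path_seg(4)[OF x _ ea, of 0] by (simp add: vec_eq_iff less_eq_vec_def)
  ultimately show "\<alpha> \<in> initial_segs x" using prefix_unique[OF _ p] by metis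
next
  fix \<alpha> \<beta> assume a: "\<alpha> \<in> initial_segs x" and b: "\<beta> \<in> initial_segs x"
  let ?j = "deg_join (deg \<Lambda> \<alpha>) (deg \<Lambda> \<beta>)"
  have ab: "enat_vec (deg \<Lambda> \<alpha>) \<le> bdeg x" "bseg x 0 (deg \<Lambda> \<alpha>) = \<alpha>"
     "enat_vec (deg \<Lambda> \<beta>) \<le> bdeg x" "bseg x 0 (deg \<Lambda> \<beta>) = \<beta>"
    using a b initial_segs_deg(2)[OF x] by auto
  have j: "enat_vec ?j \<le> bdeg x" using ab enat_vec_join_le by blast
  have "prefix \<alpha> (bseg x 0 ?j)" "prefix \<beta> (bseg x 0 ?j)"
    using initial_segs_prefix[OF x deg_join_upper(1) j] initial_segs_prefix[OF x deg_join_upper(2) j] ab by simp_all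
  moreover have "bseg x 0 ?j \<in> initial_segs x" using j by (auto simp: initial_segs_def)
  ultimately show "\<exists>\<tau> \<in> initial_segs x. prefix \<alpha> \<tau> \<and> prefix \<beta> \<tau>" by blast
next
  fix \<alpha> E assume a: "\<alpha> \<in> initial_segs x" and E: "E \<in> FE \<Lambda> (src \<Lambda> \<alpha>)"
  have ab: "enat_vec (deg \<Lambda> \<alpha>) \<le> bdeg x" "bseg x 0 (deg \<Lambda> \<alpha>) = \<alpha>"
    using a initial_segs_deg(2)[OF x] by auto
  have z: "(0 :: nat ^ 'k) \<le> n" for n by (simp add: less_eq_vec_def)
  have "src \<Lambda> \<alpha> = bseg x (deg \<Lambda> \<alpha>) (deg \<Lambda> \<alpha>)" using boundary_path_seg(3)[OF x z ab(1)] ab by simp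
  then obtain \<nu> where n: "\<nu> \<in> E" "enat_vec (deg \<Lambda> \<alpha> + deg \<Lambda> \<nu>) \<le> bdeg x"
    "bseg x (deg \<Lambda> \<alpha>) (deg \<Lambda> \<alpha> + deg \<Lambda> \<nu>) = \<nu>"
    using boundary_path_tight[OF x ab(1)] E by auto
  have "comp \<Lambda> \<alpha> \<nu> = bseg x 0 (deg \<Lambda> \<alpha> + deg \<Lambda> \<nu>)"
    using boundary_path_comp[OF x z vec_le_add n(2)] ab(2) n(3) by simp
  then have "comp \<Lambda> \<alpha> \<nu> \<in> initial_segs x" using n(2) by (auto simp: initial_segs_def)
  then show "\<exists>\<nu> \<in> E. comp \<Lambda> \<alpha> \<nu> \<in> initial_segs x" using n(1) by blast
qed

text \<open>The degree is recovered from the degrees of the initial segments, and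
  \<open>x(p,q)\<close> from \<open>x(0,p)\<close> and \<open>x(0,q)\<close> by left cancellation.
  Outside the domain both functors are \<open>undefined\<close>, because functors are
  extensional.\<close>

lemma initial_segs_inj:
  assumes x: "x \<in> boundary_paths \<Lambda>" and y: "y \<in> boundary_paths \<Lambda>" and eq: "initial_segs x = initial_segs y"
  shows "x = y"
proof -
  have d: "bdeg x = bdeg y"
    using initial_segs_deg(1)[OF x] initial_segs_deg(1)[OF y] eq by (intro enat_vec_eqI) auto
  have z: "(0 :: nat ^ 'k) \<le> n" for n by (simp add: less_eq_vec_def)
  have s0: "bseg x 0 n = bseg y 0 n" if n: "enat_vec n \<le> bdeg x" for n
  proof -
    have "bseg x 0 n \<in> initial_segs x" using n by (auto simp: initial_segs_def)
    then have "bseg y 0 (deg \<Lambda> (bseg x 0 n)) = bseg x 0 n" using initial_segs_deg(2)[OF y] eq by blast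
    moreover have "deg \<Lambda> (bseg x 0 n) = n" using boundary_path_seg(4)[OF x z n] by (simp add: vec_eq_iff)
    ultimately show ?thesis by simp
  qed
  have "snd x a = snd y a" for a
  proof (cases "a \<in> paths (Omega (bdeg x))")
    case True
    obtain p q where a: "a = (p, q)" "p \<le> q" "enat_vec q \<le> bdeg x"
      using True by (cases a) (auto simp: mem_paths_Omega)
    have p: "enat_vec p \<le> bdeg x" using a enat_vec_le_trans by blast
    have "comp \<Lambda> (bseg x 0 p) (bseg x p q) = comp \<Lambda> (bseg x 0 p) (bseg y p q)"
      using boundary_path_comp[OF x z a(2,3)] boundary_path_comp[OF y z a(2)] a d s0 p by simp
    then have "bseg x p q = bseg y p q"
      by (rule comp_left_cancel[rotated 5])
        (use boundary_path_seg[OF x z p] boundary_path_seg[OF x a(2,3)] boundary_path_seg[OF y z, of p]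
            boundary_path_seg[OF y a(2)] a p d s0[OF p] in simp_all)
    then show ?thesis using a by simp
  next
    case False
    have "snd x \<in> paths (Omega (bdeg x)) \<rightarrow>\<^sub>E paths \<Lambda>" "snd y \<in> paths (Omega (bdeg x)) \<rightarrow>\<^sub>E paths \<Lambda>"
      using x y d by (simp_all add: boundary_paths_def degree_functors_def)
    then show ?thesis using PiE_arb[OF _ False] by metis
  qed
  then show ?thesis using d by (intro prod_eqI) auto
qed

end

lemma vec_zero_le: "(0 :: nat ^ 'k::finite) \<le> n"
  by (simp add: less_eq_vec_def)

context k_graph
begin

text \<open>The coordinates of the supremum might be approached by different members of
  \<open>F\<close>. Each finite coordinate bound is reached by a single member; directedness merges
  the finitely many coordinates, and heredity cuts the result down to degree exactly
  \<open>q\<close>.\<close>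

lemma tight_deg_attained:
  assumes F: "tight F" and q: "enat_vec q \<le> (\<chi> i. SUP \<alpha> \<in> F. enat (deg \<Lambda> \<alpha> $ i))"
  obtains \<alpha> where "\<alpha> \<in> F" "deg \<Lambda> \<alpha> = q"
proof -
  have one: "\<exists>\<alpha> \<in> F. q $ i \<le> deg \<Lambda> \<alpha> $ i" for i
  proof (rule ccontr)
    assume "\<not> ?thesis"
    then have n: "\<forall>\<alpha> \<in> F. deg \<Lambda> \<alpha> $ i < q $ i" by auto
    obtain \<alpha>0 where "\<alpha>0 \<in> F" using F by (auto simp: tight_def)
    \<comment> \<open>Truncated subtraction: \<open>q $ i - 1\<close> is a strictly smaller bound
      only because \<open>q $ i\<close> is positive.\<close>
    then have pos: "0 < q $ i" using n by fastforce
    have "(SUP \<alpha> \<in> F. enat (deg \<Lambda> \<alpha> $ i)) \<le> enat (q $ i - 1)"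
    proof (rule SUP_least)
      fix \<alpha> assume "\<alpha> \<in> F"
      then have "deg \<Lambda> \<alpha> $ i < q $ i" using n by blast
      then show "enat (deg \<Lambda> \<alpha> $ i) \<le> enat (q $ i - 1)" by simp
    qed
    moreover have "enat (q $ i) \<le> (SUP \<alpha> \<in> F. enat (deg \<Lambda> \<alpha> $ i))"
      using q by (simp add: enat_vec_le_iff)
    ultimately have "enat (q $ i) \<le> enat (q $ i - 1)" by (rule order_trans[rotated])
    then show False using pos by simp
  qed
  have "\<exists>\<alpha> \<in> F. \<forall>i \<in> I. q $ i \<le> deg \<Lambda> \<alpha> $ i" if "finite I" for I
    using that
  proof (induction I rule: finite_induct)
    case empty
    then show ?case using F by (auto simp: tight_def)
  next
    case (insert j I)
    then obtain \<alpha> where a: "\<alpha> \<in> F" "\<forall>i \<in> I. q $ i \<le> deg \<Lambda> \<alpha> $ i" by blast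
    obtain \<beta> where b: "\<beta> \<in> F" "q $ j \<le> deg \<Lambda> \<beta> $ j" using one by blast
    obtain \<tau> where t: "\<tau> \<in> F" "prefix \<alpha> \<tau>" "prefix \<beta> \<tau>" using tight_directed[OF F a(1) b(1)] .
    have "deg \<Lambda> \<alpha> $ i \<le> deg \<Lambda> \<tau> $ i" "deg \<Lambda> \<beta> $ i \<le> deg \<Lambda> \<tau> $ i" for i
      using prefix_deg[OF t(2)] prefix_deg[OF t(3)] by (simp_all add: less_eq_vec_def)
    then have "\<forall>i \<in> insert j I. q $ i \<le> deg \<Lambda> \<tau> $ i" using a(2) b(2) order_trans by blast
    then show ?case using t(1) by blast
  qed
  from this[OF finite[of UNIV]] obtain \<beta> where b: "\<beta> \<in> F" "q \<le> deg \<Lambda> \<beta>"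
    by (auto simp: less_eq_vec_def)
  then obtain \<alpha> where "prefix \<alpha> \<beta>" "deg \<Lambda> \<alpha> = q" using prefix_ex tight_paths[OF F] by blast
  then show ?thesis using that tight_hereditary[OF F b(1)] by blast
qed

text \<open>The boundary path is rebuilt from \<open>F\<close>: \<open>a q\<close> is the only
  member of degree \<open>q\<close>, and \<open>b p q\<close> is what remains of \<open>a q\<close>
  after \<open>a p\<close>. Left cancellation makes \<open>b p q\<close> unique, so the composition
  law follows by comparing both sides behind \<open>a p\<close>.\<close>

lemma tight_initial_segs_ex:
  assumes F: "tight F"
  shows "\<exists>x \<in> boundary_paths \<Lambda>. initial_segs x = F"
proof -
  define m where "m = (\<chi> i. SUP \<alpha> \<in> F. enat (deg \<Lambda> \<alpha> $ i))"
  have att: "\<exists>\<alpha>. \<alpha> \<in> F \<and> deg \<Lambda> \<alpha> = q" if "enat_vec q \<le> m" for q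
    using tight_deg_attained[OF F] that unfolding m_def by metis
  define a where "a = (\<lambda>q. SOME \<alpha>. \<alpha> \<in> F \<and> deg \<Lambda> \<alpha> = q)"
  have aF: "a q \<in> F" and ad: "deg \<Lambda> (a q) = q" if "enat_vec q \<le> m" for q
    using someI_ex[OF att[OF that]] unfolding a_def by blast+
  have ap: "a q \<in> paths \<Lambda>" if "enat_vec q \<le> m" for q using tight_paths[OF F aF[OF that]] .
  have Fm: "enat_vec (deg \<Lambda> \<alpha>) \<le> m" "a (deg \<Lambda> \<alpha>) = \<alpha>" if "\<alpha> \<in> F" for \<alpha>
  proof -
    show 1: "enat_vec (deg \<Lambda> \<alpha>) \<le> m"
      unfolding enat_vec_le_iff m_def using that by (auto intro: SUP_upper)
    show "a (deg \<Lambda> \<alpha>) = \<alpha>" by (rule tight_deg_unique[OF F aF[OF 1] that ad[OF 1]])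
  qed
  define b where "b = (\<lambda>p q. SOME \<beta>. \<beta> \<in> paths \<Lambda> \<and> src \<Lambda> (a p) = rng \<Lambda> \<beta> \<and> a q = comp \<Lambda> (a p) \<beta>)"
  have b: "b p q \<in> paths \<Lambda>" "src \<Lambda> (a p) = rng \<Lambda> (b p q)" "a q = comp \<Lambda> (a p) (b p q)"
    if "p \<le> q" "enat_vec q \<le> m" for p q
  proof -
    have p: "enat_vec p \<le> m" using that enat_vec_le_trans by blast
    have "prefix (a p) (a q)" by (rule tight_prefix[OF F aF[OF p] aF[OF that(2)]]) (simp add: ad p that)
    then have "\<exists>\<beta>. \<beta> \<in> paths \<Lambda> \<and> src \<Lambda> (a p) = rng \<Lambda> \<beta> \<and> a q = comp \<Lambda> (a p) \<beta>"
      unfolding prefix_def by blast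
    from someI_ex[OF this] show "b p q \<in> paths \<Lambda>" "src \<Lambda> (a p) = rng \<Lambda> (b p q)" "a q = comp \<Lambda> (a p) (b p q)"
      unfolding b_def by blast+
  qed
  have b_eqI: "b p q = \<beta>" if "p \<le> q" "enat_vec q \<le> m" "\<beta> \<in> paths \<Lambda>" "src \<Lambda> (a p) = rng \<Lambda> \<beta>"
      "a q = comp \<Lambda> (a p) \<beta>" for p q \<beta>
    by (rule comp_left_cancel[OF ap b(1,2)]) (use that b(3) enat_vec_le_trans in auto)
  have bb: "b p p = src \<Lambda> (a p)" if "enat_vec p \<le> m" for p
    by (rule b_eqI) (use ap[OF that] that in \<open>simp_all add: src_closed rng_src comp_src\<close>)
  have bd: "deg \<Lambda> (b p q) = q - p" if pq: "p \<le> q" "enat_vec q \<le> m" for p q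
  proof -
    have p: "enat_vec p \<le> m" using pq enat_vec_le_trans by blast
    have "p + deg \<Lambda> (b p q) = q"
      using deg_comp[OF ap[OF p] b(1,2)[OF pq]] ad[OF p] ad[OF pq(2)] b(3)[OF pq] by simp
    then show ?thesis by (metis add_diff_cancel_left')
  qed
  have bs: "src \<Lambda> (b p q) = b q q" if pq: "p \<le> q" "enat_vec q \<le> m" for p q
  proof -
    have p: "enat_vec p \<le> m" using pq enat_vec_le_trans by blast
    show ?thesis using src_comp[OF ap[OF p] b(1,2)[OF pq]] b(3)[OF pq] bb[OF pq(2)] by simp
  qed
  have br: "rng \<Lambda> (b p q) = b p p" if pq: "p \<le> q" "enat_vec q \<le> m" for p q
  proof -
    have p: "enat_vec p \<le> m" using pq enat_vec_le_trans by blast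
    show ?thesis using b(2)[OF pq] bb[OF p] by simp
  qed
  have bc: "comp \<Lambda> (b p q) (b q r) = b p r" if pq: "p \<le> q" "q \<le> r" "enat_vec r \<le> m" for p q r
  proof (rule sym, rule b_eqI)
    have q: "enat_vec q \<le> m" using pq enat_vec_le_trans by blast
    have p: "enat_vec p \<le> m" using pq q enat_vec_le_trans by blast
    have s: "src \<Lambda> (b p q) = rng \<Lambda> (b q r)" using bs[OF pq(1) q] br[OF pq(2,3)] by simp
    show "p \<le> r" using pq by order
    show "enat_vec r \<le> m" by fact
    show "comp \<Lambda> (b p q) (b q r) \<in> paths \<Lambda>" by (rule comp_closed[OF b(1)[OF pq(1) q] b(1)[OF pq(2,3)] s])
    show "src \<Lambda> (a p) = rng \<Lambda> (comp \<Lambda> (b p q) (b q r))"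
      using b(2)[OF pq(1) q] rng_comp[OF b(1)[OF pq(1) q] b(1)[OF pq(2,3)] s] by simp
    have "a r = comp \<Lambda> (comp \<Lambda> (a p) (b p q)) (b q r)"
      using b(3)[OF pq(1) q] b(3)[OF pq(2,3)] by simp
    also have "\<dots> = comp \<Lambda> (a p) (comp \<Lambda> (b p q) (b q r))"
      by (rule comp_assoc[OF ap[OF p] b(1)[OF pq(1) q] b(1)[OF pq(2,3)] b(2)[OF pq(1) q] s])
    finally show "a r = comp \<Lambda> (a p) (comp \<Lambda> (b p q) (b q r))" .
  qed
  define x where "x = (m, \<lambda>(p, q) \<in> paths (Omega m). b p q)"
  have xs: "bdeg x = m" "\<And>p q. \<lbrakk>p \<le> q; enat_vec q \<le> m\<rbrakk> \<Longrightarrow> bseg x p q = b p q"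
    by (simp_all add: x_def mem_paths_Omega)
  have "x \<in> boundary_paths \<Lambda>"
  proof (rule boundary_pathI, unfold xs(1))
    show "snd x \<in> extensional (paths (Omega m))" by (simp add: x_def)
    show "bseg x p q \<in> paths \<Lambda> \<and> rng \<Lambda> (bseg x p q) = bseg x p p \<and>
       src \<Lambda> (bseg x p q) = bseg x q q \<and> deg \<Lambda> (bseg x p q) = q - p" if "p \<le> q" "enat_vec q \<le> m" for p q
      using that enat_vec_le_trans[OF that] by (simp add: xs(2) b(1) bs bd br)
    show "comp \<Lambda> (bseg x p q) (bseg x q r) = bseg x p r" if "p \<le> q" "q \<le> r" "enat_vec r \<le> m" for p q r
      using bc[OF that] enat_vec_le_trans[OF that(2,3)] that by (simp add: xs(2) order_trans[OF that(1,2)])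
    show "\<exists>\<alpha> \<in> E. enat_vec (n + deg \<Lambda> \<alpha>) \<le> m \<and> bseg x n (n + deg \<Lambda> \<alpha>) = \<alpha>"
      if n: "enat_vec n \<le> m" and E: "E \<in> FE \<Lambda> (bseg x n n)" for n E
    proof -
      have "E \<in> FE \<Lambda> (src \<Lambda> (a n))" using E n by (simp add: xs(2) bb)
      then obtain \<nu> where v: "\<nu> \<in> E" "comp \<Lambda> (a n) \<nu> \<in> F" using tight_FE[OF F aF[OF n]] by blast
      have vp: "\<nu> \<in> paths \<Lambda>" "src \<Lambda> (a n) = rng \<Lambda> \<nu>"
        using \<open>E \<in> FE \<Lambda> (src \<Lambda> (a n))\<close> v by (auto simp: FE_def exhaustive_def paths_from_def)
      have d: "deg \<Lambda> (comp \<Lambda> (a n) \<nu>) = n + deg \<Lambda> \<nu>" using deg_comp[OF ap[OF n] vp] ad[OF n] by simp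
      have nm: "enat_vec (n + deg \<Lambda> \<nu>) \<le> m" "a (n + deg \<Lambda> \<nu>) = comp \<Lambda> (a n) \<nu>"
        using Fm[OF v(2)] unfolding d by auto
      have "b n (n + deg \<Lambda> \<nu>) = \<nu>" by (rule b_eqI[OF vec_le_add nm(1) vp nm(2)])
      then show ?thesis using v(1) nm by (auto simp: xs(2) vec_le_add)
    qed
  qed
  moreover have "initial_segs x = F"
  proof -
    have b0: "b 0 n = a n" if n: "enat_vec n \<le> m" for n
    proof (rule b_eqI[OF vec_zero_le n ap[OF n]])
      have v: "a 0 \<in> vertices \<Lambda>" using ap[OF enat_vec_zero_le] ad[OF enat_vec_zero_le] vertices_iff_deg_0 by blast
      have "rng \<Lambda> (a n) = rng \<Lambda> (a 0)" by (rule tight_rng[OF F aF[OF n] aF[OF enat_vec_zero_le]])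
      then have r: "rng \<Lambda> (a n) = a 0" using vertexD(2)[OF v] by simp
      show "src \<Lambda> (a 0) = rng \<Lambda> (a n)" using vertexD(3)[OF v] r by simp
      show "a n = comp \<Lambda> (a 0) (a n)" using comp_rng[OF ap[OF n]] r by simp
    qed
    show ?thesis
    proof (intro equalityI subsetI)
      fix \<alpha> assume "\<alpha> \<in> initial_segs x"
      then show "\<alpha> \<in> F" using aF by (auto simp: initial_segs_def xs b0 vec_zero_le)
    next
      fix \<alpha> assume a: "\<alpha> \<in> F"
      then have "\<alpha> = bseg x 0 (deg \<Lambda> \<alpha>)" using Fm[OF a] by (simp add: xs b0 vec_zero_le)
      then show "\<alpha> \<in> initial_segs x" using Fm[OF a] unfolding initial_segs_def xs(1) by blast
    qed
  qed
  ultimately show ?thesis by blast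
qed

text \<open>The initial segments of \<open>\<alpha>x\<close> when \<open>F\<close> consists of those
  of \<open>x\<close>. The closure under \<open>prefix\<close> is essential: an initial segment of
  \<open>\<alpha>x\<close> need not extend \<open>\<alpha>\<close>, and its degree need not be
  comparable with that of \<open>\<alpha>\<close>.\<close>

definition cone :: "'l \<Rightarrow> 'l set \<Rightarrow> 'l set" where
  "cone \<alpha> F = {\<beta>. \<exists>\<gamma> \<in> F. prefix \<beta> (comp \<Lambda> \<alpha> \<gamma>)}"

lemma tight_mem_comp:
  assumes F: "tight F" and a: "\<alpha> \<in> paths \<Lambda>" "src \<Lambda> \<alpha> \<in> F" and g: "\<gamma> \<in> F"
  shows "src \<Lambda> \<alpha> = rng \<Lambda> \<gamma>" "comp \<Lambda> \<alpha> \<gamma> \<in> paths \<Lambda>" "\<gamma> \<in> paths \<Lambda>"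
proof -
  show 1: "src \<Lambda> \<alpha> = rng \<Lambda> \<gamma>" using tight_rng[OF F a(2) g] rng_src[OF a(1)] by simp
  show 2: "\<gamma> \<in> paths \<Lambda>" using tight_paths[OF F g] .
  show "comp \<Lambda> \<alpha> \<gamma> \<in> paths \<Lambda>" using comp_closed[OF a(1) 2 1] .
qed

lemma comp_mem_cone_iff:
  assumes F: "tight F" and a: "\<alpha> \<in> paths \<Lambda>" "src \<Lambda> \<alpha> \<in> F" and b: "\<beta> \<in> paths \<Lambda>" "src \<Lambda> \<alpha> = rng \<Lambda> \<beta>"
  shows "comp \<Lambda> \<alpha> \<beta> \<in> cone \<alpha> F \<longleftrightarrow> \<beta> \<in> F"
proof
  assume "comp \<Lambda> \<alpha> \<beta> \<in> cone \<alpha> F"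
  then obtain \<gamma> where g: "\<gamma> \<in> F" "prefix (comp \<Lambda> \<alpha> \<beta>) (comp \<Lambda> \<alpha> \<gamma>)" by (auto simp: cone_def)
  note t = tight_mem_comp[OF F a g(1)]
  have "prefix \<beta> \<gamma>" using g(2) prefix_comp_iff[OF a(1) b(1) t(3) b(2) t(1)] by simp
  then show "\<beta> \<in> F" using tight_hereditary[OF F g(1)] by simp
next
  assume g: "\<beta> \<in> F"
  then show "comp \<Lambda> \<alpha> \<beta> \<in> cone \<alpha> F" using prefix_refl[OF comp_closed[OF a(1) b]] by (auto simp: cone_def)
qed

end

locale finitely_aligned_kgraph = k_graph \<Lambda> for \<Lambda> :: "('l, 'k::finite) kgraph" +
  assumes aligned: "finitely_aligned \<Lambda>"
begin

lemma finite_Lambda_min: "\<lbrakk>\<alpha> \<in> paths \<Lambda>; \<mu> \<in> paths \<Lambda>\<rbrakk> \<Longrightarrow> finite (Lambda_min \<Lambda> \<alpha> \<mu>)"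
  using aligned by (simp add: finitely_aligned_def)

lemma finite_extensions:
  assumes "finite E" "E \<subseteq> paths \<Lambda>" "\<delta> \<in> paths \<Lambda>"
  shows "finite {\<rho>. \<exists>\<mu> \<in> E. \<exists>\<tau>. (\<rho>, \<tau>) \<in> Lambda_min \<Lambda> \<delta> \<mu>}"
proof -
  have "{\<rho>. \<exists>\<mu> \<in> E. \<exists>\<tau>. (\<rho>, \<tau>) \<in> Lambda_min \<Lambda> \<delta> \<mu>} = (\<Union>\<mu> \<in> E. fst ` Lambda_min \<Lambda> \<delta> \<mu>)"
    by force
  then show ?thesis using assms finite_Lambda_min by auto
qed

text \<open>For \<open>\<beta>\<close> after \<open>\<delta>\<close>, exhaustiveness applied to
  \<open>\<delta>\<beta>\<close> yields a common extension with some \<open>\<mu>\<close> in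
  \<open>E\<close>. It lies above a minimal common extension of \<open>\<delta>\<close> and
  \<open>\<mu>\<close>, whose part after \<open>\<delta>\<close> is compatible with
  \<open>\<beta>\<close>.\<close>

lemma exhaustive_extension:
  assumes E: "exhaustive \<Lambda> v E" and d: "\<delta> \<in> paths \<Lambda>" "rng \<Lambda> \<delta> = v"
  shows "exhaustive \<Lambda> (src \<Lambda> \<delta>) {\<rho>. \<exists>\<mu> \<in> E. \<exists>\<tau>. (\<rho>, \<tau>) \<in> Lambda_min \<Lambda> \<delta> \<mu>}" (is "exhaustive _ _ ?E")
  unfolding exhaustive_def
proof (intro conjI ballI)
  have Ep: "E \<subseteq> paths \<Lambda>" using E by (auto simp: exhaustive_def paths_from_def)
  show "?E \<subseteq> paths_from \<Lambda> (src \<Lambda> \<delta>)" by (auto simp: paths_from_def dest: Lambda_minD)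
  fix \<beta> assume "\<beta> \<in> paths_from \<Lambda> (src \<Lambda> \<delta>)"
  then have b: "\<beta> \<in> paths \<Lambda>" "src \<Lambda> \<delta> = rng \<Lambda> \<beta>" by (auto simp: paths_from_def)
  have "comp \<Lambda> \<delta> \<beta> \<in> paths_from \<Lambda> v"
    using comp_closed[OF d(1) b] rng_comp[OF d(1) b] d(2) by (simp add: paths_from_def)
  then obtain \<mu> where m: "\<mu> \<in> E" "Lambda_min \<Lambda> (comp \<Lambda> \<delta> \<beta>) \<mu> \<noteq> {}" using E unfolding exhaustive_def by blast
  have mp: "\<mu> \<in> paths \<Lambda>" using m Ep by blast
  obtain \<eta> \<theta> where h: "(\<eta>, \<theta>) \<in> Lambda_min \<Lambda> (comp \<Lambda> \<delta> \<beta>) \<mu>" using m(2) by auto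
  note l = Lambda_minD[OF h]
  have sb: "src \<Lambda> \<beta> = rng \<Lambda> \<eta>" using l(3) src_comp[OF d(1) b] by simp
  have be: "comp \<Lambda> \<beta> \<eta> \<in> paths \<Lambda>" "src \<Lambda> \<delta> = rng \<Lambda> (comp \<Lambda> \<beta> \<eta>)"
    using comp_closed[OF b(1) l(1) sb] rng_comp[OF b(1) l(1) sb] b(2) by simp_all
  have "comp \<Lambda> \<delta> (comp \<Lambda> \<beta> \<eta>) = comp \<Lambda> \<mu> \<theta>"
    using comp_assoc[OF d(1) b(1) l(1) b(2) sb] l(5) by simp
  then obtain \<rho> \<tau> \<gamma> where r: "(\<rho>, \<tau>) \<in> Lambda_min \<Lambda> \<delta> \<mu>" "\<gamma> \<in> paths \<Lambda>" "src \<Lambda> \<rho> = rng \<Lambda> \<gamma>"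
    "comp \<Lambda> \<beta> \<eta> = comp \<Lambda> \<rho> \<gamma>"
    using common_extension[OF d(1) be mp l(2,4)] by metis
  have "prefix \<beta> (comp \<Lambda> \<beta> \<eta>)" "prefix \<rho> (comp \<Lambda> \<beta> \<eta>)"
    using prefixI[OF b(1) l(1) sb] prefixI[OF Lambda_minD(1)[OF r(1)] r(2,3)] r(4) by simp_all
  then have "Lambda_min \<Lambda> \<beta> \<rho> \<noteq> {}"
    using Lambda_min_nonempty_iff[OF b(1) Lambda_minD(1)[OF r(1)]] by blast
  then show "\<exists>\<mu> \<in> ?E. Lambda_min \<Lambda> \<beta> \<mu> \<noteq> {}" using m(1) r(1) by blast
qed

text \<open>Members of \<open>FE\<close> must not contain their range vertex. The vertex
  \<open>src \<Lambda> \<delta>\<close> occurs in the new set only if some member of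
  \<open>E\<close> is an initial segment of \<open>\<delta>\<close>, which is excluded; finiteness
  is finite alignment.\<close>

lemma FE_extension:
  assumes E: "E \<in> FE \<Lambda> v" and d: "\<delta> \<in> paths \<Lambda>" "rng \<Lambda> \<delta> = v" and n: "\<And>\<nu>. \<nu> \<in> E \<Longrightarrow> \<not> prefix \<nu> \<delta>"
  shows "{\<rho>. \<exists>\<mu> \<in> E. \<exists>\<tau>. (\<rho>, \<tau>) \<in> Lambda_min \<Lambda> \<delta> \<mu>} \<in> FE \<Lambda> (src \<Lambda> \<delta>)" (is "?E \<in> _")
proof -
  have e: "finite E" "exhaustive \<Lambda> v E" using E by (auto simp: FE_def)
  then have Ep: "E \<subseteq> paths \<Lambda>" by (auto simp: exhaustive_def paths_from_def)
  have "src \<Lambda> \<delta> \<notin> ?E"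
  proof
    assume "src \<Lambda> \<delta> \<in> ?E"
    then obtain \<mu> \<tau> where m: "\<mu> \<in> E" "(src \<Lambda> \<delta>, \<tau>) \<in> Lambda_min \<Lambda> \<delta> \<mu>" by blast
    note l = Lambda_minD[OF m(2)]
    have "\<delta> = comp \<Lambda> \<mu> \<tau>" using l(5) comp_src[OF d(1)] by simp
    then have "prefix \<mu> \<delta>" using prefixI[of \<mu> \<tau>] m(1) Ep l by auto
    then show False using n m(1) by blast
  qed
  then show ?thesis
    using exhaustive_extension[OF e(2) d] finite_extensions[OF e(1) Ep d(1)] by (simp add: FE_def)
qed

text \<open>Only the last clause of \<open>tight\<close> is delicate, since \<open>\<beta>\<close>
  need not extend \<open>\<alpha>\<close>. Write an extension \<open>\<alpha>\<gamma>\<close> as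
  \<open>\<beta>\<delta>\<close>. Either \<open>\<delta>\<close> already runs through
  \<open>E\<close>, or \<open>E\<close> is pulled back along \<open>\<delta>\<close> to a set in
  \<open>FE\<close> at the source of \<open>\<gamma>\<close>, where tightness of \<open>F\<close>
  applies.\<close>

lemma tight_cone:
  assumes F: "tight F" and a: "\<alpha> \<in> paths \<Lambda>" "src \<Lambda> \<alpha> \<in> F"
  shows "tight (cone \<alpha> F)" "\<alpha> \<in> cone \<alpha> F"
proof -
  have mem: "comp \<Lambda> \<alpha> \<gamma> \<in> cone \<alpha> F" if "\<gamma> \<in> F" for \<gamma>
    using that prefix_refl[OF tight_mem_comp(2)[OF F a that]] by (auto simp: cone_def)
  show "\<alpha> \<in> cone \<alpha> F" using mem[OF a(2)] comp_src[OF a(1)] by simp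
  show "tight (cone \<alpha> F)"
    unfolding tight_def
  proof (intro conjI ballI allI impI)
    show "cone \<alpha> F \<subseteq> paths \<Lambda>" by (auto simp: cone_def dest: prefix_paths)
    show "cone \<alpha> F \<noteq> {}" using mem a by blast
  next
    fix \<tau> \<beta> assume "\<tau> \<in> cone \<alpha> F" "prefix \<beta> \<tau>"
    then show "\<beta> \<in> cone \<alpha> F" unfolding cone_def using prefix_trans by blast
  next
    fix \<beta> \<beta>' assume "\<beta> \<in> cone \<alpha> F" "\<beta>' \<in> cone \<alpha> F"
    then obtain \<gamma> \<gamma>' where g: "\<gamma> \<in> F" "prefix \<beta> (comp \<Lambda> \<alpha> \<gamma>)" "\<gamma>' \<in> F" "prefix \<beta>' (comp \<Lambda> \<alpha> \<gamma>')"
      by (auto simp: cone_def)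
    obtain \<tau> where t: "\<tau> \<in> F" "prefix \<gamma> \<tau>" "prefix \<gamma>' \<tau>" using tight_directed[OF F g(1,3)] .
    have "prefix (comp \<Lambda> \<alpha> \<gamma>) (comp \<Lambda> \<alpha> \<tau>)" "prefix (comp \<Lambda> \<alpha> \<gamma>') (comp \<Lambda> \<alpha> \<tau>)"
      using prefix_comp_mono[OF a(1) tight_mem_comp(1)[OF F a t(1)]] t by auto
    then show "\<exists>\<tau> \<in> cone \<alpha> F. prefix \<beta> \<tau> \<and> prefix \<beta>' \<tau>" using g mem[OF t(1)] prefix_trans by blast
  next
    fix \<beta> E assume "\<beta> \<in> cone \<alpha> F" and E: "E \<in> FE \<Lambda> (src \<Lambda> \<beta>)"
    then obtain \<gamma> where g: "\<gamma> \<in> F" "prefix \<beta> (comp \<Lambda> \<alpha> \<gamma>)" by (auto simp: cone_def)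
    note tg = tight_mem_comp[OF F a g(1)]
    obtain \<delta> where d: "\<beta> \<in> paths \<Lambda>" "\<delta> \<in> paths \<Lambda>" "src \<Lambda> \<beta> = rng \<Lambda> \<delta>" "comp \<Lambda> \<alpha> \<gamma> = comp \<Lambda> \<beta> \<delta>"
      using g(2) by (rule prefixE)
    have sd: "src \<Lambda> \<delta> = src \<Lambda> \<gamma>" using src_comp[OF a(1) tg(3,1)] src_comp[OF d(1-3)] d(4) by simp
    have Ef: "E \<subseteq> paths_from \<Lambda> (src \<Lambda> \<beta>)" using E by (auto simp: FE_def exhaustive_def)
    show "\<exists>\<nu> \<in> E. comp \<Lambda> \<beta> \<nu> \<in> cone \<alpha> F"
    proof (cases "\<exists>\<nu> \<in> E. prefix \<nu> \<delta>")
      case True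
      then obtain \<nu> where n: "\<nu> \<in> E" "prefix \<nu> \<delta>" by blast
      then have "prefix (comp \<Lambda> \<beta> \<nu>) (comp \<Lambda> \<alpha> \<gamma>)" using prefix_comp_mono[OF d(1,3)] d(4) by simp
      then show ?thesis using g(1) n(1) unfolding cone_def by blast
    next
      case False
      then have "{\<rho>. \<exists>\<mu> \<in> E. \<exists>\<tau>. (\<rho>, \<tau>) \<in> Lambda_min \<Lambda> \<delta> \<mu>} \<in> FE \<Lambda> (src \<Lambda> \<delta>)"
        by (intro FE_extension[OF E d(2) d(3)[symmetric]]) auto
      then obtain \<rho> \<mu> \<tau> where r: "\<mu> \<in> E" "(\<rho>, \<tau>) \<in> Lambda_min \<Lambda> \<delta> \<mu>" "comp \<Lambda> \<gamma> \<rho> \<in> F"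
        using tight_FE[OF F g(1)] unfolding sd by blast
      note l = Lambda_minD[OF r(2)]
      have m: "\<mu> \<in> paths \<Lambda>" "src \<Lambda> \<beta> = rng \<Lambda> \<mu>" using Ef r(1) by (auto simp: paths_from_def)
      have sg: "src \<Lambda> \<gamma> = rng \<Lambda> \<rho>" using l(3) sd by simp
      have "comp \<Lambda> \<alpha> (comp \<Lambda> \<gamma> \<rho>) = comp \<Lambda> (comp \<Lambda> \<alpha> \<gamma>) \<rho>"
        by (rule comp_assoc[symmetric, OF a(1) tg(3) l(1) tg(1) sg])
      also have "\<dots> = comp \<Lambda> \<beta> (comp \<Lambda> \<delta> \<rho>)" unfolding d(4) by (rule comp_assoc[OF d(1,2) l(1) d(3) l(3)])
      also have "\<dots> = comp \<Lambda> \<beta> (comp \<Lambda> \<mu> \<tau>)" using l(5) by simp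
      also have "\<dots> = comp \<Lambda> (comp \<Lambda> \<beta> \<mu>) \<tau>" by (rule comp_assoc[symmetric, OF d(1) m(1) l(2) m(2) l(4)])
      finally have "prefix (comp \<Lambda> \<beta> \<mu>) (comp \<Lambda> \<alpha> (comp \<Lambda> \<gamma> \<rho>))"
        using prefixI[OF comp_closed[OF d(1) m] l(2)] src_comp[OF d(1) m] l(4) by simp
      then show ?thesis using r(1,3) by (auto simp: cone_def)
    qed
  qed
qed

end

section \<open>Shifting and prepending\<close>

context k_graph
begin

lemma bdeg_shift: "bdeg (shift n y) = bdeg y - enat_vec n"
  by (simp add: shift_def Let_def)

lemma bseg_shift:
  "\<lbrakk>enat_vec n \<le> bdeg y; p \<le> q; enat_vec (n + q) \<le> bdeg y\<rbrakk> \<Longrightarrow> bseg (shift n y) p q = bseg y (n + p) (n + q)"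
  by (simp add: shift_def Let_def mem_paths_Omega enat_vec_le_diff_iff)

lemma shift_boundary_path:
  assumes y: "y \<in> boundary_paths \<Lambda>" and n: "enat_vec n \<le> bdeg y"
  shows "shift n y \<in> boundary_paths \<Lambda>"
proof (rule boundary_pathI)
  note le = enat_vec_le_diff_iff[OF n]
  note sg = bseg_shift[OF n]
  have mono: "n + p \<le> n + q" if "p \<le> q" for p q using that by (simp add: vec_add_le_cancel_left)
  have tr: "enat_vec (n + p) \<le> bdeg y" if "p \<le> q" "enat_vec (n + q) \<le> bdeg y" for p q
    by (rule enat_vec_le_trans[OF mono[OF that(1)] that(2)])
  show "snd (shift n y) \<in> extensional (paths (Omega (bdeg (shift n y))))"
    by (simp add: shift_def Let_def)
  show "bseg (shift n y) p q \<in> paths \<Lambda> \<and> rng \<Lambda> (bseg (shift n y) p q) = bseg (shift n y) p p \<and>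
     src \<Lambda> (bseg (shift n y) p q) = bseg (shift n y) q q \<and> deg \<Lambda> (bseg (shift n y) p q) = q - p"
    if pq: "p \<le> q" "enat_vec q \<le> bdeg (shift n y)" for p q
  proof -
    have q: "enat_vec (n + q) \<le> bdeg y" using pq(2) by (simp add: bdeg_shift le)
    show ?thesis using boundary_path_seg[OF y mono[OF pq(1)] q] tr[OF pq(1) q] q
      by (simp add: sg pq(1))
  qed
  show "comp \<Lambda> (bseg (shift n y) p q) (bseg (shift n y) q r) = bseg (shift n y) p r"
    if pq: "p \<le> q" "q \<le> r" "enat_vec r \<le> bdeg (shift n y)" for p q r
  proof -
    have r: "enat_vec (n + r) \<le> bdeg y" using pq(3) by (simp add: bdeg_shift le)
    show ?thesis using boundary_path_comp[OF y mono[OF pq(1)] mono[OF pq(2)] r] tr[OF pq(2) r] r order_trans[OF pq(1,2)]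
      by (simp add: sg pq(1,2))
  qed
  show "\<exists>\<alpha> \<in> E. enat_vec (l + deg \<Lambda> \<alpha>) \<le> bdeg (shift n y) \<and> bseg (shift n y) l (l + deg \<Lambda> \<alpha>) = \<alpha>"
    if l: "enat_vec l \<le> bdeg (shift n y)" and E: "E \<in> FE \<Lambda> (bseg (shift n y) l l)" for l E
  proof -
    have l': "enat_vec (n + l) \<le> bdeg y" using l by (simp add: bdeg_shift le)
    then have "E \<in> FE \<Lambda> (bseg y (n + l) (n + l))" using E by (simp add: sg)
    then obtain \<alpha> where "\<alpha> \<in> E" "enat_vec (n + l + deg \<Lambda> \<alpha>) \<le> bdeg y"
      "bseg y (n + l) (n + l + deg \<Lambda> \<alpha>) = \<alpha>" using boundary_path_tight[OF y l'] by blast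
    then show ?thesis by (auto simp: bdeg_shift le sg vec_le_add add.assoc intro!: bexI[of _ \<alpha>])
  qed
qed

lemma initial_segs_shift:
  assumes y: "y \<in> boundary_paths \<Lambda>" and a: "\<alpha> \<in> initial_segs y"
  shows "initial_segs (shift (deg \<Lambda> \<alpha>) y) = {\<beta> \<in> paths \<Lambda>. src \<Lambda> \<alpha> = rng \<Lambda> \<beta> \<and> comp \<Lambda> \<alpha> \<beta> \<in> initial_segs y}"
proof -
  let ?n = "deg \<Lambda> \<alpha>"
  have n: "enat_vec ?n \<le> bdeg y" and an: "bseg y 0 ?n = \<alpha>" using a initial_segs_deg(2)[OF y] by auto
  have ap: "\<alpha> \<in> paths \<Lambda>" using tight_paths[OF initial_segs_tight[OF y] a] .
  have s: "bseg y ?n (?n + q) \<in> paths \<Lambda>" "src \<Lambda> \<alpha> = rng \<Lambda> (bseg y ?n (?n + q))"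
    "comp \<Lambda> \<alpha> (bseg y ?n (?n + q)) = bseg y 0 (?n + q)" if q: "enat_vec (?n + q) \<le> bdeg y" for q
    using boundary_path_seg(1,2)[OF y vec_le_add q] boundary_path_seg(3)[OF y vec_zero_le n] an
      boundary_path_comp[OF y vec_zero_le vec_le_add q] by simp_all
  have m: "bseg (shift ?n y) 0 q = bseg y ?n (?n + q)" if "enat_vec (?n + q) \<le> bdeg y" for q
    using bseg_shift[OF n vec_zero_le that] by simp
  show ?thesis
  proof (intro equalityI subsetI)
    fix \<beta> assume "\<beta> \<in> initial_segs (shift ?n y)"
    then obtain q where q: "enat_vec (?n + q) \<le> bdeg y" "\<beta> = bseg y ?n (?n + q)"
      by (auto simp: initial_segs_def bdeg_shift enat_vec_le_diff_iff[OF n] m)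
    then show "\<beta> \<in> {\<beta> \<in> paths \<Lambda>. src \<Lambda> \<alpha> = rng \<Lambda> \<beta> \<and> comp \<Lambda> \<alpha> \<beta> \<in> initial_segs y}"
      using s[OF q(1)] by (auto simp: initial_segs_def)
  next
    fix \<beta> assume "\<beta> \<in> {\<beta> \<in> paths \<Lambda>. src \<Lambda> \<alpha> = rng \<Lambda> \<beta> \<and> comp \<Lambda> \<alpha> \<beta> \<in> initial_segs y}"
    then have b: "\<beta> \<in> paths \<Lambda>" "src \<Lambda> \<alpha> = rng \<Lambda> \<beta>" "comp \<Lambda> \<alpha> \<beta> \<in> initial_segs y" by auto
    let ?q = "deg \<Lambda> \<beta>"
    have q: "enat_vec (?n + ?q) \<le> bdeg y" "bseg y 0 (?n + ?q) = comp \<Lambda> \<alpha> \<beta>"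
      using initial_segs_deg(2)[OF y] b(3) deg_comp[OF ap b(1,2)] by auto
    have "\<beta> = bseg y ?n (?n + ?q)"
      by (rule comp_left_cancel[OF ap b(1,2) s(1,2)[OF q(1)]]) (simp add: s(3)[OF q(1)] q(2))
    then have "\<beta> = bseg (shift ?n y) 0 ?q" using m[OF q(1)] by simp
    then show "\<beta> \<in> initial_segs (shift ?n y)" unfolding initial_segs_def bdeg_shift using q(1)
      enat_vec_le_diff_iff[OF n] by blast
  qed
qed

lemma src_mem_shift:
  assumes y: "y \<in> boundary_paths \<Lambda>" and a: "\<alpha> \<in> initial_segs y"
  shows "shift (deg \<Lambda> \<alpha>) y \<in> boundary_paths \<Lambda>" "src \<Lambda> \<alpha> \<in> initial_segs (shift (deg \<Lambda> \<alpha>) y)"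
proof -
  show "shift (deg \<Lambda> \<alpha>) y \<in> boundary_paths \<Lambda>"
    using shift_boundary_path[OF y] initial_segs_deg(2)[OF y] a by blast
  have "\<alpha> \<in> paths \<Lambda>" using tight_paths[OF initial_segs_tight[OF y] a] .
  then show "src \<Lambda> \<alpha> \<in> initial_segs (shift (deg \<Lambda> \<alpha>) y)"
    unfolding initial_segs_shift[OF y a] using a by (simp add: src_closed rng_src comp_src)
qed

text \<open>Every initial segment of \<open>y\<close> has a common extension with
  \<open>\<alpha>\<close> inside \<open>initial_segs y\<close>, so the part of \<open>y\<close>
  after \<open>\<alpha>\<close> determines all of \<open>y\<close>.\<close>

lemma cone_initial_segs_shift:
  assumes y: "y \<in> boundary_paths \<Lambda>" and a: "\<alpha> \<in> initial_segs y"
  shows "cone \<alpha> (initial_segs (shift (deg \<Lambda> \<alpha>) y)) = initial_segs y"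
proof -
  note F = initial_segs_tight[OF y]
  show ?thesis
  proof (intro equalityI subsetI)
    fix \<beta> assume "\<beta> \<in> cone \<alpha> (initial_segs (shift (deg \<Lambda> \<alpha>) y))"
    then show "\<beta> \<in> initial_segs y"
      unfolding cone_def initial_segs_shift[OF y a] using tight_hereditary[OF F] by blast
  next
    fix \<beta> assume b: "\<beta> \<in> initial_segs y"
    obtain \<tau> where t: "\<tau> \<in> initial_segs y" "prefix \<alpha> \<tau>" "prefix \<beta> \<tau>" using tight_directed[OF F a b] .
    obtain \<gamma> where "\<gamma> \<in> paths \<Lambda>" "src \<Lambda> \<alpha> = rng \<Lambda> \<gamma>" "\<tau> = comp \<Lambda> \<alpha> \<gamma>" using t(2) by (rule prefixE)
    then show "\<beta> \<in> cone \<alpha> (initial_segs (shift (deg \<Lambda> \<alpha>) y))"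
      unfolding cone_def initial_segs_shift[OF y a] using t by blast
  qed
qed

lemma mem_boundary_paths_from:
  "v \<in> vertices \<Lambda> \<Longrightarrow> x \<in> boundary_paths_from \<Lambda> v \<longleftrightarrow> x \<in> boundary_paths \<Lambda> \<and> v \<in> initial_segs x"
  using initial_segs_deg(2)[of x v] vertexD(4)[of v]
  by (auto simp: boundary_paths_from_def enat_vec_zero_le)

end

context finitely_aligned_kgraph
begin

text \<open>This discharges the \<open>THE\<close> in \<open>prepend\<close>: a value exists because
  the tight set \<open>cone \<alpha> (initial_segs x)\<close> is realised by a boundary path, and it
  is unique because every candidate has exactly this set of initial segments.\<close>

lemma prepend_props:
  assumes a: "\<alpha> \<in> paths \<Lambda>" and x: "x \<in> boundary_paths_from \<Lambda> (src \<Lambda> \<alpha>)"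
  shows "prepend \<Lambda> \<alpha> x \<in> boundary_paths \<Lambda>"
    "initial_segs (prepend \<Lambda> \<alpha> x) = cone \<alpha> (initial_segs x)"
    "shift (deg \<Lambda> \<alpha>) (prepend \<Lambda> \<alpha> x) = x"
proof -
  have xB: "x \<in> boundary_paths \<Lambda>" and s: "src \<Lambda> \<alpha> \<in> initial_segs x"
    using x mem_boundary_paths_from[OF vertex_src[OF a]] by auto
  note F = initial_segs_tight[OF xB]
  obtain y where y: "y \<in> boundary_paths \<Lambda>" "initial_segs y = cone \<alpha> (initial_segs x)"
    using tight_initial_segs_ex[OF tight_cone(1)[OF F a s]] by blast
  have ay: "\<alpha> \<in> initial_segs y" using tight_cone(2)[OF F a s] y(2) by simp
  have "initial_segs (shift (deg \<Lambda> \<alpha>) y) = initial_segs x"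
    unfolding initial_segs_shift[OF y(1) ay] y(2)
    using comp_mem_cone_iff[OF F a s] tight_mem_comp(1,3)[OF F a s] by blast
  then have sh: "shift (deg \<Lambda> \<alpha>) y = x" by (rule initial_segs_inj[OF src_mem_shift(1)[OF y(1) ay] xB])
  have "prepend \<Lambda> \<alpha> x = y"
    unfolding prepend_def
  proof (rule the_equality)
    show "y \<in> boundary_paths \<Lambda> \<and> enat_vec (deg \<Lambda> \<alpha>) \<le> bdeg y \<and> bseg y 0 (deg \<Lambda> \<alpha>) = \<alpha> \<and> shift (deg \<Lambda> \<alpha>) y = x"
      using y(1) ay sh initial_segs_deg(2)[OF y(1)] by blast
    fix y' assume h: "y' \<in> boundary_paths \<Lambda> \<and> enat_vec (deg \<Lambda> \<alpha>) \<le> bdeg y' \<and> bseg y' 0 (deg \<Lambda> \<alpha>) = \<alpha> \<and> shift (deg \<Lambda> \<alpha>) y' = x"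
    then have y': "y' \<in> boundary_paths \<Lambda>" "\<alpha> \<in> initial_segs y'" using initial_segs_deg(2) by blast+
    have "initial_segs y' = cone \<alpha> (initial_segs x)" using cone_initial_segs_shift[OF y'] h by simp
    then show "y' = y" using initial_segs_inj[OF y'(1) y(1)] y(2) by simp
  qed
  then show "prepend \<Lambda> \<alpha> x \<in> boundary_paths \<Lambda>"
    "initial_segs (prepend \<Lambda> \<alpha> x) = cone \<alpha> (initial_segs x)"
    "shift (deg \<Lambda> \<alpha>) (prepend \<Lambda> \<alpha> x) = x" using y sh by simp_all
qed

lemma mem_initial_segs_prepend:
  assumes "\<alpha> \<in> paths \<Lambda>" "x \<in> boundary_paths_from \<Lambda> (src \<Lambda> \<alpha>)"
  shows "\<alpha> \<in> initial_segs (prepend \<Lambda> \<alpha> x)"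
  using assms mem_boundary_paths_from[OF vertex_src[OF assms(1)]] tight_cone(2)[OF initial_segs_tight]
    prepend_props(2)[OF assms] by auto

lemma prepend_mem:
  assumes "\<alpha> \<in> paths \<Lambda>" "x \<in> boundary_paths_from \<Lambda> (src \<Lambda> \<alpha>)"
  shows "prepend \<Lambda> \<alpha> x \<in> boundary_paths_from \<Lambda> (rng \<Lambda> \<alpha>)"
  using prepend_props(1)[OF assms] mem_initial_segs_prepend[OF assms] initial_segs_tight tight_rng_mem
    mem_boundary_paths_from[OF vertex_rng[OF assms(1)]] by blast

lemma prepend_inj:
  assumes "\<alpha> \<in> paths \<Lambda>" "x \<in> boundary_paths_from \<Lambda> (src \<Lambda> \<alpha>)" "y \<in> boundary_paths_from \<Lambda> (src \<Lambda> \<alpha>)"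
    "prepend \<Lambda> \<alpha> x = prepend \<Lambda> \<alpha> y"
  shows "x = y"
  using prepend_props(3)[OF assms(1,2)] prepend_props(3)[OF assms(1,3)] assms(4) by metis

lemma initial_segs_obtain:
  assumes y: "y \<in> boundary_paths \<Lambda>" and a: "\<alpha> \<in> initial_segs y"
  obtains z where "z \<in> boundary_paths_from \<Lambda> (src \<Lambda> \<alpha>)" "y = prepend \<Lambda> \<alpha> z" "z = shift (deg \<Lambda> \<alpha>) y"
proof -
  let ?z = "shift (deg \<Lambda> \<alpha>) y"
  have ap: "\<alpha> \<in> paths \<Lambda>" using tight_paths[OF initial_segs_tight[OF y] a] .
  have z: "?z \<in> boundary_paths_from \<Lambda> (src \<Lambda> \<alpha>)"
    using src_mem_shift[OF y a] mem_boundary_paths_from[OF vertex_src[OF ap]] by simp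
  have "initial_segs (prepend \<Lambda> \<alpha> ?z) = initial_segs y"
    using prepend_props(2)[OF ap z] cone_initial_segs_shift[OF y a] by simp
  then have "prepend \<Lambda> \<alpha> ?z = y" by (rule initial_segs_inj[OF prepend_props(1)[OF ap z] y])
  then show ?thesis using that z by metis
qed

lemma prepend_comp:
  assumes a: "\<alpha> \<in> paths \<Lambda>" and b: "\<beta> \<in> paths \<Lambda>" "src \<Lambda> \<alpha> = rng \<Lambda> \<beta>"
    and z: "z \<in> boundary_paths_from \<Lambda> (src \<Lambda> \<beta>)"
  shows "prepend \<Lambda> (comp \<Lambda> \<alpha> \<beta>) z = prepend \<Lambda> \<alpha> (prepend \<Lambda> \<beta> z)"
proof -
  have ab: "comp \<Lambda> \<alpha> \<beta> \<in> paths \<Lambda>" using comp_closed a b by blast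
  have z': "z \<in> boundary_paths_from \<Lambda> (src \<Lambda> (comp \<Lambda> \<alpha> \<beta>))" using z src_comp[OF a b] by simp
  have w: "prepend \<Lambda> \<beta> z \<in> boundary_paths_from \<Lambda> (src \<Lambda> \<alpha>)" using prepend_mem[OF b(1) z] b(2) by simp
  have zB: "z \<in> boundary_paths \<Lambda>" "src \<Lambda> \<beta> \<in> initial_segs z"
    using z mem_boundary_paths_from[OF vertex_src[OF b(1)]] by auto
  note F = initial_segs_tight[OF zB(1)]
  have "cone (comp \<Lambda> \<alpha> \<beta>) (initial_segs z) = cone \<alpha> (cone \<beta> (initial_segs z))"
  proof (intro equalityI subsetI)
    fix \<gamma> assume "\<gamma> \<in> cone (comp \<Lambda> \<alpha> \<beta>) (initial_segs z)"
    then obtain \<delta> where d: "\<delta> \<in> initial_segs z" "prefix \<gamma> (comp \<Lambda> (comp \<Lambda> \<alpha> \<beta>) \<delta>)" by (auto simp: cone_def)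
    note t = tight_mem_comp[OF F b(1) zB(2) d(1)]
    have "comp \<Lambda> \<beta> \<delta> \<in> cone \<beta> (initial_segs z)" using comp_mem_cone_iff[OF F b(1) zB(2) t(3,1)] d(1) by simp
    then show "\<gamma> \<in> cone \<alpha> (cone \<beta> (initial_segs z))"
      using d(2) comp_assoc[OF a b(1) t(3) b(2) t(1)] by (auto simp: cone_def[of \<alpha>])
  next
    fix \<gamma> assume "\<gamma> \<in> cone \<alpha> (cone \<beta> (initial_segs z))"
    then obtain \<epsilon> \<delta> where d: "\<delta> \<in> initial_segs z" "prefix \<epsilon> (comp \<Lambda> \<beta> \<delta>)" "prefix \<gamma> (comp \<Lambda> \<alpha> \<epsilon>)"
      by (auto simp: cone_def)
    note t = tight_mem_comp[OF F b(1) zB(2) d(1)]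
    have "src \<Lambda> \<alpha> = rng \<Lambda> (comp \<Lambda> \<beta> \<delta>)" using rng_comp[OF b(1) t(3,1)] b(2) by simp
    then have "prefix (comp \<Lambda> \<alpha> \<epsilon>) (comp \<Lambda> \<alpha> (comp \<Lambda> \<beta> \<delta>))" using prefix_comp_mono[OF a _ d(2)] by simp
    then have "prefix \<gamma> (comp \<Lambda> (comp \<Lambda> \<alpha> \<beta>) \<delta>)"
      using d(3) prefix_trans comp_assoc[OF a b(1) t(3) b(2) t(1)] by metis
    then show "\<gamma> \<in> cone (comp \<Lambda> \<alpha> \<beta>) (initial_segs z)" using d(1) by (auto simp: cone_def)
  qed
  then have "initial_segs (prepend \<Lambda> (comp \<Lambda> \<alpha> \<beta>) z) = initial_segs (prepend \<Lambda> \<alpha> (prepend \<Lambda> \<beta> z))"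
    using prepend_props(2)[OF ab z'] prepend_props(2)[OF a w] prepend_props(2)[OF b(1) z] by simp
  then show ?thesis by (rule initial_segs_inj[OF prepend_props(1)[OF ab z'] prepend_props(1)[OF a w]])
qed

text \<open>Both \<open>\<alpha>\<close> and \<open>\<mu>\<close> are initial segments of one
  boundary path, hence have a common extension in it; the minimal common extension below is again an
  initial segment, and the rest of the path after it is the required \<open>z\<close>.\<close>

lemma prepend_eqE:
  assumes a: "\<alpha> \<in> paths \<Lambda>" "x \<in> boundary_paths_from \<Lambda> (src \<Lambda> \<alpha>)"
    and m: "\<mu> \<in> paths \<Lambda>" "y \<in> boundary_paths_from \<Lambda> (src \<Lambda> \<mu>)"
    and eq: "prepend \<Lambda> \<alpha> x = prepend \<Lambda> \<mu> y"
  obtains \<rho> \<tau> z where "(\<rho>, \<tau>) \<in> Lambda_min \<Lambda> \<alpha> \<mu>" "z \<in> boundary_paths_from \<Lambda> (src \<Lambda> \<rho>)"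
    "x = prepend \<Lambda> \<rho> z" "y = prepend \<Lambda> \<tau> z"
proof -
  let ?y = "prepend \<Lambda> \<alpha> x"
  have yB: "?y \<in> boundary_paths \<Lambda>" using prepend_props(1)[OF a] .
  have mem: "\<alpha> \<in> initial_segs ?y" "\<mu> \<in> initial_segs ?y"
    using mem_initial_segs_prepend[OF a] mem_initial_segs_prepend[OF m] eq by simp_all
  obtain \<kappa> where k: "\<kappa> \<in> initial_segs ?y" "prefix \<alpha> \<kappa>" "prefix \<mu> \<kappa>"
    using tight_directed[OF initial_segs_tight[OF yB] mem] .
  obtain \<beta> where b: "\<beta> \<in> paths \<Lambda>" "src \<Lambda> \<alpha> = rng \<Lambda> \<beta>" "\<kappa> = comp \<Lambda> \<alpha> \<beta>" using k(2) by (rule prefixE)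
  obtain \<nu> where n: "\<nu> \<in> paths \<Lambda>" "src \<Lambda> \<mu> = rng \<Lambda> \<nu>" "\<kappa> = comp \<Lambda> \<mu> \<nu>" using k(3) by (rule prefixE)
  obtain \<rho> \<tau> \<gamma> where r: "(\<rho>, \<tau>) \<in> Lambda_min \<Lambda> \<alpha> \<mu>" "\<gamma> \<in> paths \<Lambda>" "src \<Lambda> \<rho> = rng \<Lambda> \<gamma>"
    "\<beta> = comp \<Lambda> \<rho> \<gamma>"
    using common_extension[OF a(1) b(1,2) m(1) n(1,2)] b(3) n(3) by metis
  note l = Lambda_minD[OF r(1)]
  have s: "src \<Lambda> \<rho> = src \<Lambda> \<tau>" using Lambda_min_src[OF a(1) m(1) r(1)] .
  have ar: "comp \<Lambda> \<alpha> \<rho> \<in> paths \<Lambda>" "src \<Lambda> (comp \<Lambda> \<alpha> \<rho>) = src \<Lambda> \<rho>"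
    using comp_closed[OF a(1) l(1,3)] src_comp[OF a(1) l(1,3)] by auto
  have "prefix (comp \<Lambda> \<alpha> \<rho>) \<kappa>"
    using prefixI[OF ar(1) r(2)] ar(2) r(3,4) comp_assoc[OF a(1) l(1) r(2) l(3) r(3)] b(3) by simp
  then have "comp \<Lambda> \<alpha> \<rho> \<in> initial_segs ?y" using tight_hereditary[OF initial_segs_tight[OF yB] k(1)] by blast
  then obtain z where z: "z \<in> boundary_paths_from \<Lambda> (src \<Lambda> \<rho>)" "?y = prepend \<Lambda> (comp \<Lambda> \<alpha> \<rho>) z"
    using initial_segs_obtain[OF yB] ar(2) by metis
  have z': "z \<in> boundary_paths_from \<Lambda> (src \<Lambda> \<tau>)" using z(1) s by simp
  have "prepend \<Lambda> \<alpha> x = prepend \<Lambda> \<alpha> (prepend \<Lambda> \<rho> z)"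
    using z(2) prepend_comp[OF a(1) l(1,3) z(1)] by simp
  then have "x = prepend \<Lambda> \<rho> z"
    by (rule prepend_inj[OF a, rotated]) (use prepend_mem[OF l(1) z(1)] l(3) in simp)
  moreover have "prepend \<Lambda> \<mu> y = prepend \<Lambda> \<mu> (prepend \<Lambda> \<tau> z)"
    using z(2) prepend_comp[OF m(1) l(2,4) z'] eq l(5) by simp
  then have "y = prepend \<Lambda> \<tau> z"
    by (rule prepend_inj[OF m, rotated]) (use prepend_mem[OF l(2) z'] l(4) in simp)
  ultimately show ?thesis using that r(1) z(1) by blast
qed

lemma prepend_eq_same_deg:
  assumes "\<alpha> \<in> paths \<Lambda>" "x \<in> boundary_paths_from \<Lambda> (src \<Lambda> \<alpha>)"
    and "\<mu> \<in> paths \<Lambda>" "y \<in> boundary_paths_from \<Lambda> (src \<Lambda> \<mu>)"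
    and "prepend \<Lambda> \<alpha> x = prepend \<Lambda> \<mu> y" "deg \<Lambda> \<alpha> = deg \<Lambda> \<mu>"
  shows "\<alpha> = \<mu>"
  using prepend_eqE[OF assms(1-5)] Lambda_min_same_deg[OF assms(1,3,6)] by blast

section \<open>Existence of boundary paths with prescribed behaviour\<close>

lemma boundary_path_through_FE:
  assumes v: "v \<in> vertices \<Lambda>" and x: "x \<in> boundary_paths_from \<Lambda> v" and E: "E \<in> FE \<Lambda> v"
  obtains \<nu> z where "\<nu> \<in> E" "z \<in> boundary_paths_from \<Lambda> (src \<Lambda> \<nu>)" "x = prepend \<Lambda> \<nu> z"
proof -
  have xB: "x \<in> boundary_paths \<Lambda>" "v \<in> initial_segs x" using x mem_boundary_paths_from[OF v] by auto
  have "E \<in> FE \<Lambda> (src \<Lambda> v)" using E vertexD[OF v] by simp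
  then obtain \<nu> where n: "\<nu> \<in> E" "comp \<Lambda> v \<nu> \<in> initial_segs x"
    using tight_FE[OF initial_segs_tight[OF xB(1)] xB(2)] by blast
  have "\<nu> \<in> paths \<Lambda>" "rng \<Lambda> \<nu> = v" using n(1) E by (auto simp: FE_def exhaustive_def paths_from_def)
  then have "\<nu> \<in> initial_segs x" using n(2) comp_rng[of \<nu>] by simp
  then show ?thesis using initial_segs_obtain[OF xB(1)] that n(1) by metis
qed

text \<open>The requirements imposed on a boundary path by all the sets in \<open>FE \<Lambda> v\<close> are countably many
  and each can be met by extending a given path, so they can be met one after the other.\<close>

lemma boundary_path_exists:
  assumes v: "v \<in> vertices \<Lambda>"
  shows "boundary_paths_from \<Lambda> v \<noteq> {}"
proof -
  define Q where "Q = {(\<alpha>, E). \<alpha> \<in> paths \<Lambda> \<and> E \<in> FE \<Lambda> (src \<Lambda> \<alpha>)}"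
  \<comment> \<open>A requirement is settled in one of two ways: \<open>\<beta>\<close> runs through
    \<open>E\<close> after \<open>\<alpha>\<close>, or \<open>\<beta>\<close> is incompatible with
    \<open>\<alpha>\<close>, so that \<open>\<alpha>\<close> never becomes an initial segment of an
    extension. Both persist when \<open>\<beta>\<close> is extended; hence one visit to each
    requirement suffices.\<close>
  define D where "D = (\<lambda>(\<alpha>, E) \<beta>. (\<exists>\<nu> \<in> E. prefix (comp \<Lambda> \<alpha> \<nu>) \<beta>) \<or> \<not> (\<exists>\<tau>. prefix \<alpha> \<tau> \<and> prefix \<beta> \<tau>))"
  have "Q \<subseteq> paths \<Lambda> \<times> {E. finite E \<and> E \<subseteq> paths \<Lambda>}"
    by (auto simp: Q_def FE_def exhaustive_def paths_from_def)
  then have cQ: "countable Q"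
    by (rule countable_subset) (intro countable_SIGMA countable_paths countable_Collect_finite_subset)
  have step: "\<exists>\<beta>'. prefix \<beta> \<beta>' \<and> (q \<in> Q \<longrightarrow> D q \<beta>')" if b: "\<beta> \<in> paths \<Lambda>" for \<beta> q
  proof (cases "q \<in> Q \<and> \<not> D q \<beta>")
    case True
    obtain \<alpha> E where q: "q = (\<alpha>, E)" by (cases q)
    have E: "\<alpha> \<in> paths \<Lambda>" "E \<in> FE \<Lambda> (src \<Lambda> \<alpha>)" using True q by (auto simp: Q_def)
    obtain \<tau> where t: "prefix \<alpha> \<tau>" "prefix \<beta> \<tau>" using True q by (auto simp: D_def)
    obtain \<gamma> where g: "\<gamma> \<in> paths \<Lambda>" "src \<Lambda> \<alpha> = rng \<Lambda> \<gamma>" "\<tau> = comp \<Lambda> \<alpha> \<gamma>" using t(1) by (rule prefixE)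
    have "\<gamma> \<in> paths_from \<Lambda> (src \<Lambda> \<alpha>)" using g by (simp add: paths_from_def)
    then obtain \<nu> where n: "\<nu> \<in> E" "Lambda_min \<Lambda> \<gamma> \<nu> \<noteq> {}" using E(2) unfolding FE_def exhaustive_def by blast
    have np: "\<nu> \<in> paths \<Lambda>" using n(1) E(2) by (auto simp: FE_def exhaustive_def paths_from_def)
    obtain \<kappa> where k: "prefix \<gamma> \<kappa>" "prefix \<nu> \<kappa>" using n(2) Lambda_min_nonempty_iff[OF g(1) np] by blast
    have s: "src \<Lambda> \<alpha> = rng \<Lambda> \<kappa>" using g(2) prefix_rng[OF k(1)] by simp
    have "prefix \<beta> (comp \<Lambda> \<alpha> \<kappa>)" using prefix_comp_mono[OF E(1) s k(1)] prefix_trans[OF t(2)] g(3) by simp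
    moreover have "D q (comp \<Lambda> \<alpha> \<kappa>)" using prefix_comp_mono[OF E(1) s k(2)] n(1) by (auto simp: q D_def)
    ultimately show ?thesis by blast
  qed (use prefix_refl[OF b] in blast)
  \<comment> \<open>The guard \<open>from_nat_into Q n \<in> Q\<close> covers empty
    \<open>Q\<close>, where the enumeration has no value in \<open>Q\<close>.\<close>
  have "\<exists>f. \<forall>n. (f n \<in> paths \<Lambda> \<and> (n = 0 \<longrightarrow> f n = v)) \<and>
      (prefix (f n) (f (Suc n)) \<and> (from_nat_into Q n \<in> Q \<longrightarrow> D (from_nat_into Q n) (f (Suc n))))"
  proof (rule dependent_nat_choice)
    show "\<exists>x. x \<in> paths \<Lambda> \<and> (0 = (0::nat) \<longrightarrow> x = v)" using vertexD[OF v] by blast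
  next
    fix x and n :: nat
    assume "x \<in> paths \<Lambda> \<and> (n = 0 \<longrightarrow> x = v)"
    then show "\<exists>y. (y \<in> paths \<Lambda> \<and> (Suc n = 0 \<longrightarrow> y = v)) \<and>
        prefix x y \<and> (from_nat_into Q n \<in> Q \<longrightarrow> D (from_nat_into Q n) y)"
      using step[of x "from_nat_into Q n"] prefix_paths(2) by auto
  qed
  then obtain f where f0: "f 0 = v" and fp: "\<And>n. f n \<in> paths \<Lambda>" and fs: "\<And>n. prefix (f n) (f (Suc n))"
    and fD: "\<And>n. from_nat_into Q n \<in> Q \<Longrightarrow> D (from_nat_into Q n) (f (Suc n))" by metis
  have mono: "prefix (f i) (f j)" if "i \<le> j" for i j
    using that by (induction rule: dec_induct) (use prefix_refl[OF fp] prefix_trans fs in blast)+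
  define F where "F = {\<alpha>. \<exists>n. prefix \<alpha> (f n)}"
  have fF: "f n \<in> F" for n using prefix_refl[OF fp] by (auto simp: F_def)
  have "tight F"
    unfolding tight_def
  proof (intro conjI ballI allI impI)
    show "F \<subseteq> paths \<Lambda>" by (auto simp: F_def dest: prefix_paths)
    show "F \<noteq> {}" using fF by blast
  next
    fix \<tau> \<alpha> assume "\<tau> \<in> F" "prefix \<alpha> \<tau>"
    then show "\<alpha> \<in> F" unfolding F_def using prefix_trans by blast
  next
    fix \<alpha> \<beta> assume "\<alpha> \<in> F" "\<beta> \<in> F"
    then obtain i j where "prefix \<alpha> (f i)" "prefix \<beta> (f j)" by (auto simp: F_def)
    then have "prefix \<alpha> (f (max i j))" "prefix \<beta> (f (max i j))"
      by (auto intro: prefix_trans[OF _ mono])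
    then show "\<exists>\<tau> \<in> F. prefix \<alpha> \<tau> \<and> prefix \<beta> \<tau>" using fF by blast
  next
    fix \<alpha> E assume a: "\<alpha> \<in> F" and E: "E \<in> FE \<Lambda> (src \<Lambda> \<alpha>)"
    obtain i where i: "prefix \<alpha> (f i)" using a by (auto simp: F_def)
    have q: "(\<alpha>, E) \<in> Q" using E prefix_paths[OF i] by (simp add: Q_def)
    define n where "n = to_nat_on Q (\<alpha>, E)"
    have n: "from_nat_into Q n = (\<alpha>, E)" using q cQ by (simp add: n_def)
    \<comment> \<open>This common extension of \<open>\<alpha>\<close> and \<open>f (Suc n)\<close>
      rules out the incompatible alternative in \<open>D\<close>.\<close>
    have "prefix \<alpha> (f (max i (Suc n)))" "prefix (f (Suc n)) (f (max i (Suc n)))"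
      using prefix_trans[OF i] mono[of i "max i (Suc n)"] mono[of "Suc n" "max i (Suc n)"] by auto
    moreover have "D (\<alpha>, E) (f (Suc n))" using fD[of n] n q by simp
    ultimately have "\<exists>\<nu> \<in> E. prefix (comp \<Lambda> \<alpha> \<nu>) (f (Suc n))" by (auto simp: D_def)
    then show "\<exists>\<nu> \<in> E. comp \<Lambda> \<alpha> \<nu> \<in> F" by (auto simp: F_def)
  qed
  then obtain x where "x \<in> boundary_paths \<Lambda>" "initial_segs x = F" using tight_initial_segs_ex by blast
  then have "x \<in> boundary_paths_from \<Lambda> v" using mem_boundary_paths_from[OF v] fF[of 0] f0 by simp
  then show ?thesis by blast
qed

text \<open>Non-exhaustiveness supplies a path \<open>\<alpha>\<close> without common extension with
  any member of \<open>G\<close>. Every boundary path starting with \<open>\<alpha>\<close> avoids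
  \<open>G\<close>, since two of its initial segments always have a common extension.\<close>

lemma boundary_path_avoiding:
  assumes v: "v \<in> vertices \<Lambda>" and G: "G \<subseteq> paths_from \<Lambda> v" "\<not> exhaustive \<Lambda> v G"
  obtains x where "x \<in> boundary_paths_from \<Lambda> v" "initial_segs x \<inter> G = {}"
proof -
  obtain \<alpha> where a: "\<alpha> \<in> paths \<Lambda>" "rng \<Lambda> \<alpha> = v" "\<And>\<mu>. \<mu> \<in> G \<Longrightarrow> Lambda_min \<Lambda> \<alpha> \<mu> = {}"
    using G by (auto simp: exhaustive_def paths_from_def)
  obtain z where z: "z \<in> boundary_paths_from \<Lambda> (src \<Lambda> \<alpha>)" using boundary_path_exists[OF vertex_src[OF a(1)]] by blast
  let ?x = "prepend \<Lambda> \<alpha> z"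
  have "\<mu> \<notin> initial_segs ?x" if m: "\<mu> \<in> G" for \<mu>
  proof
    assume mx: "\<mu> \<in> initial_segs ?x"
    obtain \<tau> where "prefix \<alpha> \<tau>" "prefix \<mu> \<tau>"
      using tight_directed[OF initial_segs_tight[OF prepend_props(1)[OF a(1) z]] mem_initial_segs_prepend[OF a(1) z] mx]
      by blast
    then show False using Lambda_min_nonempty_iff[OF a(1)] a(3)[OF m] prefix_paths by blast
  qed
  then show ?thesis using that prepend_mem[OF a(1) z] a(2) by blast
qed

end

section \<open>The topology of the boundary-path groupoid\<close>

lemma deg_diff_add: "deg_diff (m + l) (n + l) = deg_diff m n"
  by (simp add: deg_diff_def vec_eq_iff)

lemma deg_diff_cancel:
  assumes "deg_diff a m = deg_diff b n" "a + r = b + t" shows "m + r = n + (t :: nat ^ 'k::finite)"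
proof -
  have "m $ i + r $ i = n $ i + t $ i" for i
  proof -
    have "int (a $ i) - int (m $ i) = int (b $ i) - int (n $ i)"
      using assms(1) by (simp add: deg_diff_def vec_eq_iff)
    moreover have "a $ i + r $ i = b $ i + t $ i" using assms(2) by (metis vector_add_component)
    ultimately show ?thesis by linarith
  qed
  then show ?thesis by (simp add: vec_eq_iff)
qed

lemma closed_Collect_bex_finite:
  assumes "finite A" "\<And>a. a \<in> A \<Longrightarrow> closed {x. P a x}"
  shows "closed {x. \<exists>a \<in> A. P a x}"
proof -
  have "{x. \<exists>a \<in> A. P a x} = (\<Union>a \<in> A. {x. P a x})" by auto
  then show ?thesis using assms by (simp add: closed_UN)
qed

lemma clopen_coordinate:
  "open {\<xi> :: 'a \<Rightarrow> bool. \<xi> a}" "closed {\<xi> :: 'a \<Rightarrow> bool. \<xi> a}"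
proof -
  have c: "continuous_on UNIV (\<lambda>\<xi> :: 'a \<Rightarrow> bool. \<xi> a)" by (rule continuous_on_product_coordinates)
  have e: "{\<xi> :: 'a \<Rightarrow> bool. \<xi> a} = (\<lambda>\<xi>. \<xi> a) -` {True}" by auto
  show "open {\<xi> :: 'a \<Rightarrow> bool. \<xi> a}" unfolding e using c by (intro open_vimage open_discrete)
  show "closed {\<xi> :: 'a \<Rightarrow> bool. \<xi> a}" unfolding e using c by (intro closed_vimage closed_singleton)
qed

text \<open>The space \<open>'a \<Rightarrow> bool\<close> is a product of copies of the finite
  space \<open>bool\<close>, hence compact by Tychonoff's theorem.\<close>

lemma compactin_closed_cantor:
  fixes S :: "('a \<Rightarrow> bool) set"
  assumes "closed S" shows "compactin (euclidean :: ('a \<Rightarrow> bool) topology) S"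
proof -
  have "compact_space (euclidean :: bool topology)"
    by (simp add: compact_space_def finite_imp_compact)
  then have "compact_space (product_topology (\<lambda>_ :: 'a. euclidean :: bool topology) UNIV)"
    by (simp add: compact_space_product_topology)
  then have "compact_space (euclidean :: ('a \<Rightarrow> bool) topology)" by (simp only: euclidean_product_topology)
  then show ?thesis using assms by (metis closed_closedin closedin_compact_space)
qed

context k_graph
begin

text \<open>Every arrow has this form, usually in many ways: \<open>\<alpha>\<close>,
  \<open>\<mu>\<close> and \<open>\<rho>u\<close> may be exchanged for
  \<open>\<alpha>\<rho>\<close>, \<open>\<mu>\<rho>\<close> and \<open>u\<close>, which is
  \<open>arrow_comp\<close>.\<close>

definition arrow :: "'l \<Rightarrow> 'l \<Rightarrow> ('l, 'k) bpath \<Rightarrow> ('l, 'k) barrow" where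
  "arrow \<alpha> \<mu> z = (prepend \<Lambda> \<alpha> z, deg_diff (deg \<Lambda> \<alpha>) (deg \<Lambda> \<mu>), prepend \<Lambda> \<mu> z)"

text \<open>The set of those \<open>\<rho>\<close> for which \<open>Z(\<alpha>\<rho> *\<^sub>s \<mu>\<rho>)\<close> is one of the pieces of
  \<open>Z(\<alpha> *\<^sub>s \<mu>) \<inter> Z(\<beta> *\<^sub>s \<nu>)\<close>.\<close>

definition meet_exts :: "'l \<Rightarrow> 'l \<Rightarrow> 'l \<Rightarrow> 'l \<Rightarrow> 'l set" where
  "meet_exts \<alpha> \<mu> \<beta> \<nu> = {\<rho>. \<exists>\<tau>. (\<rho>, \<tau>) \<in> Lambda_min \<Lambda> \<alpha> \<beta> \<and> comp \<Lambda> \<mu> \<rho> = comp \<Lambda> \<nu> \<tau>}"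

definition pairs :: "('l \<times> 'l) set" where
  "pairs = {(\<alpha>, \<mu>). \<alpha> \<in> paths \<Lambda> \<and> \<mu> \<in> paths \<Lambda> \<and> src \<Lambda> \<alpha> = src \<Lambda> \<mu>}"

lemma pairsD:
  assumes "(\<alpha>, \<mu>) \<in> pairs"
  shows "\<alpha> \<in> paths \<Lambda>" "\<mu> \<in> paths \<Lambda>" "src \<Lambda> \<mu> = src \<Lambda> \<alpha>"
  using assms by (auto simp: pairs_def)

lemma pairs_src:
  assumes "\<alpha> \<in> paths \<Lambda>"
  shows "(\<alpha>, src \<Lambda> \<alpha>) \<in> pairs" "(src \<Lambda> \<alpha>, \<alpha>) \<in> pairs"
  using assms by (auto simp: pairs_def src_closed src_src)

lemma pairs_comp:
  assumes "(\<alpha>, \<mu>) \<in> pairs" "\<rho> \<in> paths \<Lambda>" "src \<Lambda> \<alpha> = rng \<Lambda> \<rho>"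
  shows "(comp \<Lambda> \<alpha> \<rho>, comp \<Lambda> \<mu> \<rho>) \<in> pairs" "src \<Lambda> (comp \<Lambda> \<alpha> \<rho>) = src \<Lambda> \<rho>" "src \<Lambda> (comp \<Lambda> \<mu> \<rho>) = src \<Lambda> \<rho>"
  using pairsD[OF assms(1)] assms(2,3) by (auto simp: pairs_def comp_closed src_comp)

lemma boundary_arrows_eq: "boundary_arrows \<Lambda> = {arrow \<alpha> \<mu> z | \<alpha> \<mu> z. (\<alpha>, \<mu>) \<in> pairs \<and> z \<in> boundary_paths_from \<Lambda> (src \<Lambda> \<alpha>)}"
  unfolding boundary_arrows_def arrow_def pairs_def by auto

lemma arrow_mem: "\<lbrakk>(\<alpha>, \<mu>) \<in> pairs; z \<in> boundary_paths_from \<Lambda> (src \<Lambda> \<alpha>)\<rbrakk> \<Longrightarrow> arrow \<alpha> \<mu> z \<in> boundary_arrows \<Lambda>"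
  unfolding boundary_arrows_eq by blast

lemma arrowE:
  assumes "a \<in> boundary_arrows \<Lambda>"
  obtains \<alpha> \<mu> z where "(\<alpha>, \<mu>) \<in> pairs" "z \<in> boundary_paths_from \<Lambda> (src \<Lambda> \<alpha>)" "a = arrow \<alpha> \<mu> z"
  using assms unfolding boundary_arrows_eq by blast

lemma meet_exts_paths:
  assumes "\<rho> \<in> meet_exts \<alpha> \<mu> \<beta> \<nu>"
  shows "\<rho> \<in> paths \<Lambda>" "src \<Lambda> \<alpha> = rng \<Lambda> \<rho>"
  using assms Lambda_minD unfolding meet_exts_def by blast+

end

section \<open>The sets \<open>Z_pair\<close> and their intersections\<close>

context finitely_aligned_kgraph
begin

abbreviation GT :: "('l, 'k) barrow topology" where
  "GT \<equiv> g_top (boundary_groupoid \<Lambda>)"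

lemma finite_meet_exts:
  assumes "\<alpha> \<in> paths \<Lambda>" "\<beta> \<in> paths \<Lambda>"
  shows "finite (meet_exts \<alpha> \<mu> \<beta> \<nu>)"
proof (rule finite_subset)
  show "meet_exts \<alpha> \<mu> \<beta> \<nu> \<subseteq> fst ` Lambda_min \<Lambda> \<alpha> \<beta>" by (force simp: meet_exts_def)
  show "finite (fst ` Lambda_min \<Lambda> \<alpha> \<beta>)" using finite_Lambda_min[OF assms] by simp
qed

text \<open>Both halves of an arrow in \<open>Z_pair\<close> have the same tail, because shifting
  undoes prepending; so the tail alone parametrises the set.\<close>

lemma Z_pair_eq:
  assumes "(\<alpha>, \<mu>) \<in> pairs"
  shows "Z_pair \<Lambda> \<alpha> \<mu> = arrow \<alpha> \<mu> ` boundary_paths_from \<Lambda> (src \<Lambda> \<alpha>)"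
proof (intro equalityI subsetI)
  note p = pairsD[OF assms]
  fix a assume "a \<in> Z_pair \<Lambda> \<alpha> \<mu>"
  then obtain x y where a: "a = (x, deg_diff (deg \<Lambda> \<alpha>) (deg \<Lambda> \<mu>), y)" "x \<in> Z_path \<Lambda> \<alpha>" "y \<in> Z_path \<Lambda> \<mu>"
    "shift (deg \<Lambda> \<alpha>) x = shift (deg \<Lambda> \<mu>) y" by (auto simp: Z_pair_def)
  obtain z where z: "z \<in> boundary_paths_from \<Lambda> (src \<Lambda> \<alpha>)" "x = prepend \<Lambda> \<alpha> z" using a(2) by (auto simp: Z_path_def)
  obtain z' where z': "z' \<in> boundary_paths_from \<Lambda> (src \<Lambda> \<mu>)" "y = prepend \<Lambda> \<mu> z'" using a(3) by (auto simp: Z_path_def)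
  have "z = z'" using a(4) prepend_props(3)[OF p(1) z(1)] prepend_props(3)[OF p(2) z'(1)] z(2) z'(2) by metis
  then have "a = arrow \<alpha> \<mu> z" using a(1) z(2) z'(2) by (simp add: arrow_def)
  then show "a \<in> arrow \<alpha> \<mu> ` boundary_paths_from \<Lambda> (src \<Lambda> \<alpha>)" using z(1) by blast
next
  note p = pairsD[OF assms]
  fix a assume "a \<in> arrow \<alpha> \<mu> ` boundary_paths_from \<Lambda> (src \<Lambda> \<alpha>)"
  then obtain z where z: "z \<in> boundary_paths_from \<Lambda> (src \<Lambda> \<alpha>)" "a = arrow \<alpha> \<mu> z" by blast
  have z': "z \<in> boundary_paths_from \<Lambda> (src \<Lambda> \<mu>)" using z(1) p(3) by simp
  have "prepend \<Lambda> \<alpha> z \<in> Z_path \<Lambda> \<alpha>" "prepend \<Lambda> \<mu> z \<in> Z_path \<Lambda> \<mu>" using z z' by (auto simp: Z_path_def)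
  moreover have "shift (deg \<Lambda> \<alpha>) (prepend \<Lambda> \<alpha> z) = shift (deg \<Lambda> \<mu>) (prepend \<Lambda> \<mu> z)"
    using prepend_props(3)[OF p(1) z(1)] prepend_props(3)[OF p(2) z'] by simp
  moreover have "a \<in> boundary_arrows \<Lambda>" using arrow_mem[OF assms z(1)] z(2) by simp
  ultimately show "a \<in> Z_pair \<Lambda> \<alpha> \<mu>" using z(2) by (auto simp: Z_pair_def arrow_def)
qed

lemma Z_pair_subset: "Z_pair \<Lambda> \<alpha> \<mu> \<subseteq> boundary_arrows \<Lambda>"
  by (auto simp: Z_pair_def)

lemma arrow_comp:
  assumes "(\<alpha>, \<mu>) \<in> pairs" "\<rho> \<in> paths \<Lambda>" "src \<Lambda> \<alpha> = rng \<Lambda> \<rho>" "z \<in> boundary_paths_from \<Lambda> (src \<Lambda> \<rho>)"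
  shows "arrow (comp \<Lambda> \<alpha> \<rho>) (comp \<Lambda> \<mu> \<rho>) z = arrow \<alpha> \<mu> (prepend \<Lambda> \<rho> z)"
proof -
  note p = pairsD[OF assms(1)]
  have s: "src \<Lambda> \<mu> = rng \<Lambda> \<rho>" using p(3) assms(3) by simp
  show ?thesis
    using prepend_comp[OF p(1) assms(2-4)] prepend_comp[OF p(2) assms(2) s assms(4)]
      deg_comp[OF p(1) assms(2,3)] deg_comp[OF p(2) assms(2) s]
    by (simp add: arrow_def deg_diff_add)
qed

lemma arrow_inj:
  assumes "(\<alpha>, \<mu>) \<in> pairs" "z \<in> boundary_paths_from \<Lambda> (src \<Lambda> \<alpha>)" "z' \<in> boundary_paths_from \<Lambda> (src \<Lambda> \<alpha>)"
    "arrow \<alpha> \<mu> z = arrow \<alpha> \<mu> z'"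
  shows "z = z'"
  using prepend_inj[OF pairsD(1)[OF assms(1)] assms(2,3)] assms(4) by (simp add: arrow_def)

text \<open>If \<open>\<alpha>z = \<beta>w\<close>, the two paths continue by some
  \<open>\<rho>\<close> and \<open>\<tau>\<close> to a minimal common extension with the same rest
  \<open>u\<close>. Equality of the middle coordinates gives \<open>\<mu>\<rho>\<close> and
  \<open>\<nu>\<tau>\<close> the same degree, and as initial segments of one boundary path they
  coincide. So membership is a condition on finitely many possible initial segments of
  \<open>z\<close>, which is what the topological arguments use.\<close>

lemma arrow_mem_Z_pair_iff:
  assumes p: "(\<alpha>, \<mu>) \<in> pairs" and q: "(\<beta>, \<nu>) \<in> pairs" and z: "z \<in> boundary_paths_from \<Lambda> (src \<Lambda> \<alpha>)"
  shows "arrow \<alpha> \<mu> z \<in> Z_pair \<Lambda> \<beta> \<nu> \<longleftrightarrow> (\<exists>\<rho> \<in> meet_exts \<alpha> \<mu> \<beta> \<nu>. \<rho> \<in> initial_segs z)"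
proof
  note pd = pairsD[OF p] and qd = pairsD[OF q]
  assume "arrow \<alpha> \<mu> z \<in> Z_pair \<Lambda> \<beta> \<nu>"
  then obtain w where w: "w \<in> boundary_paths_from \<Lambda> (src \<Lambda> \<beta>)" "arrow \<alpha> \<mu> z = arrow \<beta> \<nu> w"
    unfolding Z_pair_eq[OF q] by blast
  then have eq: "prepend \<Lambda> \<alpha> z = prepend \<Lambda> \<beta> w" "prepend \<Lambda> \<mu> z = prepend \<Lambda> \<nu> w"
    and dd: "deg_diff (deg \<Lambda> \<alpha>) (deg \<Lambda> \<mu>) = deg_diff (deg \<Lambda> \<beta>) (deg \<Lambda> \<nu>)" by (auto simp: arrow_def)
  obtain \<rho> \<tau> u where r: "(\<rho>, \<tau>) \<in> Lambda_min \<Lambda> \<alpha> \<beta>" "u \<in> boundary_paths_from \<Lambda> (src \<Lambda> \<rho>)"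
    "z = prepend \<Lambda> \<rho> u" "w = prepend \<Lambda> \<tau> u"
    using prepend_eqE[OF pd(1) z qd(1) w(1) eq(1)] .
  note l = Lambda_minD[OF r(1)]
  have st: "src \<Lambda> \<rho> = src \<Lambda> \<tau>" using Lambda_min_src[OF pd(1) qd(1) r(1)] .
  have u': "u \<in> boundary_paths_from \<Lambda> (src \<Lambda> \<tau>)" using r(2) st by simp
  have s: "src \<Lambda> \<mu> = rng \<Lambda> \<rho>" "src \<Lambda> \<nu> = rng \<Lambda> \<tau>" using pd(3) qd(3) l(3,4) by simp_all
  have "deg \<Lambda> \<alpha> + deg \<Lambda> \<rho> = deg \<Lambda> \<beta> + deg \<Lambda> \<tau>"
    using deg_comp[OF pd(1) l(1,3)] deg_comp[OF qd(1) l(2,4)] l(5) by simp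
  then have d: "deg \<Lambda> (comp \<Lambda> \<mu> \<rho>) = deg \<Lambda> (comp \<Lambda> \<nu> \<tau>)"
    using deg_diff_cancel[OF dd] deg_comp[OF pd(2) l(1) s(1)] deg_comp[OF qd(2) l(2) s(2)] by simp
  have "comp \<Lambda> \<mu> \<rho> = comp \<Lambda> \<nu> \<tau>"
  proof (rule prepend_eq_same_deg[OF comp_closed[OF pd(2) l(1) s(1)] _ comp_closed[OF qd(2) l(2) s(2)] _ _ d])
    show "u \<in> boundary_paths_from \<Lambda> (src \<Lambda> (comp \<Lambda> \<mu> \<rho>))" using r(2) src_comp[OF pd(2) l(1) s(1)] by simp
    show "u \<in> boundary_paths_from \<Lambda> (src \<Lambda> (comp \<Lambda> \<nu> \<tau>))" using u' src_comp[OF qd(2) l(2) s(2)] by simp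
    show "prepend \<Lambda> (comp \<Lambda> \<mu> \<rho>) u = prepend \<Lambda> (comp \<Lambda> \<nu> \<tau>) u"
      using prepend_comp[OF pd(2) l(1) s(1) r(2)] prepend_comp[OF qd(2) l(2) s(2) u'] eq(2) r(3,4) by simp
  qed
  then have "\<rho> \<in> meet_exts \<alpha> \<mu> \<beta> \<nu>" using r(1) by (auto simp: meet_exts_def)
  moreover have "\<rho> \<in> initial_segs z" using mem_initial_segs_prepend[OF l(1) r(2)] r(3) by simp
  ultimately show "\<exists>\<rho> \<in> meet_exts \<alpha> \<mu> \<beta> \<nu>. \<rho> \<in> initial_segs z" by blast
next
  note pd = pairsD[OF p] and qd = pairsD[OF q]
  assume "\<exists>\<rho> \<in> meet_exts \<alpha> \<mu> \<beta> \<nu>. \<rho> \<in> initial_segs z"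
  then obtain \<rho> \<tau> where r: "(\<rho>, \<tau>) \<in> Lambda_min \<Lambda> \<alpha> \<beta>" "comp \<Lambda> \<mu> \<rho> = comp \<Lambda> \<nu> \<tau>" "\<rho> \<in> initial_segs z"
    by (auto simp: meet_exts_def)
  note l = Lambda_minD[OF r(1)]
  have st: "src \<Lambda> \<rho> = src \<Lambda> \<tau>" using Lambda_min_src[OF pd(1) qd(1) r(1)] .
  have zB: "z \<in> boundary_paths \<Lambda>" using z by (simp add: boundary_paths_from_def)
  obtain u where u: "u \<in> boundary_paths_from \<Lambda> (src \<Lambda> \<rho>)" "z = prepend \<Lambda> \<rho> u" using initial_segs_obtain[OF zB r(3)] .
  have u': "u \<in> boundary_paths_from \<Lambda> (src \<Lambda> \<tau>)" using u st by simp
  have "arrow \<alpha> \<mu> z = arrow \<beta> \<nu> (prepend \<Lambda> \<tau> u)"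
    using arrow_comp[OF p l(1,3) u(1)] arrow_comp[OF q l(2,4) u'] l(5) r(2) u(2) by simp
  then show "arrow \<alpha> \<mu> z \<in> Z_pair \<Lambda> \<beta> \<nu>"
    unfolding Z_pair_eq[OF q] using prepend_mem[OF l(2) u'] l(4) by simp
qed

lemma arrow_mem_Z_pair_comp_iff:
  assumes p: "(\<alpha>, \<mu>) \<in> pairs" and r: "\<rho> \<in> paths \<Lambda>" "src \<Lambda> \<alpha> = rng \<Lambda> \<rho>" and z: "z \<in> boundary_paths_from \<Lambda> (src \<Lambda> \<alpha>)"
  shows "arrow \<alpha> \<mu> z \<in> Z_pair \<Lambda> (comp \<Lambda> \<alpha> \<rho>) (comp \<Lambda> \<mu> \<rho>) \<longleftrightarrow> \<rho> \<in> initial_segs z"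
proof
  note c = pairs_comp[OF p r]
  have zB: "z \<in> boundary_paths \<Lambda>" using z by (simp add: boundary_paths_from_def)
  {
    assume "arrow \<alpha> \<mu> z \<in> Z_pair \<Lambda> (comp \<Lambda> \<alpha> \<rho>) (comp \<Lambda> \<mu> \<rho>)"
    then obtain u where u: "u \<in> boundary_paths_from \<Lambda> (src \<Lambda> \<rho>)" "arrow \<alpha> \<mu> z = arrow (comp \<Lambda> \<alpha> \<rho>) (comp \<Lambda> \<mu> \<rho>) u"
      unfolding Z_pair_eq[OF c(1)] c(2) by blast
    have "prepend \<Lambda> \<rho> u \<in> boundary_paths_from \<Lambda> (src \<Lambda> \<alpha>)" using prepend_mem[OF r(1) u(1)] r(2) by simp
    then have "z = prepend \<Lambda> \<rho> u" using arrow_inj[OF p z] u(2) arrow_comp[OF p r u(1)] by simp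
    then show "\<rho> \<in> initial_segs z" using mem_initial_segs_prepend[OF r(1) u(1)] by simp
  next
    assume "\<rho> \<in> initial_segs z"
    then obtain u where u: "u \<in> boundary_paths_from \<Lambda> (src \<Lambda> \<rho>)" "z = prepend \<Lambda> \<rho> u" using initial_segs_obtain[OF zB] by metis
    then show "arrow \<alpha> \<mu> z \<in> Z_pair \<Lambda> (comp \<Lambda> \<alpha> \<rho>) (comp \<Lambda> \<mu> \<rho>)"
      unfolding Z_pair_eq[OF c(1)] c(2) using arrow_comp[OF p r u(1)] by (metis imageI)
  }
qed

lemma Z_pair_inter:
  assumes p: "(\<alpha>, \<mu>) \<in> pairs" and q: "(\<beta>, \<nu>) \<in> pairs"
  shows "Z_pair \<Lambda> \<alpha> \<mu> \<inter> Z_pair \<Lambda> \<beta> \<nu> = (\<Union>\<rho> \<in> meet_exts \<alpha> \<mu> \<beta> \<nu>. Z_pair \<Lambda> (comp \<Lambda> \<alpha> \<rho>) (comp \<Lambda> \<mu> \<rho>))"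
proof (intro equalityI subsetI)
  fix a assume a: "a \<in> Z_pair \<Lambda> \<alpha> \<mu> \<inter> Z_pair \<Lambda> \<beta> \<nu>"
  then obtain z where z: "z \<in> boundary_paths_from \<Lambda> (src \<Lambda> \<alpha>)" "a = arrow \<alpha> \<mu> z" unfolding Z_pair_eq[OF p] by blast
  then show "a \<in> (\<Union>\<rho> \<in> meet_exts \<alpha> \<mu> \<beta> \<nu>. Z_pair \<Lambda> (comp \<Lambda> \<alpha> \<rho>) (comp \<Lambda> \<mu> \<rho>))"
    using a arrow_mem_Z_pair_iff[OF p q z(1)] arrow_mem_Z_pair_comp_iff[OF p meet_exts_paths z(1)] by auto
next
  fix a assume "a \<in> (\<Union>\<rho> \<in> meet_exts \<alpha> \<mu> \<beta> \<nu>. Z_pair \<Lambda> (comp \<Lambda> \<alpha> \<rho>) (comp \<Lambda> \<mu> \<rho>))"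
  then obtain \<rho> where r: "\<rho> \<in> meet_exts \<alpha> \<mu> \<beta> \<nu>" "a \<in> Z_pair \<Lambda> (comp \<Lambda> \<alpha> \<rho>) (comp \<Lambda> \<mu> \<rho>)" by blast
  note m = meet_exts_paths[OF r(1)]
  note c = pairs_comp[OF p m]
  obtain u where u: "u \<in> boundary_paths_from \<Lambda> (src \<Lambda> \<rho>)" "a = arrow (comp \<Lambda> \<alpha> \<rho>) (comp \<Lambda> \<mu> \<rho>) u"
    using r(2) unfolding Z_pair_eq[OF c(1)] c(2) by blast
  then have a: "a = arrow \<alpha> \<mu> (prepend \<Lambda> \<rho> u)" using arrow_comp[OF p m] by simp
  have z: "prepend \<Lambda> \<rho> u \<in> boundary_paths_from \<Lambda> (src \<Lambda> \<alpha>)" using prepend_mem[OF m(1) u(1)] m(2) by simp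
  have "\<rho> \<in> initial_segs (prepend \<Lambda> \<rho> u)" using mem_initial_segs_prepend[OF m(1) u(1)] .
  then show "a \<in> Z_pair \<Lambda> \<alpha> \<mu> \<inter> Z_pair \<Lambda> \<beta> \<nu>"
    using arrow_mem_Z_pair_iff[OF p q z] r(1) a z unfolding Z_pair_eq[OF p] by auto
qed

lemma Z_pair_disjoint:
  assumes p: "(\<alpha>, \<mu>) \<in> pairs" and q: "(\<beta>, \<nu>) \<in> pairs" and d: "deg \<Lambda> \<alpha> = deg \<Lambda> \<beta>" "\<alpha> \<noteq> \<beta>"
  shows "Z_pair \<Lambda> \<alpha> \<mu> \<inter> Z_pair \<Lambda> \<beta> \<nu> = {}"
  using Z_pair_inter[OF p q] Lambda_min_same_deg[OF pairsD(1)[OF p] pairsD(1)[OF q] d]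
  by (simp add: meet_exts_def)

section \<open>Open, closed and compact sets of arrows\<close>

lemma topspace_GT: "topspace GT = boundary_arrows \<Lambda>"
proof -
  have "\<Union>(boundary_basis \<Lambda>) = boundary_arrows \<Lambda>"
  proof (intro equalityI subsetI)
    fix a assume "a \<in> \<Union>(boundary_basis \<Lambda>)"
    then show "a \<in> boundary_arrows \<Lambda>" unfolding boundary_basis_def Z_pair_minus_def using Z_pair_subset by blast
  next
    fix a assume "a \<in> boundary_arrows \<Lambda>"
    then obtain \<alpha> \<mu> z where a: "(\<alpha>, \<mu>) \<in> pairs" "z \<in> boundary_paths_from \<Lambda> (src \<Lambda> \<alpha>)" "a = arrow \<alpha> \<mu> z" by (rule arrowE)
    \<comment> \<open>The empty set is not exhaustive, since the vertex itself would need a partner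
      in it; hence \<open>Z_pair\<close> is itself a basic set.\<close>
    have "src \<Lambda> \<alpha> \<in> paths_from \<Lambda> (src \<Lambda> \<alpha>)"
      using pairsD(1)[OF a(1)] by (simp add: paths_from_def src_closed rng_src)
    then have "\<not> exhaustive \<Lambda> (src \<Lambda> \<alpha>) {}" by (auto simp: exhaustive_def)
    then have "Z_pair_minus \<Lambda> \<alpha> \<mu> {} \<in> boundary_basis \<Lambda>" using pairsD[OF a(1)] unfolding boundary_basis_def by fastforce
    moreover have "a \<in> Z_pair_minus \<Lambda> \<alpha> \<mu> {}" using a by (simp add: Z_pair_minus_def Z_pair_eq)
    ultimately show "a \<in> \<Union>(boundary_basis \<Lambda>)" by blast
  qed
  then show ?thesis by (simp add: boundary_groupoid_def)
qed

lemma arrow_mem_Z_pair_minus_iff: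
  assumes p: "(\<alpha>, \<mu>) \<in> pairs" and z: "z \<in> boundary_paths_from \<Lambda> (src \<Lambda> \<alpha>)" and G: "G \<subseteq> paths_from \<Lambda> (src \<Lambda> \<alpha>)"
  shows "arrow \<alpha> \<mu> z \<in> Z_pair_minus \<Lambda> \<alpha> \<mu> G \<longleftrightarrow> initial_segs z \<inter> G = {}"
proof -
  have "arrow \<alpha> \<mu> z \<in> Z_pair \<Lambda> (comp \<Lambda> \<alpha> \<nu>) (comp \<Lambda> \<mu> \<nu>) \<longleftrightarrow> \<nu> \<in> initial_segs z" if "\<nu> \<in> G" for \<nu>
    by (rule arrow_mem_Z_pair_comp_iff[OF p _ _ z]) (use that G in \<open>auto simp: paths_from_def\<close>)
  then show ?thesis using z unfolding Z_pair_minus_def Z_pair_eq[OF p] by blast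
qed

text \<open>\<open>boundary_basis\<close> contains only the sets with non-exhaustive
  \<open>G\<close>. For exhaustive \<open>G\<close> the set is empty: either \<open>G\<close>
  contains the vertex \<open>src \<Lambda> \<alpha>\<close>, an initial segment of every
  \<open>z\<close>, or \<open>G\<close> belongs to \<open>FE\<close> and every boundary path at this
  vertex meets it.\<close>

lemma openin_Z_pair_minus:
  assumes p: "(\<alpha>, \<mu>) \<in> pairs" and G: "finite G" "G \<subseteq> paths_from \<Lambda> (src \<Lambda> \<alpha>)"
  shows "openin GT (Z_pair_minus \<Lambda> \<alpha> \<mu> G)"
proof (cases "exhaustive \<Lambda> (src \<Lambda> \<alpha>) G")
  case False
  then have "Z_pair_minus \<Lambda> \<alpha> \<mu> G \<in> boundary_basis \<Lambda>"
    unfolding boundary_basis_def using pairsD(1,2)[OF p] pairsD(3)[OF p, symmetric] G by blast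
  then show ?thesis by (simp add: boundary_groupoid_def topology_generated_by_Basis)
next
  case True
  have v: "src \<Lambda> \<alpha> \<in> vertices \<Lambda>" using vertex_src[OF pairsD(1)[OF p]] .
  have "Z_pair_minus \<Lambda> \<alpha> \<mu> G = {}"
  proof (rule ccontr)
    assume "Z_pair_minus \<Lambda> \<alpha> \<mu> G \<noteq> {}"
    then obtain z where z: "z \<in> boundary_paths_from \<Lambda> (src \<Lambda> \<alpha>)" "arrow \<alpha> \<mu> z \<in> Z_pair_minus \<Lambda> \<alpha> \<mu> G"
      unfolding Z_pair_minus_def Z_pair_eq[OF p] by blast
    then have e: "initial_segs z \<inter> G = {}" using arrow_mem_Z_pair_minus_iff[OF p z(1) G(2)] by simp
    then have "src \<Lambda> \<alpha> \<notin> G" using z(1) mem_boundary_paths_from[OF v] by blast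
    then have "G \<in> FE \<Lambda> (src \<Lambda> \<alpha>)" using True G by (simp add: FE_def)
    then obtain \<nu> u where n: "\<nu> \<in> G" "u \<in> boundary_paths_from \<Lambda> (src \<Lambda> \<nu>)" "z = prepend \<Lambda> \<nu> u"
      using boundary_path_through_FE[OF v z(1)] by metis
    then have "\<nu> \<in> initial_segs z" using mem_initial_segs_prepend[of \<nu> u] G(2) by (auto simp: paths_from_def)
    then show False using e n(1) by blast
  qed
  then show ?thesis by simp
qed

lemma openin_Z_pair:
  assumes "(\<alpha>, \<mu>) \<in> pairs" shows "openin GT (Z_pair \<Lambda> \<alpha> \<mu>)"
  using openin_Z_pair_minus[OF assms, of "{}"] by (simp add: Z_pair_minus_def)

text \<open>Around an arrow of the complement, given through \<open>\<beta>\<close> and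
  \<open>\<nu>\<close>, it suffices to remove from \<open>Z_pair \<Lambda> \<beta> \<nu>\<close> the
  finitely many pieces that make up its intersection with
  \<open>Z_pair \<Lambda> \<alpha> \<mu>\<close>.\<close>

lemma openin_Compl_Z_pair:
  assumes p: "(\<alpha>, \<mu>) \<in> pairs" shows "openin GT (boundary_arrows \<Lambda> - Z_pair \<Lambda> \<alpha> \<mu>)"
proof (subst openin_subopen, intro ballI)
  fix a assume a: "a \<in> boundary_arrows \<Lambda> - Z_pair \<Lambda> \<alpha> \<mu>"
  then obtain \<beta> \<nu> z where z: "(\<beta>, \<nu>) \<in> pairs" "z \<in> boundary_paths_from \<Lambda> (src \<Lambda> \<beta>)" "a = arrow \<beta> \<nu> z"
    using arrowE by blast
  let ?U = "Z_pair_minus \<Lambda> \<beta> \<nu> (meet_exts \<beta> \<nu> \<alpha> \<mu>)"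
  have U: "?U = Z_pair \<Lambda> \<beta> \<nu> - Z_pair \<Lambda> \<alpha> \<mu>"
    using Z_pair_inter[OF z(1) p] unfolding Z_pair_minus_def by blast
  have "openin GT ?U"
    by (rule openin_Z_pair_minus[OF z(1)])
      (auto intro: finite_meet_exts pairsD[OF z(1)] pairsD[OF p] simp: paths_from_def dest: meet_exts_paths)
  moreover have "a \<in> ?U" using a z U by (simp add: Z_pair_eq)
  moreover have "?U \<subseteq> boundary_arrows \<Lambda> - Z_pair \<Lambda> \<alpha> \<mu>" using U Z_pair_subset by blast
  ultimately show "\<exists>T. openin GT T \<and> a \<in> T \<and> T \<subseteq> boundary_arrows \<Lambda> - Z_pair \<Lambda> \<alpha> \<mu>" by blast
qed

text \<open>The filters at \<open>v\<close> are cut out of the Cantor space by conditions on finitely many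
  coordinates each; directedness and tightness have this form because of finite alignment.\<close>

lemma closed_tight:
  assumes v: "v \<in> vertices \<Lambda>"
  shows "closed {\<xi>. tight {\<alpha>. \<xi> \<alpha>} \<and> \<xi> v}"
proof -
  \<comment> \<open>Directedness is restated with a witness from the finite set of minimal common
    extensions, which heredity permits. Nonemptiness, in general not a closed condition, is replaced
    by \<open>\<xi> v\<close>.\<close>
  let ?P = "\<lambda>\<xi>. (\<forall>\<alpha>. \<alpha> \<notin> paths \<Lambda> \<longrightarrow> \<not> \<xi> \<alpha>) \<and>
     (\<forall>\<tau> \<alpha>. prefix \<alpha> \<tau> \<longrightarrow> \<xi> \<tau> \<longrightarrow> \<xi> \<alpha>) \<and>
     (\<forall>\<alpha> \<beta>. \<alpha> \<in> paths \<Lambda> \<and> \<beta> \<in> paths \<Lambda> \<longrightarrow> \<xi> \<alpha> \<longrightarrow> \<xi> \<beta> \<longrightarrow> (\<exists>\<rho> \<in> fst ` Lambda_min \<Lambda> \<alpha> \<beta>. \<xi> (comp \<Lambda> \<alpha> \<rho>))) \<and>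
     (\<forall>\<alpha> E. \<alpha> \<in> paths \<Lambda> \<and> E \<in> FE \<Lambda> (src \<Lambda> \<alpha>) \<longrightarrow> \<xi> \<alpha> \<longrightarrow> (\<exists>\<nu> \<in> E. \<xi> (comp \<Lambda> \<alpha> \<nu>))) \<and> \<xi> v"
  have "tight {\<alpha>. \<xi> \<alpha>} \<and> \<xi> v \<longleftrightarrow> ?P \<xi>" for \<xi>
  proof
    assume h: "tight {\<alpha>. \<xi> \<alpha>} \<and> \<xi> v"
    then have F: "tight {\<alpha>. \<xi> \<alpha>}" by blast
    have "\<exists>\<rho> \<in> fst ` Lambda_min \<Lambda> \<alpha> \<beta>. \<xi> (comp \<Lambda> \<alpha> \<rho>)"
      if ab: "\<alpha> \<in> paths \<Lambda>" "\<beta> \<in> paths \<Lambda>" "\<xi> \<alpha>" "\<xi> \<beta>" for \<alpha> \<beta>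
    proof -
      obtain \<tau> where t: "\<xi> \<tau>" "prefix \<alpha> \<tau>" "prefix \<beta> \<tau>" using tight_directed[OF F, of \<alpha> \<beta>] ab by auto
      obtain \<gamma> where g: "\<gamma> \<in> paths \<Lambda>" "src \<Lambda> \<alpha> = rng \<Lambda> \<gamma>" "\<tau> = comp \<Lambda> \<alpha> \<gamma>" using t(2) by (rule prefixE)
      obtain \<delta> where d: "\<delta> \<in> paths \<Lambda>" "src \<Lambda> \<beta> = rng \<Lambda> \<delta>" "\<tau> = comp \<Lambda> \<beta> \<delta>" using t(3) by (rule prefixE)
      obtain \<rho> \<sigma> \<kappa> where r: "(\<rho>, \<sigma>) \<in> Lambda_min \<Lambda> \<alpha> \<beta>" "\<kappa> \<in> paths \<Lambda>" "src \<Lambda> \<rho> = rng \<Lambda> \<kappa>" "\<gamma> = comp \<Lambda> \<rho> \<kappa>"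
        using common_extension[OF ab(1) g(1,2) ab(2) d(1,2)] g(3) d(3) by metis
      note l = Lambda_minD[OF r(1)]
      have "prefix \<rho> \<gamma>" using prefixI[OF l(1) r(2,3)] r(4) by simp
      then have "prefix (comp \<Lambda> \<alpha> \<rho>) \<tau>" using prefix_comp_mono[OF ab(1) g(2)] g(3) by simp
      then have "\<xi> (comp \<Lambda> \<alpha> \<rho>)" using tight_hereditary[OF F, of \<tau>] t(1) by simp
      then show ?thesis using r(1) by force
    qed
    moreover have "\<And>\<alpha>. \<alpha> \<notin> paths \<Lambda> \<Longrightarrow> \<not> \<xi> \<alpha>" using tight_paths[OF F] by auto
    moreover have "\<And>\<tau> \<alpha>. \<lbrakk>prefix \<alpha> \<tau>; \<xi> \<tau>\<rbrakk> \<Longrightarrow> \<xi> \<alpha>" using tight_hereditary[OF F] by auto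
    moreover have "\<And>\<alpha> E. \<lbrakk>E \<in> FE \<Lambda> (src \<Lambda> \<alpha>); \<xi> \<alpha>\<rbrakk> \<Longrightarrow> \<exists>\<nu> \<in> E. \<xi> (comp \<Lambda> \<alpha> \<nu>)"
      using tight_FE[OF F] by auto
    ultimately show "?P \<xi>" using h by (intro conjI allI impI) (elim conjE, assumption?; metis)+
  next
    assume h: "?P \<xi>"
    have "\<exists>\<tau>. \<xi> \<tau> \<and> prefix \<alpha> \<tau> \<and> prefix \<beta> \<tau>" if ab: "\<xi> \<alpha>" "\<xi> \<beta>" for \<alpha> \<beta>
    proof -
      have p: "\<alpha> \<in> paths \<Lambda>" "\<beta> \<in> paths \<Lambda>" using h ab by blast+
      then have "\<exists>\<rho> \<in> fst ` Lambda_min \<Lambda> \<alpha> \<beta>. \<xi> (comp \<Lambda> \<alpha> \<rho>)" using h ab by blast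
      then obtain \<rho> \<sigma> where r: "(\<rho>, \<sigma>) \<in> Lambda_min \<Lambda> \<alpha> \<beta>" "\<xi> (comp \<Lambda> \<alpha> \<rho>)" by auto
      note l = Lambda_minD[OF r(1)]
      show ?thesis using r(2) prefixI[OF p(1) l(1,3)] prefixI[OF p(2) l(2,4)] l(5) by auto
    qed
    then have "\<forall>\<alpha> \<in> {\<alpha>. \<xi> \<alpha>}. \<forall>\<beta> \<in> {\<alpha>. \<xi> \<alpha>}. \<exists>\<tau> \<in> {\<alpha>. \<xi> \<alpha>}. prefix \<alpha> \<tau> \<and> prefix \<beta> \<tau>" by simp
    moreover have pa: "{\<alpha>. \<xi> \<alpha>} \<subseteq> paths \<Lambda>" using h by blast
    moreover have "\<forall>\<tau> \<in> {\<alpha>. \<xi> \<alpha>}. \<forall>\<alpha>. prefix \<alpha> \<tau> \<longrightarrow> \<alpha> \<in> {\<alpha>. \<xi> \<alpha>}" using h by simp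
    moreover have "\<forall>\<alpha> \<in> {\<alpha>. \<xi> \<alpha>}. \<forall>E \<in> FE \<Lambda> (src \<Lambda> \<alpha>). \<exists>\<nu> \<in> E. comp \<Lambda> \<alpha> \<nu> \<in> {\<alpha>. \<xi> \<alpha>}"
    proof (intro ballI)
      fix \<alpha> E assume "\<alpha> \<in> {\<alpha>. \<xi> \<alpha>}" "E \<in> FE \<Lambda> (src \<Lambda> \<alpha>)"
      then show "\<exists>\<nu> \<in> E. comp \<Lambda> \<alpha> \<nu> \<in> {\<alpha>. \<xi> \<alpha>}" using h pa by auto
    qed
    moreover have "\<xi> v" using h by simp
    ultimately show "tight {\<alpha>. \<xi> \<alpha>} \<and> \<xi> v" unfolding tight_def by auto
  qed
  then have e: "{\<xi>. tight {\<alpha>. \<xi> \<alpha>} \<and> \<xi> v} = {\<xi>. ?P \<xi>}" by (rule Collect_cong)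
  have fin: "finite (fst ` Lambda_min \<Lambda> \<alpha> \<beta>)" if "\<alpha> \<in> paths \<Lambda> \<and> \<beta> \<in> paths \<Lambda>" for \<alpha> \<beta>
    using finite_Lambda_min that by simp
  have finE: "finite E" if "\<alpha> \<in> paths \<Lambda> \<and> E \<in> FE \<Lambda> (src \<Lambda> \<alpha>)" for \<alpha> E
    using that by (simp add: FE_def)
  have imp: "closed {\<xi>. b \<longrightarrow> Q \<xi>}" if "b \<Longrightarrow> closed {\<xi>. Q \<xi>}" for b and Q :: "('l \<Rightarrow> bool) \<Rightarrow> bool"
    using that by (cases b) simp_all
  show ?thesis unfolding e
    by (intro closed_Collect_conj closed_Collect_all imp closed_Collect_imp closed_Collect_neg
        closed_Collect_bex_finite clopen_coordinate) (use fin finE in auto)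
qed

text \<open>The set is the image of the compact set \<open>S\<close> of filters through
  \<open>src \<Lambda> \<alpha>\<close> under a continuous map. Continuity is checked on
  \<open>boundary_basis\<close> only; by \<open>arrow_mem_Z_pair_iff\<close> the preimages are
  described by finitely many coordinates.\<close>

lemma compactin_Z_pair:
  assumes p: "(\<alpha>, \<mu>) \<in> pairs"
  shows "compactin GT (Z_pair \<Lambda> \<alpha> \<mu>)"
proof -
  let ?v = "src \<Lambda> \<alpha>"
  have v: "?v \<in> vertices \<Lambda>" using vertex_src[OF pairsD(1)[OF p]] .
  define S where "S = {\<xi>. tight {\<beta>. \<xi> \<beta>} \<and> \<xi> ?v}"
  define X where "X = subtopology (euclidean :: ('l \<Rightarrow> bool) topology) S"
  define b where "b = (\<lambda>\<xi>. SOME z. z \<in> boundary_paths \<Lambda> \<and> initial_segs z = {\<beta>. \<xi> \<beta>})"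
  have b: "b \<xi> \<in> boundary_paths_from \<Lambda> ?v" "initial_segs (b \<xi>) = {\<beta>. \<xi> \<beta>}" if "\<xi> \<in> S" for \<xi>
  proof -
    have "\<exists>z. z \<in> boundary_paths \<Lambda> \<and> initial_segs z = {\<beta>. \<xi> \<beta>}"
      using tight_initial_segs_ex[of "{\<beta>. \<xi> \<beta>}"] that by (auto simp: S_def)
    from someI_ex[OF this] have "b \<xi> \<in> boundary_paths \<Lambda> \<and> initial_segs (b \<xi>) = {\<beta>. \<xi> \<beta>}" by (simp add: b_def)
    then show "b \<xi> \<in> boundary_paths_from \<Lambda> ?v" "initial_segs (b \<xi>) = {\<beta>. \<xi> \<beta>}"
      using that mem_boundary_paths_from[OF v] by (auto simp: S_def)
  qed
  have tX: "topspace X = S" by (simp add: X_def)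
  have cS: "compactin X S"
    using compactin_closed_cantor[OF closed_tight[OF v]] by (simp add: X_def S_def compactin_subtopology)
  have "continuous_map X (topology_generated_by (boundary_basis \<Lambda>)) (\<lambda>\<xi>. arrow \<alpha> \<mu> (b \<xi>))"
  proof (rule continuous_on_generated_topo)
    have "arrow \<alpha> \<mu> (b \<xi>) \<in> boundary_arrows \<Lambda>" if "\<xi> \<in> S" for \<xi> using arrow_mem[OF p b(1)[OF that]] .
    then show "(\<lambda>\<xi>. arrow \<alpha> \<mu> (b \<xi>)) ` topspace X \<subseteq> \<Union>(boundary_basis \<Lambda>)"
      using topspace_GT by (auto simp: tX boundary_groupoid_def)
  next
    fix U assume "U \<in> boundary_basis \<Lambda>"
    then obtain \<beta> \<nu> G where U: "U = Z_pair_minus \<Lambda> \<beta> \<nu> G" "(\<beta>, \<nu>) \<in> pairs" "finite G" "G \<subseteq> paths_from \<Lambda> (src \<Lambda> \<beta>)"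
      by (auto simp: boundary_basis_def pairs_def)
    have q: "(comp \<Lambda> \<beta> \<gamma>, comp \<Lambda> \<nu> \<gamma>) \<in> pairs" if "\<gamma> \<in> G" for \<gamma>
      using pairs_comp(1)[OF U(2)] that U(4) by (auto simp: paths_from_def)
    have pre: "arrow \<alpha> \<mu> (b \<xi>) \<in> Z_pair \<Lambda> \<beta>' \<nu>' \<longleftrightarrow> (\<exists>\<rho> \<in> meet_exts \<alpha> \<mu> \<beta>' \<nu>'. \<xi> \<rho>)"
      if "\<xi> \<in> S" "(\<beta>', \<nu>') \<in> pairs" for \<xi> \<beta>' \<nu>'
      using arrow_mem_Z_pair_iff[OF p that(2) b(1)[OF that(1)]] b(2)[OF that(1)] by auto
    let ?W = "{\<xi>. (\<exists>\<rho> \<in> meet_exts \<alpha> \<mu> \<beta> \<nu>. \<xi> \<rho>)} -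
      (\<Union>\<gamma> \<in> G. {\<xi>. (\<exists>\<rho> \<in> meet_exts \<alpha> \<mu> (comp \<Lambda> \<beta> \<gamma>) (comp \<Lambda> \<nu> \<gamma>). \<xi> \<rho>)})"
    have "open {\<xi>. (\<exists>\<rho> \<in> meet_exts \<alpha> \<mu> \<beta> \<nu>. \<xi> \<rho>)}"
      unfolding Collect_bex_eq by (intro open_UN ballI clopen_coordinate)
    moreover have "closed (\<Union>\<gamma> \<in> G. {\<xi>. (\<exists>\<rho> \<in> meet_exts \<alpha> \<mu> (comp \<Lambda> \<beta> \<gamma>) (comp \<Lambda> \<nu> \<gamma>). \<xi> \<rho>)})"
      by (intro closed_UN U(3) ballI closed_Collect_bex_finite finite_meet_exts clopen_coordinate(2)
          pairsD(1)[OF p] pairsD(1)[OF q])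
    ultimately have "open ?W" by (rule open_Diff)
    moreover have "(\<lambda>\<xi>. arrow \<alpha> \<mu> (b \<xi>)) -` U \<inter> topspace X = S \<inter> ?W"
    proof (rule Set.set_eqI)
      fix \<xi>
      show "\<xi> \<in> (\<lambda>\<xi>. arrow \<alpha> \<mu> (b \<xi>)) -` U \<inter> topspace X \<longleftrightarrow> \<xi> \<in> S \<inter> ?W"
        using pre[OF _ U(2)] pre[OF _ q] unfolding U(1) Z_pair_minus_def tX by (cases "\<xi> \<in> S") simp_all
    qed
    ultimately show "openin X ((\<lambda>\<xi>. arrow \<alpha> \<mu> (b \<xi>)) -` U \<inter> topspace X)"
      unfolding X_def by (simp add: openin_open_Int)
  qed
  then have "compactin GT ((\<lambda>\<xi>. arrow \<alpha> \<mu> (b \<xi>)) ` S)"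
    using image_compactin[OF cS] by (simp add: boundary_groupoid_def)
  moreover have "(\<lambda>\<xi>. arrow \<alpha> \<mu> (b \<xi>)) ` S = Z_pair \<Lambda> \<alpha> \<mu>"
  proof (intro equalityI subsetI)
    fix a assume "a \<in> (\<lambda>\<xi>. arrow \<alpha> \<mu> (b \<xi>)) ` S"
    then show "a \<in> Z_pair \<Lambda> \<alpha> \<mu>" using b(1) unfolding Z_pair_eq[OF p] by blast
  next
    fix a assume "a \<in> Z_pair \<Lambda> \<alpha> \<mu>"
    then obtain z where z: "z \<in> boundary_paths_from \<Lambda> ?v" "a = arrow \<alpha> \<mu> z" unfolding Z_pair_eq[OF p] by blast
    then have zB: "z \<in> boundary_paths \<Lambda>" "?v \<in> initial_segs z" using mem_boundary_paths_from[OF v] by auto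
    let ?\<xi> = "\<lambda>\<beta>. \<beta> \<in> initial_segs z"
    have S: "?\<xi> \<in> S" using initial_segs_tight[OF zB(1)] zB(2) by (simp add: S_def)
    have "b ?\<xi> = z"
      by (rule initial_segs_inj) (use b[OF S] zB in \<open>auto simp: boundary_paths_from_def\<close>)
    then show "a \<in> (\<lambda>\<xi>. arrow \<alpha> \<mu> (b \<xi>)) ` S" using z(2) S by (metis imageI)
  qed
  ultimately show ?thesis by simp
qed

end

section \<open>The Steinberg algebra of the boundary-path groupoid\<close>

locale boundary_steinberg = finitely_aligned_kgraph \<Lambda> + cring R
  for \<Lambda> :: "('l, 'k::finite) kgraph" and R :: "('r, 'm) ring_scheme" (structure)
begin

abbreviation SA :: "('r, ('l, 'k) barrow \<Rightarrow> 'r) module" where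
  "SA \<equiv> steinberg_algebra R (boundary_groupoid \<Lambda>)"

abbreviation ind :: "('l, 'k) barrow set \<Rightarrow> ('l, 'k) barrow \<Rightarrow> 'r" where
  "ind \<equiv> char_fun R (boundary_groupoid \<Lambda>)"

lemma arrows_boundary_groupoid [simp]: "arrows (boundary_groupoid \<Lambda>) = boundary_arrows \<Lambda>"
  by (simp add: boundary_groupoid_def)

lemma SA_simps:
  "\<zero>\<^bsub>SA\<^esub> = (\<lambda>a \<in> boundary_arrows \<Lambda>. \<zero>)"
  "f \<oplus>\<^bsub>SA\<^esub> g = (\<lambda>a \<in> boundary_arrows \<Lambda>. f a \<oplus> g a)"
  "r \<odot>\<^bsub>SA\<^esub> f = (\<lambda>a \<in> boundary_arrows \<Lambda>. r \<otimes> f a)"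
  "ind U = (\<lambda>a \<in> boundary_arrows \<Lambda>. if a \<in> U then \<one> else \<zero>)"
  by (simp_all add: steinberg_algebra_def char_fun_def)

lemma SA_carrierD:
  assumes "f \<in> carrier SA"
  shows "f \<in> boundary_arrows \<Lambda> \<rightarrow>\<^sub>E carrier R"
    "\<And>a. a \<in> boundary_arrows \<Lambda> \<Longrightarrow> f a \<in> carrier R"
    "\<And>a. a \<in> boundary_arrows \<Lambda> \<Longrightarrow> \<exists>U. openin GT U \<and> a \<in> U \<and> (\<forall>b \<in> U. f b = f a)"
    "\<exists>K. compactin GT K \<and> {a \<in> boundary_arrows \<Lambda>. f a \<noteq> \<zero>} \<subseteq> K"
proof -
  let ?S = "{a \<in> boundary_arrows \<Lambda>. f a \<noteq> \<zero>}"
  have h: "f \<in> boundary_arrows \<Lambda> \<rightarrow>\<^sub>E carrier R \<and>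
    (\<forall>a \<in> boundary_arrows \<Lambda>. \<exists>U. openin GT U \<and> a \<in> U \<and> (\<forall>b \<in> U. f b = f a)) \<and>
    compactin GT (GT closure_of ?S)"
    using assms by (simp add: steinberg_algebra_def)
  then show "f \<in> boundary_arrows \<Lambda> \<rightarrow>\<^sub>E carrier R" by blast
  then show "\<And>a. a \<in> boundary_arrows \<Lambda> \<Longrightarrow> f a \<in> carrier R" by (auto simp: PiE_iff)
  show "\<And>a. a \<in> boundary_arrows \<Lambda> \<Longrightarrow> \<exists>U. openin GT U \<and> a \<in> U \<and> (\<forall>b \<in> U. f b = f a)" using h by blast
  have "?S \<subseteq> GT closure_of ?S" by (rule closure_of_subset) (auto simp: topspace_GT)
  then show "\<exists>K. compactin GT K \<and> ?S \<subseteq> K" using h by blast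
qed

text \<open>\<open>steinberg_algebra\<close> asks for the closure of the support to be compact. A
  locally constant function has closed support, so it suffices to place the support inside some
  compact set.\<close>

lemma SA_carrierI:
  assumes f: "f \<in> boundary_arrows \<Lambda> \<rightarrow>\<^sub>E carrier R"
    and loc: "\<And>a. a \<in> boundary_arrows \<Lambda> \<Longrightarrow> \<exists>U. openin GT U \<and> a \<in> U \<and> (\<forall>b \<in> U. f b = f a)"
    and K: "compactin GT K" "{a \<in> boundary_arrows \<Lambda>. f a \<noteq> \<zero>} \<subseteq> K"
  shows "f \<in> carrier SA" "compactin GT {a \<in> boundary_arrows \<Lambda>. f a \<noteq> \<zero>}"
proof -
  let ?S = "{a \<in> boundary_arrows \<Lambda>. f a \<noteq> \<zero>}"
  have "openin GT (boundary_arrows \<Lambda> - ?S)"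
  proof (subst openin_subopen, intro ballI)
    fix a assume a: "a \<in> boundary_arrows \<Lambda> - ?S"
    then obtain U where U: "openin GT U" "a \<in> U" "\<forall>b \<in> U. f b = f a" using loc by blast
    have "U \<subseteq> boundary_arrows \<Lambda>" using openin_subset[OF U(1)] by (simp add: topspace_GT)
    moreover have "f a = \<zero>" using a by blast
    ultimately have "U \<subseteq> boundary_arrows \<Lambda> - ?S" using U(3) by fastforce
    then show "\<exists>T. openin GT T \<and> a \<in> T \<and> T \<subseteq> boundary_arrows \<Lambda> - ?S" using U(1,2) by blast
  qed
  then have cl: "closedin GT ?S" by (auto simp: closedin_def topspace_GT)
  then show c: "compactin GT ?S" using closed_compactin[OF K] by blast
  then have "compactin GT (GT closure_of ?S)" using cl by (simp add: closure_of_closedin)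
  then show "f \<in> carrier SA" using f loc by (simp add: steinberg_algebra_def)
qed

lemma SA_ext:
  assumes "f \<in> boundary_arrows \<Lambda> \<rightarrow>\<^sub>E carrier R" "g \<in> boundary_arrows \<Lambda> \<rightarrow>\<^sub>E carrier R"
    "\<And>a. a \<in> boundary_arrows \<Lambda> \<Longrightarrow> f a = g a"
  shows "f = g"
  using assms by (rule PiE_ext)

lemma SA_zero_closed: "\<zero>\<^bsub>SA\<^esub> \<in> carrier SA"
  by (rule SA_carrierI(1)[of _ "{}"]) (auto simp: SA_simps topspace_GT[symmetric] intro!: exI[of _ "topspace GT"])

lemma SA_add_closed:
  assumes f: "f \<in> carrier SA" and g: "g \<in> carrier SA"
  shows "f \<oplus>\<^bsub>SA\<^esub> g \<in> carrier SA"
proof -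
  note fd = SA_carrierD[OF f] and gd = SA_carrierD[OF g]
  obtain K L where K: "compactin GT K" "{a \<in> boundary_arrows \<Lambda>. f a \<noteq> \<zero>} \<subseteq> K"
    and L: "compactin GT L" "{a \<in> boundary_arrows \<Lambda>. g a \<noteq> \<zero>} \<subseteq> L"
    using fd(4) gd(4) by blast
  show ?thesis
  proof (rule SA_carrierI(1))
    show "f \<oplus>\<^bsub>SA\<^esub> g \<in> boundary_arrows \<Lambda> \<rightarrow>\<^sub>E carrier R" using fd(2) gd(2) by (auto simp: SA_simps)
    show "compactin GT (K \<union> L)" using K(1) L(1) by (rule compactin_Un)
    have "f a \<noteq> \<zero> \<or> g a \<noteq> \<zero>" if "a \<in> boundary_arrows \<Lambda>" "f a \<oplus> g a \<noteq> \<zero>" for a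
      using that by auto
    moreover have "(f \<oplus>\<^bsub>SA\<^esub> g) a = f a \<oplus> g a" if "a \<in> boundary_arrows \<Lambda>" for a using that by (simp add: SA_simps)
    ultimately show "{a \<in> boundary_arrows \<Lambda>. (f \<oplus>\<^bsub>SA\<^esub> g) a \<noteq> \<zero>} \<subseteq> K \<union> L"
      using K(2) L(2) by fastforce
    fix a assume a: "a \<in> boundary_arrows \<Lambda>"
    obtain U where U: "openin GT U" "a \<in> U" "\<forall>b \<in> U. f b = f a" using fd(3)[OF a] by blast
    obtain W where W: "openin GT W" "a \<in> W" "\<forall>b \<in> W. g b = g a" using gd(3)[OF a] by blast
    have "U \<subseteq> boundary_arrows \<Lambda>" using openin_subset[OF U(1)] by (simp add: topspace_GT)
    then have "(f \<oplus>\<^bsub>SA\<^esub> g) b = (f \<oplus>\<^bsub>SA\<^esub> g) a" if "b \<in> U \<inter> W" for b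
      using U(3) W(3) a that subsetD[of U "boundary_arrows \<Lambda>" b] by (simp add: SA_simps)
    moreover have "openin GT (U \<inter> W)" "a \<in> U \<inter> W" using U(1,2) W(1,2) by (simp_all add: openin_Int)
    ultimately show "\<exists>U. openin GT U \<and> a \<in> U \<and> (\<forall>b \<in> U. (f \<oplus>\<^bsub>SA\<^esub> g) b = (f \<oplus>\<^bsub>SA\<^esub> g) a)"
      by blast
  qed
qed

lemma SA_smult_closed:
  assumes r: "r \<in> carrier R" and f: "f \<in> carrier SA"
  shows "r \<odot>\<^bsub>SA\<^esub> f \<in> carrier SA"
proof -
  note fd = SA_carrierD[OF f]
  obtain K where K: "compactin GT K" "{a \<in> boundary_arrows \<Lambda>. f a \<noteq> \<zero>} \<subseteq> K"
    using fd(4) by blast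
  show ?thesis
  proof (rule SA_carrierI(1))
    show "r \<odot>\<^bsub>SA\<^esub> f \<in> boundary_arrows \<Lambda> \<rightarrow>\<^sub>E carrier R" using fd(2) r by (auto simp: SA_simps)
    show "compactin GT K" by fact
    have "f a \<noteq> \<zero>" if "a \<in> boundary_arrows \<Lambda>" "r \<otimes> f a \<noteq> \<zero>" for a
      using that r by auto
    moreover have "(r \<odot>\<^bsub>SA\<^esub> f) a = r \<otimes> f a" if "a \<in> boundary_arrows \<Lambda>" for a using that by (simp add: SA_simps)
    ultimately show "{a \<in> boundary_arrows \<Lambda>. (r \<odot>\<^bsub>SA\<^esub> f) a \<noteq> \<zero>} \<subseteq> K"
      using K(2) by fastforce
    fix a assume a: "a \<in> boundary_arrows \<Lambda>"
    obtain U where U: "openin GT U" "a \<in> U" "\<forall>b \<in> U. f b = f a" using fd(3)[OF a] by blast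
    have "U \<subseteq> boundary_arrows \<Lambda>" using openin_subset[OF U(1)] by (simp add: topspace_GT)
    then have "(r \<odot>\<^bsub>SA\<^esub> f) b = (r \<odot>\<^bsub>SA\<^esub> f) a" if "b \<in> U" for b
      using U(3) a that subsetD[of U "boundary_arrows \<Lambda>" b] by (simp add: SA_simps)
    then show "\<exists>U. openin GT U \<and> a \<in> U \<and> (\<forall>b \<in> U. (r \<odot>\<^bsub>SA\<^esub> f) b = (r \<odot>\<^bsub>SA\<^esub> f) a)"
      using U by blast
  qed
qed

lemma ind_closed:
  assumes p: "(\<alpha>, \<mu>) \<in> pairs"
  shows "ind (Z_pair \<Lambda> \<alpha> \<mu>) \<in> carrier SA"
proof (rule SA_carrierI(1))
  let ?Z = "Z_pair \<Lambda> \<alpha> \<mu>"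
  show "ind ?Z \<in> boundary_arrows \<Lambda> \<rightarrow>\<^sub>E carrier R" by (auto simp: SA_simps)
  show "compactin GT ?Z" by (rule compactin_Z_pair[OF p])
  show "{a \<in> boundary_arrows \<Lambda>. ind ?Z a \<noteq> \<zero>} \<subseteq> ?Z" by (auto simp: SA_simps split: if_splits)
  fix a assume a: "a \<in> boundary_arrows \<Lambda>"
  show "\<exists>U. openin GT U \<and> a \<in> U \<and> (\<forall>b \<in> U. ind ?Z b = ind ?Z a)"
  proof (cases "a \<in> ?Z")
    case True
    then show ?thesis using openin_Z_pair[OF p] Z_pair_subset a
      by (intro exI[of _ ?Z]) (auto simp: SA_simps)
  next
    case False
    then show ?thesis using openin_Compl_Z_pair[OF p] a
      by (intro exI[of _ "boundary_arrows \<Lambda> - ?Z"]) (auto simp: SA_simps)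
  qed
qed

lemma SA_module: "module R SA"
proof (rule moduleI)
  note c = SA_carrierD(2)
  note e = SA_carrierD(1)
  have ext: "f = (\<lambda>a \<in> boundary_arrows \<Lambda>. f a)" if "f \<in> carrier SA" for f
    using e[OF that] by (simp add: PiE_iff extensional_restrict)
  show "abelian_group SA"
  proof (rule abelian_groupI)
    fix x y z assume x: "x \<in> carrier SA" and y: "y \<in> carrier SA" and z: "z \<in> carrier SA"
    show "x \<oplus>\<^bsub>SA\<^esub> y \<in> carrier SA" by (rule SA_add_closed[OF x y])
    show "x \<oplus>\<^bsub>SA\<^esub> y \<oplus>\<^bsub>SA\<^esub> z = x \<oplus>\<^bsub>SA\<^esub> (y \<oplus>\<^bsub>SA\<^esub> z)"
      unfolding SA_simps by (rule restrict_ext) (simp add: c[OF x] c[OF y] c[OF z] a_assoc)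
    show "x \<oplus>\<^bsub>SA\<^esub> y = y \<oplus>\<^bsub>SA\<^esub> x"
      unfolding SA_simps by (rule restrict_ext) (simp add: c[OF x] c[OF y] a_comm)
    show "\<zero>\<^bsub>SA\<^esub> \<oplus>\<^bsub>SA\<^esub> x = x"
      unfolding SA_simps by (subst (2) ext[OF x], rule restrict_ext) (simp add: c[OF x])
    have "(\<ominus> \<one>) \<odot>\<^bsub>SA\<^esub> x \<in> carrier SA" by (rule SA_smult_closed[OF _ x]) simp
    moreover have "(\<ominus> \<one>) \<odot>\<^bsub>SA\<^esub> x \<oplus>\<^bsub>SA\<^esub> x = \<zero>\<^bsub>SA\<^esub>"
      unfolding SA_simps by (rule restrict_ext) (simp add: c[OF x] l_minus l_neg)
    ultimately show "\<exists>y \<in> carrier SA. y \<oplus>\<^bsub>SA\<^esub> x = \<zero>\<^bsub>SA\<^esub>" by blast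
  qed (rule SA_zero_closed)
next
  note c = SA_carrierD(2)
  fix r s x y assume r: "r \<in> carrier R" and s: "s \<in> carrier R" and x: "x \<in> carrier SA" and y: "y \<in> carrier SA"
  show "r \<odot>\<^bsub>SA\<^esub> x \<in> carrier SA" by (rule SA_smult_closed[OF r x])
  show "(r \<oplus> s) \<odot>\<^bsub>SA\<^esub> x = r \<odot>\<^bsub>SA\<^esub> x \<oplus>\<^bsub>SA\<^esub> s \<odot>\<^bsub>SA\<^esub> x"
    unfolding SA_simps by (rule restrict_ext) (simp add: c[OF x] r s l_distr)
  show "r \<odot>\<^bsub>SA\<^esub> (x \<oplus>\<^bsub>SA\<^esub> y) = r \<odot>\<^bsub>SA\<^esub> x \<oplus>\<^bsub>SA\<^esub> r \<odot>\<^bsub>SA\<^esub> y"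
    unfolding SA_simps by (rule restrict_ext) (simp add: c[OF x] c[OF y] r r_distr)
  show "(r \<otimes> s) \<odot>\<^bsub>SA\<^esub> x = r \<odot>\<^bsub>SA\<^esub> (s \<odot>\<^bsub>SA\<^esub> x)"
    unfolding SA_simps by (rule restrict_ext) (simp add: c[OF x] r s m_assoc)
next
  fix x assume x: "x \<in> carrier SA"
  have "\<one> \<odot>\<^bsub>SA\<^esub> x = (\<lambda>a \<in> boundary_arrows \<Lambda>. x a)"
    unfolding SA_simps by (rule restrict_ext) (simp add: SA_carrierD(2)[OF x])
  also have "\<dots> = x" using SA_carrierD(1)[OF x] by (simp add: PiE_iff extensional_restrict)
  finally show "\<one> \<odot>\<^bsub>SA\<^esub> x = x" .
qed (rule is_cring)

sublocale SA: module R SA by (rule SA_module)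

section \<open>Spanning by indicator functions\<close>

inductive_set ind_span :: "(('l, 'k) barrow \<Rightarrow> 'r) set" where
  zero: "\<zero>\<^bsub>SA\<^esub> \<in> ind_span"
| step: "\<lbrakk>r \<in> carrier R; (\<alpha>, \<mu>) \<in> pairs; f \<in> ind_span\<rbrakk>
    \<Longrightarrow> r \<odot>\<^bsub>SA\<^esub> ind (Z_pair \<Lambda> \<alpha> \<mu>) \<oplus>\<^bsub>SA\<^esub> f \<in> ind_span"

lemma ind_span_closed: "f \<in> ind_span \<Longrightarrow> f \<in> carrier SA"
  by (induction rule: ind_span.induct) (simp_all add: ind_closed)

lemma ind_span_add: "\<lbrakk>f \<in> ind_span; g \<in> ind_span\<rbrakk> \<Longrightarrow> f \<oplus>\<^bsub>SA\<^esub> g \<in> ind_span"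
proof (induction rule: ind_span.induct)
  case zero
  then show ?case using ind_span_closed by simp
next
  case (step r \<alpha> \<mu> f)
  then have "r \<odot>\<^bsub>SA\<^esub> ind (Z_pair \<Lambda> \<alpha> \<mu>) \<oplus>\<^bsub>SA\<^esub> (f \<oplus>\<^bsub>SA\<^esub> g) \<in> ind_span" by (intro ind_span.step) auto
  then show ?case using step ind_span_closed by (simp add: ind_closed SA.M.a_assoc)
qed

lemma ind_span_smult: "\<lbrakk>f \<in> ind_span; s \<in> carrier R\<rbrakk> \<Longrightarrow> s \<odot>\<^bsub>SA\<^esub> f \<in> ind_span"
proof (induction rule: ind_span.induct)
  case zero
  then show ?case by (simp add: ind_span.zero)
next
  case (step r \<alpha> \<mu> f)
  then have "(s \<otimes> r) \<odot>\<^bsub>SA\<^esub> ind (Z_pair \<Lambda> \<alpha> \<mu>) \<oplus>\<^bsub>SA\<^esub> (s \<odot>\<^bsub>SA\<^esub> f) \<in> ind_span" by (intro ind_span.step) auto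
  then show ?case using step ind_span_closed by (simp add: ind_closed SA.smult_r_distr SA.smult_assoc1)
qed

definition restr :: "(('l, 'k) barrow \<Rightarrow> 'r) \<Rightarrow> ('l, 'k) barrow set \<Rightarrow> ('l, 'k) barrow \<Rightarrow> 'r" where
  "restr f U = (\<lambda>a \<in> boundary_arrows \<Lambda>. if a \<in> U then f a else \<zero>)"

lemma ind_Union_mem:
  assumes "finite K" "r \<in> carrier R" "\<And>\<rho>. \<rho> \<in> K \<Longrightarrow> (\<phi> \<rho>, \<psi> \<rho>) \<in> pairs"
    and "\<And>\<rho> \<rho>'. \<lbrakk>\<rho> \<in> K; \<rho>' \<in> K; \<rho> \<noteq> \<rho>'\<rbrakk> \<Longrightarrow> Z_pair \<Lambda> (\<phi> \<rho>) (\<psi> \<rho>) \<inter> Z_pair \<Lambda> (\<phi> \<rho>') (\<psi> \<rho>') = {}"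
  shows "r \<odot>\<^bsub>SA\<^esub> ind (\<Union>\<rho> \<in> K. Z_pair \<Lambda> (\<phi> \<rho>) (\<psi> \<rho>)) \<in> ind_span"
  using assms
proof (induction K rule: finite_induct)
  case empty
  then have "r \<odot>\<^bsub>SA\<^esub> ind (\<Union>\<rho> \<in> {}. Z_pair \<Lambda> (\<phi> \<rho>) (\<psi> \<rho>)) = \<zero>\<^bsub>SA\<^esub>"
    unfolding SA_simps by (intro restrict_ext) simp
  then show ?case by (simp add: ind_span.zero)
next
  case (insert \<rho> K)
  let ?Y = "\<Union>\<rho> \<in> K. Z_pair \<Lambda> (\<phi> \<rho>) (\<psi> \<rho>)"
  have d: "Z_pair \<Lambda> (\<phi> \<rho>) (\<psi> \<rho>) \<inter> ?Y = {}" using insert.prems(3) insert.hyps(2) by blast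
  have "r \<odot>\<^bsub>SA\<^esub> ind (\<Union>\<rho> \<in> insert \<rho> K. Z_pair \<Lambda> (\<phi> \<rho>) (\<psi> \<rho>))
     = r \<odot>\<^bsub>SA\<^esub> ind (Z_pair \<Lambda> (\<phi> \<rho>) (\<psi> \<rho>)) \<oplus>\<^bsub>SA\<^esub> r \<odot>\<^bsub>SA\<^esub> ind ?Y"
    unfolding SA_simps UN_insert
  proof (rule restrict_ext)
    fix a assume a: "a \<in> boundary_arrows \<Lambda>"
    show "r \<otimes> (\<lambda>a \<in> boundary_arrows \<Lambda>. if a \<in> Z_pair \<Lambda> (\<phi> \<rho>) (\<psi> \<rho>) \<union> ?Y then \<one> else \<zero>) a =
      (\<lambda>a \<in> boundary_arrows \<Lambda>. r \<otimes> (\<lambda>a \<in> boundary_arrows \<Lambda>. if a \<in> Z_pair \<Lambda> (\<phi> \<rho>) (\<psi> \<rho>) then \<one> else \<zero>) a) a \<oplus>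
      (\<lambda>a \<in> boundary_arrows \<Lambda>. r \<otimes> (\<lambda>a \<in> boundary_arrows \<Lambda>. if a \<in> ?Y then \<one> else \<zero>) a) a"
      using a d insert.prems(1) by (cases "a \<in> Z_pair \<Lambda> (\<phi> \<rho>) (\<psi> \<rho>)"; cases "a \<in> ?Y") auto
  qed
  moreover have "r \<odot>\<^bsub>SA\<^esub> ind ?Y \<in> ind_span" using insert by simp
  ultimately show ?case using ind_span.step[of r "\<phi> \<rho>" "\<psi> \<rho>"] insert.prems by simp
qed

lemma restr_simps:
  assumes "f \<in> carrier SA"
  shows "restr f (U \<inter> W) = restr (restr f U) W"
    and "restr f (- U) = f \<oplus>\<^bsub>SA\<^esub> (\<ominus> \<one>) \<odot>\<^bsub>SA\<^esub> restr f U"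
    and "restr f (U \<union> W) = restr f U \<oplus>\<^bsub>SA\<^esub> restr (restr f W) (- U)"
  using SA_carrierD(2)[OF assms]
  unfolding restr_def SA_simps by (auto intro!: restrict_ext simp: l_minus r_neg)

text \<open>For an indicator this is the indicator of an intersection, which by
  \<open>Z_pair_inter\<close> is a finite union of \<open>Z_pair\<close> sets. Their left-hand paths
  are different and of equal degree, so the union is disjoint and its indicator is a sum.\<close>

lemma restr_ind_span:
  assumes f: "f \<in> ind_span" and p: "(\<beta>, \<nu>) \<in> pairs"
  shows "restr f (Z_pair \<Lambda> \<beta> \<nu>) \<in> ind_span"
  using f
proof (induction rule: ind_span.induct)
  case zero
  have "restr \<zero>\<^bsub>SA\<^esub> (Z_pair \<Lambda> \<beta> \<nu>) = \<zero>\<^bsub>SA\<^esub>" unfolding restr_def SA_simps by (rule restrict_ext) simp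
  then show ?case by (simp add: ind_span.zero)
next
  case (step r \<alpha> \<mu> f)
  let ?K = "meet_exts \<alpha> \<mu> \<beta> \<nu>"
  note fd = SA_carrierD(2)[OF ind_span_closed[OF step(3)]]
  have "restr (r \<odot>\<^bsub>SA\<^esub> ind (Z_pair \<Lambda> \<alpha> \<mu>) \<oplus>\<^bsub>SA\<^esub> f) (Z_pair \<Lambda> \<beta> \<nu>)
    = r \<odot>\<^bsub>SA\<^esub> ind (Z_pair \<Lambda> \<alpha> \<mu> \<inter> Z_pair \<Lambda> \<beta> \<nu>) \<oplus>\<^bsub>SA\<^esub> restr f (Z_pair \<Lambda> \<beta> \<nu>)"
    unfolding restr_def SA_simps by (rule restrict_ext) (use step(1) fd in simp)
  moreover have "r \<odot>\<^bsub>SA\<^esub> ind (Z_pair \<Lambda> \<alpha> \<mu> \<inter> Z_pair \<Lambda> \<beta> \<nu>) \<in> ind_span"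
    unfolding Z_pair_inter[OF step(2) p]
  proof (rule ind_Union_mem)
    show "finite ?K" by (rule finite_meet_exts[OF pairsD(1)[OF step(2)] pairsD(1)[OF p]])
    show "(comp \<Lambda> \<alpha> \<rho>, comp \<Lambda> \<mu> \<rho>) \<in> pairs" if "\<rho> \<in> ?K" for \<rho>
      using pairs_comp(1)[OF step(2) meet_exts_paths[OF that]] .
    fix \<rho> \<rho>' assume r: "\<rho> \<in> ?K" "\<rho>' \<in> ?K" "\<rho> \<noteq> \<rho>'"
    note m = meet_exts_paths[OF r(1)] and m' = meet_exts_paths[OF r(2)]
    note a = pairsD(1)[OF step(2)]
    have "deg \<Lambda> (comp \<Lambda> \<alpha> \<rho>) = deg \<Lambda> (comp \<Lambda> \<alpha> \<rho>')"
      using r(1,2) Lambda_minD(6) unfolding meet_exts_def by fastforce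
    moreover have "comp \<Lambda> \<alpha> \<rho> \<noteq> comp \<Lambda> \<alpha> \<rho>'" using comp_left_cancel[OF a m m'] r(3) by blast
    ultimately show "Z_pair \<Lambda> (comp \<Lambda> \<alpha> \<rho>) (comp \<Lambda> \<mu> \<rho>) \<inter> Z_pair \<Lambda> (comp \<Lambda> \<alpha> \<rho>') (comp \<Lambda> \<mu> \<rho>') = {}"
      by (rule Z_pair_disjoint[OF pairs_comp(1)[OF step(2) m] pairs_comp(1)[OF step(2) m']])
  qed (rule step(1))
  ultimately show ?case using ind_span_add step.IH by simp
qed

text \<open>The splitting sets form a Boolean algebra that contains a basis of the topology, so finitely many
  of them cover the support of a locally constant function and cut it into pieces of the span.\<close>

definition splitting :: "('l, 'k) barrow set set" where
  "splitting = {U. \<forall>f \<in> ind_span. restr f U \<in> ind_span}"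

lemma splitting_Int: "\<lbrakk>U \<in> splitting; W \<in> splitting\<rbrakk> \<Longrightarrow> U \<inter> W \<in> splitting"
  unfolding splitting_def using restr_simps(1)[OF ind_span_closed] by auto

lemma splitting_Compl: "U \<in> splitting \<Longrightarrow> - U \<in> splitting"
  unfolding splitting_def using restr_simps(2)[OF ind_span_closed] by (auto intro!: ind_span_add ind_span_smult)

lemma splitting_Z_pair: "(\<alpha>, \<mu>) \<in> pairs \<Longrightarrow> Z_pair \<Lambda> \<alpha> \<mu> \<in> splitting"
  by (simp add: splitting_def restr_ind_span)

lemma splitting_Z_pair_minus:
  assumes p: "(\<alpha>, \<mu>) \<in> pairs" and G: "finite G" "G \<subseteq> paths_from \<Lambda> (src \<Lambda> \<alpha>)"
  shows "Z_pair_minus \<Lambda> \<alpha> \<mu> G \<in> splitting"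
  using G
proof (induction G rule: finite_induct)
  case empty
  then show ?case using splitting_Z_pair[OF p] by (simp add: Z_pair_minus_def)
next
  case (insert \<nu> G)
  have "(comp \<Lambda> \<alpha> \<nu>, comp \<Lambda> \<mu> \<nu>) \<in> pairs"
    using pairs_comp(1)[OF p] insert.prems by (auto simp: paths_from_def)
  then have "- Z_pair \<Lambda> (comp \<Lambda> \<alpha> \<nu>) (comp \<Lambda> \<mu> \<nu>) \<inter> Z_pair_minus \<Lambda> \<alpha> \<mu> G \<in> splitting"
    using insert by (intro splitting_Int splitting_Compl splitting_Z_pair) auto
  moreover have "Z_pair_minus \<Lambda> \<alpha> \<mu> (insert \<nu> G) = - Z_pair \<Lambda> (comp \<Lambda> \<alpha> \<nu>) (comp \<Lambda> \<mu> \<nu>) \<inter> Z_pair_minus \<Lambda> \<alpha> \<mu> G"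
    by (auto simp: Z_pair_minus_def)
  ultimately show ?case by simp
qed

text \<open>The induction follows the generation of the topology from \<open>boundary_basis\<close>;
  finite intersections are absorbed by \<open>splitting_Int\<close>.\<close>

lemma splitting_neighbourhood:
  assumes "openin GT U" "a \<in> U"
  shows "\<exists>W \<in> splitting. openin GT W \<and> a \<in> W \<and> W \<subseteq> U"
proof -
  have e: "GT = topology_generated_by (boundary_basis \<Lambda>)" by (simp add: boundary_groupoid_def)
  have "generate_topology_on (boundary_basis \<Lambda>) U"
    using assms(1) unfolding e by (rule openin_topology_generated_by)
  then show ?thesis using assms(2)
  proof (induction rule: generate_topology_on.induct)
    case (Int U U')
    then obtain W W' where "W \<in> splitting" "openin GT W" "a \<in> W" "W \<subseteq> U"
      "W' \<in> splitting" "openin GT W'" "a \<in> W'" "W' \<subseteq> U'" by blast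
    then show ?case by (intro bexI[of _ "W \<inter> W'"]) (auto intro: splitting_Int)
  next
    case (UN K)
    then obtain U where U: "U \<in> K" "a \<in> U" by blast
    then show ?case using UN.IH[OF U] by blast
  next
    case (Basis U)
    then obtain \<beta> \<nu> G where U: "U = Z_pair_minus \<Lambda> \<beta> \<nu> G" "(\<beta>, \<nu>) \<in> pairs" "finite G" "G \<subseteq> paths_from \<Lambda> (src \<Lambda> \<beta>)"
      by (auto simp: boundary_basis_def pairs_def)
    then show ?case using Basis.prems splitting_Z_pair_minus[OF U(2-4)] openin_Z_pair_minus[OF U(2-4)] by blast
  qed simp
qed

text \<open>Near each arrow \<open>a\<close> the function \<open>f\<close> agrees with
  \<open>f a\<close> times the indicator of some \<open>Z_pair\<close>, and on a small enough set in
  \<open>splitting\<close> the restriction of \<open>f\<close> lies in the span. Compactness of the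
  support leaves finitely many such sets.\<close>

theorem SA_carrier_eq: "carrier SA = ind_span"
proof (intro equalityI subsetI)
  fix f assume f: "f \<in> carrier SA"
  note fd = SA_carrierD[OF f]
  define C where "C = {W \<in> splitting. openin GT W \<and> restr f W \<in> ind_span}"
  have nb: "\<exists>W \<in> C. a \<in> W" if a: "a \<in> boundary_arrows \<Lambda>" for a
  proof -
    obtain U where U: "openin GT U" "a \<in> U" "\<forall>b \<in> U. f b = f a" using fd(3)[OF a] by blast
    obtain \<alpha> \<mu> z where z: "(\<alpha>, \<mu>) \<in> pairs" "z \<in> boundary_paths_from \<Lambda> (src \<Lambda> \<alpha>)" "a = arrow \<alpha> \<mu> z"
      using a by (rule arrowE)
    have "openin GT (U \<inter> Z_pair \<Lambda> \<alpha> \<mu>)" "a \<in> U \<inter> Z_pair \<Lambda> \<alpha> \<mu>"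
      using U(1,2) openin_Z_pair[OF z(1)] z Z_pair_eq[OF z(1)] by auto
    then obtain W where W: "W \<in> splitting" "openin GT W" "a \<in> W" "W \<subseteq> U \<inter> Z_pair \<Lambda> \<alpha> \<mu>"
      using splitting_neighbourhood by blast
    have "f a \<odot>\<^bsub>SA\<^esub> ind (Z_pair \<Lambda> \<alpha> \<mu>) \<oplus>\<^bsub>SA\<^esub> \<zero>\<^bsub>SA\<^esub> \<in> ind_span"
      by (rule ind_span.step[OF fd(2)[OF a] z(1) ind_span.zero])
    then have "restr (f a \<odot>\<^bsub>SA\<^esub> ind (Z_pair \<Lambda> \<alpha> \<mu>)) W \<in> ind_span"
      using W(1) fd(2)[OF a] ind_closed[OF z(1)] by (simp add: splitting_def)
    moreover have "restr f W = restr (f a \<odot>\<^bsub>SA\<^esub> ind (Z_pair \<Lambda> \<alpha> \<mu>)) W"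
      unfolding restr_def SA_simps using W(4) U(3) fd(2)[OF a] by (intro restrict_ext) auto
    ultimately show ?thesis using W by (auto simp: C_def)
  qed
  let ?S = "{a \<in> boundary_arrows \<Lambda>. f a \<noteq> \<zero>}"
  obtain K where K: "compactin GT K" "?S \<subseteq> K" using fd(4) by blast
  have "compactin GT ?S" by (rule SA_carrierI(2)[OF fd(1) fd(3) K])
  moreover have "\<forall>W \<in> C. openin GT W" by (simp add: C_def)
  moreover have "?S \<subseteq> \<Union>C" using nb by blast
  ultimately have "\<exists>F. finite F \<and> F \<subseteq> C \<and> ?S \<subseteq> \<Union>F" unfolding compactin_def by blast
  then obtain F where F: "finite F" "F \<subseteq> C" "?S \<subseteq> \<Union>F" by blast
  have "restr f (\<Union>F) \<in> ind_span" using F(1,2)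
  proof (induction F rule: finite_induct)
    case empty
    have "restr f (\<Union>{}) = \<zero>\<^bsub>SA\<^esub>" unfolding restr_def SA_simps by (rule restrict_ext) simp
    then show ?case by (simp add: ind_span.zero)
  next
    case (insert W F)
    \<comment> \<open>The covering sets overlap; only the part of \<open>\<Union>F\<close> outside
      \<open>W\<close> is added, so that nothing is counted twice.\<close>
    have "restr (restr f (\<Union>F)) (- W) \<in> ind_span"
      using insert splitting_Compl[of W] by (auto simp: splitting_def C_def)
    then show ?case unfolding Union_insert restr_simps(3)[OF f]
      using insert.prems by (intro ind_span_add) (auto simp: C_def)
  qed
  moreover have "restr f (\<Union>F) = f"
  proof (rule SA_ext)
    show "restr f (\<Union>F) \<in> boundary_arrows \<Lambda> \<rightarrow>\<^sub>E carrier R" using fd(2) by (auto simp: restr_def)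
    show "restr f (\<Union>F) a = f a" if "a \<in> boundary_arrows \<Lambda>" for a using that F(3) by (auto simp: restr_def)
  qed (rule fd(1))
  ultimately show "f \<in> ind_span" by simp
qed (rule ind_span_closed)

end

section \<open>Products of arrows and of the sets \<open>Z_pair\<close>\<close>

context finitely_aligned_kgraph
begin

text \<open>\<open>lquot b a\<close> is \<open>b\<^sup>-\<^sup>1a\<close>, the second argument in the convolution sum.\<close>

definition lquot :: "('l, 'k) barrow \<Rightarrow> ('l, 'k) barrow \<Rightarrow> ('l, 'k) barrow" where
  "lquot b a = (snd (snd b), - fst (snd b) + fst (snd a), snd (snd a))"

lemma lquot_arrow:
  assumes "deg \<Lambda> \<alpha> = deg \<Lambda> \<beta>"
  shows "lquot (arrow \<beta> \<nu> u) (arrow \<alpha> \<mu> u) = arrow \<nu> \<mu> u"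
  using assms by (simp add: lquot_def arrow_def deg_diff_def vec_eq_iff)

lemma lquot_lquot: "fst b = fst a \<Longrightarrow> lquot (lquot c b) (lquot c a) = lquot b a"
  by (simp add: lquot_def)

text \<open>Two arrows with the same range can be written with the same left-hand path and the same
  tail, once both are lengthened to a minimal common extension of the given left-hand paths. Their
  quotient can then be read off.\<close>

lemma common_range:
  assumes a: "a \<in> boundary_arrows \<Lambda>" and b: "b \<in> boundary_arrows \<Lambda>" and eq: "fst a = fst b"
  obtains \<alpha> \<mu> \<nu> u where "(\<alpha>, \<mu>) \<in> pairs" "(\<alpha>, \<nu>) \<in> pairs" "u \<in> boundary_paths_from \<Lambda> (src \<Lambda> \<alpha>)"
    "a = arrow \<alpha> \<mu> u" "b = arrow \<alpha> \<nu> u"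
proof -
  obtain \<alpha> \<mu> z where z: "(\<alpha>, \<mu>) \<in> pairs" "z \<in> boundary_paths_from \<Lambda> (src \<Lambda> \<alpha>)" "a = arrow \<alpha> \<mu> z"
    using a by (rule arrowE)
  obtain \<beta> \<nu> w where w: "(\<beta>, \<nu>) \<in> pairs" "w \<in> boundary_paths_from \<Lambda> (src \<Lambda> \<beta>)" "b = arrow \<beta> \<nu> w"
    using b by (rule arrowE)
  note zd = pairsD[OF z(1)] and wd = pairsD[OF w(1)]
  have "prepend \<Lambda> \<alpha> z = prepend \<Lambda> \<beta> w" using eq z(3) w(3) by (simp add: arrow_def)
  then obtain \<rho> \<tau> u where r: "(\<rho>, \<tau>) \<in> Lambda_min \<Lambda> \<alpha> \<beta>" "u \<in> boundary_paths_from \<Lambda> (src \<Lambda> \<rho>)"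
    "z = prepend \<Lambda> \<rho> u" "w = prepend \<Lambda> \<tau> u"
    using prepend_eqE[OF zd(1) z(2) wd(1) w(2)] by metis
  note l = Lambda_minD[OF r(1)]
  have s: "src \<Lambda> \<rho> = src \<Lambda> \<tau>" using Lambda_min_src[OF zd(1) wd(1) r(1)] .
  have u': "u \<in> boundary_paths_from \<Lambda> (src \<Lambda> \<tau>)" using r(2) s by simp
  note c = pairs_comp[OF z(1) l(1,3)] and c' = pairs_comp[OF w(1) l(2,4)]
  have "(comp \<Lambda> \<alpha> \<rho>, comp \<Lambda> \<nu> \<tau>) \<in> pairs" using c'(1) l(5) by simp
  moreover have "u \<in> boundary_paths_from \<Lambda> (src \<Lambda> (comp \<Lambda> \<alpha> \<rho>))" using r(2) c(2) by simp
  moreover have "a = arrow (comp \<Lambda> \<alpha> \<rho>) (comp \<Lambda> \<mu> \<rho>) u" using arrow_comp[OF z(1) l(1,3) r(2)] z(3) r(3) by simp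
  moreover have "b = arrow (comp \<Lambda> \<alpha> \<rho>) (comp \<Lambda> \<nu> \<tau>) u"
    using arrow_comp[OF w(1) l(2,4) u'] w(3) r(4) l(5) by simp
  ultimately show ?thesis using that c(1) by blast
qed

lemma lquot_mem:
  assumes "a \<in> boundary_arrows \<Lambda>" "b \<in> boundary_arrows \<Lambda>" "fst a = fst b"
  shows "lquot b a \<in> boundary_arrows \<Lambda>"
proof -
  obtain \<alpha> \<mu> \<nu> u where u: "(\<alpha>, \<mu>) \<in> pairs" "(\<alpha>, \<nu>) \<in> pairs" "u \<in> boundary_paths_from \<Lambda> (src \<Lambda> \<alpha>)"
    "a = arrow \<alpha> \<mu> u" "b = arrow \<alpha> \<nu> u" using common_range[OF assms] .
  have "(\<nu>, \<mu>) \<in> pairs" "src \<Lambda> \<nu> = src \<Lambda> \<alpha>" using pairsD[OF u(1)] pairsD[OF u(2)] by (auto simp: pairs_def)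
  then show ?thesis using arrow_mem[of \<nu> \<mu> u] lquot_arrow[of \<alpha> \<alpha>] u by simp
qed

text \<open>The groupoid product \<open>cb\<close>, meaningful only if the source of
  \<open>c\<close> is the range of \<open>b\<close>.\<close>

definition lmult :: "('l, 'k) barrow \<Rightarrow> ('l, 'k) barrow \<Rightarrow> ('l, 'k) barrow" where
  "lmult c b = (fst c, fst (snd c) + fst (snd b), snd (snd b))"

lemma lmult_lquot: "fst b = fst c \<Longrightarrow> lmult c (lquot c b) = b"
  by (simp add: lmult_def lquot_def prod_eq_iff)

lemma lquot_lmult: "fst b = snd (snd c) \<Longrightarrow> lquot c (lmult c b) = b"
  by (simp add: lmult_def lquot_def prod_eq_iff)

lemma lmult_mem:
  assumes b: "b \<in> boundary_arrows \<Lambda>" and c: "c \<in> boundary_arrows \<Lambda>" and eq: "fst b = snd (snd c)"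
  shows "lmult c b \<in> boundary_arrows \<Lambda>"
proof -
  \<comment> \<open>This is the inverse of \<open>c\<close>, so \<open>lquot ?c b\<close> is the
    product \<open>cb\<close> and closure follows from \<open>lquot_mem\<close>.\<close>
  let ?c = "(snd (snd c), - fst (snd c), fst c)"
  obtain \<alpha> \<mu> z where z: "(\<alpha>, \<mu>) \<in> pairs" "z \<in> boundary_paths_from \<Lambda> (src \<Lambda> \<alpha>)" "c = arrow \<alpha> \<mu> z"
    using c by (rule arrowE)
  have "?c = arrow \<mu> \<alpha> z" using z(3) by (simp add: arrow_def deg_diff_def vec_eq_iff)
  moreover have "(\<mu>, \<alpha>) \<in> pairs" "z \<in> boundary_paths_from \<Lambda> (src \<Lambda> \<mu>)"
    using pairsD[OF z(1)] z(2) by (auto simp: pairs_def)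
  ultimately have "?c \<in> boundary_arrows \<Lambda>" using arrow_mem by simp
  then have "lquot ?c b \<in> boundary_arrows \<Lambda>" using lquot_mem[OF b] eq by simp
  then show ?thesis by (simp add: lquot_def lmult_def)
qed

text \<open>Pointwise form of the product of two bisections:
  \<open>Z_pair \<Lambda> \<alpha> \<mu>\<close> times \<open>Z_pair \<Lambda> \<beta> \<nu>\<close>
  is the union of the sets for \<open>\<alpha>\<rho>\<close> and \<open>\<nu>\<tau>\<close>. In the
  middle \<open>\<mu>z\<close> must equal some \<open>\<beta>w\<close>, and
  \<open>prepend_eqE\<close> resolves this into minimal common extensions.\<close>

lemma mem_Z_pair_product_iff:
  assumes p: "(\<alpha>, \<mu>) \<in> pairs" and q: "(\<beta>, \<nu>) \<in> pairs" and a: "a \<in> boundary_arrows \<Lambda>"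
    and z: "z \<in> boundary_paths_from \<Lambda> (src \<Lambda> \<alpha>)" "fst a = prepend \<Lambda> \<alpha> z"
  shows "lquot (arrow \<alpha> \<mu> z) a \<in> Z_pair \<Lambda> \<beta> \<nu> \<longleftrightarrow>
    (\<exists>(\<rho>, \<tau>) \<in> Lambda_min \<Lambda> \<mu> \<beta>. a \<in> Z_pair \<Lambda> (comp \<Lambda> \<alpha> \<rho>) (comp \<Lambda> \<nu> \<tau>))" (is "?L \<longleftrightarrow> ?R")
proof
  note pd = pairsD[OF p] and qd = pairsD[OF q]
  have z': "z \<in> boundary_paths_from \<Lambda> (src \<Lambda> \<mu>)" using z(1) pd(3) by simp
  {
    assume ?L
    then obtain w where w: "w \<in> boundary_paths_from \<Lambda> (src \<Lambda> \<beta>)" "lquot (arrow \<alpha> \<mu> z) a = arrow \<beta> \<nu> w"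
      unfolding Z_pair_eq[OF q] by blast
    then have "prepend \<Lambda> \<mu> z = prepend \<Lambda> \<beta> w" by (simp add: lquot_def arrow_def)
    then obtain \<rho> \<tau> u where r: "(\<rho>, \<tau>) \<in> Lambda_min \<Lambda> \<mu> \<beta>" "u \<in> boundary_paths_from \<Lambda> (src \<Lambda> \<rho>)"
      "z = prepend \<Lambda> \<rho> u" "w = prepend \<Lambda> \<tau> u"
      using prepend_eqE[OF pd(2) z' qd(1) w(1)] by metis
    note l = Lambda_minD[OF r(1)]
    have s: "src \<Lambda> \<rho> = src \<Lambda> \<tau>" using Lambda_min_src[OF pd(2) qd(1) r(1)] .
    have u': "u \<in> boundary_paths_from \<Lambda> (src \<Lambda> \<tau>)" using r(2) s by simp
    have sa: "src \<Lambda> \<alpha> = rng \<Lambda> \<rho>" using l(3) pd(3) by simp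
    note c = pairs_comp[OF p l(1) sa] and c' = pairs_comp[OF q l(2,4)]
    have pp: "(comp \<Lambda> \<alpha> \<rho>, comp \<Lambda> \<nu> \<tau>) \<in> pairs"
      using pairsD[OF c(1)] pairsD[OF c'(1)] c(2) c'(3) s by (simp add: pairs_def)
    have e1: "arrow \<alpha> \<mu> z = arrow (comp \<Lambda> \<alpha> \<rho>) (comp \<Lambda> \<mu> \<rho>) u" using arrow_comp[OF p l(1) sa r(2)] r(3) by simp
    have e2: "arrow \<beta> \<nu> w = arrow (comp \<Lambda> \<mu> \<rho>) (comp \<Lambda> \<nu> \<tau>) u"
      using arrow_comp[OF q l(2,4) u'] r(4) l(5) by simp
    have "a = lmult (arrow \<alpha> \<mu> z) (arrow \<beta> \<nu> w)"
      using lmult_lquot[of a "arrow \<alpha> \<mu> z"] w(2) z(2) by (simp add: arrow_def)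
    also have "\<dots> = arrow (comp \<Lambda> \<alpha> \<rho>) (comp \<Lambda> \<nu> \<tau>) u"
      unfolding e1 e2 by (simp add: lmult_def arrow_def deg_diff_def vec_eq_iff)
    finally have "a \<in> Z_pair \<Lambda> (comp \<Lambda> \<alpha> \<rho>) (comp \<Lambda> \<nu> \<tau>)"
      unfolding Z_pair_eq[OF pp] c(2) using r(2) by blast
    then show ?R using r(1) by blast
  next
    assume ?R
    then obtain \<rho> \<tau> where r: "(\<rho>, \<tau>) \<in> Lambda_min \<Lambda> \<mu> \<beta>" "a \<in> Z_pair \<Lambda> (comp \<Lambda> \<alpha> \<rho>) (comp \<Lambda> \<nu> \<tau>)" by blast
    note l = Lambda_minD[OF r(1)]
    have s: "src \<Lambda> \<rho> = src \<Lambda> \<tau>" using Lambda_min_src[OF pd(2) qd(1) r(1)] .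
    have sa: "src \<Lambda> \<alpha> = rng \<Lambda> \<rho>" using l(3) pd(3) by simp
    note c = pairs_comp[OF p l(1) sa] and c' = pairs_comp[OF q l(2,4)]
    have pp: "(comp \<Lambda> \<alpha> \<rho>, comp \<Lambda> \<nu> \<tau>) \<in> pairs"
      using pairsD[OF c(1)] pairsD[OF c'(1)] c(2) c'(3) s by (simp add: pairs_def)
    obtain u where u: "u \<in> boundary_paths_from \<Lambda> (src \<Lambda> \<rho>)" "a = arrow (comp \<Lambda> \<alpha> \<rho>) (comp \<Lambda> \<nu> \<tau>) u"
      using r(2) unfolding Z_pair_eq[OF pp] c(2) by blast
    have u': "u \<in> boundary_paths_from \<Lambda> (src \<Lambda> \<tau>)" using u(1) s by simp
    have e: "prepend \<Lambda> \<alpha> (prepend \<Lambda> \<rho> u) = prepend \<Lambda> \<alpha> z"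
      using u(2) z(2) prepend_comp[OF pd(1) l(1) sa u(1)] by (simp add: arrow_def)
    have zu: "prepend \<Lambda> \<rho> u = z"
      by (rule prepend_inj[OF pd(1) _ z(1) e]) (use prepend_mem[OF l(1) u(1)] sa in simp)
    have "lquot (arrow \<alpha> \<mu> z) a = arrow (comp \<Lambda> \<mu> \<rho>) (comp \<Lambda> \<nu> \<tau>) u"
      unfolding u(2) using lquot_arrow[OF refl] arrow_comp[OF p l(1) sa u(1)] zu by metis
    also have "\<dots> = arrow \<beta> \<nu> (prepend \<Lambda> \<tau> u)" using arrow_comp[OF q l(2,4) u'] l(5) by simp
    finally show ?L unfolding Z_pair_eq[OF q] using prepend_mem[OF l(2) u'] l(4) by simp
  }
qed

lemma Z_pair_product_fst:
  assumes p: "(\<alpha>, \<mu>) \<in> pairs" and q: "(\<beta>, \<nu>) \<in> pairs" and r: "(\<rho>, \<tau>) \<in> Lambda_min \<Lambda> \<mu> \<beta>"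
  shows "(comp \<Lambda> \<alpha> \<rho>, comp \<Lambda> \<nu> \<tau>) \<in> pairs"
    "\<And>a. a \<in> Z_pair \<Lambda> (comp \<Lambda> \<alpha> \<rho>) (comp \<Lambda> \<nu> \<tau>) \<Longrightarrow> \<exists>z \<in> boundary_paths_from \<Lambda> (src \<Lambda> \<alpha>). fst a = prepend \<Lambda> \<alpha> z"
proof -
  note pd = pairsD[OF p] and qd = pairsD[OF q]
  note l = Lambda_minD[OF r]
  have s: "src \<Lambda> \<rho> = src \<Lambda> \<tau>" using Lambda_min_src[OF pd(2) qd(1) r] .
  have sa: "src \<Lambda> \<alpha> = rng \<Lambda> \<rho>" using l(3) pd(3) by simp
  note c = pairs_comp[OF p l(1) sa] and c' = pairs_comp[OF q l(2,4)]
  show pp: "(comp \<Lambda> \<alpha> \<rho>, comp \<Lambda> \<nu> \<tau>) \<in> pairs"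
    using pairsD[OF c(1)] pairsD[OF c'(1)] c(2) c'(3) s by (simp add: pairs_def)
  fix a assume "a \<in> Z_pair \<Lambda> (comp \<Lambda> \<alpha> \<rho>) (comp \<Lambda> \<nu> \<tau>)"
  then obtain u where u: "u \<in> boundary_paths_from \<Lambda> (src \<Lambda> \<rho>)" "a = arrow (comp \<Lambda> \<alpha> \<rho>) (comp \<Lambda> \<nu> \<tau>) u"
    unfolding Z_pair_eq[OF pp] c(2) by blast
  then have "fst a = prepend \<Lambda> \<alpha> (prepend \<Lambda> \<rho> u)" using prepend_comp[OF pd(1) l(1) sa u(1)] by (simp add: arrow_def)
  moreover have "prepend \<Lambda> \<rho> u \<in> boundary_paths_from \<Lambda> (src \<Lambda> \<alpha>)" using prepend_mem[OF l(1) u(1)] sa by simp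
  ultimately show "\<exists>z \<in> boundary_paths_from \<Lambda> (src \<Lambda> \<alpha>). fst a = prepend \<Lambda> \<alpha> z" by blast
qed

text \<open>All paths \<open>\<alpha>\<rho>\<close> have the same degree, and \<open>\<rho>\<close>
  determines \<open>\<tau>\<close>; so different pairs give different left-hand paths of equal
  degree.\<close>

lemma Z_pair_product_disjoint:
  assumes p: "(\<alpha>, \<mu>) \<in> pairs" and q: "(\<beta>, \<nu>) \<in> pairs"
    and r: "(\<rho>, \<tau>) \<in> Lambda_min \<Lambda> \<mu> \<beta>" "(\<rho>', \<tau>') \<in> Lambda_min \<Lambda> \<mu> \<beta>" "(\<rho>, \<tau>) \<noteq> (\<rho>', \<tau>')"
  shows "Z_pair \<Lambda> (comp \<Lambda> \<alpha> \<rho>) (comp \<Lambda> \<nu> \<tau>) \<inter> Z_pair \<Lambda> (comp \<Lambda> \<alpha> \<rho>') (comp \<Lambda> \<nu> \<tau>') = {}"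
proof (rule Z_pair_disjoint[OF Z_pair_product_fst(1)[OF p q r(1)] Z_pair_product_fst(1)[OF p q r(2)]])
  note pd = pairsD[OF p] and qd = pairsD[OF q]
  note l = Lambda_minD[OF r(1)] and l' = Lambda_minD[OF r(2)]
  have s: "src \<Lambda> \<alpha> = rng \<Lambda> \<rho>" "src \<Lambda> \<alpha> = rng \<Lambda> \<rho>'" using l(3) l'(3) pd(3) by simp_all
  have "deg \<Lambda> \<mu> + deg \<Lambda> \<rho> = deg \<Lambda> \<mu> + deg \<Lambda> \<rho>'"
    using Lambda_min_deg_fst[OF pd(2) r(1)] Lambda_min_deg_fst[OF pd(2) r(2)] by simp
  then show "deg \<Lambda> (comp \<Lambda> \<alpha> \<rho>) = deg \<Lambda> (comp \<Lambda> \<alpha> \<rho>')"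
    using deg_comp[OF pd(1) l(1) s(1)] deg_comp[OF pd(1) l'(1) s(2)] by simp
  show "comp \<Lambda> \<alpha> \<rho> \<noteq> comp \<Lambda> \<alpha> \<rho>'"
  proof
    assume "comp \<Lambda> \<alpha> \<rho> = comp \<Lambda> \<alpha> \<rho>'"
    then have e: "\<rho> = \<rho>'" by (rule comp_left_cancel[OF pd(1) l(1) s(1) l'(1) s(2)])
    then have "\<tau> = \<tau>'" using Lambda_min_fst_unique[OF pd(2) qd(1) r(1)] r(2) by simp
    then show False using e r(3) by simp
  qed
qed

end

section \<open>Convolution\<close>

context boundary_steinberg
begin

lemma SA_mult:
  "f \<otimes>\<^bsub>SA\<^esub> g = (\<lambda>a \<in> boundary_arrows \<Lambda>.
     \<Oplus>b \<in> {b \<in> boundary_arrows \<Lambda>. fst b = fst a \<and> f b \<noteq> \<zero>}. f b \<otimes> g (lquot b a))"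
proof -
  have 1: "g_rng (boundary_groupoid \<Lambda>) b = g_rng (boundary_groupoid \<Lambda>) a \<longleftrightarrow> fst b = fst a"
    for a b :: "('l, 'k) barrow"
    by (simp add: boundary_groupoid_def split: prod.split)
  have 2: "g_comp (boundary_groupoid \<Lambda>) (g_inv (boundary_groupoid \<Lambda>) b) a = lquot b a"
    for a b :: "('l, 'k) barrow"
    by (simp add: boundary_groupoid_def lquot_def split: prod.split)
  show ?thesis by (simp add: steinberg_algebra_def 1 2)
qed

lemma ind_fibre:
  assumes p: "(\<alpha>, \<mu>) \<in> pairs"
  shows "z \<in> boundary_paths_from \<Lambda> (src \<Lambda> \<alpha>) \<Longrightarrow> b \<in> Z_pair \<Lambda> \<alpha> \<mu> \<Longrightarrow> fst b = prepend \<Lambda> \<alpha> z \<Longrightarrow> b = arrow \<alpha> \<mu> z"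
    and "b \<in> Z_pair \<Lambda> \<alpha> \<mu> \<Longrightarrow> \<exists>z \<in> boundary_paths_from \<Lambda> (src \<Lambda> \<alpha>). fst b = prepend \<Lambda> \<alpha> z"
proof -
  assume z: "z \<in> boundary_paths_from \<Lambda> (src \<Lambda> \<alpha>)" and b: "b \<in> Z_pair \<Lambda> \<alpha> \<mu>" "fst b = prepend \<Lambda> \<alpha> z"
  obtain w where w: "w \<in> boundary_paths_from \<Lambda> (src \<Lambda> \<alpha>)" "b = arrow \<alpha> \<mu> w" using b(1) unfolding Z_pair_eq[OF p] by blast
  then have "w = z" using prepend_inj[OF pairsD(1)[OF p] w(1) z] b(2) by (simp add: arrow_def)
  then show "b = arrow \<alpha> \<mu> z" using w(2) by simp
next
  assume "b \<in> Z_pair \<Lambda> \<alpha> \<mu>"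
  then obtain w where "w \<in> boundary_paths_from \<Lambda> (src \<Lambda> \<alpha>)" "b = arrow \<alpha> \<mu> w" unfolding Z_pair_eq[OF p] by blast
  then show "\<exists>z \<in> boundary_paths_from \<Lambda> (src \<Lambda> \<alpha>). fst b = prepend \<Lambda> \<alpha> z" by (auto simp: arrow_def)
qed

text \<open>The range map is injective on each \<open>Z_pair\<close>, so every term of a spanning
  combination adds at most one arrow to the fibre. On an infinite index set \<open>finsum\<close>
  would be 0 by convention.\<close>

lemma finite_fibre:
  assumes "f \<in> carrier SA"
  shows "finite {b \<in> boundary_arrows \<Lambda>. fst b = x \<and> f b \<noteq> \<zero>}"
  using assms unfolding SA_carrier_eq
proof (induction rule: ind_span.induct)
  case zero
  have e: "{b \<in> boundary_arrows \<Lambda>. fst b = x \<and> \<zero>\<^bsub>SA\<^esub> b \<noteq> \<zero>} = {}" by (auto simp: SA_simps)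
  show ?case unfolding e by simp
next
  case (step r \<alpha> \<mu> f)
  let ?B = "{b \<in> Z_pair \<Lambda> \<alpha> \<mu>. fst b = x}"
  have "finite ?B"
  proof (cases "?B = {}")
    case False
    then obtain z where "z \<in> boundary_paths_from \<Lambda> (src \<Lambda> \<alpha>)" "x = prepend \<Lambda> \<alpha> z" using ind_fibre(2)[OF step(2)] by blast
    then have "?B \<subseteq> {arrow \<alpha> \<mu> z}" using ind_fibre(1)[OF step(2)] by blast
    then show ?thesis by (rule finite_subset) simp
  next
    case True
    show ?thesis unfolding True by simp
  qed
  moreover have "b \<in> ?B \<union> {b \<in> boundary_arrows \<Lambda>. fst b = x \<and> f b \<noteq> \<zero>}"
    if "b \<in> boundary_arrows \<Lambda>" "fst b = x" "(r \<odot>\<^bsub>SA\<^esub> ind (Z_pair \<Lambda> \<alpha> \<mu>) \<oplus>\<^bsub>SA\<^esub> f) b \<noteq> \<zero>" for b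
    using that step(1) by (cases "b \<in> Z_pair \<Lambda> \<alpha> \<mu>") (auto simp: SA_simps)
  then have "{b \<in> boundary_arrows \<Lambda>. fst b = x \<and> (r \<odot>\<^bsub>SA\<^esub> ind (Z_pair \<Lambda> \<alpha> \<mu>) \<oplus>\<^bsub>SA\<^esub> f) b \<noteq> \<zero>}
    \<subseteq> ?B \<union> {b \<in> boundary_arrows \<Lambda>. fst b = x \<and> f b \<noteq> \<zero>}" by blast
  ultimately show ?case using step.IH finite_subset by blast
qed

text \<open>The index set in the product depends on the support of \<open>f\<close>. Any finite
  \<open>B\<close> between this support and the fibre may replace it, so that several products can
  be summed over one index set, as bilinearity requires.\<close>

lemma SA_mult_eval:
  assumes f: "f \<in> carrier SA" and g: "g \<in> carrier SA" and a: "a \<in> boundary_arrows \<Lambda>"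
    and B: "finite B" "B \<subseteq> {b \<in> boundary_arrows \<Lambda>. fst b = fst a}"
      "\<And>b. \<lbrakk>b \<in> boundary_arrows \<Lambda>; fst b = fst a; f b \<noteq> \<zero>\<rbrakk> \<Longrightarrow> b \<in> B"
  shows "(f \<otimes>\<^bsub>SA\<^esub> g) a = (\<Oplus>b \<in> B. f b \<otimes> g (lquot b a))"
proof -
  have c: "f b \<in> carrier R" "g (lquot b a) \<in> carrier R" if "b \<in> boundary_arrows \<Lambda>" "fst b = fst a" for b
    using SA_carrierD(2)[OF f that(1)] SA_carrierD(2)[OF g lquot_mem[OF a that(1)]] that(2) by simp_all
  have z: "f b \<otimes> g (lquot b a) = \<zero>" if "b \<in> B - {b \<in> boundary_arrows \<Lambda>. fst b = fst a \<and> f b \<noteq> \<zero>}" for b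
  proof -
    have b: "b \<in> boundary_arrows \<Lambda>" "fst b = fst a" "f b = \<zero>" using that B(2) by blast+
    then show ?thesis using c[OF b(1,2)] by simp
  qed
  have "(\<Oplus>b \<in> {b \<in> boundary_arrows \<Lambda>. fst b = fst a \<and> f b \<noteq> \<zero>}. f b \<otimes> g (lquot b a)) = (\<Oplus>b \<in> B. f b \<otimes> g (lquot b a))"
  proof (rule add.finprod_mono_neutral_cong_left)
    show "{b \<in> boundary_arrows \<Lambda>. fst b = fst a \<and> f b \<noteq> \<zero>} \<subseteq> B" using B(3) by blast
    show "(\<lambda>b. f b \<otimes> g (lquot b a)) \<in> B \<rightarrow> carrier R" using B(2) c by blast
  qed (use B(1) z in auto)
  then show ?thesis using a by (simp add: SA_mult)
qed

lemma SA_mult_PiE: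
  assumes f: "f \<in> carrier SA" and g: "g \<in> carrier SA"
  shows "f \<otimes>\<^bsub>SA\<^esub> g \<in> boundary_arrows \<Lambda> \<rightarrow>\<^sub>E carrier R"
proof (rule PiE_I)
  fix a assume a: "a \<in> boundary_arrows \<Lambda>"
  have "(\<Oplus>b \<in> {b \<in> boundary_arrows \<Lambda>. fst b = fst a \<and> f b \<noteq> \<zero>}. f b \<otimes> g (lquot b a)) \<in> carrier R"
    by (rule finsum_closed) (use SA_carrierD(2)[OF f] SA_carrierD(2)[OF g lquot_mem[OF a]] in auto)
  then show "(f \<otimes>\<^bsub>SA\<^esub> g) a \<in> carrier R" using a by (simp add: SA_mult)
qed (simp add: SA_mult)

lemma SA_add_eval: "a \<in> boundary_arrows \<Lambda> \<Longrightarrow> (f \<oplus>\<^bsub>SA\<^esub> g) a = f a \<oplus> g a"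
  by (simp add: SA_simps)

lemma SA_smult_eval: "a \<in> boundary_arrows \<Lambda> \<Longrightarrow> (r \<odot>\<^bsub>SA\<^esub> f) a = r \<otimes> f a"
  by (simp add: SA_simps)

lemma SA_mult_linear:
  assumes f: "f \<in> carrier SA" and f': "f' \<in> carrier SA" and g: "g \<in> carrier SA" and r: "r \<in> carrier R"
  shows "(f \<oplus>\<^bsub>SA\<^esub> f') \<otimes>\<^bsub>SA\<^esub> g = f \<otimes>\<^bsub>SA\<^esub> g \<oplus>\<^bsub>SA\<^esub> f' \<otimes>\<^bsub>SA\<^esub> g"
    and "g \<otimes>\<^bsub>SA\<^esub> (f \<oplus>\<^bsub>SA\<^esub> f') = g \<otimes>\<^bsub>SA\<^esub> f \<oplus>\<^bsub>SA\<^esub> g \<otimes>\<^bsub>SA\<^esub> f'"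
    and "(r \<odot>\<^bsub>SA\<^esub> f) \<otimes>\<^bsub>SA\<^esub> g = r \<odot>\<^bsub>SA\<^esub> (f \<otimes>\<^bsub>SA\<^esub> g)"
    and "f \<otimes>\<^bsub>SA\<^esub> (r \<odot>\<^bsub>SA\<^esub> g) = r \<odot>\<^bsub>SA\<^esub> (f \<otimes>\<^bsub>SA\<^esub> g)"
proof -
  note ff' = SA_add_closed[OF f f'] and rf = SA_smult_closed[OF r f] and rg = SA_smult_closed[OF r g]
  have m: "(h \<otimes>\<^bsub>SA\<^esub> h') a \<in> carrier R" if "h \<in> carrier SA" "h' \<in> carrier SA" "a \<in> boundary_arrows \<Lambda>" for h h' a
    using SA_mult_PiE[OF that(1,2)] that(3) by (auto simp: PiE_iff)
  have "(f \<oplus>\<^bsub>SA\<^esub> f') \<otimes>\<^bsub>SA\<^esub> g = f \<otimes>\<^bsub>SA\<^esub> g \<oplus>\<^bsub>SA\<^esub> f' \<otimes>\<^bsub>SA\<^esub> g \<and>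
    g \<otimes>\<^bsub>SA\<^esub> (f \<oplus>\<^bsub>SA\<^esub> f') = g \<otimes>\<^bsub>SA\<^esub> f \<oplus>\<^bsub>SA\<^esub> g \<otimes>\<^bsub>SA\<^esub> f' \<and>
    (r \<odot>\<^bsub>SA\<^esub> f) \<otimes>\<^bsub>SA\<^esub> g = r \<odot>\<^bsub>SA\<^esub> (f \<otimes>\<^bsub>SA\<^esub> g) \<and>
    f \<otimes>\<^bsub>SA\<^esub> (r \<odot>\<^bsub>SA\<^esub> g) = r \<odot>\<^bsub>SA\<^esub> (f \<otimes>\<^bsub>SA\<^esub> g)" (is "?L1 = ?R1 \<and> ?L2 = ?R2 \<and> ?L3 = ?R3 \<and> ?L4 = ?R4")
  proof -
    have ev: "?L1 a = ?R1 a \<and> ?L2 a = ?R2 a \<and> ?L3 a = ?R3 a \<and> ?L4 a = ?R4 a" if a: "a \<in> boundary_arrows \<Lambda>" for a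
    proof -
      \<comment> \<open>One finite index set that serves all the products in the statement.\<close>
      define C where "C = (\<Union>h \<in> {f, f', g}. {b \<in> boundary_arrows \<Lambda>. fst b = fst a \<and> h b \<noteq> \<zero>})"
      have C: "finite C" "C \<subseteq> {b \<in> boundary_arrows \<Lambda>. fst b = fst a}"
        unfolding C_def using finite_fibre f f' g by blast+
      have s: "b \<in> C" if "h \<in> {f, f', g}" "b \<in> boundary_arrows \<Lambda>" "fst b = fst a" "h b \<noteq> \<zero>" for h b
        unfolding C_def using that by blast
      have bC: "b \<in> boundary_arrows \<Lambda>" "lquot b a \<in> boundary_arrows \<Lambda>" if "b \<in> C" for b
      proof -
        have b: "b \<in> boundary_arrows \<Lambda>" "fst a = fst b" using C(2) that by force+
        show "b \<in> boundary_arrows \<Lambda>" "lquot b a \<in> boundary_arrows \<Lambda>" using b(1) lquot_mem[OF a b] by simp_all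
      qed
      have e: "h b \<in> carrier R" "h (lquot b a) \<in> carrier R" if "h \<in> {f, f', g}" "b \<in> C" for h b
      proof -
        have "h \<in> carrier SA" using that(1) f f' g by blast
        then show "h b \<in> carrier R" "h (lquot b a) \<in> carrier R" using SA_carrierD(2) bC[OF that(2)] by blast+
      qed
      note ef = e[of f, simplified] and ef' = e[of f', simplified] and eg = e[of g, simplified]
      note ev = bC SA_add_eval SA_smult_eval
      have mv: "(h \<otimes>\<^bsub>SA\<^esub> h') a = (\<Oplus>b \<in> C. h b \<otimes> h' (lquot b a))"
        if "h \<in> carrier SA" "h' \<in> carrier SA" "h \<in> {f, f', g}" for h h'
        by (rule SA_mult_eval[OF that(1,2) a C]) (rule s[OF that(3)])
      have "?L1 a = (\<Oplus>b \<in> C. (f \<oplus>\<^bsub>SA\<^esub> f') b \<otimes> g (lquot b a))"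
      proof (rule SA_mult_eval[OF ff' g a C])
        fix b assume b: "b \<in> boundary_arrows \<Lambda>" "fst b = fst a" "(f \<oplus>\<^bsub>SA\<^esub> f') b \<noteq> \<zero>"
        then have "f b \<noteq> \<zero> \<or> f' b \<noteq> \<zero>" by (auto simp: SA_add_eval)
        then show "b \<in> C" using s b by blast
      qed
      also have "\<dots> = (\<Oplus>b \<in> C. f b \<otimes> g (lquot b a) \<oplus> f' b \<otimes> g (lquot b a))"
        by (rule finsum_cong') (simp_all add: ev ef ef' eg l_distr)
      also have "\<dots> = (\<Oplus>b \<in> C. f b \<otimes> g (lquot b a)) \<oplus> (\<Oplus>b \<in> C. f' b \<otimes> g (lquot b a))"
        by (rule finsum_addf) (simp_all add: ef ef' eg)
      also have "\<dots> = ?R1 a"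
        unfolding SA_add_eval[OF a] mv[OF f g, simplified] mv[OF f' g, simplified] by simp
      finally have 1: "?L1 a = ?R1 a" .
      have "?L2 a = (\<Oplus>b \<in> C. g b \<otimes> (f \<oplus>\<^bsub>SA\<^esub> f') (lquot b a))"
        by (rule SA_mult_eval[OF g ff' a C s]) simp_all
      also have "\<dots> = (\<Oplus>b \<in> C. g b \<otimes> f (lquot b a) \<oplus> g b \<otimes> f' (lquot b a))"
        by (rule finsum_cong') (simp_all add: ev ef ef' eg r_distr)
      also have "\<dots> = (\<Oplus>b \<in> C. g b \<otimes> f (lquot b a)) \<oplus> (\<Oplus>b \<in> C. g b \<otimes> f' (lquot b a))"
        by (rule finsum_addf) (simp_all add: ef ef' eg)
      also have "\<dots> = ?R2 a"
        unfolding SA_add_eval[OF a] mv[OF g f, simplified] mv[OF g f', simplified] by simp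
      finally have 2: "?L2 a = ?R2 a" .
      have fg: "(f \<otimes>\<^bsub>SA\<^esub> g) a = (\<Oplus>b \<in> C. f b \<otimes> g (lquot b a))"
        by (rule SA_mult_eval[OF f g a C s]) simp_all
      have q: "(\<Oplus>b \<in> C. r \<otimes> (f b \<otimes> g (lquot b a))) = r \<otimes> (f \<otimes>\<^bsub>SA\<^esub> g) a"
        unfolding fg by (rule finsum_rdistr[symmetric, OF C(1) r]) (simp_all add: ef eg)
      have "?L3 a = (\<Oplus>b \<in> C. (r \<odot>\<^bsub>SA\<^esub> f) b \<otimes> g (lquot b a))"
      proof (rule SA_mult_eval[OF rf g a C])
        fix b assume b: "b \<in> boundary_arrows \<Lambda>" "fst b = fst a" "(r \<odot>\<^bsub>SA\<^esub> f) b \<noteq> \<zero>"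
        then have "f b \<noteq> \<zero>" using r by (auto simp: SA_smult_eval)
        then show "b \<in> C" using s b by blast
      qed
      also have "\<dots> = (\<Oplus>b \<in> C. r \<otimes> (f b \<otimes> g (lquot b a)))"
        by (rule finsum_cong') (simp_all add: ev ef eg r m_assoc)
      finally have 3: "?L3 a = ?R3 a" unfolding q using a by (simp add: SA_smult_eval)
      have "?L4 a = (\<Oplus>b \<in> C. f b \<otimes> (r \<odot>\<^bsub>SA\<^esub> g) (lquot b a))"
        by (rule SA_mult_eval[OF f rg a C s]) simp_all
      also have "\<dots> = (\<Oplus>b \<in> C. r \<otimes> (f b \<otimes> g (lquot b a)))"
        by (rule finsum_cong') (simp_all add: ev ef eg r m_lcomm)
      finally have 4: "?L4 a = ?R4 a" unfolding q using a by (simp add: SA_smult_eval)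
      show ?thesis using 1 2 3 4 by blast
    qed
    have PE: "?R1 \<in> boundary_arrows \<Lambda> \<rightarrow>\<^sub>E carrier R" "?R2 \<in> boundary_arrows \<Lambda> \<rightarrow>\<^sub>E carrier R"
      "?R3 \<in> boundary_arrows \<Lambda> \<rightarrow>\<^sub>E carrier R"
      unfolding SA_simps by (simp_all add: m f f' g r)
    show ?thesis
      using SA_ext[OF SA_mult_PiE[OF ff' g] PE(1)] SA_ext[OF SA_mult_PiE[OF g ff'] PE(2)]
        SA_ext[OF SA_mult_PiE[OF rf g] PE(3)] SA_ext[OF SA_mult_PiE[OF f rg] PE(3)] ev by blast
  qed
  then show "(f \<oplus>\<^bsub>SA\<^esub> f') \<otimes>\<^bsub>SA\<^esub> g = f \<otimes>\<^bsub>SA\<^esub> g \<oplus>\<^bsub>SA\<^esub> f' \<otimes>\<^bsub>SA\<^esub> g"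
    "g \<otimes>\<^bsub>SA\<^esub> (f \<oplus>\<^bsub>SA\<^esub> f') = g \<otimes>\<^bsub>SA\<^esub> f \<oplus>\<^bsub>SA\<^esub> g \<otimes>\<^bsub>SA\<^esub> f'"
    "(r \<odot>\<^bsub>SA\<^esub> f) \<otimes>\<^bsub>SA\<^esub> g = r \<odot>\<^bsub>SA\<^esub> (f \<otimes>\<^bsub>SA\<^esub> g)"
    "f \<otimes>\<^bsub>SA\<^esub> (r \<odot>\<^bsub>SA\<^esub> g) = r \<odot>\<^bsub>SA\<^esub> (f \<otimes>\<^bsub>SA\<^esub> g)"
    by blast+
qed

text \<open>At most one arrow of a bisection has the range of \<open>a\<close>, so the convolution
  sum has at most one term, and left multiplication by the indicator is a translation.\<close>

lemma ind_mult_eval: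
  assumes p: "(\<alpha>, \<mu>) \<in> pairs" and g: "g \<in> carrier SA" and a: "a \<in> boundary_arrows \<Lambda>"
  shows "\<lbrakk>z \<in> boundary_paths_from \<Lambda> (src \<Lambda> \<alpha>); fst a = prepend \<Lambda> \<alpha> z\<rbrakk>
      \<Longrightarrow> (ind (Z_pair \<Lambda> \<alpha> \<mu>) \<otimes>\<^bsub>SA\<^esub> g) a = g (lquot (arrow \<alpha> \<mu> z) a)"
    and "\<not> (\<exists>z \<in> boundary_paths_from \<Lambda> (src \<Lambda> \<alpha>). fst a = prepend \<Lambda> \<alpha> z)
      \<Longrightarrow> (ind (Z_pair \<Lambda> \<alpha> \<mu>) \<otimes>\<^bsub>SA\<^esub> g) a = \<zero>"
proof -
  let ?Z = "Z_pair \<Lambda> \<alpha> \<mu>"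
  have nz: "b \<in> ?Z" if "b \<in> boundary_arrows \<Lambda>" "ind ?Z b \<noteq> \<zero>" for b
    using that by (auto simp: SA_simps split: if_splits)
  {
    assume z: "z \<in> boundary_paths_from \<Lambda> (src \<Lambda> \<alpha>)" "fst a = prepend \<Lambda> \<alpha> z"
    have m: "arrow \<alpha> \<mu> z \<in> boundary_arrows \<Lambda>" "arrow \<alpha> \<mu> z \<in> ?Z" "fst (arrow \<alpha> \<mu> z) = fst a"
      using arrow_mem[OF p z(1)] z by (auto simp: Z_pair_eq[OF p] arrow_def)
    have "(ind ?Z \<otimes>\<^bsub>SA\<^esub> g) a = (\<Oplus>b \<in> {arrow \<alpha> \<mu> z}. ind ?Z b \<otimes> g (lquot b a))"
    proof (rule SA_mult_eval[OF ind_closed[OF p] g a])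
      show "{arrow \<alpha> \<mu> z} \<subseteq> {b \<in> boundary_arrows \<Lambda>. fst b = fst a}" using m by simp
      show "b \<in> {arrow \<alpha> \<mu> z}" if "b \<in> boundary_arrows \<Lambda>" "fst b = fst a" "ind ?Z b \<noteq> \<zero>" for b
        using ind_fibre(1)[OF p z(1) nz[OF that(1,3)]] that(2) z(2) by simp
    qed simp
    also have "\<dots> = g (lquot (arrow \<alpha> \<mu> z) a)"
      using m SA_carrierD(2)[OF g lquot_mem[OF a m(1)]] by (simp add: SA_simps)
    finally show "(ind ?Z \<otimes>\<^bsub>SA\<^esub> g) a = g (lquot (arrow \<alpha> \<mu> z) a)" .
  next
    assume n: "\<not> (\<exists>z \<in> boundary_paths_from \<Lambda> (src \<Lambda> \<alpha>). fst a = prepend \<Lambda> \<alpha> z)"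
    have "(ind ?Z \<otimes>\<^bsub>SA\<^esub> g) a = (\<Oplus>b \<in> {}. ind ?Z b \<otimes> g (lquot b a))"
    proof (rule SA_mult_eval[OF ind_closed[OF p] g a])
      show "b \<in> {}" if "b \<in> boundary_arrows \<Lambda>" "fst b = fst a" "ind ?Z b \<noteq> \<zero>" for b
        using ind_fibre(2)[OF p nz[OF that(1,3)]] that(2) n by simp
    qed simp_all
    then show "(ind ?Z \<otimes>\<^bsub>SA\<^esub> g) a = \<zero>" by simp
  }
qed

lemma SA_finsum_closed: "F \<in> I \<rightarrow> carrier SA \<Longrightarrow> finsum SA F I \<in> carrier SA"
  by (rule SA.M.finsum_closed)

lemma SA_finsum_eval:
  assumes "finite I" "F \<in> I \<rightarrow> carrier SA" "a \<in> boundary_arrows \<Lambda>"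
  shows "finsum SA F I a = (\<Oplus>i \<in> I. F i a)"
  using assms
proof (induction I rule: finite_induct)
  case empty
  then show ?case by (simp add: SA_simps)
next
  case (insert i I)
  have "F j a \<in> carrier R" if "j \<in> insert i I" for j
    using SA_carrierD(2)[of "F j" a] insert.prems that by blast
  then show ?case using insert by (simp add: SA_add_eval Pi_iff)
qed

text \<open>The pieces are disjoint, so at each arrow at most one summand is nonzero, and
  \<open>mem_Z_pair_product_iff\<close> says where. The formula contains the image of (KP3) and
  makes the span of the indicators closed under products.\<close>

lemma ind_mult_ind:
  assumes p: "(\<alpha>, \<mu>) \<in> pairs" and q: "(\<beta>, \<nu>) \<in> pairs"
  shows "ind (Z_pair \<Lambda> \<alpha> \<mu>) \<otimes>\<^bsub>SA\<^esub> ind (Z_pair \<Lambda> \<beta> \<nu>)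
    = (\<Oplus>\<^bsub>SA\<^esub>l \<in> Lambda_min \<Lambda> \<mu> \<beta>. ind (Z_pair \<Lambda> (comp \<Lambda> \<alpha> (fst l)) (comp \<Lambda> \<nu> (snd l))))"
proof -
  let ?L = "Lambda_min \<Lambda> \<mu> \<beta>"
  let ?Z = "\<lambda>l. Z_pair \<Lambda> (comp \<Lambda> \<alpha> (fst l)) (comp \<Lambda> \<nu> (snd l))"
  have fin: "finite ?L" using finite_Lambda_min[OF pairsD(2)[OF p] pairsD(1)[OF q]] .
  have pp: "(comp \<Lambda> \<alpha> (fst l), comp \<Lambda> \<nu> (snd l)) \<in> pairs" if "l \<in> ?L" for l
    using Z_pair_product_fst(1)[OF p q, of "fst l" "snd l"] that by simp
  have cl: "(\<lambda>l. ind (?Z l)) \<in> ?L \<rightarrow> carrier SA" using ind_closed pp by blast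
  note SA1 = SA_carrierD(1)[OF SA_finsum_closed[OF cl]]
  show ?thesis
  proof (rule SA_ext[OF SA_mult_PiE[OF ind_closed[OF p] ind_closed[OF q]] SA1])
    fix a assume a: "a \<in> boundary_arrows \<Lambda>"
    have "finsum SA (\<lambda>l. ind (?Z l)) ?L a = (\<Oplus>l \<in> ?L. ind (?Z l) a)" by (rule SA_finsum_eval[OF fin cl a])
    also have "\<dots> = (if \<exists>l \<in> ?L. a \<in> ?Z l then \<one> else \<zero>)"
    proof (cases "\<exists>l \<in> ?L. a \<in> ?Z l")
      case True
      then obtain l where l: "l \<in> ?L" "a \<in> ?Z l" by blast
      have u: "ind (?Z l') a = (if l = l' then \<one> else \<zero>)" if "l' \<in> ?L" for l'
      proof (cases "l = l'")
        case False
        then have "?Z l \<inter> ?Z l' = {}"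
          using Z_pair_product_disjoint[OF p q, of "fst l" "snd l" "fst l'" "snd l'"] l that by simp
        then show ?thesis using False a l(2) by (auto simp: SA_simps)
      qed (use a l in \<open>simp add: SA_simps\<close>)
      have "(\<Oplus>l' \<in> ?L. ind (?Z l') a) = (\<Oplus>l' \<in> ?L. if l = l' then \<one> else \<zero>)"
        by (rule finsum_cong') (simp_all add: u)
      also have "\<dots> = \<one>" using add.finprod_singleton[OF l(1) fin, of "\<lambda>_. \<one>"] by simp
      finally show ?thesis using True by simp
    next
      case False
      then have "(\<Oplus>l' \<in> ?L. ind (?Z l') a) = (\<Oplus>l' \<in> ?L. \<zero>)"
        by (intro finsum_cong') (use a in \<open>auto simp: SA_simps\<close>)
      then show ?thesis using False by simp
    qed
    finally have R: "finsum SA (\<lambda>l. ind (?Z l)) ?L a = (if \<exists>l \<in> ?L. a \<in> ?Z l then \<one> else \<zero>)" .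
    show "(ind (Z_pair \<Lambda> \<alpha> \<mu>) \<otimes>\<^bsub>SA\<^esub> ind (Z_pair \<Lambda> \<beta> \<nu>)) a = finsum SA (\<lambda>l. ind (?Z l)) ?L a"
    proof (cases "\<exists>z \<in> boundary_paths_from \<Lambda> (src \<Lambda> \<alpha>). fst a = prepend \<Lambda> \<alpha> z")
      case True
      then obtain z where z: "z \<in> boundary_paths_from \<Lambda> (src \<Lambda> \<alpha>)" "fst a = prepend \<Lambda> \<alpha> z" by blast
      have "fst (arrow \<alpha> \<mu> z) = fst a" using z(2) by (simp add: arrow_def)
      then have "lquot (arrow \<alpha> \<mu> z) a \<in> boundary_arrows \<Lambda>" using lquot_mem[OF a arrow_mem[OF p z(1)]] by simp
      then show ?thesis
        using R ind_mult_eval(1)[OF p ind_closed[OF q] a z] mem_Z_pair_product_iff[OF p q a z]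
        by (simp add: SA_simps(4) case_prod_beta)
    next
      case False
      have "\<not> (\<exists>l \<in> ?L. a \<in> ?Z l)"
        using False Z_pair_product_fst(2)[OF p q, of "fst _" "snd _" a] by (metis prod.collapse)
      then show ?thesis using R ind_mult_eval(2)[OF p ind_closed[OF q] a False] by simp
    qed
  qed
qed

lemma SA_induct [consumes 1, case_names zero step]:
  assumes "f \<in> carrier SA" "P \<zero>\<^bsub>SA\<^esub>"
    and "\<And>r \<alpha> \<mu> f. \<lbrakk>r \<in> carrier R; (\<alpha>, \<mu>) \<in> pairs; f \<in> carrier SA; P f\<rbrakk>
      \<Longrightarrow> P (r \<odot>\<^bsub>SA\<^esub> ind (Z_pair \<Lambda> \<alpha> \<mu>) \<oplus>\<^bsub>SA\<^esub> f)"
  shows "P f"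
  using assms(1) unfolding SA_carrier_eq
proof (induction rule: ind_span.induct)
  case (step r \<alpha> \<mu> f)
  then show ?case using assms(3) by (simp add: SA_carrier_eq)
qed (rule assms(2))

lemma SA_mult_zero:
  assumes "f \<in> carrier SA"
  shows "\<zero>\<^bsub>SA\<^esub> \<otimes>\<^bsub>SA\<^esub> f = \<zero>\<^bsub>SA\<^esub>" "f \<otimes>\<^bsub>SA\<^esub> \<zero>\<^bsub>SA\<^esub> = \<zero>\<^bsub>SA\<^esub>"
proof -
  show "\<zero>\<^bsub>SA\<^esub> \<otimes>\<^bsub>SA\<^esub> f = \<zero>\<^bsub>SA\<^esub>" unfolding SA_mult SA_simps(1)
    by (rule restrict_ext) (simp cong: conj_cong)
  show "f \<otimes>\<^bsub>SA\<^esub> \<zero>\<^bsub>SA\<^esub> = \<zero>\<^bsub>SA\<^esub>" unfolding SA_mult SA_simps(1)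
  proof (rule restrict_ext)
    fix a assume a: "a \<in> boundary_arrows \<Lambda>"
    have "(\<Oplus>b \<in> {b \<in> boundary_arrows \<Lambda>. fst b = fst a \<and> f b \<noteq> \<zero>}. f b \<otimes> (\<lambda>a \<in> boundary_arrows \<Lambda>. \<zero>) (lquot b a))
      = (\<Oplus>b \<in> {b \<in> boundary_arrows \<Lambda>. fst b = fst a \<and> f b \<noteq> \<zero>}. \<zero>)"
      by (rule finsum_cong') (use SA_carrierD(2)[OF assms] lquot_mem[OF a] in auto)
    then show "(\<Oplus>b \<in> {b \<in> boundary_arrows \<Lambda>. fst b = fst a \<and> f b \<noteq> \<zero>}. f b \<otimes> (\<lambda>a \<in> boundary_arrows \<Lambda>. \<zero>) (lquot b a)) = \<zero>"
      by simp
  qed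
qed

lemma SA_mult_closed:
  assumes f: "f \<in> carrier SA" and g: "g \<in> carrier SA"
  shows "f \<otimes>\<^bsub>SA\<^esub> g \<in> carrier SA"
  using f
proof (induction rule: SA_induct)
  case zero
  then show ?case using SA_mult_zero[OF g] by simp
next
  case (step r \<alpha> \<mu> f)
  have "ind (Z_pair \<Lambda> \<alpha> \<mu>) \<otimes>\<^bsub>SA\<^esub> g \<in> carrier SA" using g
  proof (induction rule: SA_induct)
    case zero
    then show ?case using SA_mult_zero[OF ind_closed[OF step(2)]] by simp
  next
    case (step s \<beta> \<nu> g)
    have c: "ind (Z_pair \<Lambda> \<alpha> \<mu>) \<otimes>\<^bsub>SA\<^esub> ind (Z_pair \<Lambda> \<beta> \<nu>) \<in> carrier SA"
      unfolding ind_mult_ind[OF \<open>(\<alpha>, \<mu>) \<in> pairs\<close> step(2)]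
      using Z_pair_product_fst(1)[OF \<open>(\<alpha>, \<mu>) \<in> pairs\<close> step(2)] by (intro SA_finsum_closed) (auto intro: ind_closed)
    then show ?case
      using step \<open>(\<alpha>, \<mu>) \<in> pairs\<close> by (simp add: SA_mult_linear(2,4)[of _ _ _ s] ind_closed)
  qed
  then show ?case using step g by (simp add: SA_mult_linear(1,3)[of _ _ _ r] ind_closed)
qed

text \<open>By linearity the left factor may be taken to be an indicator, which acts by translation
  with a single arrow \<open>?t\<close>. Both sides are then sums over fibres, matched by the
  bijection \<open>lmult ?t\<close>.\<close>

lemma SA_mult_assoc:
  assumes f: "f \<in> carrier SA" and g: "g \<in> carrier SA" and h: "h \<in> carrier SA"
  shows "(f \<otimes>\<^bsub>SA\<^esub> g) \<otimes>\<^bsub>SA\<^esub> h = f \<otimes>\<^bsub>SA\<^esub> (g \<otimes>\<^bsub>SA\<^esub> h)"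
  using f
proof (induction rule: SA_induct)
  case zero
  then show ?case using SA_mult_zero g h SA_mult_closed by simp
next
  case (step r \<alpha> \<mu> f)
  note p = step(2)
  let ?c = "ind (Z_pair \<Lambda> \<alpha> \<mu>)"
  note cg = SA_mult_closed[OF ind_closed[OF p] g] and gh = SA_mult_closed[OF g h]
  have "(?c \<otimes>\<^bsub>SA\<^esub> g) \<otimes>\<^bsub>SA\<^esub> h = ?c \<otimes>\<^bsub>SA\<^esub> (g \<otimes>\<^bsub>SA\<^esub> h)"
  proof (rule SA_ext[OF SA_mult_PiE[OF cg h] SA_mult_PiE[OF ind_closed[OF p] gh]])
    fix a assume a: "a \<in> boundary_arrows \<Lambda>"
    let ?B = "{b \<in> boundary_arrows \<Lambda>. fst b = fst a \<and> (?c \<otimes>\<^bsub>SA\<^esub> g) b \<noteq> \<zero>}"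
    show "((?c \<otimes>\<^bsub>SA\<^esub> g) \<otimes>\<^bsub>SA\<^esub> h) a = (?c \<otimes>\<^bsub>SA\<^esub> (g \<otimes>\<^bsub>SA\<^esub> h)) a"
    proof (cases "\<exists>z \<in> boundary_paths_from \<Lambda> (src \<Lambda> \<alpha>). fst a = prepend \<Lambda> \<alpha> z")
      case False
      have "b \<notin> ?B" for b using ind_mult_eval(2)[OF p g, of b] False by force
      then have e: "?B = {}" by blast
      have "((?c \<otimes>\<^bsub>SA\<^esub> g) \<otimes>\<^bsub>SA\<^esub> h) a = (\<Oplus>b \<in> ?B. (?c \<otimes>\<^bsub>SA\<^esub> g) b \<otimes> h (lquot b a))"
        using a by (simp only: SA_mult[of "?c \<otimes>\<^bsub>SA\<^esub> g"]) simp
      then have "((?c \<otimes>\<^bsub>SA\<^esub> g) \<otimes>\<^bsub>SA\<^esub> h) a = \<zero>" unfolding e by simp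
      then show ?thesis using ind_mult_eval(2)[OF p gh a False] by simp
    next
      case True
      then obtain z where z: "z \<in> boundary_paths_from \<Lambda> (src \<Lambda> \<alpha>)" "fst a = prepend \<Lambda> \<alpha> z" by blast
      let ?t = "arrow \<alpha> \<mu> z"
      have t: "?t \<in> boundary_arrows \<Lambda>" "fst ?t = fst a" using arrow_mem[OF p z(1)] z(2) by (simp_all add: arrow_def)
      have la: "lquot ?t a \<in> boundary_arrows \<Lambda>" using lquot_mem[OF a t(1)] t(2) by simp
      let ?C = "{b \<in> boundary_arrows \<Lambda>. fst b = fst (lquot ?t a) \<and> g b \<noteq> \<zero>}"
      have fl: "fst (lquot ?t b) = snd (snd ?t)" for b by (simp add: lquot_def)
      have cge: "(?c \<otimes>\<^bsub>SA\<^esub> g) b = g (lquot ?t b)" if "b \<in> boundary_arrows \<Lambda>" "fst b = fst a" for b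
        using ind_mult_eval(1)[OF p g that(1) z(1)] that(2) z(2) by simp
      have img: "lmult ?t ` ?C = ?B"
      proof (intro equalityI subsetI)
        fix b assume "b \<in> lmult ?t ` ?C"
        then obtain d where d: "d \<in> boundary_arrows \<Lambda>" "fst d = snd (snd ?t)" "g d \<noteq> \<zero>" "b = lmult ?t d" by (auto simp: fl)
        have "b \<in> boundary_arrows \<Lambda>" using lmult_mem[OF d(1) t(1) d(2)] d(4) by simp
        moreover have "fst b = fst a" using d(4) t(2) by (simp add: lmult_def)
        ultimately show "b \<in> ?B" using cge lquot_lmult[OF d(2)] d(3,4) by simp
      next
        fix b assume "b \<in> ?B"
        then have b: "b \<in> boundary_arrows \<Lambda>" "fst b = fst a" "(?c \<otimes>\<^bsub>SA\<^esub> g) b \<noteq> \<zero>" by blast+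
        have e: "fst b = fst ?t" using b(2) t(2) by simp
        have "lquot ?t b \<in> ?C" using lquot_mem[OF b(1) t(1) e] b(3) cge[OF b(1,2)] by (simp add: fl)
        then show "b \<in> lmult ?t ` ?C" by (rule image_eqI[rotated]) (rule lmult_lquot[OF e, symmetric])
      qed
      have inj: "inj_on (lmult ?t) ?C"
        by (rule inj_on_inverseI[of _ "lquot ?t"]) (simp add: lquot_lmult fl)
      have hc: "h (lquot b a) \<in> carrier R" if "b \<in> ?B" for b
        using SA_carrierD(2)[OF h lquot_mem[OF a]] that by auto
      have "((?c \<otimes>\<^bsub>SA\<^esub> g) \<otimes>\<^bsub>SA\<^esub> h) a = (\<Oplus>b \<in> ?B. (?c \<otimes>\<^bsub>SA\<^esub> g) b \<otimes> h (lquot b a))"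
        using a by (simp only: SA_mult[of "?c \<otimes>\<^bsub>SA\<^esub> g"]) simp
      also have "\<dots> = (\<Oplus>d \<in> ?C. (?c \<otimes>\<^bsub>SA\<^esub> g) (lmult ?t d) \<otimes> h (lquot (lmult ?t d) a))"
        unfolding img[symmetric]
      proof (rule finsum_reindex[OF _ inj])
        show "(\<lambda>b. (?c \<otimes>\<^bsub>SA\<^esub> g) b \<otimes> h (lquot b a)) \<in> lmult ?t ` ?C \<rightarrow> carrier R"
          unfolding img using hc SA_carrierD(2)[OF cg] by blast
      qed
      also have "\<dots> = (\<Oplus>d \<in> ?C. g d \<otimes> h (lquot d (lquot ?t a)))"
      proof (rule finsum_cong'[OF refl])
        show "(\<lambda>d. g d \<otimes> h (lquot d (lquot ?t a))) \<in> ?C \<rightarrow> carrier R"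
          using SA_carrierD(2)[OF g] SA_carrierD(2)[OF h lquot_mem[OF la]] by auto
        fix d assume d: "d \<in> ?C"
        then have "lmult ?t d \<in> ?B" unfolding img[symmetric] by (rule imageI)
        then have m: "lmult ?t d \<in> boundary_arrows \<Lambda>" "fst (lmult ?t d) = fst a" by blast+
        have l: "lquot ?t (lmult ?t d) = d" using d by (simp add: lquot_lmult fl)
        have "lquot (lmult ?t d) a = lquot d (lquot ?t a)" using lquot_lquot[OF m(2), of ?t] l by simp
        then show "(?c \<otimes>\<^bsub>SA\<^esub> g) (lmult ?t d) \<otimes> h (lquot (lmult ?t d) a) = g d \<otimes> h (lquot d (lquot ?t a))"
          using cge[OF m] l by simp
      qed
      also have "\<dots> = (g \<otimes>\<^bsub>SA\<^esub> h) (lquot ?t a)" using la by (simp add: SA_mult)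
      also have "\<dots> = (?c \<otimes>\<^bsub>SA\<^esub> (g \<otimes>\<^bsub>SA\<^esub> h)) a" using ind_mult_eval(1)[OF p gh a z] by simp
      finally show ?thesis .
    qed
  qed
  then show ?case using step g h cg gh SA_mult_closed
    by (simp add: SA_mult_linear(1,3)[of _ _ _ r] ind_closed)
qed

lemma nonunital_algebra_SA: "nonunital_algebra R SA"
  by (intro nonunital_algebra.intro nonunital_algebra_axioms.intro SA_module SA_mult_closed
      SA_mult_assoc SA_mult_linear) (assumption | rule one_closed)+

end

section \<open>The Kumjian-Pask family of indicators\<close>

context k_graph
begin

lemma Lambda_min_rng_left:
  assumes "\<mu> \<in> paths \<Lambda>" "v = rng \<Lambda> \<mu>"
  shows "Lambda_min \<Lambda> v \<mu> = {(\<mu>, src \<Lambda> \<mu>)}" "Lambda_min \<Lambda> \<mu> v = {(src \<Lambda> \<mu>, \<mu>)}"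
proof -
  have v: "v \<in> paths \<Lambda>" "src \<Lambda> v = rng \<Lambda> \<mu>" "comp \<Lambda> v \<mu> = \<mu>"
    using assms by (simp_all add: rng_closed src_rng comp_rng)
  show 1: "Lambda_min \<Lambda> v \<mu> = {(\<mu>, src \<Lambda> \<mu>)}" using Lambda_min_prefix[OF v(1) assms(1) v(2)] v(3) by simp
  have "l \<in> Lambda_min \<Lambda> \<mu> v \<longleftrightarrow> l \<in> {(src \<Lambda> \<mu>, \<mu>)}" for l
    using Lambda_min_swap[OF assms(1) v(1), of "fst l" "snd l"] unfolding 1 by (cases l) auto
  then show "Lambda_min \<Lambda> \<mu> v = {(src \<Lambda> \<mu>, \<mu>)}" by blast
qed

end

context boundary_steinberg
begin

definition T :: "'l generator \<Rightarrow> ('l, 'k) barrow \<Rightarrow> 'r" where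
  "T g = (case g of Path \<alpha> \<Rightarrow> ind (Z_pair \<Lambda> \<alpha> (src \<Lambda> \<alpha>)) | Ghost \<mu> \<Rightarrow> ind (Z_pair \<Lambda> (src \<Lambda> \<mu>) \<mu>))"

lemma T_Path: "T (Path \<alpha>) = ind (Z_pair \<Lambda> \<alpha> (src \<Lambda> \<alpha>))"
  by (simp add: T_def)

lemma T_star: "\<mu> \<in> paths \<Lambda> \<Longrightarrow> T (star \<Lambda> \<mu>) = ind (Z_pair \<Lambda> (src \<Lambda> \<mu>) \<mu>)"
  using vertexD(3)[of \<mu>] by (simp add: T_def star_def)

lemma T_closed: "T \<in> kp_generators \<Lambda> \<rightarrow> carrier SA"
  by (auto simp: kp_generators_def T_def intro!: ind_closed pairs_src)

lemma ind_mult_ind_single: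
  assumes p: "(\<alpha>, \<mu>) \<in> pairs" and q: "(\<beta>, \<nu>) \<in> pairs" and L: "Lambda_min \<Lambda> \<mu> \<beta> = {(\<rho>, \<tau>)}"
  shows "ind (Z_pair \<Lambda> \<alpha> \<mu>) \<otimes>\<^bsub>SA\<^esub> ind (Z_pair \<Lambda> \<beta> \<nu>) = ind (Z_pair \<Lambda> (comp \<Lambda> \<alpha> \<rho>) (comp \<Lambda> \<nu> \<tau>))"
proof -
  have "ind (Z_pair \<Lambda> (comp \<Lambda> \<alpha> \<rho>) (comp \<Lambda> \<nu> \<tau>)) \<in> carrier SA"
    using Z_pair_product_fst(1)[OF p q, of \<rho> \<tau>] L by (simp add: ind_closed)
  then show ?thesis unfolding ind_mult_ind[OF p q] L by simp
qed

lemma T_Path_star: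
  assumes p: "(\<alpha>, \<mu>) \<in> pairs"
  shows "T (Path \<alpha>) \<otimes>\<^bsub>SA\<^esub> T (star \<Lambda> \<mu>) = ind (Z_pair \<Lambda> \<alpha> \<mu>)"
proof -
  note d = pairsD[OF p]
  have "Lambda_min \<Lambda> (src \<Lambda> \<alpha>) (src \<Lambda> \<mu>) = {(src \<Lambda> \<alpha>, src \<Lambda> \<mu>)}"
    using Lambda_min_self[OF src_closed[OF d(1)]] d by (simp add: src_src)
  then show ?thesis
    unfolding T_Path T_star[OF d(2)] using ind_mult_ind_single[OF pairs_src(1)[OF d(1)] pairs_src(2)[OF d(2)]]
      comp_src[OF d(1)] comp_src[OF d(2)] by simp
qed

text \<open>Both idempotents are indicators of sets of units, so left multiplication by their
  difference multiplies \<open>h\<close> by a function of the range of \<open>a\<close>. Products of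
  such factors can be evaluated one factor at a time.\<close>

lemma T_factor_mult:
  assumes v: "v \<in> vertices \<Lambda>" and al: "\<alpha> \<in> paths \<Lambda>" "rng \<Lambda> \<alpha> = v" and h: "h \<in> carrier SA" and a: "a \<in> boundary_arrows \<Lambda>"
  shows "((T (Path v) \<ominus>\<^bsub>SA\<^esub> T (Path \<alpha>) \<otimes>\<^bsub>SA\<^esub> T (star \<Lambda> \<alpha>)) \<otimes>\<^bsub>SA\<^esub> h) a =
    (if fst a \<in> boundary_paths_from \<Lambda> v \<and> \<alpha> \<notin> initial_segs (fst a) then h a else \<zero>)"
proof -
  interpret N: nonunital_algebra R SA by (rule nonunital_algebra_SA)
  note vd = vertexD[OF v]
  have pa: "(\<alpha>, \<alpha>) \<in> pairs" and pv: "(v, v) \<in> pairs" using al vd by (auto simp: pairs_def)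
  note ca = ind_closed[OF pa] and cv = ind_closed[OF pv]
  have ha: "h a \<in> carrier R" using SA_carrierD(2)[OF h a] .
  have "T (Path v) \<ominus>\<^bsub>SA\<^esub> T (Path \<alpha>) \<otimes>\<^bsub>SA\<^esub> T (star \<Lambda> \<alpha>) = ind (Z_pair \<Lambda> v v) \<oplus>\<^bsub>SA\<^esub> (\<ominus> \<one>) \<odot>\<^bsub>SA\<^esub> ind (Z_pair \<Lambda> \<alpha> \<alpha>)"
    unfolding T_Path_star[OF pa] using T_Path[of v] vd cv ca by (simp add: a_minus_def SA.smult_l_minus)
  then have e: "((T (Path v) \<ominus>\<^bsub>SA\<^esub> T (Path \<alpha>) \<otimes>\<^bsub>SA\<^esub> T (star \<Lambda> \<alpha>)) \<otimes>\<^bsub>SA\<^esub> h) a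
    = (ind (Z_pair \<Lambda> v v) \<otimes>\<^bsub>SA\<^esub> h) a \<oplus> (\<ominus> \<one>) \<otimes> (ind (Z_pair \<Lambda> \<alpha> \<alpha>) \<otimes>\<^bsub>SA\<^esub> h) a"
    using ca cv h a by (simp add: SA_mult_linear(1,3)[of _ _ _ "\<ominus> \<one>"] SA_add_eval SA_smult_eval)
  have idt: "(ind (Z_pair \<Lambda> \<beta> \<beta>) \<otimes>\<^bsub>SA\<^esub> h) a = (if \<beta> \<in> initial_segs (fst a) then h a else \<zero>)"
    if b: "(\<beta>, \<beta>) \<in> pairs" for \<beta>
  proof -
    have faB: "fst a \<in> boundary_paths \<Lambda>"
    proof -
      obtain \<gamma> \<mu> z where z: "(\<gamma>, \<mu>) \<in> pairs" "z \<in> boundary_paths_from \<Lambda> (src \<Lambda> \<gamma>)" "a = arrow \<gamma> \<mu> z"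
        using a by (rule arrowE)
      then show ?thesis using prepend_props(1)[OF pairsD(1)[OF z(1)] z(2)] by (simp add: arrow_def)
    qed
    show ?thesis
    proof (cases "\<beta> \<in> initial_segs (fst a)")
      case True
      then obtain z where z: "z \<in> boundary_paths_from \<Lambda> (src \<Lambda> \<beta>)" "fst a = prepend \<Lambda> \<beta> z"
        using initial_segs_obtain[OF faB] by metis
      have "lquot (arrow \<beta> \<beta> z) a = a"
        using z(2) by (simp add: lquot_def arrow_def deg_diff_def prod_eq_iff vec_eq_iff)
      then show ?thesis using ind_mult_eval(1)[OF b h a z] True by simp
    next
      case False
      then have "\<not> (\<exists>z \<in> boundary_paths_from \<Lambda> (src \<Lambda> \<beta>). fst a = prepend \<Lambda> \<beta> z)"
        using mem_initial_segs_prepend[OF pairsD(1)[OF b]] by metis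
      then show ?thesis using ind_mult_eval(2)[OF b h a] False by simp
    qed
  qed
  have faB: "fst a \<in> boundary_paths \<Lambda>"
  proof -
    obtain \<gamma> \<mu> z where z: "(\<gamma>, \<mu>) \<in> pairs" "z \<in> boundary_paths_from \<Lambda> (src \<Lambda> \<gamma>)" "a = arrow \<gamma> \<mu> z"
      using a by (rule arrowE)
    then show ?thesis using prepend_props(1)[OF pairsD(1)[OF z(1)] z(2)] by (simp add: arrow_def)
  qed
  have 1: "fst a \<in> boundary_paths_from \<Lambda> v \<longleftrightarrow> v \<in> initial_segs (fst a)"
    using mem_boundary_paths_from[OF v] faB by simp
  have 2: "\<alpha> \<in> initial_segs (fst a) \<Longrightarrow> v \<in> initial_segs (fst a)"
    using tight_rng_mem[OF initial_segs_tight[OF faB]] al(2) by blast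
  show ?thesis unfolding e idt[OF pv] idt[OF pa] 1 using 2 ha by (auto simp: l_minus r_neg)
qed

lemma kp_family_T: "kp_family \<Lambda> SA T"
  unfolding kp_family_def
proof (intro conjI T_closed ballI)
  interpret N: nonunital_algebra R SA by (rule nonunital_algebra_SA)
  have vp: "v \<in> vertices \<Lambda> \<Longrightarrow> T (Path v) = ind (Z_pair \<Lambda> v v)" for v
    using T_Path[of v] vertexD(3)[of v] by simp
  have path: "T (Path \<alpha>) \<otimes>\<^bsub>SA\<^esub> T (Path \<mu>) = T (Path (comp \<Lambda> \<alpha> \<mu>))"
    if am: "\<alpha> \<in> paths \<Lambda>" "\<mu> \<in> paths \<Lambda>" "src \<Lambda> \<alpha> = rng \<Lambda> \<mu>" for \<alpha> \<mu>
    unfolding T_Path src_comp[OF am]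
    using ind_mult_ind_single[OF pairs_src(1)[OF am(1)] pairs_src(1)[OF am(2)] Lambda_min_rng_left(1)[OF am(2,3)]]
      comp_src[OF src_closed[OF am(2)]] src_src[OF am(2)] by simp
  have ghost: "T (star \<Lambda> \<mu>) \<otimes>\<^bsub>SA\<^esub> T (star \<Lambda> \<alpha>) = T (star \<Lambda> (comp \<Lambda> \<alpha> \<mu>))"
    if am: "\<alpha> \<in> paths \<Lambda>" "\<mu> \<in> paths \<Lambda>" "src \<Lambda> \<alpha> = rng \<Lambda> \<mu>" for \<alpha> \<mu>
    unfolding T_star[OF am(1)] T_star[OF am(2)] T_star[OF comp_closed[OF am]] src_comp[OF am]
    using ind_mult_ind_single[OF pairs_src(2)[OF am(2)] pairs_src(2)[OF am(1)] Lambda_min_rng_left(2)[OF am(2,3)]]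
      comp_src[OF src_closed[OF am(2)]] src_src[OF am(2)] by simp
  fix p assume p: "p \<in> kp_relations \<Lambda> SA T"
  obtain a b where ab: "p = (a, b)" by (cases p)
  have "a = b" using p unfolding ab
  proof (cases rule: kp_relations.cases)
    case (KP1_idem v)
    then show ?thesis using path[of v v] vertexD[of v] comp_rng[of v] by simp
  next
    case (KP1_orth v w)
    note vd = vertexD[OF KP1_orth(3)] and wd = vertexD[OF KP1_orth(4)]
    have "Lambda_min \<Lambda> v w = {}" by (rule Lambda_min_same_deg) (use vd wd KP1_orth(5) in simp_all)
    moreover have "(v, v) \<in> pairs" "(w, w) \<in> pairs" using vd wd by (simp_all add: pairs_def)
    ultimately show ?thesis using KP1_orth vp ind_mult_ind[of v v w w] by simp
  next
    case (KP2_path \<alpha> \<mu>)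
    then show ?thesis using path by simp
  next
    case (KP2_ghost \<alpha> \<mu>)
    then show ?thesis using ghost by simp
  next
    case (KP3 \<alpha> \<mu>)
    have "a = (\<Oplus>\<^bsub>SA\<^esub>l \<in> Lambda_min \<Lambda> \<alpha> \<mu>. ind (Z_pair \<Lambda> (comp \<Lambda> (src \<Lambda> \<alpha>) (fst l)) (comp \<Lambda> (src \<Lambda> \<mu>) (snd l))))"
      unfolding KP3(1) T_Path T_star[OF KP3(3)]
      by (rule ind_mult_ind[OF pairs_src(2)[OF KP3(3)] pairs_src(1)[OF KP3(4)]])
    also have "\<dots> = b" unfolding KP3(2)
    proof (rule SA.M.finsum_cong'[OF refl])
      have lp: "(fst l, snd l) \<in> pairs" if "l \<in> Lambda_min \<Lambda> \<alpha> \<mu>" for l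
      proof -
        have m: "(fst l, snd l) \<in> Lambda_min \<Lambda> \<alpha> \<mu>" using that by simp
        show ?thesis unfolding pairs_def mem_Collect_eq prod.case
          using Lambda_minD(1,2)[OF m] Lambda_min_src[OF KP3(3,4) m] by blast
      qed
      show "(\<lambda>l. T (Path (fst l)) \<otimes>\<^bsub>SA\<^esub> T (star \<Lambda> (snd l))) \<in> Lambda_min \<Lambda> \<alpha> \<mu> \<rightarrow> carrier SA"
        using T_Path_star[OF lp] ind_closed[OF lp] by simp
      fix l assume l: "l \<in> Lambda_min \<Lambda> \<alpha> \<mu>"
      note d = Lambda_minD[of "fst l" "snd l", simplified, OF l]
      have "comp \<Lambda> (src \<Lambda> \<alpha>) (fst l) = fst l" "comp \<Lambda> (src \<Lambda> \<mu>) (snd l) = snd l"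
        using comp_rng[OF d(1)] comp_rng[OF d(2)] d(3,4) by simp_all
      then show "ind (Z_pair \<Lambda> (comp \<Lambda> (src \<Lambda> \<alpha>) (fst l)) (comp \<Lambda> (src \<Lambda> \<mu>) (snd l))) = T (Path (fst l)) \<otimes>\<^bsub>SA\<^esub> T (star \<Lambda> (snd l))"
        using T_Path_star[OF lp[OF l]] by simp
    qed
    finally show ?thesis .
  next
    case (KP4 v E \<alpha>s)
    note v = KP4(3) and E = KP4(4) and sE = KP4(6)
    let ?D = "\<lambda>\<alpha>. T (Path v) \<ominus>\<^bsub>SA\<^esub> T (Path \<alpha>) \<otimes>\<^bsub>SA\<^esub> T (star \<Lambda> \<alpha>)"
    note kf = kp_factors_closed[OF nonunital_algebra_SA T_closed v E sE]
    have Ev: "\<alpha> \<in> paths \<Lambda>" "rng \<Lambda> \<alpha> = v" if "\<alpha> \<in> set \<alpha>s" for \<alpha>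
      using that E sE by (auto simp: FE_def exhaustive_def paths_from_def)
    have pv: "(v, v) \<in> pairs" using vertexD[OF v] by (simp add: pairs_def)
    \<comment> \<open>The last factor of a \<open>list_product\<close> stands alone; multiplying it
      by \<open>T (Path v)\<close> brings it into the form treated by
      \<open>T_factor_mult\<close>.\<close>
    have Dv: "?D \<alpha> \<otimes>\<^bsub>SA\<^esub> T (Path v) = ?D \<alpha>" if al: "\<alpha> \<in> set \<alpha>s" for \<alpha>
    proof -
      note e = Ev[OF al]
      have pa: "(\<alpha>, \<alpha>) \<in> pairs" using e by (simp add: pairs_def)
      have "ind (Z_pair \<Lambda> \<alpha> \<alpha>) \<otimes>\<^bsub>SA\<^esub> ind (Z_pair \<Lambda> v v) = ind (Z_pair \<Lambda> \<alpha> \<alpha>)"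
        using ind_mult_ind_single[OF pa pv Lambda_min_rng_left(2)[OF e(1) e(2)[symmetric]]] comp_src[OF e(1)] comp_rng[OF e(1)] e(2)
        by simp
      moreover have "T (Path v) \<otimes>\<^bsub>SA\<^esub> T (Path v) = T (Path v)"
        using path[of v v] vertexD[OF v] comp_rng[of v] by simp
      moreover have "?D \<alpha> = ind (Z_pair \<Lambda> v v) \<oplus>\<^bsub>SA\<^esub> (\<ominus> \<one>) \<odot>\<^bsub>SA\<^esub> ind (Z_pair \<Lambda> \<alpha> \<alpha>)"
        unfolding T_Path_star[OF pa] vp[OF v] using ind_closed[OF pa] ind_closed[OF pv] by (simp add: a_minus_def SA.smult_l_minus)
      ultimately show ?thesis
        using ind_closed[OF pa] ind_closed[OF pv] by (simp add: vp[OF v] SA_mult_linear(1,3)[of _ _ _ "\<ominus> \<one>"])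
    qed
    have Dc: "?D \<alpha> \<in> carrier SA" if "\<alpha> \<in> set \<alpha>s" for \<alpha> using kf(3) that by auto
    have lpc: "list_product SA (map ?D \<beta>s) \<in> carrier SA" if "\<beta>s \<noteq> []" "set \<beta>s \<subseteq> set \<alpha>s" for \<beta>s
      using that Dc by (intro N.list_product_closed) auto
    \<comment> \<open>The product lives on arrows whose range avoids every path in the list; for a
      set in \<open>FE\<close> there is no such boundary path.\<close>
    have nz: "fst x \<in> boundary_paths_from \<Lambda> v \<and> (\<forall>\<alpha> \<in> set \<beta>s. \<alpha> \<notin> initial_segs (fst x))"
      if "\<beta>s \<noteq> []" "set \<beta>s \<subseteq> set \<alpha>s" "x \<in> boundary_arrows \<Lambda>" "list_product SA (map ?D \<beta>s) x \<noteq> \<zero>" for \<beta>s x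
      using that
    proof (induction \<beta>s)
      case (Cons \<beta> \<beta>s)
      have b: "\<beta> \<in> set \<alpha>s" using Cons.prems by simp
      show ?case
      proof (cases "\<beta>s = []")
        case True
        have "(?D \<beta> \<otimes>\<^bsub>SA\<^esub> T (Path v)) x \<noteq> \<zero>" using Cons.prems(4) True Dv[OF b] by simp
        moreover have "T (Path v) \<in> carrier SA" using ind_closed[OF pv] vp[OF v] by simp
        ultimately show ?thesis
          using T_factor_mult[OF v Ev[OF b] _ Cons.prems(3), of "T (Path v)"] True by (auto split: if_splits)
      next
        case False
        then have e: "list_product SA (map ?D (\<beta> # \<beta>s)) = ?D \<beta> \<otimes>\<^bsub>SA\<^esub> list_product SA (map ?D \<beta>s)"
          by (cases \<beta>s) auto
        have "list_product SA (map ?D \<beta>s) \<in> carrier SA" using lpc[OF False] Cons.prems(2) by simp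
        then show ?thesis
          using T_factor_mult[OF v Ev[OF b] _ Cons.prems(3)] Cons.prems(4) Cons.IH[OF False _ Cons.prems(3)] Cons.prems(2)
          unfolding e by (auto split: if_splits)
      qed
    qed simp
    have ac: "a \<in> carrier SA" unfolding KP4(1) using lpc[OF kf(1)] by simp
    have "a x = \<zero>" if x: "x \<in> boundary_arrows \<Lambda>" for x
    proof (rule ccontr)
      assume "a x \<noteq> \<zero>"
      then have h: "fst x \<in> boundary_paths_from \<Lambda> v" "\<forall>\<alpha> \<in> E. \<alpha> \<notin> initial_segs (fst x)"
        using nz[OF kf(1) _ x] sE unfolding KP4(1) by auto
      obtain \<nu> u where n: "\<nu> \<in> E" "u \<in> boundary_paths_from \<Lambda> (src \<Lambda> \<nu>)" "fst x = prepend \<Lambda> \<nu> u"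
        using boundary_path_through_FE[OF v h(1) E] .
      then show False using h(2) mem_initial_segs_prepend[of \<nu> u] Ev[of \<nu>] sE by auto
    qed
    then show ?thesis unfolding KP4(2)
      by (intro SA_ext[OF SA_carrierD(1)[OF ac] SA_carrierD(1)[OF SA_zero_closed]]) (simp add: SA_simps)
  qed
  then show "case p of (a, b) \<Rightarrow> a = b" using ab by simp
qed

end

section \<open>Kumjian-Pask families in an arbitrary algebra\<close>

context nonunital_algebra
begin

lemma finsum_mult_left:
  assumes "finite I" "x \<in> carrier A" "F \<in> I \<rightarrow> carrier A"
  shows "x \<otimes>\<^bsub>A\<^esub> (\<Oplus>\<^bsub>A\<^esub>i \<in> I. F i) = (\<Oplus>\<^bsub>A\<^esub>i \<in> I. x \<otimes>\<^bsub>A\<^esub> F i)"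
  using assms
proof (induction I rule: finite_induct)
  case (insert i I)
  have "(\<Oplus>\<^bsub>A\<^esub>i \<in> I. F i) \<in> carrier A" using insert by (intro M.finsum_closed) auto
  then show ?case using insert by (simp add: amult_r_distr amult_closed Pi_iff)
qed (simp add: amult_zero)

lemma finsum_mult_right:
  assumes "finite I" "x \<in> carrier A" "F \<in> I \<rightarrow> carrier A"
  shows "(\<Oplus>\<^bsub>A\<^esub>i \<in> I. F i) \<otimes>\<^bsub>A\<^esub> x = (\<Oplus>\<^bsub>A\<^esub>i \<in> I. F i \<otimes>\<^bsub>A\<^esub> x)"
  using assms
proof (induction I rule: finite_induct)
  case (insert i I)
  have "(\<Oplus>\<^bsub>A\<^esub>i \<in> I. F i) \<in> carrier A" using insert by (intro M.finsum_closed) auto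
  then show ?case using insert by (simp add: amult_l_distr amult_closed Pi_iff)
qed (simp add: amult_zero)

lemma amult_minus_left:
  assumes "x \<in> carrier A" "y \<in> carrier A" "z \<in> carrier A"
  shows "(x \<ominus>\<^bsub>A\<^esub> y) \<otimes>\<^bsub>A\<^esub> z = x \<otimes>\<^bsub>A\<^esub> z \<ominus>\<^bsub>A\<^esub> y \<otimes>\<^bsub>A\<^esub> z"
proof -
  have "x \<otimes>\<^bsub>A\<^esub> z = ((x \<ominus>\<^bsub>A\<^esub> y) \<oplus>\<^bsub>A\<^esub> y) \<otimes>\<^bsub>A\<^esub> z"
    using assms by (simp add: a_minus_def[of A] M.a_assoc M.l_neg)
  also have "\<dots> = (x \<ominus>\<^bsub>A\<^esub> y) \<otimes>\<^bsub>A\<^esub> z \<oplus>\<^bsub>A\<^esub> y \<otimes>\<^bsub>A\<^esub> z" using assms by (simp add: amult_l_distr)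
  finally show ?thesis using assms
    by (simp add: a_minus_def[of A] M.a_assoc M.r_neg amult_closed)
qed

lemma amult_minus_right:
  assumes "x \<in> carrier A" "y \<in> carrier A" "z \<in> carrier A"
  shows "z \<otimes>\<^bsub>A\<^esub> (x \<ominus>\<^bsub>A\<^esub> y) = z \<otimes>\<^bsub>A\<^esub> x \<ominus>\<^bsub>A\<^esub> z \<otimes>\<^bsub>A\<^esub> y"
proof -
  have "z \<otimes>\<^bsub>A\<^esub> x = z \<otimes>\<^bsub>A\<^esub> ((x \<ominus>\<^bsub>A\<^esub> y) \<oplus>\<^bsub>A\<^esub> y)"
    using assms by (simp add: a_minus_def[of A] M.a_assoc M.l_neg)
  also have "\<dots> = z \<otimes>\<^bsub>A\<^esub> (x \<ominus>\<^bsub>A\<^esub> y) \<oplus>\<^bsub>A\<^esub> z \<otimes>\<^bsub>A\<^esub> y" using assms by (simp add: amult_r_distr)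
  finally show ?thesis using assms
    by (simp add: a_minus_def[of A] M.a_assoc M.r_neg amult_closed)
qed

end

section \<open>Range projections of a Kumjian-Pask family\<close>

locale kp_fam = finitely_aligned_kgraph \<Lambda> + A: nonunital_algebra R A
  for \<Lambda> :: "('l, 'k::finite) kgraph" and R :: "('r, 'm) ring_scheme" (structure)
    and A :: "('r, 'a, 'n) module_scheme" +
  fixes S :: "'l generator \<Rightarrow> 'a"
  assumes family: "kp_family \<Lambda> A S"
begin

definition P :: "'l \<Rightarrow> 'a" where "P \<alpha> = S (Path \<alpha>)"
definition Q :: "'l \<Rightarrow> 'a" where "Q \<alpha> = S (star \<Lambda> \<alpha>)"

abbreviation amult (infixl "\<otimes>\<^sub>A" 70) where "x \<otimes>\<^sub>A y \<equiv> x \<otimes>\<^bsub>A\<^esub> y"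
abbreviation aadd (infixl "\<oplus>\<^sub>A" 65) where "x \<oplus>\<^sub>A y \<equiv> x \<oplus>\<^bsub>A\<^esub> y"
abbreviation aminus (infixl "\<ominus>\<^sub>A" 65) where "x \<ominus>\<^sub>A y \<equiv> x \<ominus>\<^bsub>A\<^esub> y"
abbreviation azero ("\<zero>\<^sub>A") where "\<zero>\<^sub>A \<equiv> \<zero>\<^bsub>A\<^esub>"

lemma relation: "(a, b) \<in> kp_relations \<Lambda> A S \<Longrightarrow> a = b"
  using family by (auto simp: kp_family_def)

lemma S_closed: "S \<in> kp_generators \<Lambda> \<rightarrow> carrier A"
  using family by (simp add: kp_family_def)

lemma P_closed [simp, intro]: "\<alpha> \<in> paths \<Lambda> \<Longrightarrow> P \<alpha> \<in> carrier A"
  using funcset_mem[OF S_closed Path_mem_generators] by (simp add: P_def)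

lemma Q_closed [simp, intro]: "\<alpha> \<in> paths \<Lambda> \<Longrightarrow> Q \<alpha> \<in> carrier A"
  using funcset_mem[OF S_closed star_mem_generators] by (simp add: Q_def)

lemma Q_vertex: "v \<in> vertices \<Lambda> \<Longrightarrow> Q v = P v"
  by (simp add: P_def Q_def star_def)

lemma P_mult: "\<lbrakk>\<alpha> \<in> paths \<Lambda>; \<mu> \<in> paths \<Lambda>; src \<Lambda> \<alpha> = rng \<Lambda> \<mu>\<rbrakk> \<Longrightarrow> P \<alpha> \<otimes>\<^sub>A P \<mu> = P (comp \<Lambda> \<alpha> \<mu>)"
  unfolding P_def by (rule relation[OF kp_relations.KP2_path])

lemma Q_mult: "\<lbrakk>\<alpha> \<in> paths \<Lambda>; \<mu> \<in> paths \<Lambda>; src \<Lambda> \<alpha> = rng \<Lambda> \<mu>\<rbrakk> \<Longrightarrow> Q \<mu> \<otimes>\<^sub>A Q \<alpha> = Q (comp \<Lambda> \<alpha> \<mu>)"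
  unfolding Q_def by (rule relation[OF kp_relations.KP2_ghost])

lemma Q_P: "\<lbrakk>\<alpha> \<in> paths \<Lambda>; \<mu> \<in> paths \<Lambda>\<rbrakk> \<Longrightarrow> Q \<alpha> \<otimes>\<^sub>A P \<mu> = (\<Oplus>\<^bsub>A\<^esub>l \<in> Lambda_min \<Lambda> \<alpha> \<mu>. P (fst l) \<otimes>\<^sub>A Q (snd l))"
  unfolding P_def Q_def by (rule relation[OF kp_relations.KP3])

lemma Lambda_min_paths: "l \<in> Lambda_min \<Lambda> \<alpha> \<mu> \<Longrightarrow> fst l \<in> paths \<Lambda>" "l \<in> Lambda_min \<Lambda> \<alpha> \<mu> \<Longrightarrow> snd l \<in> paths \<Lambda>"
  using Lambda_minD(1,2)[of "fst l" "snd l"] by simp_all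

lemma P_src: "\<alpha> \<in> paths \<Lambda> \<Longrightarrow> P \<alpha> \<otimes>\<^sub>A P (src \<Lambda> \<alpha>) = P \<alpha>"
  using P_mult[of \<alpha> "src \<Lambda> \<alpha>"] by (simp add: src_closed rng_src comp_src)

lemma P_rng: "\<alpha> \<in> paths \<Lambda> \<Longrightarrow> P (rng \<Lambda> \<alpha>) \<otimes>\<^sub>A P \<alpha> = P \<alpha>"
  using P_mult[of "rng \<Lambda> \<alpha>" \<alpha>] by (simp add: rng_closed src_rng comp_rng)

lemma Q_src: "\<alpha> \<in> paths \<Lambda> \<Longrightarrow> P (src \<Lambda> \<alpha>) \<otimes>\<^sub>A Q \<alpha> = Q \<alpha>"
  using Q_mult[of \<alpha> "src \<Lambda> \<alpha>"] by (simp add: src_closed rng_src comp_src Q_vertex[OF vertex_src])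

lemma Q_rng: "\<alpha> \<in> paths \<Lambda> \<Longrightarrow> Q \<alpha> \<otimes>\<^sub>A P (rng \<Lambda> \<alpha>) = Q \<alpha>"
  using Q_mult[of "rng \<Lambda> \<alpha>" \<alpha>] by (simp add: rng_closed src_rng comp_rng Q_vertex[OF vertex_rng])

lemma Q_P_self:
  assumes "\<alpha> \<in> paths \<Lambda>" shows "Q \<alpha> \<otimes>\<^sub>A P \<alpha> = P (src \<Lambda> \<alpha>)"
  using Q_P[OF assms assms] Lambda_min_self[OF assms] assms P_src[OF src_closed[OF assms]]
  by (simp add: src_closed Q_vertex[OF vertex_src] src_src A.amult_closed)

definition proj :: "'l \<Rightarrow> 'a" where "proj \<alpha> = P \<alpha> \<otimes>\<^sub>A Q \<alpha>"

lemma proj_closed [simp, intro]: "\<alpha> \<in> paths \<Lambda> \<Longrightarrow> proj \<alpha> \<in> carrier A"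
  by (simp add: proj_def A.amult_closed)

text \<open>(KP3) in the middle of \<open>P \<alpha> Q \<alpha> P \<mu> Q \<mu>\<close> gives one
  projection for each minimal common extension. The index set is rewritten as \<open>MCE\<close> to
  exhibit the symmetry in \<open>\<alpha>\<close> and \<open>\<mu>\<close> behind
  \<open>proj_commute\<close>.\<close>

lemma proj_mult:
  assumes a: "\<alpha> \<in> paths \<Lambda>" and m: "\<mu> \<in> paths \<Lambda>"
  shows "proj \<alpha> \<otimes>\<^sub>A proj \<mu> = (\<Oplus>\<^bsub>A\<^esub>\<kappa> \<in> (\<lambda>l. comp \<Lambda> \<alpha> (fst l)) ` Lambda_min \<Lambda> \<alpha> \<mu>. proj \<kappa>)"
    "(\<lambda>l. comp \<Lambda> \<alpha> (fst l)) ` Lambda_min \<Lambda> \<alpha> \<mu> = MCE \<Lambda> \<alpha> \<mu>"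
proof -
  let ?L = "Lambda_min \<Lambda> \<alpha> \<mu>"
  note fin = finite_Lambda_min[OF a m]
  have d: "fst l \<in> paths \<Lambda>" "snd l \<in> paths \<Lambda>" "src \<Lambda> \<alpha> = rng \<Lambda> (fst l)" "src \<Lambda> \<mu> = rng \<Lambda> (snd l)"
    "comp \<Lambda> \<mu> (snd l) = comp \<Lambda> \<alpha> (fst l)" if "l \<in> ?L" for l
    using Lambda_minD(1-5)[of "fst l" "snd l"] that by simp_all
  have "proj \<alpha> \<otimes>\<^sub>A proj \<mu> = P \<alpha> \<otimes>\<^sub>A (Q \<alpha> \<otimes>\<^sub>A P \<mu>) \<otimes>\<^sub>A Q \<mu>"
    using a m by (simp add: proj_def A.amult_closed A.amult_assoc)
  also have "P \<alpha> \<otimes>\<^sub>A (Q \<alpha> \<otimes>\<^sub>A P \<mu>) = (\<Oplus>\<^bsub>A\<^esub>l \<in> ?L. P \<alpha> \<otimes>\<^sub>A (P (fst l) \<otimes>\<^sub>A Q (snd l)))"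
    unfolding Q_P[OF a m] by (rule A.finsum_mult_left[OF fin]) (use a d in \<open>auto intro: A.amult_closed\<close>)
  also have "\<dots> \<otimes>\<^sub>A Q \<mu> = (\<Oplus>\<^bsub>A\<^esub>l \<in> ?L. P \<alpha> \<otimes>\<^sub>A (P (fst l) \<otimes>\<^sub>A Q (snd l)) \<otimes>\<^sub>A Q \<mu>)"
    by (rule A.finsum_mult_right[OF fin]) (use a m d in \<open>auto intro!: A.amult_closed\<close>)
  also have "\<dots> = (\<Oplus>\<^bsub>A\<^esub>l \<in> ?L. proj (comp \<Lambda> \<alpha> (fst l)))"
  proof (rule A.M.finsum_cong'[OF refl])
    show "(\<lambda>l. proj (comp \<Lambda> \<alpha> (fst l))) \<in> ?L \<rightarrow> carrier A" using a d by (auto intro!: proj_closed comp_closed)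
    fix l assume l: "l \<in> ?L"
    note dl = d[OF l]
    have "P \<alpha> \<otimes>\<^sub>A (P (fst l) \<otimes>\<^sub>A Q (snd l)) \<otimes>\<^sub>A Q \<mu> = (P \<alpha> \<otimes>\<^sub>A P (fst l)) \<otimes>\<^sub>A (Q (snd l) \<otimes>\<^sub>A Q \<mu>)"
      using a m dl(1,2) by (simp add: A.amult_closed A.amult_assoc)
    also have "\<dots> = proj (comp \<Lambda> \<alpha> (fst l))"
      unfolding proj_def using P_mult[OF a dl(1,3)] Q_mult[OF m dl(2,4)] dl(5) by simp
    finally show "P \<alpha> \<otimes>\<^sub>A (P (fst l) \<otimes>\<^sub>A Q (snd l)) \<otimes>\<^sub>A Q \<mu> = proj (comp \<Lambda> \<alpha> (fst l))" .
  qed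
  also have "\<dots> = (\<Oplus>\<^bsub>A\<^esub>\<kappa> \<in> (\<lambda>l. comp \<Lambda> \<alpha> (fst l)) ` ?L. proj \<kappa>)"
  proof (rule A.M.finsum_reindex[symmetric])
    show "proj \<in> (\<lambda>l. comp \<Lambda> \<alpha> (fst l)) ` ?L \<rightarrow> carrier A" using a d by (auto intro!: proj_closed comp_closed)
    show "inj_on (\<lambda>l. comp \<Lambda> \<alpha> (fst l)) ?L"
    proof (rule inj_onI)
      fix l l' assume l: "l \<in> ?L" "l' \<in> ?L" "comp \<Lambda> \<alpha> (fst l) = comp \<Lambda> \<alpha> (fst l')"
      have "fst l = fst l'" by (rule comp_left_cancel[OF a d(1,3)[OF l(1)] d(1,3)[OF l(2)] l(3)])
      moreover have "snd l = snd l'"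
      proof (rule Lambda_min_fst_unique[OF a m])
        show "(fst l, snd l) \<in> ?L" using l(1) by simp
        show "(fst l, snd l') \<in> ?L" using l(2) calculation by simp
      qed
      ultimately show "l = l'" by (rule prod_eqI)
    qed
  qed
  finally show "proj \<alpha> \<otimes>\<^sub>A proj \<mu> = (\<Oplus>\<^bsub>A\<^esub>\<kappa> \<in> (\<lambda>l. comp \<Lambda> \<alpha> (fst l)) ` ?L. proj \<kappa>)" .
  show "(\<lambda>l. comp \<Lambda> \<alpha> (fst l)) ` ?L = MCE \<Lambda> \<alpha> \<mu>"
  proof (intro equalityI subsetI)
    fix \<kappa> assume "\<kappa> \<in> (\<lambda>l. comp \<Lambda> \<alpha> (fst l)) ` ?L"
    then show "\<kappa> \<in> MCE \<Lambda> \<alpha> \<mu>" by (auto simp: Lambda_min_def)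
  next
    fix \<kappa> assume k: "\<kappa> \<in> MCE \<Lambda> \<alpha> \<mu>"
    then have kp: "\<kappa> \<in> paths \<Lambda>" "deg \<Lambda> \<kappa> = deg_join (deg \<Lambda> \<alpha>) (deg \<Lambda> \<mu>)" by (auto simp: MCE_def)
    have "prefix \<alpha> \<kappa>" "prefix \<mu> \<kappa>"
      using k initial_seg_eq_iff[OF kp(1) a] initial_seg_eq_iff[OF kp(1) m] kp(2) deg_join_upper by (auto simp: MCE_def)
    then obtain \<rho> \<tau> where "\<rho> \<in> paths \<Lambda>" "src \<Lambda> \<alpha> = rng \<Lambda> \<rho>" "\<kappa> = comp \<Lambda> \<alpha> \<rho>"
      "\<tau> \<in> paths \<Lambda>" "src \<Lambda> \<mu> = rng \<Lambda> \<tau>" "\<kappa> = comp \<Lambda> \<mu> \<tau>" by (metis prefixE)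
    then have "(\<rho>, \<tau>) \<in> ?L" using k by (auto simp: Lambda_min_def)
    then show "\<kappa> \<in> (\<lambda>l. comp \<Lambda> \<alpha> (fst l)) ` ?L" using \<open>\<kappa> = comp \<Lambda> \<alpha> \<rho>\<close> by force
  qed
qed

lemma proj_commute: "\<lbrakk>\<alpha> \<in> paths \<Lambda>; \<mu> \<in> paths \<Lambda>\<rbrakk> \<Longrightarrow> proj \<alpha> \<otimes>\<^sub>A proj \<mu> = proj \<mu> \<otimes>\<^sub>A proj \<alpha>"
  by (simp add: proj_mult) (simp add: MCE_def deg_join_commute conj_ac)

lemma proj_idem: "\<alpha> \<in> paths \<Lambda> \<Longrightarrow> proj \<alpha> \<otimes>\<^sub>A proj \<alpha> = proj \<alpha>"
  by (simp add: proj_mult(1) Lambda_min_self comp_src)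

lemma proj_orth: "\<lbrakk>\<alpha> \<in> paths \<Lambda>; \<mu> \<in> paths \<Lambda>; Lambda_min \<Lambda> \<alpha> \<mu> = {}\<rbrakk> \<Longrightarrow> proj \<alpha> \<otimes>\<^sub>A proj \<mu> = \<zero>\<^sub>A"
  by (simp add: proj_mult(1))

lemma P_rng_proj: "\<alpha> \<in> paths \<Lambda> \<Longrightarrow> P (rng \<Lambda> \<alpha>) \<otimes>\<^sub>A proj \<alpha> = proj \<alpha>"
  by (simp add: proj_def A.amult_assoc[symmetric] rng_closed P_rng)

lemma proj_P_rng: "\<alpha> \<in> paths \<Lambda> \<Longrightarrow> proj \<alpha> \<otimes>\<^sub>A P (rng \<Lambda> \<alpha>) = proj \<alpha>"
  by (simp add: proj_def A.amult_assoc rng_closed Q_rng)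

definition fac :: "'l \<Rightarrow> 'l \<Rightarrow> 'a" where "fac v \<nu> = P v \<ominus>\<^sub>A proj \<nu>"

text \<open>Unlike \<open>list_product\<close> this ends with \<open>P v\<close>, so the empty list
  gives the local unit at \<open>v\<close>, and inductions and concatenations can start from
  it.\<close>

fun PL :: "'l \<Rightarrow> 'l list \<Rightarrow> 'a" where
  "PL v [] = P v"
| "PL v (\<nu> # \<nu>s) = fac v \<nu> \<otimes>\<^sub>A PL v \<nu>s"

end

context nonunital_algebra
begin

lemma minus_add_cancel:
  assumes "x \<in> carrier A" "p \<in> carrier A" "s \<in> carrier A"
  shows "(x \<ominus>\<^bsub>A\<^esub> p) \<oplus>\<^bsub>A\<^esub> (p \<oplus>\<^bsub>A\<^esub> s) = x \<oplus>\<^bsub>A\<^esub> s"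
proof -
  have "(x \<ominus>\<^bsub>A\<^esub> p) \<oplus>\<^bsub>A\<^esub> (p \<oplus>\<^bsub>A\<^esub> s) = x \<oplus>\<^bsub>A\<^esub> ((\<ominus>\<^bsub>A\<^esub> p \<oplus>\<^bsub>A\<^esub> p) \<oplus>\<^bsub>A\<^esub> s)"
    unfolding a_minus_def using assms M.a_assoc M.a_closed M.a_inv_closed by metis
  then show ?thesis using assms by (simp add: M.l_neg)
qed

end

section \<open>Products of the factors in (KP4)\<close>

context kp_fam
begin

lemma fac_closed [simp, intro]: "\<lbrakk>v \<in> paths \<Lambda>; \<nu> \<in> paths \<Lambda>\<rbrakk> \<Longrightarrow> fac v \<nu> \<in> carrier A"
  by (simp add: fac_def)

lemma PL_closed [simp, intro]: "\<lbrakk>v \<in> paths \<Lambda>; set \<nu>s \<subseteq> paths \<Lambda>\<rbrakk> \<Longrightarrow> PL v \<nu>s \<in> carrier A"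
  by (induction \<nu>s) (auto simp: A.amult_closed)

lemma P_idem: "v \<in> vertices \<Lambda> \<Longrightarrow> P v \<otimes>\<^sub>A P v = P v"
  using P_src[of v] vertexD[of v] by simp

lemma fac_P:
  assumes "v \<in> vertices \<Lambda>" "\<nu> \<in> paths_from \<Lambda> v"
  shows "P v \<otimes>\<^sub>A fac v \<nu> = fac v \<nu>" "fac v \<nu> \<otimes>\<^sub>A P v = fac v \<nu>"
proof -
  have n: "\<nu> \<in> paths \<Lambda>" "rng \<Lambda> \<nu> = v" and v: "v \<in> paths \<Lambda>"
    using assms vertexD(1) by (auto simp: paths_from_def)
  show "P v \<otimes>\<^sub>A fac v \<nu> = fac v \<nu>" unfolding fac_def
    using A.amult_minus_right[OF P_closed[OF v] proj_closed[OF n(1)] P_closed[OF v]] P_idem[OF assms(1)] P_rng_proj[OF n(1)] n(2) by simp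
  show "fac v \<nu> \<otimes>\<^sub>A P v = fac v \<nu>" unfolding fac_def
    using A.amult_minus_left[OF P_closed[OF v] proj_closed[OF n(1)] P_closed[OF v]] P_idem[OF assms(1)] proj_P_rng[OF n(1)] n(2) by simp
qed

lemma P_PL:
  assumes "v \<in> vertices \<Lambda>" "set \<nu>s \<subseteq> paths_from \<Lambda> v"
  shows "P v \<otimes>\<^sub>A PL v \<nu>s = PL v \<nu>s" "PL v \<nu>s \<otimes>\<^sub>A P v = PL v \<nu>s"
proof -
  have v: "v \<in> paths \<Lambda>" using assms vertexD(1) by blast
  have n: "set \<nu>s \<subseteq> paths \<Lambda>" using assms(2) by (auto simp: paths_from_def)
  show "P v \<otimes>\<^sub>A PL v \<nu>s = PL v \<nu>s"
  proof (cases \<nu>s)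
    case (Cons \<nu> \<nu>s')
    then show ?thesis using assms n v fac_P(1)[OF assms(1), of \<nu>] by (simp add: A.amult_assoc[symmetric])
  qed (simp add: P_idem assms(1))
  show "PL v \<nu>s \<otimes>\<^sub>A P v = PL v \<nu>s" using assms(2) n
  proof (induction \<nu>s)
    case (Cons \<nu> \<nu>s)
    then show ?case using v by (simp add: A.amult_assoc)
  qed (simp add: P_idem assms(1))
qed

lemma PL_append:
  assumes v: "v \<in> vertices \<Lambda>" and "set xs \<subseteq> paths_from \<Lambda> v" "set ys \<subseteq> paths_from \<Lambda> v"
  shows "PL v (xs @ ys) = PL v xs \<otimes>\<^sub>A PL v ys"
  using assms(2)
proof (induction xs)
  case Nil
  then show ?case using P_PL(1)[OF v assms(3)] by simp
next
  case (Cons x xs)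
  have "v \<in> paths \<Lambda>" "x \<in> paths \<Lambda>" "set xs \<subseteq> paths \<Lambda>" "set ys \<subseteq> paths \<Lambda>"
    using vertexD(1)[OF v] Cons.prems assms(3) by (auto simp: paths_from_def)
  then show ?case using Cons by (simp add: A.amult_assoc)
qed

lemma fac_commute:
  assumes v: "v \<in> vertices \<Lambda>" and m: "\<mu> \<in> paths_from \<Lambda> v" and n: "\<nu> \<in> paths_from \<Lambda> v"
  shows "fac v \<mu> \<otimes>\<^sub>A fac v \<nu> = fac v \<nu> \<otimes>\<^sub>A fac v \<mu>"
proof -
  have vp: "v \<in> paths \<Lambda>" using vertexD(1)[OF v] .
  have mp: "\<mu> \<in> paths \<Lambda>" "rng \<Lambda> \<mu> = v" and np: "\<nu> \<in> paths \<Lambda>" "rng \<Lambda> \<nu> = v" using m n by (auto simp: paths_from_def)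
  have e: "fac v \<mu> \<otimes>\<^sub>A fac v \<nu> = fac v \<nu> \<ominus>\<^sub>A (proj \<mu> \<ominus>\<^sub>A proj \<mu> \<otimes>\<^sub>A proj \<nu>)"
    if m: "\<mu> \<in> paths_from \<Lambda> v" and n: "\<nu> \<in> paths_from \<Lambda> v" for \<mu> \<nu>
  proof -
    have p: "\<mu> \<in> paths \<Lambda>" "rng \<Lambda> \<mu> = v" "\<nu> \<in> paths \<Lambda>" "rng \<Lambda> \<nu> = v" using m n by (auto simp: paths_from_def)
    have "fac v \<mu> \<otimes>\<^sub>A fac v \<nu> = P v \<otimes>\<^sub>A fac v \<nu> \<ominus>\<^sub>A proj \<mu> \<otimes>\<^sub>A fac v \<nu>"
      unfolding fac_def[of v \<mu>] using p vp by (simp add: A.amult_minus_left)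
    also have "proj \<mu> \<otimes>\<^sub>A fac v \<nu> = proj \<mu> \<otimes>\<^sub>A P v \<ominus>\<^sub>A proj \<mu> \<otimes>\<^sub>A proj \<nu>"
      unfolding fac_def using p vp by (simp add: A.amult_minus_right)
    also have "proj \<mu> \<otimes>\<^sub>A P v = proj \<mu>" using proj_P_rng[OF p(1)] p(2) by simp
    finally show ?thesis using fac_P(1)[OF v n] by simp
  qed
  have "fac v \<mu> \<otimes>\<^sub>A fac v \<nu> = P v \<ominus>\<^sub>A proj \<nu> \<ominus>\<^sub>A proj \<mu> \<oplus>\<^sub>A proj \<mu> \<otimes>\<^sub>A proj \<nu>"
    if "\<mu> \<in> paths_from \<Lambda> v" "\<nu> \<in> paths_from \<Lambda> v" for \<mu> \<nu>
    by (subst e[OF that])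
      (use that vp in \<open>simp add: fac_def paths_from_def a_minus_def[of A] A.M.minus_add A.amult_closed A.M.a_ac\<close>)
  then show ?thesis
    using m n mp np vp proj_commute[OF mp(1) np(1)]
    by (simp add: a_minus_def[of A] A.M.a_ac A.amult_closed)
qed

lemma fac_idem:
  assumes v: "v \<in> vertices \<Lambda>" and n: "\<nu> \<in> paths_from \<Lambda> v"
  shows "fac v \<nu> \<otimes>\<^sub>A fac v \<nu> = fac v \<nu>"
proof -
  have p: "\<nu> \<in> paths \<Lambda>" "rng \<Lambda> \<nu> = v" and vp: "v \<in> paths \<Lambda>" using n vertexD(1)[OF v] by (auto simp: paths_from_def)
  have "proj \<nu> \<otimes>\<^sub>A fac v \<nu> = proj \<nu> \<otimes>\<^sub>A P v \<ominus>\<^sub>A proj \<nu> \<otimes>\<^sub>A proj \<nu>"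
    unfolding fac_def using p vp by (simp add: A.amult_minus_right)
  also have "\<dots> = \<zero>\<^sub>A" using proj_P_rng[OF p(1)] p proj_idem[OF p(1)] by (simp add: a_minus_def[of A] A.M.r_neg)
  finally have z: "proj \<nu> \<otimes>\<^sub>A fac v \<nu> = \<zero>\<^sub>A" .
  have "fac v \<nu> \<otimes>\<^sub>A fac v \<nu> = P v \<otimes>\<^sub>A fac v \<nu> \<ominus>\<^sub>A proj \<nu> \<otimes>\<^sub>A fac v \<nu>"
    unfolding fac_def[of v \<nu>] using p vp by (subst A.amult_minus_left) auto
  then show ?thesis using z fac_P(1)[OF v n] p vp by (simp add: a_minus_def[of A])
qed

text \<open>The factors are commuting idempotents, so a repeated factor can be moved next to its
  copy and absorbed.\<close>

lemma fac_PL_absorb: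
  assumes v: "v \<in> vertices \<Lambda>" and "set \<nu>s \<subseteq> paths_from \<Lambda> v" "\<nu> \<in> set \<nu>s"
  shows "fac v \<nu> \<otimes>\<^sub>A PL v \<nu>s = PL v \<nu>s"
  using assms(2,3)
proof (induction \<nu>s)
  case (Cons \<mu> \<nu>s)
  have c: "v \<in> paths \<Lambda>" "\<mu> \<in> paths \<Lambda>" "\<nu> \<in> paths \<Lambda>" "set \<nu>s \<subseteq> paths \<Lambda>"
    using vertexD(1)[OF v] Cons.prems by (auto simp: paths_from_def)
  have mn: "\<mu> \<in> paths_from \<Lambda> v" "\<nu> \<in> paths_from \<Lambda> v" using Cons.prems by auto
  show ?case
  proof (cases "\<nu> = \<mu>")
    case True
    then show ?thesis using fac_idem[OF v mn(1)] c by (simp add: A.amult_assoc[symmetric])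
  next
    case False
    then have IH: "fac v \<nu> \<otimes>\<^sub>A PL v \<nu>s = PL v \<nu>s" using Cons by simp
    have "fac v \<nu> \<otimes>\<^sub>A PL v (\<mu> # \<nu>s) = (fac v \<nu> \<otimes>\<^sub>A fac v \<mu>) \<otimes>\<^sub>A PL v \<nu>s" using c by (simp add: A.amult_assoc)
    also have "\<dots> = fac v \<mu> \<otimes>\<^sub>A (fac v \<nu> \<otimes>\<^sub>A PL v \<nu>s)"
      unfolding fac_commute[OF v mn(2,1)] using c by (simp add: A.amult_assoc)
    finally show ?thesis using IH by simp
  qed
qed simp

lemma PL_remdups:
  assumes v: "v \<in> vertices \<Lambda>" and "set \<nu>s \<subseteq> paths_from \<Lambda> v"
  shows "PL v (remdups \<nu>s) = PL v \<nu>s"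
  using assms(2)
proof (induction \<nu>s)
  case (Cons \<nu> \<nu>s)
  then show ?case using fac_PL_absorb[OF v, of \<nu>s \<nu>] by simp
qed simp

lemma PL_list_product:
  assumes v: "v \<in> vertices \<Lambda>" and "\<nu>s \<noteq> []" "set \<nu>s \<subseteq> paths_from \<Lambda> v"
  shows "PL v \<nu>s = list_product A (map (\<lambda>\<nu>. S (Path v) \<ominus>\<^bsub>A\<^esub> S (Path \<nu>) \<otimes>\<^bsub>A\<^esub> S (star \<Lambda> \<nu>)) \<nu>s)"
  using assms(2,3)
proof (induction \<nu>s)
  case (Cons \<nu> \<nu>s)
  show ?case
  proof (cases \<nu>s)
    case Nil
    then show ?thesis using Cons.prems fac_P(2)[OF v, of \<nu>] by (simp add: fac_def P_def Q_def proj_def)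
  next
    case (Cons \<nu>' \<nu>s')
    then show ?thesis using Cons.IH Cons.prems by (simp add: fac_def P_def Q_def proj_def)
  qed
qed simp

text \<open>(KP4) speaks of distinct enumerations of sets in \<open>FE\<close>, which exclude the
  vertex \<open>v\<close>. Repetitions are removed by \<open>PL_remdups\<close>, and if
  \<open>v\<close> itself occurs, its factor is already 0.\<close>

lemma PL_exhaustive:
  assumes v: "v \<in> vertices \<Lambda>" and "exhaustive \<Lambda> v (set \<nu>s)"
  shows "PL v \<nu>s = \<zero>\<^sub>A"
proof -
  have sub: "set \<nu>s \<subseteq> paths_from \<Lambda> v" using assms(2) by (simp add: exhaustive_def)
  have c: "v \<in> paths \<Lambda>" "set \<nu>s \<subseteq> paths \<Lambda>" using vertexD(1)[OF v] sub by (auto simp: paths_from_def)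
  show ?thesis
  proof (cases "v \<in> set \<nu>s")
    case True
    have "fac v v = \<zero>\<^sub>A"
      using Q_vertex[OF v] P_idem[OF v] c(1) by (simp add: fac_def proj_def a_minus_def[of A] A.M.r_neg)
    then show ?thesis using fac_PL_absorb[OF v sub True] PL_closed[OF c] by (simp add: A.amult_zero)
  next
    case False
    then have E: "set \<nu>s \<in> FE \<Lambda> v" using assms(2) by (simp add: FE_def)
    have "v \<in> paths_from \<Lambda> v" using vertexD[OF v] by (simp add: paths_from_def)
    then have ne: "\<nu>s \<noteq> []" using assms(2) by (auto simp: exhaustive_def)
    have "list_product A (map (\<lambda>\<nu>. S (Path v) \<ominus>\<^bsub>A\<^esub> S (Path \<nu>) \<otimes>\<^bsub>A\<^esub> S (star \<Lambda> \<nu>)) (remdups \<nu>s)) = \<zero>\<^sub>A"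
      by (rule relation[OF kp_relations.KP4[OF v E]]) simp_all
    then have "PL v (remdups \<nu>s) = \<zero>\<^sub>A" using PL_list_product[OF v, of "remdups \<nu>s"] ne sub by simp
    then show ?thesis using PL_remdups[OF v sub] by simp
  qed
qed

text \<open>For pairwise orthogonal projections below \<open>P v\<close> the product of the
  complements is the complement of the sum. Written as a decomposition of \<open>P v\<close>, this
  cuts a cell into orthogonal parts.\<close>

lemma PL_orthogonal:
  assumes v: "v \<in> vertices \<Lambda>" and "distinct hs" "set hs \<subseteq> paths_from \<Lambda> v"
    and "\<And>\<eta> \<eta>'. \<lbrakk>\<eta> \<in> set hs; \<eta>' \<in> set hs; \<eta> \<noteq> \<eta>'\<rbrakk> \<Longrightarrow> Lambda_min \<Lambda> \<eta> \<eta>' = {}"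
  shows "PL v hs \<oplus>\<^sub>A (\<Oplus>\<^bsub>A\<^esub>\<eta> \<in> set hs. proj \<eta>) = P v"
  using assms(2-4)
proof (induction hs)
  case Nil
  then show ?case using vertexD(1)[OF v] by simp
next
  case (Cons h hs)
  let ?s = "\<Oplus>\<^bsub>A\<^esub>\<eta> \<in> set hs. proj \<eta>"
  have c: "v \<in> paths \<Lambda>" "h \<in> paths \<Lambda>" "set hs \<subseteq> paths \<Lambda>" "rng \<Lambda> h = v"
    using vertexD(1)[OF v] Cons.prems by (auto simp: paths_from_def)
  have sc: "?s \<in> carrier A" using c by (intro A.M.finsum_closed) auto
  have PLc: "PL v hs \<in> carrier A" using c by simp
  have IH: "PL v hs \<oplus>\<^sub>A ?s = P v" using Cons by auto
  have "proj h \<otimes>\<^sub>A ?s = (\<Oplus>\<^bsub>A\<^esub>\<eta> \<in> set hs. proj h \<otimes>\<^sub>A proj \<eta>)"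
    by (rule A.finsum_mult_left) (use c in auto)
  also have "\<dots> = (\<Oplus>\<^bsub>A\<^esub>\<eta> \<in> set hs. \<zero>\<^sub>A)"
  proof (rule A.M.finsum_cong'[OF refl])
    fix \<eta> assume e: "\<eta> \<in> set hs"
    then have "h \<noteq> \<eta>" using Cons.prems(1) by auto
    then have "Lambda_min \<Lambda> h \<eta> = {}" using Cons.prems(3) e by simp
    then show "proj h \<otimes>\<^sub>A proj \<eta> = \<zero>\<^sub>A" using proj_orth c e by blast
  qed simp
  finally have z: "proj h \<otimes>\<^sub>A ?s = \<zero>\<^sub>A" by simp
  have "proj h \<otimes>\<^sub>A PL v hs = proj h \<otimes>\<^sub>A (PL v hs \<oplus>\<^sub>A ?s)"
    using z c PLc sc by (simp add: A.amult_r_distr A.amult_closed)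
  also have "\<dots> = proj h" unfolding IH using proj_P_rng[OF c(2)] c(4) by simp
  finally have hp: "proj h \<otimes>\<^sub>A PL v hs = proj h" .
  have "PL v (h # hs) = P v \<otimes>\<^sub>A PL v hs \<ominus>\<^sub>A proj h \<otimes>\<^sub>A PL v hs"
    using c PLc by (simp add: fac_def A.amult_minus_left)
  also have "\<dots> = PL v hs \<ominus>\<^sub>A proj h" using hp P_PL(1)[OF v] Cons.prems by simp
  finally have e: "PL v (h # hs) = PL v hs \<ominus>\<^sub>A proj h" .
  have "(\<Oplus>\<^bsub>A\<^esub>\<eta> \<in> set (h # hs). proj \<eta>) = proj h \<oplus>\<^sub>A ?s"
    using A.M.finsum_insert[of "set hs" h proj] Cons.prems(1) c by (simp add: Pi_iff subset_iff)
  then have "PL v (h # hs) \<oplus>\<^sub>A (\<Oplus>\<^bsub>A\<^esub>\<eta> \<in> set (h # hs). proj \<eta>) = (PL v hs \<ominus>\<^sub>A proj h) \<oplus>\<^sub>A (proj h \<oplus>\<^sub>A ?s)"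
    using e by simp
  also have "\<dots> = PL v hs \<oplus>\<^sub>A ?s"
    by (rule A.minus_add_cancel) (use c PLc sc in auto)
  finally show ?case using IH by simp
qed

text \<open>The second components all complete \<open>\<rho>\<close> to the same degree, so they
  have equal degrees themselves; hence their projections are orthogonal and
  \<open>PL_orthogonal\<close> applies.\<close>

lemma snd_Lambda_min_list:
  assumes n: "\<nu> \<in> paths \<Lambda>" and r: "\<rho> \<in> paths \<Lambda>"
  obtains hs where "distinct hs" "set hs = snd ` Lambda_min \<Lambda> \<nu> \<rho>" "set hs \<subseteq> paths_from \<Lambda> (src \<Lambda> \<rho>)"
    "\<And>\<eta> \<eta>'. \<lbrakk>\<eta> \<in> set hs; \<eta>' \<in> set hs; \<eta> \<noteq> \<eta>'\<rbrakk> \<Longrightarrow> Lambda_min \<Lambda> \<eta> \<eta>' = {}"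
proof -
  obtain hs where h: "distinct hs" "set hs = snd ` Lambda_min \<Lambda> \<nu> \<rho>"
    using finite_distinct_list[OF finite_imageI[OF finite_Lambda_min[OF n r], of snd]] by metis
  have sub: "set hs \<subseteq> paths_from \<Lambda> (src \<Lambda> \<rho>)"
  proof
    fix \<eta> assume "\<eta> \<in> set hs"
    then obtain \<xi> where "(\<xi>, \<eta>) \<in> Lambda_min \<Lambda> \<nu> \<rho>" using h(2) by auto
    from Lambda_minD(2,4)[OF this] show "\<eta> \<in> paths_from \<Lambda> (src \<Lambda> \<rho>)" by (simp add: paths_from_def)
  qed
  have "Lambda_min \<Lambda> \<eta> \<eta>' = {}" if e: "\<eta> \<in> set hs" "\<eta>' \<in> set hs" "\<eta> \<noteq> \<eta>'" for \<eta> \<eta>'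
  proof -
    obtain \<xi> \<xi>' where x: "(\<xi>, \<eta>) \<in> Lambda_min \<Lambda> \<nu> \<rho>" "(\<xi>', \<eta>') \<in> Lambda_min \<Lambda> \<nu> \<rho>" using e h(2) by auto
    have "(\<eta>, \<xi>) \<in> Lambda_min \<Lambda> \<rho> \<nu>" "(\<eta>', \<xi>') \<in> Lambda_min \<Lambda> \<rho> \<nu>" using x Lambda_min_swap[OF n r] by auto
    then have "deg \<Lambda> \<rho> + deg \<Lambda> \<eta> = deg \<Lambda> \<rho> + deg \<Lambda> \<eta>'" using Lambda_min_deg_fst[OF r] by metis
    then show ?thesis using Lambda_min_same_deg[of \<eta> \<eta>'] Lambda_minD(2)[OF x(1)] Lambda_minD(2)[OF x(2)] e(3) by simp
  qed
  then show ?thesis using that h sub by blast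
qed

text \<open>Moving a factor past \<open>P \<rho>\<close> replaces it by the factors of the extensions that \<open>\<rho>\<close> needs.\<close>

lemma fac_P_shift:
  assumes v: "v \<in> vertices \<Lambda>" and n: "\<nu> \<in> paths_from \<Lambda> v" and r: "\<rho> \<in> paths \<Lambda>" "rng \<Lambda> \<rho> = v"
    and hs: "distinct hs" "set hs = snd ` Lambda_min \<Lambda> \<nu> \<rho>" "set hs \<subseteq> paths_from \<Lambda> (src \<Lambda> \<rho>)"
      "\<And>\<eta> \<eta>'. \<lbrakk>\<eta> \<in> set hs; \<eta>' \<in> set hs; \<eta> \<noteq> \<eta>'\<rbrakk> \<Longrightarrow> Lambda_min \<Lambda> \<eta> \<eta>' = {}"
  shows "fac v \<nu> \<otimes>\<^sub>A P \<rho> = P \<rho> \<otimes>\<^sub>A PL (src \<Lambda> \<rho>) hs"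
proof -
  let ?L = "Lambda_min \<Lambda> \<nu> \<rho>" and ?s = "src \<Lambda> \<rho>"
  let ?sum = "\<Oplus>\<^bsub>A\<^esub>\<eta> \<in> set hs. proj \<eta>"
  have np: "\<nu> \<in> paths \<Lambda>" and vp: "v \<in> paths \<Lambda>" using n vertexD(1)[OF v] by (auto simp: paths_from_def)
  have sv: "?s \<in> vertices \<Lambda>" "?s \<in> paths \<Lambda>" using vertex_src[OF r(1)] src_closed[OF r(1)] by auto
  have hp: "set hs \<subseteq> paths \<Lambda>" using hs(3) by (auto simp: paths_from_def)
  have sc: "?sum \<in> carrier A" using hp by (intro A.M.finsum_closed) auto
  have fin: "finite ?L" using finite_Lambda_min[OF np r(1)] .
  have d: "fst l \<in> paths \<Lambda>" "snd l \<in> paths \<Lambda>" "src \<Lambda> \<nu> = rng \<Lambda> (fst l)" "?s = rng \<Lambda> (snd l)"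
    "comp \<Lambda> \<nu> (fst l) = comp \<Lambda> \<rho> (snd l)" if "l \<in> ?L" for l
    using Lambda_minD(1-5)[of "fst l" "snd l"] that by simp_all
  \<comment> \<open>(KP3) carries the projection of \<open>\<nu>\<close> past
    \<open>P \<rho>\<close>, where it becomes the sum of the projections of the extensions;
    \<open>PL_orthogonal\<close> then turns the complement of this sum into a product.\<close>
  have "proj \<nu> \<otimes>\<^sub>A P \<rho> = P \<nu> \<otimes>\<^sub>A (\<Oplus>\<^bsub>A\<^esub>l \<in> ?L. P (fst l) \<otimes>\<^sub>A Q (snd l))"
    unfolding proj_def using np r(1) by (simp add: A.amult_assoc Q_P)
  also have "\<dots> = (\<Oplus>\<^bsub>A\<^esub>l \<in> ?L. P \<nu> \<otimes>\<^sub>A (P (fst l) \<otimes>\<^sub>A Q (snd l)))"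
    by (rule A.finsum_mult_left[OF fin]) (use np d in \<open>auto intro: A.amult_closed\<close>)
  also have "\<dots> = (\<Oplus>\<^bsub>A\<^esub>l \<in> ?L. P \<rho> \<otimes>\<^sub>A proj (snd l))"
  proof (rule A.M.finsum_cong'[OF refl])
    show "(\<lambda>l. P \<rho> \<otimes>\<^sub>A proj (snd l)) \<in> ?L \<rightarrow> carrier A" using r d by (auto intro: A.amult_closed)
    fix l assume l: "l \<in> ?L"
    note dl = d[OF l]
    have "P \<nu> \<otimes>\<^sub>A (P (fst l) \<otimes>\<^sub>A Q (snd l)) = P (comp \<Lambda> \<nu> (fst l)) \<otimes>\<^sub>A Q (snd l)"
      using np dl(1,2) P_mult[OF np dl(1,3)] by (simp add: A.amult_assoc[symmetric])
    also have "\<dots> = P \<rho> \<otimes>\<^sub>A proj (snd l)"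
      unfolding dl(5) proj_def using r(1) dl(2) P_mult[OF r(1) dl(2,4)] by (simp add: A.amult_assoc[symmetric])
    finally show "P \<nu> \<otimes>\<^sub>A (P (fst l) \<otimes>\<^sub>A Q (snd l)) = P \<rho> \<otimes>\<^sub>A proj (snd l)" .
  qed
  also have "\<dots> = (\<Oplus>\<^bsub>A\<^esub>\<eta> \<in> snd ` ?L. P \<rho> \<otimes>\<^sub>A proj \<eta>)"
  proof (rule A.M.finsum_reindex[symmetric])
    show "(\<lambda>\<eta>. P \<rho> \<otimes>\<^sub>A proj \<eta>) \<in> snd ` ?L \<rightarrow> carrier A" using r d by (auto intro: A.amult_closed)
    show "inj_on snd ?L"
    proof (rule inj_onI)
      fix l l' assume l: "l \<in> ?L" "l' \<in> ?L" "snd l = snd l'"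
      have "comp \<Lambda> \<nu> (fst l) = comp \<Lambda> \<nu> (fst l')" using d(5)[OF l(1)] d(5)[OF l(2)] l(3) by simp
      then have "fst l = fst l'" by (rule comp_left_cancel[OF np d(1,3)[OF l(1)] d(1,3)[OF l(2)]])
      then show "l = l'" using l(3) by (rule prod_eqI)
    qed
  qed
  also have "\<dots> = P \<rho> \<otimes>\<^sub>A ?sum"
    unfolding hs(2)[symmetric] by (rule A.finsum_mult_left[symmetric]) (use r hp in auto)
  finally have 1: "proj \<nu> \<otimes>\<^sub>A P \<rho> = P \<rho> \<otimes>\<^sub>A ?sum" .
  have "P \<rho> = P \<rho> \<otimes>\<^sub>A (PL ?s hs \<oplus>\<^sub>A ?sum)"
    using PL_orthogonal[OF sv(1) hs(1,3,4)] P_src[OF r(1)] by simp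
  then have 2: "P \<rho> = P \<rho> \<otimes>\<^sub>A PL ?s hs \<oplus>\<^sub>A P \<rho> \<otimes>\<^sub>A ?sum"
    using A.amult_r_distr[of "PL ?s hs" ?sum "P \<rho>"] r(1) sv(2) hp sc by simp
  have "fac v \<nu> \<otimes>\<^sub>A P \<rho> = P \<rho> \<ominus>\<^sub>A P \<rho> \<otimes>\<^sub>A ?sum"
    unfolding fac_def using A.amult_minus_left[OF P_closed[OF vp] proj_closed[OF np] P_closed[OF r(1)]] 1 P_rng[OF r(1)] r(2) by simp
  also have "\<dots> = (P \<rho> \<otimes>\<^sub>A PL ?s hs \<oplus>\<^sub>A P \<rho> \<otimes>\<^sub>A ?sum) \<ominus>\<^sub>A P \<rho> \<otimes>\<^sub>A ?sum" using 2 by simp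
  also have "\<dots> = P \<rho> \<otimes>\<^sub>A PL ?s hs"
    using r(1) sv(2) hp sc by (simp add: a_minus_def[of A] A.M.a_assoc A.M.r_neg A.amult_closed)
  finally show ?thesis .
qed

text \<open>The exact set of new paths is recorded because \<open>decided_extend\<close> uses this
  same set to carry decisions over to the longer path.\<close>

lemma PL_P_shift:
  assumes v: "v \<in> vertices \<Lambda>" and n: "set \<nu>s \<subseteq> paths_from \<Lambda> v" and r: "\<rho> \<in> paths \<Lambda>" "rng \<Lambda> \<rho> = v"
  shows "\<exists>G. set G = (\<Union>\<nu> \<in> set \<nu>s. snd ` Lambda_min \<Lambda> \<nu> \<rho>) \<and> set G \<subseteq> paths_from \<Lambda> (src \<Lambda> \<rho>) \<and>
    PL v \<nu>s \<otimes>\<^sub>A P \<rho> = P \<rho> \<otimes>\<^sub>A PL (src \<Lambda> \<rho>) G"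
  using n
proof (induction \<nu>s)
  case Nil
  then show ?case using P_rng[OF r(1)] P_src[OF r(1)] r(2) by (intro exI[of _ "[]"]) simp
next
  case (Cons \<nu> \<nu>s)
  then obtain G where G: "set G = (\<Union>\<nu> \<in> set \<nu>s. snd ` Lambda_min \<Lambda> \<nu> \<rho>)" "set G \<subseteq> paths_from \<Lambda> (src \<Lambda> \<rho>)"
    "PL v \<nu>s \<otimes>\<^sub>A P \<rho> = P \<rho> \<otimes>\<^sub>A PL (src \<Lambda> \<rho>) G" by auto
  have nv: "\<nu> \<in> paths_from \<Lambda> v" using Cons.prems by simp
  have c: "v \<in> paths \<Lambda>" "\<nu> \<in> paths \<Lambda>" "set \<nu>s \<subseteq> paths \<Lambda>" using Cons.prems vertexD(1)[OF v] by (auto simp: paths_from_def)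
  obtain hs where hs: "distinct hs" "set hs = snd ` Lambda_min \<Lambda> \<nu> \<rho>" "set hs \<subseteq> paths_from \<Lambda> (src \<Lambda> \<rho>)"
    "\<And>\<eta> \<eta>'. \<lbrakk>\<eta> \<in> set hs; \<eta>' \<in> set hs; \<eta> \<noteq> \<eta>'\<rbrakk> \<Longrightarrow> Lambda_min \<Lambda> \<eta> \<eta>' = {}"
    using snd_Lambda_min_list[OF c(2) r(1)] by blast
  have s: "src \<Lambda> \<rho> \<in> vertices \<Lambda>" "src \<Lambda> \<rho> \<in> paths \<Lambda>" using vertex_src[OF r(1)] src_closed[OF r(1)] by auto
  have Gp: "set G \<subseteq> paths \<Lambda>" "set hs \<subseteq> paths \<Lambda>" using G(2) hs(3) by (auto simp: paths_from_def)
  have "PL v (\<nu> # \<nu>s) \<otimes>\<^sub>A P \<rho> = fac v \<nu> \<otimes>\<^sub>A (PL v \<nu>s \<otimes>\<^sub>A P \<rho>)" using c r by (simp add: A.amult_assoc)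
  also have "\<dots> = (fac v \<nu> \<otimes>\<^sub>A P \<rho>) \<otimes>\<^sub>A PL (src \<Lambda> \<rho>) G" unfolding G(3) using c r s Gp by (simp add: A.amult_assoc)
  also have "\<dots> = P \<rho> \<otimes>\<^sub>A (PL (src \<Lambda> \<rho>) hs \<otimes>\<^sub>A PL (src \<Lambda> \<rho>) G)"
    using fac_P_shift[OF v nv r hs] r s Gp by (simp add: A.amult_assoc)
  also have "\<dots> = P \<rho> \<otimes>\<^sub>A PL (src \<Lambda> \<rho>) (hs @ G)" using PL_append[OF s(1) hs(3) G(2)] by simp
  finally show ?case using G(1,2) hs(2,3) by (intro exI[of _ "hs @ G"]) auto
qed

text \<open>The ghost \<open>Q \<rho>\<close> ends in \<open>Q \<nu>\<close>, which is annihilated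
  by the factor of \<open>\<nu>\<close>; by \<open>fac_PL_absorb\<close> a copy of this factor may
  be placed in front of the product.\<close>

lemma Q_PL_zero:
  assumes v: "v \<in> vertices \<Lambda>" and n: "set \<nu>s \<subseteq> paths_from \<Lambda> v" "\<nu> \<in> set \<nu>s" and r: "prefix \<nu> \<rho>"
  shows "Q \<rho> \<otimes>\<^sub>A PL v \<nu>s = \<zero>\<^sub>A"
proof -
  obtain \<kappa> where k: "\<nu> \<in> paths \<Lambda>" "\<kappa> \<in> paths \<Lambda>" "src \<Lambda> \<nu> = rng \<Lambda> \<kappa>" "\<rho> = comp \<Lambda> \<nu> \<kappa>" using r by (rule prefixE)
  have c: "v \<in> paths \<Lambda>" "set \<nu>s \<subseteq> paths \<Lambda>" "rng \<Lambda> \<nu> = v" using n vertexD(1)[OF v] by (auto simp: paths_from_def)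
  have "Q \<nu> \<otimes>\<^sub>A proj \<nu> = P (src \<Lambda> \<nu>) \<otimes>\<^sub>A Q \<nu>"
    unfolding proj_def using k(1) Q_P_self[OF k(1)] by (simp add: A.amult_assoc[symmetric])
  then have "Q \<nu> \<otimes>\<^sub>A fac v \<nu> = Q \<nu> \<ominus>\<^sub>A Q \<nu>"
    unfolding fac_def using A.amult_minus_right[OF P_closed[OF c(1)] proj_closed[OF k(1)] Q_closed[OF k(1)]]
      Q_rng[OF k(1)] Q_src[OF k(1)] c(3) by simp
  then have z: "Q \<nu> \<otimes>\<^sub>A fac v \<nu> = \<zero>\<^sub>A" using k(1) by (simp add: a_minus_def[of A] A.M.r_neg)
  have "Q \<rho> \<otimes>\<^sub>A PL v \<nu>s = (Q \<kappa> \<otimes>\<^sub>A Q \<nu>) \<otimes>\<^sub>A (fac v \<nu> \<otimes>\<^sub>A PL v \<nu>s)"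
    using Q_mult[OF k(1-3)] k(4) fac_PL_absorb[OF v n] by simp
  also have "\<dots> = Q \<kappa> \<otimes>\<^sub>A ((Q \<nu> \<otimes>\<^sub>A fac v \<nu>) \<otimes>\<^sub>A PL v \<nu>s)"
    using k(1,2) c by (simp add: A.amult_assoc A.amult_closed)
  also have "\<dots> = \<zero>\<^sub>A" unfolding z using k(2) c by (simp add: A.amult_zero)
  finally show ?thesis .
qed

text \<open>(KP3) expands \<open>Q \<mu> P \<tau>\<close> into terms ending in ghosts of extensions
  of \<open>\<tau>\<close>; each extension runs through some path of \<open>G\<close>, so its ghost
  is killed by \<open>Q_PL_zero\<close>.\<close>

lemma Q_P_PL_zero:
  assumes m: "\<mu> \<in> paths \<Lambda>" and t: "\<tau> \<in> paths \<Lambda>" and G: "set G \<subseteq> paths_from \<Lambda> (src \<Lambda> \<tau>)"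
    and dec: "\<And>\<rho> \<rho>'. (\<rho>, \<rho>') \<in> Lambda_min \<Lambda> \<tau> \<mu> \<Longrightarrow> \<exists>\<nu> \<in> set G. prefix \<nu> \<rho>"
  shows "Q \<mu> \<otimes>\<^sub>A P \<tau> \<otimes>\<^sub>A PL (src \<Lambda> \<tau>) G = \<zero>\<^sub>A"
proof -
  let ?L = "Lambda_min \<Lambda> \<mu> \<tau>" and ?G = "PL (src \<Lambda> \<tau>) G"
  have s: "src \<Lambda> \<tau> \<in> vertices \<Lambda>" "src \<Lambda> \<tau> \<in> paths \<Lambda>" using vertex_src[OF t] src_closed[OF t] by auto
  have c: "?G \<in> carrier A" using s G by (auto simp: paths_from_def)
  have "Q \<mu> \<otimes>\<^sub>A P \<tau> \<otimes>\<^sub>A ?G = (\<Oplus>\<^bsub>A\<^esub>l \<in> ?L. P (fst l) \<otimes>\<^sub>A Q (snd l) \<otimes>\<^sub>A ?G)"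
    unfolding Q_P[OF m t] by (rule A.finsum_mult_right[OF finite_Lambda_min[OF m t] c]) (auto intro!: A.amult_closed dest: Lambda_min_paths)
  also have "\<dots> = (\<Oplus>\<^bsub>A\<^esub>l \<in> ?L. \<zero>\<^sub>A)"
  proof (rule A.M.finsum_cong'[OF refl])
    fix l assume l: "l \<in> ?L"
    then have "(snd l, fst l) \<in> Lambda_min \<Lambda> \<tau> \<mu>" using Lambda_min_swap[OF m t, of "fst l" "snd l"] by simp
    then obtain \<nu> where "\<nu> \<in> set G" "prefix \<nu> (snd l)" using dec by blast
    then have "Q (snd l) \<otimes>\<^sub>A ?G = \<zero>\<^sub>A" using Q_PL_zero[OF s(1) G] by blast
    then show "P (fst l) \<otimes>\<^sub>A Q (snd l) \<otimes>\<^sub>A ?G = \<zero>\<^sub>A"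
      using Lambda_min_paths[OF l] c by (simp add: A.amult_assoc A.amult_zero)
  qed simp
  finally show ?thesis by simp
qed

end

section \<open>Injectivity\<close>

fun lsum :: "('c, 'n) ring_scheme \<Rightarrow> ('x \<Rightarrow> 'c) \<Rightarrow> 'x list \<Rightarrow> 'c" where
  "lsum M f [] = \<zero>\<^bsub>M\<^esub>"
| "lsum M f (x # xs) = f x \<oplus>\<^bsub>M\<^esub> lsum M f xs"

lemma (in abelian_monoid) lsum_closed: "(\<And>x. x \<in> set xs \<Longrightarrow> f x \<in> carrier G) \<Longrightarrow> lsum G f xs \<in> carrier G"
  by (induction xs) auto

lemma lsum_cong: "(\<And>x. x \<in> set xs \<Longrightarrow> f x = g x) \<Longrightarrow> lsum M f xs = lsum M g xs"
  by (induction xs) auto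

context nonunital_algebra
begin

text \<open>Collection of like terms: entries with \<open>b x\<close> are grouped by
  \<open>key x\<close>. Different entries of a list may share a key, so coefficients must be added
  before they can be read off.\<close>

lemma lsum_collect:
  assumes W: "finite W" and "\<And>x. \<lbrakk>x \<in> set xs; b x\<rbrakk> \<Longrightarrow> key x \<in> W"
    and "\<And>x. x \<in> set xs \<Longrightarrow> c x \<in> carrier R" and v: "\<And>\<sigma>. \<sigma> \<in> W \<Longrightarrow> v \<sigma> \<in> carrier A"
  shows "lsum A (\<lambda>x. if b x then c x \<odot>\<^bsub>A\<^esub> v (key x) else \<zero>\<^bsub>A\<^esub>) xs
    = (\<Oplus>\<^bsub>A\<^esub>\<sigma> \<in> W. lsum R (\<lambda>x. if b x \<and> key x = \<sigma> then c x else \<zero>) xs \<odot>\<^bsub>A\<^esub> v \<sigma>)"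
  using assms(2,3)
proof (induction xs)
  case Nil
  have "(\<Oplus>\<^bsub>A\<^esub>\<sigma> \<in> W. \<zero> \<odot>\<^bsub>A\<^esub> v \<sigma>) = (\<Oplus>\<^bsub>A\<^esub>\<sigma> \<in> W. \<zero>\<^bsub>A\<^esub>)" by (rule M.finsum_cong') (simp_all add: v)
  then show ?case by simp
next
  case (Cons x xs)
  let ?s = "\<lambda>xs \<sigma>. lsum R (\<lambda>x. if b x \<and> key x = \<sigma> then c x else \<zero>) xs"
  have sc: "?s xs \<sigma> \<in> carrier R" for \<sigma> using Cons.prems by (intro R.lsum_closed) auto
  have cx: "c x \<in> carrier R" using Cons.prems by simp
  let ?d = "\<lambda>\<sigma>. if b x \<and> key x = \<sigma> then c x else \<zero>"
  have "(\<Oplus>\<^bsub>A\<^esub>\<sigma> \<in> W. ?s (x # xs) \<sigma> \<odot>\<^bsub>A\<^esub> v \<sigma>) = (\<Oplus>\<^bsub>A\<^esub>\<sigma> \<in> W. ?d \<sigma> \<odot>\<^bsub>A\<^esub> v \<sigma> \<oplus>\<^bsub>A\<^esub> ?s xs \<sigma> \<odot>\<^bsub>A\<^esub> v \<sigma>)"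
    by (rule M.finsum_cong') (use sc cx v in \<open>auto simp: smult_l_distr\<close>)
  also have "\<dots> = (\<Oplus>\<^bsub>A\<^esub>\<sigma> \<in> W. ?d \<sigma> \<odot>\<^bsub>A\<^esub> v \<sigma>) \<oplus>\<^bsub>A\<^esub> (\<Oplus>\<^bsub>A\<^esub>\<sigma> \<in> W. ?s xs \<sigma> \<odot>\<^bsub>A\<^esub> v \<sigma>)"
    by (rule M.finsum_addf) (use sc cx v in auto)
  also have "(\<Oplus>\<^bsub>A\<^esub>\<sigma> \<in> W. ?d \<sigma> \<odot>\<^bsub>A\<^esub> v \<sigma>) = (if b x then c x \<odot>\<^bsub>A\<^esub> v (key x) else \<zero>\<^bsub>A\<^esub>)"
  proof (cases "b x")
    case True
    then have k: "key x \<in> W" using Cons.prems by simp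
    have "(\<Oplus>\<^bsub>A\<^esub>\<sigma> \<in> W. ?d \<sigma> \<odot>\<^bsub>A\<^esub> v \<sigma>) = (\<Oplus>\<^bsub>A\<^esub>\<sigma> \<in> W. if key x = \<sigma> then c x \<odot>\<^bsub>A\<^esub> v \<sigma> else \<zero>\<^bsub>A\<^esub>)"
      by (rule M.finsum_cong') (use True cx v in auto)
    also have "\<dots> = c x \<odot>\<^bsub>A\<^esub> v (key x)"
      using M.add.finprod_singleton[OF k W, of "\<lambda>\<sigma>. c x \<odot>\<^bsub>A\<^esub> v \<sigma>"] cx v by (simp add: Pi_iff)
    finally show ?thesis using True by simp
  next
    case False
    have "(\<Oplus>\<^bsub>A\<^esub>\<sigma> \<in> W. ?d \<sigma> \<odot>\<^bsub>A\<^esub> v \<sigma>) = (\<Oplus>\<^bsub>A\<^esub>\<sigma> \<in> W. \<zero>\<^bsub>A\<^esub>)"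
      by (rule M.finsum_cong') (use False v in auto)
    then show ?thesis using False by simp
  qed
  finally show ?case using Cons.IH Cons.prems by simp
qed

end

section \<open>Cells and decided paths\<close>

context finitely_aligned_kgraph
begin

text \<open>On the arrows of the form \<open>(\<sigma>z, d(\<sigma>) - d(\<tau>), \<tau>z)\<close> with \<open>z\<close> avoiding \<open>G\<close>, the source
  either always or never lies in \<open>Z(\<mu>)\<close>.\<close>

definition decided :: "'l \<Rightarrow> 'l \<Rightarrow> 'l list \<Rightarrow> bool" where
  "decided \<mu> \<tau> G \<longleftrightarrow> prefix \<mu> \<tau> \<or> (\<forall>\<rho> \<rho>'. (\<rho>, \<rho>') \<in> Lambda_min \<Lambda> \<tau> \<mu> \<longrightarrow> (\<exists>\<nu> \<in> set G. prefix \<nu> \<rho>))"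

definition tail :: "'l \<Rightarrow> 'l \<Rightarrow> 'l" where
  "tail \<mu> \<tau> = (SOME \<beta>. \<beta> \<in> paths \<Lambda> \<and> src \<Lambda> \<mu> = rng \<Lambda> \<beta> \<and> \<tau> = comp \<Lambda> \<mu> \<beta>)"

lemma tail:
  assumes "prefix \<mu> \<tau>"
  shows "tail \<mu> \<tau> \<in> paths \<Lambda>" "src \<Lambda> \<mu> = rng \<Lambda> (tail \<mu> \<tau>)" "comp \<Lambda> \<mu> (tail \<mu> \<tau>) = \<tau>"
proof -
  have "\<exists>\<beta>. \<beta> \<in> paths \<Lambda> \<and> src \<Lambda> \<mu> = rng \<Lambda> \<beta> \<and> \<tau> = comp \<Lambda> \<mu> \<beta>" using assms by (auto simp: prefix_def)
  from someI_ex[OF this] show "tail \<mu> \<tau> \<in> paths \<Lambda>" "src \<Lambda> \<mu> = rng \<Lambda> (tail \<mu> \<tau>)" "comp \<Lambda> \<mu> (tail \<mu> \<tau>) = \<tau>"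
    unfolding tail_def by simp_all
qed

lemma tail_src: "prefix \<mu> \<tau> \<Longrightarrow> src \<Lambda> (tail \<mu> \<tau>) = src \<Lambda> \<tau>"
  using tail[of \<mu> \<tau>] src_comp[of \<mu> "tail \<mu> \<tau>"] prefix_paths(1)[of \<mu> \<tau>] by simp

text \<open>A common extension of \<open>\<tau>\<eta>\<close> and \<open>\<mu>\<close> is also one
  of \<open>\<tau>\<close> and \<open>\<mu>\<close>, so some \<open>\<nu>\<close> in
  \<open>G\<close> is an initial segment of \<open>\<eta>\<rho>\<close>. The minimal common
  extension of \<open>\<nu>\<close> and \<open>\<eta>\<close> below it contributes a member of
  \<open>G'\<close> that is an initial segment of \<open>\<rho>\<close>.\<close>

lemma decided_extend:
  assumes t: "\<tau> \<in> paths \<Lambda>" and e: "\<eta> \<in> paths \<Lambda>" "src \<Lambda> \<tau> = rng \<Lambda> \<eta>" and m: "\<mu> \<in> paths \<Lambda>"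
    and d: "decided \<mu> \<tau> G" and G: "set G \<subseteq> paths \<Lambda>" "set G' = (\<Union>\<nu> \<in> set G. snd ` Lambda_min \<Lambda> \<nu> \<eta>)"
  shows "decided \<mu> (comp \<Lambda> \<tau> \<eta>) G'"
proof (cases "prefix \<mu> \<tau>")
  case True
  then show ?thesis unfolding decided_def using prefix_trans[OF True prefixI[OF t e]] by blast
next
  case False
  have "\<exists>\<eta>' \<in> set G'. prefix \<eta>' \<rho>" if r: "(\<rho>, \<rho>') \<in> Lambda_min \<Lambda> (comp \<Lambda> \<tau> \<eta>) \<mu>" for \<rho> \<rho>'
  proof -
    note l = Lambda_minD[OF r]
    have s: "src \<Lambda> \<eta> = rng \<Lambda> \<rho>" using l(3) src_comp[OF t e] by simp
    have er: "comp \<Lambda> \<eta> \<rho> \<in> paths \<Lambda>" "src \<Lambda> \<tau> = rng \<Lambda> (comp \<Lambda> \<eta> \<rho>)"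
      using comp_closed[OF e(1) l(1) s] rng_comp[OF e(1) l(1) s] e(2) by simp_all
    have "comp \<Lambda> \<tau> (comp \<Lambda> \<eta> \<rho>) = comp \<Lambda> \<mu> \<rho>'" using l(5) comp_assoc[OF t e(1) l(1) e(2) s] by simp
    then obtain \<rho>0 \<rho>0' \<gamma> where r0: "(\<rho>0, \<rho>0') \<in> Lambda_min \<Lambda> \<tau> \<mu>" "\<gamma> \<in> paths \<Lambda>" "src \<Lambda> \<rho>0 = rng \<Lambda> \<gamma>"
      "comp \<Lambda> \<eta> \<rho> = comp \<Lambda> \<rho>0 \<gamma>"
      using common_extension[OF t er m l(2,4)] by metis
    obtain \<nu> where n: "\<nu> \<in> set G" "prefix \<nu> \<rho>0" using d False r0(1) by (auto simp: decided_def)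
    have "prefix \<rho>0 (comp \<Lambda> \<eta> \<rho>)" using prefixI[OF Lambda_minD(1)[OF r0(1)] r0(2,3)] r0(4) by simp
    then have "prefix \<nu> (comp \<Lambda> \<eta> \<rho>)" by (rule prefix_trans[OF n(2)])
    then obtain \<kappa> where k: "\<nu> \<in> paths \<Lambda>" "\<kappa> \<in> paths \<Lambda>" "src \<Lambda> \<nu> = rng \<Lambda> \<kappa>" "comp \<Lambda> \<eta> \<rho> = comp \<Lambda> \<nu> \<kappa>" by (rule prefixE)
    obtain \<xi> \<eta>' \<delta> where x: "(\<xi>, \<eta>') \<in> Lambda_min \<Lambda> \<nu> \<eta>" "\<delta> \<in> paths \<Lambda>" "src \<Lambda> \<eta>' = rng \<Lambda> \<delta>" "\<rho> = comp \<Lambda> \<eta>' \<delta>"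
      using common_extension[OF k(1-3) e(1) l(1) s k(4)[symmetric]] by metis
    have "\<eta>' \<in> set G'" using x(1) n(1) unfolding G(2) by force
    then show ?thesis using prefixI[OF Lambda_minD(2)[OF x(1)] x(2,3)] x(4) by auto
  qed
  then show ?thesis by (auto simp: decided_def)
qed

text \<open>If \<open>\<mu>\<close> is not an initial segment of \<open>\<tau>\<close>, membership
  would make \<open>z\<close> run through a member of \<open>G\<close>. Otherwise the right-hand
  paths determine the continuation of \<open>\<mu>\<close>, and cancelling the common last factor
  \<open>\<rho>\<close> determines \<open>\<sigma>\<close>.\<close>

lemma arrow_mem_decided_iff:
  assumes st: "(\<sigma>, \<tau>) \<in> pairs" and am: "(\<alpha>, \<mu>) \<in> pairs" and z: "z \<in> boundary_paths_from \<Lambda> (src \<Lambda> \<sigma>)"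
    and G: "initial_segs z \<inter> set G = {}" and d: "decided \<mu> \<tau> G"
  shows "arrow \<sigma> \<tau> z \<in> Z_pair \<Lambda> \<alpha> \<mu> \<longleftrightarrow> prefix \<mu> \<tau> \<and> comp \<Lambda> \<alpha> (tail \<mu> \<tau>) = \<sigma>"
proof
  note sd = pairsD[OF st] and ad = pairsD[OF am]
  {
    assume "arrow \<sigma> \<tau> z \<in> Z_pair \<Lambda> \<alpha> \<mu>"
    then obtain \<rho> \<xi> where r: "(\<rho>, \<xi>) \<in> Lambda_min \<Lambda> \<sigma> \<alpha>" "comp \<Lambda> \<tau> \<rho> = comp \<Lambda> \<mu> \<xi>" "\<rho> \<in> initial_segs z"
      using arrow_mem_Z_pair_iff[OF st am z] by (auto simp: meet_exts_def)
    note l = Lambda_minD[OF r(1)]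
    have zB: "z \<in> boundary_paths \<Lambda>" using z by (simp add: boundary_paths_from_def)
    have s: "src \<Lambda> \<tau> = rng \<Lambda> \<rho>" "src \<Lambda> \<mu> = rng \<Lambda> \<xi>" using l(3,4) sd(3) ad(3) by simp_all
    have pre: "prefix \<mu> \<tau>"
    proof (rule ccontr)
      assume n: "\<not> prefix \<mu> \<tau>"
      obtain \<rho>0 \<rho>0' \<gamma> where r0: "(\<rho>0, \<rho>0') \<in> Lambda_min \<Lambda> \<tau> \<mu>" "\<gamma> \<in> paths \<Lambda>" "src \<Lambda> \<rho>0 = rng \<Lambda> \<gamma>" "\<rho> = comp \<Lambda> \<rho>0 \<gamma>"
        using common_extension[OF sd(2) l(1) s(1) ad(2) l(2) s(2) r(2)] by metis
      obtain \<nu> where v: "\<nu> \<in> set G" "prefix \<nu> \<rho>0" using d n r0(1) by (auto simp: decided_def)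
      have "prefix \<nu> \<rho>" using prefix_trans[OF v(2)] prefixI[OF Lambda_minD(1)[OF r0(1)] r0(2,3)] r0(4) by simp
      then have "\<nu> \<in> initial_segs z" using tight_hereditary[OF initial_segs_tight[OF zB] r(3)] by simp
      then show False using G v(1) by blast
    qed
    note t = tail[OF pre] and ts = tail_src[OF pre]
    have sb: "src \<Lambda> (tail \<mu> \<tau>) = rng \<Lambda> \<rho>" using ts s(1) by simp
    have "comp \<Lambda> \<mu> (comp \<Lambda> (tail \<mu> \<tau>) \<rho>) = comp \<Lambda> \<mu> \<xi>"
      using comp_assoc[OF ad(2) t(1) l(1) t(2) sb] t(3) r(2) by simp
    then have x: "comp \<Lambda> (tail \<mu> \<tau>) \<rho> = \<xi>"
      using comp_left_cancel[OF ad(2) comp_closed[OF t(1) l(1) sb] _ l(2) s(2)] rng_comp[OF t(1) l(1) sb] t(2) by simp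
    have sa: "src \<Lambda> \<alpha> = rng \<Lambda> (tail \<mu> \<tau>)" using t(2) ad(3) by simp
    note c = comp_closed[OF ad(1) t(1) sa]
    have sc: "src \<Lambda> (comp \<Lambda> \<alpha> (tail \<mu> \<tau>)) = rng \<Lambda> \<rho>" using src_comp[OF ad(1) t(1) sa] sb by simp
    have eq: "comp \<Lambda> \<sigma> \<rho> = comp \<Lambda> (comp \<Lambda> \<alpha> (tail \<mu> \<tau>)) \<rho>"
      using l(5) x comp_assoc[OF ad(1) t(1) l(1) sa sb] by simp
    then have "deg \<Lambda> \<sigma> + deg \<Lambda> \<rho> = deg \<Lambda> (comp \<Lambda> \<alpha> (tail \<mu> \<tau>)) + deg \<Lambda> \<rho>"
      using deg_comp[OF sd(1) l(1,3)] deg_comp[OF c l(1) sc] by metis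
    then have "deg \<Lambda> \<sigma> = deg \<Lambda> (comp \<Lambda> \<alpha> (tail \<mu> \<tau>))" by simp
    then have "\<sigma> = comp \<Lambda> \<alpha> (tail \<mu> \<tau>)" by (rule factor_unique(1)[OF sd(1) l(1,3) c l(1) sc eq])
    then show "prefix \<mu> \<tau> \<and> comp \<Lambda> \<alpha> (tail \<mu> \<tau>) = \<sigma>" using pre by simp
  next
    assume h: "prefix \<mu> \<tau> \<and> comp \<Lambda> \<alpha> (tail \<mu> \<tau>) = \<sigma>"
    note t = tail[OF conjunct1[OF h]] and ts = tail_src[OF conjunct1[OF h]]
    have sa: "src \<Lambda> \<alpha> = rng \<Lambda> (tail \<mu> \<tau>)" using t(2) ad(3) by simp
    have z': "z \<in> boundary_paths_from \<Lambda> (src \<Lambda> (tail \<mu> \<tau>))" using z ts sd(3) by simp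
    have "arrow \<sigma> \<tau> z = arrow \<alpha> \<mu> (prepend \<Lambda> (tail \<mu> \<tau>) z)"
      using arrow_comp[OF am t(1) sa z'] h t(3) by simp
    then show "arrow \<sigma> \<tau> z \<in> Z_pair \<Lambda> \<alpha> \<mu>"
      unfolding Z_pair_eq[OF am] using prepend_mem[OF t(1) z'] sa by simp
  }
qed

end

section \<open>Combinations of the spanning elements\<close>

context kp_fam
begin

definition comb :: "('r \<times> 'l \<times> 'l) list \<Rightarrow> 'a" where
  "comb = lsum A (\<lambda>(r, \<alpha>, \<mu>). r \<odot>\<^bsub>A\<^esub> (P \<alpha> \<otimes>\<^sub>A Q \<mu>))"

definition coeffs :: "('r \<times> 'l \<times> 'l) list \<Rightarrow> bool" where
  "coeffs xs \<longleftrightarrow> (\<forall>(r, \<alpha>, \<mu>) \<in> set xs. r \<in> carrier R \<and> (\<alpha>, \<mu>) \<in> pairs)"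

lemma coeffs_simps [simp]:
  "coeffs []" "coeffs ((r, \<alpha>, \<mu>) # xs) \<longleftrightarrow> r \<in> carrier R \<and> (\<alpha>, \<mu>) \<in> pairs \<and> coeffs xs"
  "coeffs (xs @ ys) \<longleftrightarrow> coeffs xs \<and> coeffs ys"
  by (auto simp: coeffs_def)

lemma comb_simps [simp]:
  "comb [] = \<zero>\<^sub>A" "comb ((r, \<alpha>, \<mu>) # xs) = r \<odot>\<^bsub>A\<^esub> (P \<alpha> \<otimes>\<^sub>A Q \<mu>) \<oplus>\<^sub>A comb xs"
  by (simp_all add: comb_def)

lemma PQ_closed: "(\<alpha>, \<mu>) \<in> pairs \<Longrightarrow> P \<alpha> \<otimes>\<^sub>A Q \<mu> \<in> carrier A"
  by (auto dest: pairsD intro!: A.amult_closed)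

lemma comb_closed: "coeffs xs \<Longrightarrow> comb xs \<in> carrier A"
  by (induction xs) (auto simp: PQ_closed)

definition span :: "'a set" where "span = {comb xs | xs. coeffs xs}"

lemma span_closed: "x \<in> span \<Longrightarrow> x \<in> carrier A"
  using comb_closed by (auto simp: span_def)

lemma span_zero: "\<zero>\<^sub>A \<in> span"
  unfolding span_def using comb_simps(1) coeffs_simps(1) by (metis (mono_tags, lifting) mem_Collect_eq)

lemma comb_append: "\<lbrakk>coeffs xs; coeffs ys\<rbrakk> \<Longrightarrow> comb (xs @ ys) = comb xs \<oplus>\<^sub>A comb ys"
  by (induction xs) (auto simp: PQ_closed comb_closed A.M.a_assoc)

lemma span_add: "\<lbrakk>x \<in> span; y \<in> span\<rbrakk> \<Longrightarrow> x \<oplus>\<^sub>A y \<in> span"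
  unfolding span_def using comb_append coeffs_simps(3) by (smt (verit) mem_Collect_eq)

lemma span_PQ:
  assumes "r \<in> carrier R" "(\<alpha>, \<mu>) \<in> pairs" shows "r \<odot>\<^bsub>A\<^esub> (P \<alpha> \<otimes>\<^sub>A Q \<mu>) \<in> span"
proof -
  have "r \<odot>\<^bsub>A\<^esub> (P \<alpha> \<otimes>\<^sub>A Q \<mu>) = comb [(r, \<alpha>, \<mu>)]" "coeffs [(r, \<alpha>, \<mu>)]"
    using assms by (simp_all add: PQ_closed)
  then show ?thesis unfolding span_def by blast
qed

lemma span_induct [consumes 1, case_names zero step]:
  assumes "x \<in> span" "X \<zero>\<^sub>A"
    and "\<And>r \<alpha> \<mu> y. \<lbrakk>r \<in> carrier R; (\<alpha>, \<mu>) \<in> pairs; y \<in> span; X y\<rbrakk> \<Longrightarrow> X (r \<odot>\<^bsub>A\<^esub> (P \<alpha> \<otimes>\<^sub>A Q \<mu>) \<oplus>\<^sub>A y)"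
  shows "X x"
proof -
  have "coeffs xs \<Longrightarrow> X (comb xs)" for xs
  proof (induction xs)
    case (Cons x xs)
    obtain r \<alpha> \<mu> where x: "x = (r, \<alpha>, \<mu>)" by (cases x)
    have "comb xs \<in> span" using Cons.prems by (auto simp: span_def x)
    then show ?case using assms(3)[of r \<alpha> \<mu> "comb xs"] Cons by (simp add: x)
  qed (simp add: assms(2))
  then show ?thesis using assms(1) by (auto simp: span_def)
qed

lemma span_smult: "\<lbrakk>x \<in> span; s \<in> carrier R\<rbrakk> \<Longrightarrow> s \<odot>\<^bsub>A\<^esub> x \<in> span"
proof (induction rule: span_induct)
  case zero
  then show ?case by (simp add: span_zero)
next
  case (step r \<alpha> \<mu> y)
  have "s \<odot>\<^bsub>A\<^esub> (r \<odot>\<^bsub>A\<^esub> (P \<alpha> \<otimes>\<^sub>A Q \<mu>) \<oplus>\<^sub>A y) = (s \<otimes> r) \<odot>\<^bsub>A\<^esub> (P \<alpha> \<otimes>\<^sub>A Q \<mu>) \<oplus>\<^sub>A s \<odot>\<^bsub>A\<^esub> y"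
    using step PQ_closed[OF step(2)] span_closed by (simp add: A.smult_r_distr A.smult_assoc1)
  then show ?case using step by (simp add: span_add span_PQ)
qed

lemma span_finsum:
  assumes "finite I" "F \<in> I \<rightarrow> span" shows "finsum A F I \<in> span"
  using assms
proof (induction I rule: finite_induct)
  case (insert i I)
  then have "finsum A F (insert i I) = F i \<oplus>\<^sub>A finsum A F I" by (subst A.M.finsum_insert) (auto intro: span_closed)
  then show ?case using insert by (auto intro: span_add)
qed (simp add: span_zero)

lemma P_P_zero:
  assumes "\<alpha> \<in> paths \<Lambda>" "\<mu> \<in> paths \<Lambda>" "src \<Lambda> \<alpha> \<noteq> rng \<Lambda> \<mu>"
  shows "P \<alpha> \<otimes>\<^sub>A P \<mu> = \<zero>\<^sub>A"
proof -
  have s: "src \<Lambda> \<alpha> \<in> paths \<Lambda>" "rng \<Lambda> \<mu> \<in> paths \<Lambda>" using assms src_closed rng_closed by auto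
  have z: "P (src \<Lambda> \<alpha>) \<otimes>\<^sub>A P (rng \<Lambda> \<mu>) = \<zero>\<^sub>A"
    unfolding P_def by (rule relation[OF kp_relations.KP1_orth[OF vertex_src[OF assms(1)] vertex_rng[OF assms(2)] assms(3)]])
  have "P \<alpha> \<otimes>\<^sub>A P \<mu> = (P \<alpha> \<otimes>\<^sub>A P (src \<Lambda> \<alpha>)) \<otimes>\<^sub>A (P (rng \<Lambda> \<mu>) \<otimes>\<^sub>A P \<mu>)"
    using P_src[OF assms(1)] P_rng[OF assms(2)] by simp
  also have "\<dots> = P \<alpha> \<otimes>\<^sub>A ((P (src \<Lambda> \<alpha>) \<otimes>\<^sub>A P (rng \<Lambda> \<mu>)) \<otimes>\<^sub>A P \<mu>)"
    using assms s by (simp add: A.amult_assoc A.amult_closed)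
  also have "\<dots> = \<zero>\<^sub>A" unfolding z using assms by (simp add: A.amult_zero)
  finally show ?thesis .
qed

lemma P_mult_span:
  assumes b: "\<beta> \<in> paths \<Lambda>" and "x \<in> span" shows "P \<beta> \<otimes>\<^sub>A x \<in> span"
  using assms(2)
proof (induction rule: span_induct)
  case zero
  then show ?case using b by (simp add: A.amult_zero span_zero)
next
  case (step r \<alpha> \<mu> y)
  note d = pairsD[OF step(2)]
  have e: "P \<beta> \<otimes>\<^sub>A (r \<odot>\<^bsub>A\<^esub> (P \<alpha> \<otimes>\<^sub>A Q \<mu>) \<oplus>\<^sub>A y) = r \<odot>\<^bsub>A\<^esub> ((P \<beta> \<otimes>\<^sub>A P \<alpha>) \<otimes>\<^sub>A Q \<mu>) \<oplus>\<^sub>A P \<beta> \<otimes>\<^sub>A y"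
    using b d step span_closed by (simp add: A.amult_r_distr A.smult_amult_r A.amult_closed A.amult_assoc)
  have "r \<odot>\<^bsub>A\<^esub> ((P \<beta> \<otimes>\<^sub>A P \<alpha>) \<otimes>\<^sub>A Q \<mu>) \<in> span"
  proof (cases "src \<Lambda> \<beta> = rng \<Lambda> \<alpha>")
    case True
    have "(comp \<Lambda> \<beta> \<alpha>, \<mu>) \<in> pairs" using comp_closed[OF b d(1) True] src_comp[OF b d(1) True] d by (simp add: pairs_def)
    then show ?thesis using span_PQ step(1) P_mult[OF b d(1) True] by simp
  next
    case False
    then show ?thesis using P_P_zero[OF b d(1) False] d step(1) by (simp add: A.amult_zero span_zero)
  qed
  then show ?case unfolding e using step.IH by (rule span_add)
qed

text \<open>(KP3) reverses the order of a ghost followed by a path, and (KP2) merges the resulting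
  ghosts. Together with \<open>P_mult_span\<close> this brings every word in the generators into
  spanning form.\<close>

lemma Q_mult_span:
  assumes b: "\<beta> \<in> paths \<Lambda>" and "x \<in> span" shows "Q \<beta> \<otimes>\<^sub>A x \<in> span"
  using assms(2)
proof (induction rule: span_induct)
  case zero
  then show ?case using b by (simp add: A.amult_zero span_zero)
next
  case (step r \<alpha> \<mu> y)
  note d = pairsD[OF step(2)]
  let ?L = "Lambda_min \<Lambda> \<beta> \<alpha>"
  have e: "Q \<beta> \<otimes>\<^sub>A (r \<odot>\<^bsub>A\<^esub> (P \<alpha> \<otimes>\<^sub>A Q \<mu>) \<oplus>\<^sub>A y) = r \<odot>\<^bsub>A\<^esub> ((Q \<beta> \<otimes>\<^sub>A P \<alpha>) \<otimes>\<^sub>A Q \<mu>) \<oplus>\<^sub>A Q \<beta> \<otimes>\<^sub>A y"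
    using b d step span_closed by (simp add: A.amult_r_distr A.smult_amult_r A.amult_closed A.amult_assoc)
  have "(Q \<beta> \<otimes>\<^sub>A P \<alpha>) \<otimes>\<^sub>A Q \<mu> = (\<Oplus>\<^bsub>A\<^esub>l \<in> ?L. P (fst l) \<otimes>\<^sub>A Q (snd l) \<otimes>\<^sub>A Q \<mu>)"
    unfolding Q_P[OF b d(1)]
    by (rule A.finsum_mult_right[OF finite_Lambda_min[OF b d(1)]]) (use d in \<open>auto intro!: A.amult_closed dest: Lambda_min_paths\<close>)
  also have "\<dots> \<in> span"
  proof (rule span_finsum[OF finite_Lambda_min[OF b d(1)]], rule Pi_I)
    fix l assume l: "l \<in> ?L"
    then have m: "(fst l, snd l) \<in> ?L" by simp
    note ld = Lambda_minD[OF m]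
    have s: "src \<Lambda> \<mu> = rng \<Lambda> (snd l)" using ld(4) d(3) by simp
    have "P (fst l) \<otimes>\<^sub>A Q (snd l) \<otimes>\<^sub>A Q \<mu> = P (fst l) \<otimes>\<^sub>A Q (comp \<Lambda> \<mu> (snd l))"
      using Q_mult[OF d(2) ld(2) s] ld(1,2) d by (simp add: A.amult_assoc)
    moreover have p: "(fst l, comp \<Lambda> \<mu> (snd l)) \<in> pairs"
      using ld(1) comp_closed[OF d(2) ld(2) s] src_comp[OF d(2) ld(2) s] Lambda_min_src[OF b d(1) m] by (simp add: pairs_def)
    ultimately show "P (fst l) \<otimes>\<^sub>A Q (snd l) \<otimes>\<^sub>A Q \<mu> \<in> span"
      using span_PQ[OF A.R.one_closed p] PQ_closed[OF p] by simp
  qed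
  finally have "r \<odot>\<^bsub>A\<^esub> ((Q \<beta> \<otimes>\<^sub>A P \<alpha>) \<otimes>\<^sub>A Q \<mu>) \<in> span" using span_smult step(1) by blast
  then show ?case unfolding e using step.IH by (rule span_add)
qed

lemma generator_cases:
  assumes "g \<in> kp_generators \<Lambda>"
  obtains \<beta> where "\<beta> \<in> paths \<Lambda>" "S g = P \<beta>" | \<beta> where "\<beta> \<in> paths \<Lambda>" "S g = Q \<beta>"
proof -
  have "(\<exists>\<beta>. \<beta> \<in> paths \<Lambda> \<and> S g = P \<beta>) \<or> (\<exists>\<beta>. \<beta> \<in> paths \<Lambda> \<and> S g = Q \<beta>)"
    using assms by (auto simp: kp_generators_def P_def Q_def star_def)
  then show ?thesis using that by blast
qed

lemma generator_span:
  assumes "g \<in> kp_generators \<Lambda>" shows "S g \<in> span"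
  using assms
proof (cases rule: generator_cases)
  case (1 \<beta>)
  have p: "(\<beta>, src \<Lambda> \<beta>) \<in> pairs" using pairs_src(1)[OF 1(1)] .
  have "\<one> \<odot>\<^bsub>A\<^esub> (P \<beta> \<otimes>\<^sub>A Q (src \<Lambda> \<beta>)) = P \<beta>"
    using Q_vertex[OF vertex_src[OF 1(1)]] P_src[OF 1(1)] 1(1) by simp
  then show ?thesis using span_PQ[OF A.R.one_closed p] 1(2) by simp
next
  case (2 \<beta>)
  have p: "(src \<Lambda> \<beta>, \<beta>) \<in> pairs" using pairs_src(2)[OF 2(1)] .
  have "\<one> \<odot>\<^bsub>A\<^esub> (P (src \<Lambda> \<beta>) \<otimes>\<^sub>A Q \<beta>) = Q \<beta>" using Q_src[OF 2(1)] 2(1) by simp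
  then show ?thesis using span_PQ[OF A.R.one_closed p] 2(2) by simp
qed

lemma word_span: "\<lbrakk>w \<noteq> []; set w \<subseteq> kp_generators \<Lambda>\<rbrakk> \<Longrightarrow> list_product A (map S w) \<in> span"
proof (induction w)
  case (Cons g w)
  show ?case
  proof (cases w)
    case Nil
    then show ?thesis using generator_span Cons.prems by simp
  next
    case (Cons g' w')
    have e: "list_product A (map S (g # w)) = S g \<otimes>\<^sub>A list_product A (map S w)" by (simp add: Cons)
    have IH: "list_product A (map S w) \<in> span" using Cons.IH Cons.prems Cons by simp
    have "g \<in> kp_generators \<Lambda>" using Cons.prems by simp
    then show ?thesis unfolding e
      by (cases rule: generator_cases) (use P_mult_span[OF _ IH] Q_mult_span[OF _ IH] in simp_all)
  qed
qed simp

lemma P_V_zero: "\<lbrakk>\<mu> \<in> paths \<Lambda>; v \<in> vertices \<Lambda>; v \<noteq> rng \<Lambda> \<mu>\<rbrakk> \<Longrightarrow> Q \<mu> \<otimes>\<^sub>A P v = \<zero>\<^sub>A"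
proof -
  assume a: "\<mu> \<in> paths \<Lambda>" "v \<in> vertices \<Lambda>" "v \<noteq> rng \<Lambda> \<mu>"
  have "Lambda_min \<Lambda> \<mu> v = {}" using Lambda_min_rng[OF a(1) vertexD(1)[OF a(2)]] vertexD(2)[OF a(2)] a(3) by metis
  then show ?thesis using Q_P[OF a(1) vertexD(1)[OF a(2)]] by simp
qed

text \<open>\<open>Q \<mu>\<close> is fixed on the right by the vertex
  \<open>rng \<Lambda> \<mu>\<close> and annihilated by all others, so a finite sum of vertices acts
  as a right unit on \<open>comb xs\<close>. This takes the place of a unit, which \<open>A\<close>
  need not have.\<close>

lemma comb_local_unit:
  assumes xs: "coeffs xs" and V: "finite V" "V \<subseteq> vertices \<Lambda>" "\<And>r \<alpha> \<mu>. (r, \<alpha>, \<mu>) \<in> set xs \<Longrightarrow> rng \<Lambda> \<mu> \<in> V"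
  shows "comb xs = (\<Oplus>\<^bsub>A\<^esub>v \<in> V. comb xs \<otimes>\<^sub>A P v)"
proof -
  have Vp: "v \<in> paths \<Lambda>" if "v \<in> V" for v using V(2) that vertexD(1) by blast
  let ?u = "\<Oplus>\<^bsub>A\<^esub>v \<in> V. P v"
  have uc: "?u \<in> carrier A" using Vp by (intro A.M.finsum_closed) auto
  have Qu: "Q \<mu> \<otimes>\<^sub>A ?u = Q \<mu>" if m: "\<mu> \<in> paths \<Lambda>" "rng \<Lambda> \<mu> \<in> V" for \<mu>
  proof -
    have "Q \<mu> \<otimes>\<^sub>A ?u = (\<Oplus>\<^bsub>A\<^esub>v \<in> V. Q \<mu> \<otimes>\<^sub>A P v)" by (rule A.finsum_mult_left[OF V(1)]) (use m Vp in auto)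
    also have "\<dots> = (\<Oplus>\<^bsub>A\<^esub>v \<in> V. if rng \<Lambda> \<mu> = v then Q \<mu> else \<zero>\<^sub>A)"
      by (rule A.M.finsum_cong'[OF refl]) (use m V(2) Q_rng[OF m(1)] P_V_zero[OF m(1)] in auto)
    also have "\<dots> = Q \<mu>" using A.M.add.finprod_singleton[OF m(2) V(1), of "\<lambda>_. Q \<mu>"] m(1) by simp
    finally show ?thesis .
  qed
  have "comb xs \<otimes>\<^sub>A ?u = comb xs" using xs V(3)
  proof (induction xs)
    case (Cons x xs)
    obtain r \<alpha> \<mu> where x: "x = (r, \<alpha>, \<mu>)" by (cases x)
    have c: "r \<in> carrier R" "(\<alpha>, \<mu>) \<in> pairs" "coeffs xs" using Cons.prems(1) by (simp_all add: x)
    note d = pairsD[OF c(2)]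
    have "rng \<Lambda> \<mu> \<in> V" using Cons.prems(2)[of r \<alpha> \<mu>] by (simp add: x)
    then have "(P \<alpha> \<otimes>\<^sub>A Q \<mu>) \<otimes>\<^sub>A ?u = P \<alpha> \<otimes>\<^sub>A Q \<mu>" using Qu[OF d(2)] d uc by (simp add: A.amult_assoc)
    moreover have "comb xs \<otimes>\<^sub>A ?u = comb xs" using Cons.IH[OF c(3)] Cons.prems(2) by (meson list.set_intros(2))
    ultimately show ?case
      using c uc PQ_closed[OF c(2)] comb_closed[OF c(3)] by (simp add: x A.amult_l_distr A.smult_amult_l)
  qed (simp add: A.amult_zero uc)
  moreover have "comb xs \<otimes>\<^sub>A ?u = (\<Oplus>\<^bsub>A\<^esub>v \<in> V. comb xs \<otimes>\<^sub>A P v)"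
    by (rule A.finsum_mult_left[OF V(1) comb_closed[OF xs]]) (use Vp in auto)
  ultimately show ?thesis by simp
qed

text \<open>\<open>Q \<mu> P \<tau>\<close> is \<open>P (tail \<mu> \<tau>)\<close> when
  \<open>\<mu>\<close> is an initial segment of \<open>\<tau>\<close>; in the other decided case its
  product with the cell is 0 by \<open>Q_P_PL_zero\<close>. So only paths, and no ghosts, remain in
  front of \<open>PL\<close>.\<close>

lemma comb_cell:
  assumes xs: "coeffs xs" and t: "\<tau> \<in> paths \<Lambda>" and G: "set G \<subseteq> paths_from \<Lambda> (src \<Lambda> \<tau>)"
    and d: "\<And>r \<alpha> \<mu>. (r, \<alpha>, \<mu>) \<in> set xs \<Longrightarrow> decided \<mu> \<tau> G"
  shows "comb xs \<otimes>\<^sub>A (P \<tau> \<otimes>\<^sub>A PL (src \<Lambda> \<tau>) G) =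
    lsum A (\<lambda>x. if prefix (snd (snd x)) \<tau>
      then fst x \<odot>\<^bsub>A\<^esub> (P (comp \<Lambda> (fst (snd x)) (tail (snd (snd x)) \<tau>)) \<otimes>\<^sub>A PL (src \<Lambda> \<tau>) G) else \<zero>\<^sub>A) xs"
proof -
  have s: "src \<Lambda> \<tau> \<in> paths \<Lambda>" "set G \<subseteq> paths \<Lambda>" using src_closed[OF t] G by (auto simp: paths_from_def)
  have Pc: "PL (src \<Lambda> \<tau>) G \<in> carrier A" using s by simp
  show ?thesis using xs d
  proof (induction xs)
    case Nil
    then show ?case using t Pc by (simp add: A.amult_zero A.amult_closed)
  next
    case (Cons x xs)
    obtain r \<alpha> \<mu> where x: "x = (r, \<alpha>, \<mu>)" by (cases x)
    have c: "r \<in> carrier R" "(\<alpha>, \<mu>) \<in> pairs" "coeffs xs" using Cons.prems(1) by (simp_all add: x)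
    note pd = pairsD[OF c(2)]
    have dm: "decided \<mu> \<tau> G" using Cons.prems(2)[of r \<alpha> \<mu>] by (simp add: x)
    have "(P \<alpha> \<otimes>\<^sub>A Q \<mu>) \<otimes>\<^sub>A (P \<tau> \<otimes>\<^sub>A PL (src \<Lambda> \<tau>) G) = P \<alpha> \<otimes>\<^sub>A (Q \<mu> \<otimes>\<^sub>A P \<tau> \<otimes>\<^sub>A PL (src \<Lambda> \<tau>) G)"
      using pd t Pc by (simp add: A.amult_assoc A.amult_closed)
    also have "\<dots> = (if prefix \<mu> \<tau> then P (comp \<Lambda> \<alpha> (tail \<mu> \<tau>)) \<otimes>\<^sub>A PL (src \<Lambda> \<tau>) G else \<zero>\<^sub>A)"
    proof (cases "prefix \<mu> \<tau>")
      case True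
      note tl = tail[OF True]
      have sa: "src \<Lambda> \<alpha> = rng \<Lambda> (tail \<mu> \<tau>)" using tl(2) pd(3) by simp
      have "Q \<mu> \<otimes>\<^sub>A P \<tau> = (Q \<mu> \<otimes>\<^sub>A P \<mu>) \<otimes>\<^sub>A P (tail \<mu> \<tau>)"
        using P_mult[OF pd(2) tl(1,2)] tl(1,3) pd by (simp add: A.amult_assoc)
      also have "\<dots> = P (tail \<mu> \<tau>)" using Q_P_self[OF pd(2)] P_rng[OF tl(1)] tl(2) by simp
      finally have "P \<alpha> \<otimes>\<^sub>A (Q \<mu> \<otimes>\<^sub>A P \<tau> \<otimes>\<^sub>A PL (src \<Lambda> \<tau>) G) = (P \<alpha> \<otimes>\<^sub>A P (tail \<mu> \<tau>)) \<otimes>\<^sub>A PL (src \<Lambda> \<tau>) G"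
        using pd tl Pc by (simp add: A.amult_assoc)
      then show ?thesis using True P_mult[OF pd(1) tl(1) sa] by simp
    next
      case False
      then have "Q \<mu> \<otimes>\<^sub>A P \<tau> \<otimes>\<^sub>A PL (src \<Lambda> \<tau>) G = \<zero>\<^sub>A"
        using Q_P_PL_zero[OF pd(2) t G] dm unfolding decided_def by blast
      then show ?thesis using False pd by (simp add: A.amult_zero)
    qed
    finally have e: "(P \<alpha> \<otimes>\<^sub>A Q \<mu>) \<otimes>\<^sub>A (P \<tau> \<otimes>\<^sub>A PL (src \<Lambda> \<tau>) G)
      = (if prefix \<mu> \<tau> then P (comp \<Lambda> \<alpha> (tail \<mu> \<tau>)) \<otimes>\<^sub>A PL (src \<Lambda> \<tau>) G else \<zero>\<^sub>A)" .
    have IH: "comb xs \<otimes>\<^sub>A (P \<tau> \<otimes>\<^sub>A PL (src \<Lambda> \<tau>) G) = lsum A (\<lambda>x. if prefix (snd (snd x)) \<tau>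
      then fst x \<odot>\<^bsub>A\<^esub> (P (comp \<Lambda> (fst (snd x)) (tail (snd (snd x)) \<tau>)) \<otimes>\<^sub>A PL (src \<Lambda> \<tau>) G) else \<zero>\<^sub>A) xs"
      using Cons.IH[OF c(3)] Cons.prems(2) by (meson list.set_intros(2))
    have "comb (x # xs) \<otimes>\<^sub>A (P \<tau> \<otimes>\<^sub>A PL (src \<Lambda> \<tau>) G)
      = r \<odot>\<^bsub>A\<^esub> ((P \<alpha> \<otimes>\<^sub>A Q \<mu>) \<otimes>\<^sub>A (P \<tau> \<otimes>\<^sub>A PL (src \<Lambda> \<tau>) G)) \<oplus>\<^sub>A comb xs \<otimes>\<^sub>A (P \<tau> \<otimes>\<^sub>A PL (src \<Lambda> \<tau>) G)"
      using c PQ_closed[OF c(2)] comb_closed[OF c(3)] t Pc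
      by (simp add: x A.amult_l_distr A.smult_amult_l A.amult_closed)
    then show ?case unfolding e IH using c(1) by (simp add: x)
  qed
qed

text \<open>Evaluating at the arrows \<open>(\<sigma>z, d(\<sigma>) - d(\<tau>), \<tau>z)\<close> with \<open>z\<close> avoiding \<open>G\<close> isolates the coefficients
  collected in \<open>comb_cell\<close>; if no such \<open>z\<close> exists, then the cell vanishes by (KP4).\<close>

lemma comb_decided_cell_zero:
  assumes xs: "coeffs xs"
    and zero: "\<And>a. a \<in> boundary_arrows \<Lambda> \<Longrightarrow>
      lsum R (\<lambda>x. if a \<in> Z_pair \<Lambda> (fst (snd x)) (snd (snd x)) then fst x else \<zero>) xs = \<zero>"
    and t: "\<tau> \<in> paths \<Lambda>" and G: "set G \<subseteq> paths_from \<Lambda> (src \<Lambda> \<tau>)"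
    and d: "\<And>r \<alpha> \<mu>. (r, \<alpha>, \<mu>) \<in> set xs \<Longrightarrow> decided \<mu> \<tau> G"
  shows "comb xs \<otimes>\<^sub>A (P \<tau> \<otimes>\<^sub>A PL (src \<Lambda> \<tau>) G) = \<zero>\<^sub>A"
proof (cases "exhaustive \<Lambda> (src \<Lambda> \<tau>) (set G)")
  case True
  then show ?thesis using PL_exhaustive[OF vertex_src[OF t] True] t comb_closed[OF xs] by (simp add: A.amult_zero)
next
  case False
  obtain z where z: "z \<in> boundary_paths_from \<Lambda> (src \<Lambda> \<tau>)" "initial_segs z \<inter> set G = {}"
    using boundary_path_avoiding[OF vertex_src[OF t] G False] .
  have s: "src \<Lambda> \<tau> \<in> paths \<Lambda>" "set G \<subseteq> paths \<Lambda>" using src_closed[OF t] G by (auto simp: paths_from_def)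
  let ?b = "\<lambda>x. prefix (snd (snd x)) \<tau>"
  let ?key = "\<lambda>x. comp \<Lambda> (fst (snd x)) (tail (snd (snd x)) \<tau>)"
  let ?v = "\<lambda>\<sigma>. P \<sigma> \<otimes>\<^sub>A PL (src \<Lambda> \<tau>) G"
  \<comment> \<open>The left-hand paths \<open>\<sigma>\<close> that remain on the cell. Different
    entries of \<open>xs\<close> may lead to the same \<open>\<sigma>\<close>, so their coefficients
    have to be added.\<close>
  define W where "W = ?key ` {x \<in> set xs. ?b x}"
  have xd: "fst x \<in> carrier R" "(fst (snd x), snd (snd x)) \<in> pairs" "decided (snd (snd x)) \<tau> G" if "x \<in> set xs" for x
    using xs d that by (cases x; auto simp: coeffs_def)+
  have Wp: "\<sigma> \<in> paths \<Lambda>" "(\<sigma>, \<tau>) \<in> pairs" if w: "\<sigma> \<in> W" for \<sigma>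
  proof -
    obtain x where x: "x \<in> set xs" "?b x" "\<sigma> = ?key x" using w by (auto simp: W_def)
    note pd = pairsD[OF xd(2)[OF x(1)]] and tl = tail[OF x(2)]
    have sa: "src \<Lambda> (fst (snd x)) = rng \<Lambda> (tail (snd (snd x)) \<tau>)" using tl(2) pd(3) by simp
    show "\<sigma> \<in> paths \<Lambda>" "(\<sigma>, \<tau>) \<in> pairs"
      using comp_closed[OF pd(1) tl(1) sa] src_comp[OF pd(1) tl(1) sa] tail_src[OF x(2)] t x(3) by (auto simp: pairs_def)
  qed
  have "comb xs \<otimes>\<^sub>A (P \<tau> \<otimes>\<^sub>A PL (src \<Lambda> \<tau>) G) = lsum A (\<lambda>x. if ?b x then fst x \<odot>\<^bsub>A\<^esub> ?v (?key x) else \<zero>\<^sub>A) xs"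
    by (rule comb_cell[OF xs t G d])
  also have "\<dots> = (\<Oplus>\<^bsub>A\<^esub>\<sigma> \<in> W. lsum R (\<lambda>x. if ?b x \<and> ?key x = \<sigma> then fst x else \<zero>) xs \<odot>\<^bsub>A\<^esub> ?v \<sigma>)"
  proof (rule A.lsum_collect)
    show "finite W" by (simp add: W_def)
    show "?key x \<in> W" if "x \<in> set xs" "?b x" for x using that by (auto simp: W_def)
    show "?v \<sigma> \<in> carrier A" if "\<sigma> \<in> W" for \<sigma> using Wp(1)[OF that] s by (simp add: A.amult_closed)
  qed (rule xd(1))
  also have "\<dots> = (\<Oplus>\<^bsub>A\<^esub>\<sigma> \<in> W. \<zero>\<^sub>A)"
  proof (rule A.M.finsum_cong'[OF refl])
    fix \<sigma> assume w: "\<sigma> \<in> W"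
    note st = Wp(2)[OF w]
    have z': "z \<in> boundary_paths_from \<Lambda> (src \<Lambda> \<sigma>)" using z(1) pairsD(3)[OF st] by simp
    have "lsum R (\<lambda>x. if ?b x \<and> ?key x = \<sigma> then fst x else \<zero>) xs
      = lsum R (\<lambda>x. if arrow \<sigma> \<tau> z \<in> Z_pair \<Lambda> (fst (snd x)) (snd (snd x)) then fst x else \<zero>) xs"
      by (rule lsum_cong) (simp add: arrow_mem_decided_iff[OF st xd(2) z' z(2) xd(3)])
    also have "\<dots> = \<zero>" by (rule zero[OF arrow_mem[OF st z']])
    finally show "lsum R (\<lambda>x. if ?b x \<and> ?key x = \<sigma> then fst x else \<zero>) xs \<odot>\<^bsub>A\<^esub> ?v \<sigma> = \<zero>\<^sub>A"
      using Wp(1)[OF w] s by (simp add: A.amult_closed)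
  qed simp
  finally show ?thesis by simp
qed

text \<open>A cell is the orthogonal sum of the part that avoids \<open>m\<close> altogether and the parts running through
  the minimal common extensions of \<open>\<tau>\<close> and \<open>m\<close>; each of these decides \<open>m\<close>.\<close>

lemma cell_elimination:
  assumes x: "x \<in> carrier A" and "set ms \<subseteq> paths \<Lambda>" "D \<subseteq> paths \<Lambda>"
    and "\<And>\<tau> G. \<lbrakk>\<tau> \<in> paths \<Lambda>; set G \<subseteq> paths_from \<Lambda> (src \<Lambda> \<tau>); \<And>\<mu>. \<mu> \<in> set ms \<union> D \<Longrightarrow> decided \<mu> \<tau> G\<rbrakk>
      \<Longrightarrow> x \<otimes>\<^sub>A (P \<tau> \<otimes>\<^sub>A PL (src \<Lambda> \<tau>) G) = \<zero>\<^sub>A"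
    and "\<tau> \<in> paths \<Lambda>" "set G \<subseteq> paths_from \<Lambda> (src \<Lambda> \<tau>)" "\<And>\<mu>. \<mu> \<in> D \<Longrightarrow> decided \<mu> \<tau> G"
  shows "x \<otimes>\<^sub>A (P \<tau> \<otimes>\<^sub>A PL (src \<Lambda> \<tau>) G) = \<zero>\<^sub>A"
  using assms(2-)
proof (induction ms arbitrary: D \<tau> G)
  case Nil
  then show ?case by simp
next
  case (Cons m ms)
  have m: "m \<in> paths \<Lambda>" using Cons.prems(1) by simp
  \<comment> \<open>The paths in \<open>D\<close> are already decided on the cell. The induction
    moves \<open>m\<close> from the list into \<open>D\<close>; its hypothesis then covers every
    cell that decides \<open>m\<close> as well.\<close>
  have Z: "x \<otimes>\<^sub>A (P \<tau>' \<otimes>\<^sub>A PL (src \<Lambda> \<tau>') G') = \<zero>\<^sub>A"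
    if "\<tau>' \<in> paths \<Lambda>" "set G' \<subseteq> paths_from \<Lambda> (src \<Lambda> \<tau>')" "\<And>\<mu>. \<mu> \<in> insert m D \<Longrightarrow> decided \<mu> \<tau>' G'" for \<tau>' G'
    by (rule Cons.IH[of "insert m D"]) (use Cons.prems(1-3) that m in auto)
  note t = Cons.prems(4) and G = Cons.prems(5) and dec = Cons.prems(6)
  let ?s = "src \<Lambda> \<tau>"
  have s: "?s \<in> vertices \<Lambda>" "?s \<in> paths \<Lambda>" using vertex_src[OF t] src_closed[OF t] by auto
  have Gp: "set G \<subseteq> paths \<Lambda>" using G by (auto simp: paths_from_def)
  obtain hs where hs: "distinct hs" "set hs = snd ` Lambda_min \<Lambda> m \<tau>" "set hs \<subseteq> paths_from \<Lambda> ?s"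
    "\<And>\<eta> \<eta>'. \<lbrakk>\<eta> \<in> set hs; \<eta>' \<in> set hs; \<eta> \<noteq> \<eta>'\<rbrakk> \<Longrightarrow> Lambda_min \<Lambda> \<eta> \<eta>' = {}"
    using snd_Lambda_min_list[OF m t] by blast
  have hp: "set hs \<subseteq> paths \<Lambda>" using hs(3) by (auto simp: paths_from_def)
  let ?sum = "\<Oplus>\<^bsub>A\<^esub>\<eta> \<in> set hs. proj \<eta>"
  have sc: "?sum \<in> carrier A" using hp by (intro A.M.finsum_closed) auto
  let ?c = "x \<otimes>\<^sub>A (P \<tau> \<otimes>\<^sub>A PL ?s G)"
  have cc: "?c \<in> carrier A" using x t s Gp by (simp add: A.amult_closed)
  have e: "(\<rho>, \<rho>') \<in> Lambda_min \<Lambda> \<tau> m \<Longrightarrow> \<rho> \<in> set hs" for \<rho> \<rho>'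
    using Lambda_min_swap[OF t m] unfolding hs(2) by force
  \<comment> \<open>The part that avoids \<open>m\<close>: once all extensions of
    \<open>\<tau>\<close> towards \<open>m\<close> are added to \<open>G\<close>, the path
    \<open>m\<close> is decided.\<close>
  have z1: "?c \<otimes>\<^sub>A PL ?s hs = \<zero>\<^sub>A"
  proof -
    have "?c \<otimes>\<^sub>A PL ?s hs = x \<otimes>\<^sub>A (P \<tau> \<otimes>\<^sub>A PL ?s (G @ hs))"
      using PL_append[OF s(1) G hs(3)] x t s Gp hp by (simp add: A.amult_assoc A.amult_closed)
    also have "\<dots> = \<zero>\<^sub>A"
    proof (rule Z[OF t])
      show "set (G @ hs) \<subseteq> paths_from \<Lambda> ?s" using G hs(3) by simp
      fix \<mu> assume "\<mu> \<in> insert m D"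
      then show "decided \<mu> \<tau> (G @ hs)"
      proof
        assume "\<mu> = m"
        then show ?thesis unfolding decided_def using e hp prefix_refl by (metis Un_iff set_append subsetD)
      next
        assume "\<mu> \<in> D"
        then show ?thesis using dec[of \<mu>] unfolding decided_def by (metis Un_iff set_append)
      qed
    qed
    finally show ?thesis .
  qed
  \<comment> \<open>The part through \<open>\<eta>\<close>: now \<open>m\<close> is an initial
    segment of \<open>\<tau>\<eta>\<close>, and \<open>G\<close> is carried past
    \<open>P \<eta>\<close> in a way that keeps the earlier decisions.\<close>
  have z2: "?c \<otimes>\<^sub>A proj \<eta> = \<zero>\<^sub>A" if h: "\<eta> \<in> set hs" for \<eta>
  proof -
    have ep: "\<eta> \<in> paths \<Lambda>" "rng \<Lambda> \<eta> = ?s" "?s = rng \<Lambda> \<eta>" using h hs(3) by (auto simp: paths_from_def)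
    obtain G' where G': "set G' = (\<Union>\<nu> \<in> set G. snd ` Lambda_min \<Lambda> \<nu> \<eta>)" "set G' \<subseteq> paths_from \<Lambda> (src \<Lambda> \<eta>)"
      "PL ?s G \<otimes>\<^sub>A P \<eta> = P \<eta> \<otimes>\<^sub>A PL (src \<Lambda> \<eta>) G'" using PL_P_shift[OF s(1) G ep(1,2)] by blast
    have G'p: "set G' \<subseteq> paths \<Lambda>" using G'(2) by (auto simp: paths_from_def)
    have te: "comp \<Lambda> \<tau> \<eta> \<in> paths \<Lambda>" "src \<Lambda> (comp \<Lambda> \<tau> \<eta>) = src \<Lambda> \<eta>"
      using comp_closed[OF t ep(1,3)] src_comp[OF t ep(1,3)] by auto
    have sh: "src \<Lambda> \<eta> \<in> paths \<Lambda>" using src_closed[OF ep(1)] .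
    have "?c \<otimes>\<^sub>A proj \<eta> = x \<otimes>\<^sub>A (P \<tau> \<otimes>\<^sub>A (PL ?s G \<otimes>\<^sub>A P \<eta>)) \<otimes>\<^sub>A Q \<eta>"
      unfolding proj_def using x t s Gp ep(1) by (simp add: A.amult_assoc A.amult_closed)
    also have "P \<tau> \<otimes>\<^sub>A (PL ?s G \<otimes>\<^sub>A P \<eta>) = P (comp \<Lambda> \<tau> \<eta>) \<otimes>\<^sub>A PL (src \<Lambda> (comp \<Lambda> \<tau> \<eta>)) G'"
      unfolding G'(3) te(2) using P_mult[OF t ep(1,3)] t ep(1) sh G'p by (simp add: A.amult_assoc[symmetric])
    also have "x \<otimes>\<^sub>A (P (comp \<Lambda> \<tau> \<eta>) \<otimes>\<^sub>A PL (src \<Lambda> (comp \<Lambda> \<tau> \<eta>)) G') = \<zero>\<^sub>A"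
    proof (rule Z[OF te(1)])
      show "set G' \<subseteq> paths_from \<Lambda> (src \<Lambda> (comp \<Lambda> \<tau> \<eta>))" using G'(2) te(2) by simp
      fix \<mu> assume "\<mu> \<in> insert m D"
      then show "decided \<mu> (comp \<Lambda> \<tau> \<eta>) G'"
      proof
        assume mm: "\<mu> = m"
        obtain \<xi> where x: "(\<xi>, \<eta>) \<in> Lambda_min \<Lambda> m \<tau>" using h hs(2) by auto
        have "prefix m (comp \<Lambda> \<tau> \<eta>)" using prefixI[OF m Lambda_minD(1,3)[OF x]] Lambda_minD(5)[OF x] by simp
        then show ?thesis using mm by (simp add: decided_def)
      next
        assume "\<mu> \<in> D"
        then show ?thesis using decided_extend[OF t ep(1,3) _ dec Gp G'(1)] Cons.prems(2) by blast
      qed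
    qed
    finally show ?thesis using ep(1) by (simp add: A.amult_zero)
  qed
  have "?c = ?c \<otimes>\<^sub>A (PL ?s hs \<oplus>\<^sub>A ?sum)"
    using PL_orthogonal[OF s(1) hs(1,3,4)] P_PL(2)[OF s(1) G] x t s Gp by (simp add: A.amult_assoc A.amult_closed)
  also have "\<dots> = ?c \<otimes>\<^sub>A PL ?s hs \<oplus>\<^sub>A ?c \<otimes>\<^sub>A ?sum" using cc s hp sc by (simp add: A.amult_r_distr)
  also have "?c \<otimes>\<^sub>A ?sum = (\<Oplus>\<^bsub>A\<^esub>\<eta> \<in> set hs. ?c \<otimes>\<^sub>A proj \<eta>)"
    by (rule A.finsum_mult_left) (use cc hp in auto)
  also have "\<dots> = (\<Oplus>\<^bsub>A\<^esub>\<eta> \<in> set hs. \<zero>\<^sub>A)" by (rule A.M.finsum_cong') (simp_all add: z2)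
  finally show ?case using z1 by simp
qed

text \<open>The elimination starts at the cells \<open>P v\<close>, with \<open>\<tau> = v\<close>
  and empty \<open>G\<close>, where no decision is presupposed; \<open>comb_local_unit\<close>
  assembles the results for the finitely many relevant vertices.\<close>

theorem comb_zero:
  assumes xs: "coeffs xs"
    and zero: "\<And>a. a \<in> boundary_arrows \<Lambda> \<Longrightarrow>
      lsum R (\<lambda>x. if a \<in> Z_pair \<Lambda> (fst (snd x)) (snd (snd x)) then fst x else \<zero>) xs = \<zero>"
  shows "comb xs = \<zero>\<^sub>A"
proof -
  let ?ms = "map (\<lambda>x. snd (snd x)) xs"
  have mp: "(r, \<alpha>, \<mu>) \<in> set xs \<Longrightarrow> \<mu> \<in> paths \<Lambda>" for r \<alpha> \<mu> using xs pairsD(2) by (auto simp: coeffs_def)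
  have msp: "set ?ms \<subseteq> paths \<Lambda>" using mp by auto
  have cv: "comb xs \<otimes>\<^sub>A P v = \<zero>\<^sub>A" if v: "v \<in> vertices \<Lambda>" for v
  proof -
    have "comb xs \<otimes>\<^sub>A (P v \<otimes>\<^sub>A PL (src \<Lambda> v) []) = \<zero>\<^sub>A"
    proof (rule cell_elimination[OF comb_closed[OF xs] msp, of "{}"])
      fix \<tau> G assume t: "\<tau> \<in> paths \<Lambda>" "set G \<subseteq> paths_from \<Lambda> (src \<Lambda> \<tau>)" and d: "\<And>\<mu>. \<mu> \<in> set ?ms \<union> {} \<Longrightarrow> decided \<mu> \<tau> G"
      show "comb xs \<otimes>\<^sub>A (P \<tau> \<otimes>\<^sub>A PL (src \<Lambda> \<tau>) G) = \<zero>\<^sub>A"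
        by (rule comb_decided_cell_zero[OF xs zero t]) (use d in force)+
    qed (use vertexD(1)[OF v] in auto)
    then show ?thesis using vertexD(3)[OF v] P_idem[OF v] by simp
  qed
  let ?V = "rng \<Lambda> ` set ?ms"
  have V: "?V \<subseteq> vertices \<Lambda>" using msp vertex_rng by blast
  have "comb xs = (\<Oplus>\<^bsub>A\<^esub>v \<in> ?V. comb xs \<otimes>\<^sub>A P v)" by (rule comb_local_unit[OF xs _ V]) force+
  also have "\<dots> = (\<Oplus>\<^bsub>A\<^esub>v \<in> ?V. \<zero>\<^sub>A)" by (rule A.M.finsum_cong') (use cv V in auto)
  finally show ?thesis by simp
qed

end

text \<open>Every element of the quotient is represented in the free algebra by a sum of monomials;
  the quotient map takes a monomial to a scalar multiple of a word in the generators, which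
  \<open>word_span\<close> brings into spanning form.\<close>

lemma kp_algebra_span:
  fixes R (structure)
  assumes \<Lambda>: "finitely_aligned_kgraph \<Lambda>" and R: "cring R" and x: "x \<in> carrier (kp_algebra R \<Lambda>)"
  shows "x \<in> kp_fam.span \<Lambda> R (kp_algebra R \<Lambda>) (kp_gen R \<Lambda>)"
proof -
  interpret finitely_aligned_kgraph \<Lambda> by fact
  interpret cring R by fact
  let ?K = "kp_algebra R \<Lambda>" and ?F = "kp_free R \<Lambda>" and ?I = "kp_ideal R \<Lambda>"
  note u = kp_algebra_universal[OF k_graph_axioms R]
  interpret K: nonunital_algebra R ?K by (rule u(1))
  interpret K: kp_fam \<Lambda> R ?K "kp_gen R \<Lambda>" by unfold_locales (rule u(2))
  have F: "nonunital_algebra R ?F" unfolding kp_free_def by (rule nonunital_algebra_free)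
  interpret F: nonunital_algebra R ?F by fact
  have m: "(\<lambda>g. monomial R \<one> [g]) \<in> kp_generators \<Lambda> \<rightarrow> carrier ?F"
    by (auto simp: kp_free_def intro!: monomial_closed)
  have "{a \<ominus>\<^bsub>?F\<^esub> b | a b. (a, b) \<in> kp_relations \<Lambda> ?F (\<lambda>g. monomial R \<one> [g])} \<subseteq> carrier ?F"
    using kp_relations_closed[OF k_graph_axioms F m] F.M.minus_closed by blast
  then have I: "algebra_ideal R ?F ?I" unfolding kp_ideal_def by (rule F.algebra_ideal_generated(1))
  let ?q = "\<lambda>f. ?I +>\<^bsub>?F\<^esub> f"
  have q: "?q \<in> algebra_hom R ?F ?K" unfolding kp_algebra_def by (rule F.quotient_proj_hom[OF I])
  note qp = algebra_hom_props[OF F u(1) q]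
  have "?q f \<in> K.span" if "f \<in> carrier ?F" for f
    using that unfolding kp_free_def
  proof (induction rule: free_algebra_induct)
    case zero
    then show ?case using qp(5) K.span_zero by (simp add: kp_free_def)
  next
    case (add r w g)
    let ?ws = "map (\<lambda>x. monomial R \<one> [x]) w"
    have ws: "set ?ws \<subseteq> carrier ?F" using add by (auto simp: kp_free_def intro!: monomial_closed)
    have ne: "?ws \<noteq> []" using add by simp
    have lc: "list_product ?F ?ws \<in> carrier ?F" using F.list_product_closed[OF ne ws] .
    have "?q (list_product ?F ?ws) = list_product ?K (map (kp_gen R \<Lambda>) w)"
      using qp(7)[OF ne ws] by (simp add: kp_gen_def[abs_def] o_def)
    moreover have "monomial R r w = r \<odot>\<^bsub>?F\<^esub> list_product ?F ?ws"
      using monomial_eq_product[OF R add(1-3)] by (simp add: kp_free_def)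
    ultimately have "?q (monomial R r w) = r \<odot>\<^bsub>?K\<^esub> list_product ?K (map (kp_gen R \<Lambda>) w)"
      using qp(4)[OF add(1) lc] by simp
    then have "?q (monomial R r w) \<in> K.span" using K.span_smult[OF K.word_span[OF add(2,3)] add(1)] by simp
    moreover have "?q (monomial R r w \<oplus>\<^bsub>?F\<^esub> g) = ?q (monomial R r w) \<oplus>\<^bsub>?K\<^esub> ?q g"
      using add by (intro qp(2)) (auto simp: kp_free_def intro!: monomial_closed)
    ultimately show ?case using add(5) K.span_add by (simp add: kp_free_def)
  qed
  moreover obtain f where "f \<in> carrier ?F" "x = ?q f" using x F.quotient_simps(1)[OF I] by (auto simp: kp_algebra_def)
  ultimately show ?thesis by simp
qed

section \<open>The isomorphism onto the Steinberg algebra\<close>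

theorem proposition5p4:
  fixes \<Lambda> :: "('l, 'k::finite) kgraph" and R :: "('r, 'm) ring_scheme"
  assumes "k_graph \<Lambda>" and "finitely_aligned \<Lambda>" and "cring R"
  shows "\<exists>\<pi> \<in> algebra_iso R (kp_algebra R \<Lambda>) (steinberg_algebra R (boundary_groupoid \<Lambda>)).
    (\<forall>\<alpha> \<in> paths \<Lambda>. \<pi> (kp_gen R \<Lambda> (Path \<alpha>)) =
        char_fun R (boundary_groupoid \<Lambda>) (Z_pair \<Lambda> \<alpha> (src \<Lambda> \<alpha>))) \<and>
    (\<forall>\<mu> \<in> paths \<Lambda>. \<pi> (kp_gen R \<Lambda> (star \<Lambda> \<mu>)) =
        char_fun R (boundary_groupoid \<Lambda>) (Z_pair \<Lambda> (src \<Lambda> \<mu>) \<mu>))"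
proof -
  interpret finitely_aligned_kgraph \<Lambda>
    using assms by (simp add: finitely_aligned_kgraph_def finitely_aligned_kgraph_axioms_def)
  interpret B: boundary_steinberg \<Lambda> R
    using assms(3) finitely_aligned_kgraph_axioms by (simp add: boundary_steinberg_def)
  let ?K = "kp_algebra R \<Lambda>" and ?S = "steinberg_algebra R (boundary_groupoid \<Lambda>)"
  note u = kp_algebra_universal[OF assms(1,3)]
  interpret K: nonunital_algebra R ?K by (rule u(1))
  interpret K: kp_fam \<Lambda> R ?K "kp_gen R \<Lambda>" by unfold_locales (rule u(2))
  interpret N: nonunital_algebra R ?S by (rule B.nonunital_algebra_SA)
  obtain h where h: "h \<in> algebra_hom R ?K ?S" and hg: "\<And>g. g \<in> kp_generators \<Lambda> \<Longrightarrow> h (kp_gen R \<Lambda> g) = B.T g"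
    using u(3)[OF B.nonunital_algebra_SA B.kp_family_T] by blast
  note hp = algebra_hom_props[OF u(1) B.nonunital_algebra_SA h]
  have hPQ: "h (K.P \<alpha> \<otimes>\<^bsub>?K\<^esub> K.Q \<mu>) = char_fun R (boundary_groupoid \<Lambda>) (Z_pair \<Lambda> \<alpha> \<mu>)" if p: "(\<alpha>, \<mu>) \<in> pairs" for \<alpha> \<mu>
    using pairsD[OF p] B.T_Path_star[OF p] hp(3) hg[OF Path_mem_generators] hg[OF star_mem_generators]
    by (simp add: K.P_def[symmetric] K.Q_def[symmetric])
  \<comment> \<open>Stated pointwise because this is the shape of the hypothesis in
    \<open>comb_zero\<close>.\<close>
  have hcomb: "h (K.comb xs) a = lsum R (\<lambda>x. if a \<in> Z_pair \<Lambda> (fst (snd x)) (snd (snd x)) then fst x else \<zero>\<^bsub>R\<^esub>) xs"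
    if "K.coeffs xs" "a \<in> boundary_arrows \<Lambda>" for xs a
    using that(1)
  proof (induction xs)
    case Nil
    then show ?case using that(2) hp(5) by (simp add: B.SA_simps)
  next
    case (Cons x xs)
    obtain r \<alpha> \<mu> where x: "x = (r, \<alpha>, \<mu>)" by (cases x)
    have c: "r \<in> carrier R" "(\<alpha>, \<mu>) \<in> pairs" "K.coeffs xs" using Cons.prems by (simp_all add: x)
    have "h (K.comb (x # xs)) = r \<odot>\<^bsub>?S\<^esub> char_fun R (boundary_groupoid \<Lambda>) (Z_pair \<Lambda> \<alpha> \<mu>) \<oplus>\<^bsub>?S\<^esub> h (K.comb xs)"
      using c K.PQ_closed[OF c(2)] K.comb_closed[OF c(3)] by (simp add: x hp(2,4) hPQ)
    then show ?case using Cons.IH[OF c(3)] that(2) c(1) by (simp add: x B.SA_add_eval B.SA_smult_eval) (simp add: B.SA_simps)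
  qed
  have ker: "x = \<zero>\<^bsub>?K\<^esub>" if x: "x \<in> carrier ?K" "h x = \<zero>\<^bsub>?S\<^esub>" for x
  proof -
    obtain xs where xs: "K.coeffs xs" "x = K.comb xs"
      using kp_algebra_span[OF finitely_aligned_kgraph_axioms assms(3) x(1)] by (auto simp: K.span_def)
    have "lsum R (\<lambda>x. if a \<in> Z_pair \<Lambda> (fst (snd x)) (snd (snd x)) then fst x else \<zero>\<^bsub>R\<^esub>) xs = \<zero>\<^bsub>R\<^esub>"
      if "a \<in> boundary_arrows \<Lambda>" for a
      using hcomb[OF xs(1) that] x(2) xs(2) that by (simp add: B.SA_simps)
    then show ?thesis using K.comb_zero[OF xs(1)] xs(2) by simp
  qed
  have "inj_on h (carrier ?K)"
  proof (rule inj_onI)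
    fix x y assume xy: "x \<in> carrier ?K" "y \<in> carrier ?K" "h x = h y"
    have "h (x \<ominus>\<^bsub>?K\<^esub> y) = \<zero>\<^bsub>?S\<^esub>" using hp(6)[OF xy(1,2)] xy(3) hp(1)[OF xy(2)] by (simp add: a_minus_def[of ?S] B.SA.M.r_neg)
    then have "x \<ominus>\<^bsub>?K\<^esub> y = \<zero>\<^bsub>?K\<^esub>" using ker xy by simp
    then have "\<ominus>\<^bsub>?K\<^esub> (\<ominus>\<^bsub>?K\<^esub> y) = x" using xy by (intro K.M.minus_equality) (simp_all add: a_minus_def)
    then show "x = y" using xy by simp
  qed
  \<comment> \<open>Surjectivity: the image of \<open>h\<close> is closed under the steps that
    generate \<open>ind_span\<close>.\<close>
  moreover have "f \<in> h ` carrier ?K" if "f \<in> carrier ?S" for f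
    using that unfolding B.SA_carrier_eq
  proof (induction rule: B.ind_span.induct)
    case zero
    then show ?case using hp(5) by (metis K.M.zero_closed imageI)
  next
    case (step r \<alpha> \<mu> f)
    then obtain x where x: "x \<in> carrier ?K" "f = h x" by blast
    let ?y = "r \<odot>\<^bsub>?K\<^esub> (K.P \<alpha> \<otimes>\<^bsub>?K\<^esub> K.Q \<mu>) \<oplus>\<^bsub>?K\<^esub> x"
    have "h ?y = r \<odot>\<^bsub>?S\<^esub> char_fun R (boundary_groupoid \<Lambda>) (Z_pair \<Lambda> \<alpha> \<mu>) \<oplus>\<^bsub>?S\<^esub> f"
      using step(1) x K.PQ_closed[OF step(2)] by (simp add: hp(2,4) hPQ[OF step(2)])
    moreover have "?y \<in> carrier ?K" using step(1) x K.PQ_closed[OF step(2)] by simp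
    ultimately show ?case by (metis imageI)
  qed
  ultimately have "bij_betw h (carrier ?K) (carrier ?S)" using hp(1) by (auto simp: bij_betw_def)
  then have "h \<in> algebra_iso R ?K ?S" using h by (simp add: algebra_iso_def)
  moreover have "h (kp_gen R \<Lambda> (Path \<alpha>)) = char_fun R (boundary_groupoid \<Lambda>) (Z_pair \<Lambda> \<alpha> (src \<Lambda> \<alpha>))"
    if "\<alpha> \<in> paths \<Lambda>" for \<alpha>
    using hg[OF Path_mem_generators[OF that]] B.T_Path by simp
  moreover have "h (kp_gen R \<Lambda> (star \<Lambda> \<mu>)) = char_fun R (boundary_groupoid \<Lambda>) (Z_pair \<Lambda> (src \<Lambda> \<mu>) \<mu>)"
    if "\<mu> \<in> paths \<Lambda>" for \<mu>
    using hg[OF star_mem_generators[OF that]] B.T_star[OF that] by simp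
  ultimately show ?thesis by blast
qed

end
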